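(* Let $k\in\mathbb{N}$ and let $\mathcal{A}=\{(1,a_0),\dots,(1,a_N)\}\subset\mathbb{Z}^{n+1}$ be a lattice configuration with associated matrix $A$. The projective toric variety $X_{\mathcal{A}}$ is $k$-selfdual if and only if $\mathcal{A}$ is $k$nap and the vectors $e_L$ lie in the row span of $A$ for each line $L$ through the origin in $\mathbb{R}^{c_k}$. More explicitly, let $L_1,\dots,L_r$ be the (distinct) lines through the origin in $\mathbb{R}^{c_k}$ containing some of the nonzero vectors $b_i$, and for $j=1,\dots,r$ set $\Gamma_j:=\{i : b_i\in L_j\}\subseteq\{0,\dots,N\}$. Then $r\ge c_k$, and $X_{\mathcal{A}}$ is $k$-selfdual if and only if $\mathcal{A}$ is $k$nap and $\mathcal{A}$ is $r$-Cayley with respect to the partition $\Gamma_1,\dots,\Gamma_r$ of $\{0,\dots,N\}$. In particular, if $X_{\mathcal{A}}$ is $k$-selfdual, then $\sum_{\ell\in\Gamma_j}b_\ell=0$ for every $j=1,\dots,r$.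
   Context: $\mathbb{K}$ is an algebraically closed field of characteristic zero. The points $a_0,\dots,a_N\in\mathbb{Z}^n$ are distinct and $\mathbb{Z}\mathcal{A}=\mathbb{Z}^{n+1}$. $A$ is the $(n+1)\times(N+1)$ integer matrix with columns $(1,a_0),\dots,(1,a_N)$. $X_{\mathcal{A}}\subset\mathbb{P}^N$ is the Zariski closure of $\{(\mathbf{t}^{a_0}:\dots:\mathbf{t}^{a_N}) : \mathbf{t}\in(\mathbb{K}^* )^n\}$; it has dimension $n$. Higher duals: let $X\subset\mathbb{P}^N$ be a nondegenerate irreducible projective variety. For a smooth point $x\in X$, let $j_{k,x}:\mathbb{K}^{N+1}\to\mathcal{L}_x/\mathfrak{m}_x^{k+1}\mathcal{L}_x$, with $\mathcal{L}=\mathcal{O}_{\mathbb{P}^N}(1)|_X$, be the linear map sending a linear form to the Taylor expansion up to order $k$ at $x$ of its restriction to $X$. The $k$-th osculating space is $\mathbb{T}^k_{X,x}=\mathbb{P}(\operatorname{Im} j_{k,x})\subset\mathbb{P}^N$; thus a hyperplane contains $\mathbb{T}^k_{X,x}$ iff its equation restricted to $X$ vanishes to order at least $k+1$ at $x$. Let $X_{k\text{-cst}}$ be the open dense subset of $X$ where the rank of $j_k$ is constant. The $k$-th dual variety $X^{(k)}\subset(\mathbb{P}^N)^\vee$ is the Zariski closure of $\{H : H\supseteq\mathbb{T}^k_{X,x}\text{ for some }x\in X_{k\text{-cst}}\}$. $X$ is $k$-selfdual if there is a linear isomorphism $\varphi:\mathbb{P}^N\to(\mathbb{P}^N)^\vee$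 with $\varphi(X)=X^{(k)}$. $A^{(k)}$ is the $\binom{n+k}{k}\times(N+1)$ integer matrix whose rows are the vectors $(a_0^\beta,\dots,a_N^\beta)$ for $\beta\in\mathbb{N}^n$, $|\beta|\le k$, and $c_k:=\dim\operatorname{Ker}A^{(k)}$. $\mathcal{A}$ is $k$nap if no canonical basis vector $e_i$, $i=0,\dots,N$, of $\mathbb{R}^{N+1}$ lies in the row span of $A^{(k)}$. Given a $\mathbb{Z}$-basis $\nu^1,\dots,\nu^{c_k}$ of the integer kernel of $A^{(k)}$, set $b_i:=(\nu^1_i,\dots,\nu^{c_k}_i)\in\mathbb{Z}^{c_k}$ for $i=0,\dots,N$. For a line $L$ through the origin in $\mathbb{R}^{c_k}$, $e_L\in\mathbb{R}^{N+1}$ is the $(0,1)$-vector with $(e_L)_i=1$ if and only if $b_i\in L$ (it is independent of the choice of basis). A lattice configuration is $r$-Cayley if there are $r$ lattice configurations $\mathcal{A}_1,\dots,\mathcal{A}_r\subset\mathbb{Z}^d$ such that it is affinely isomorphic (via an isomorphism of the affine lattices generated by the configurations, carrying one configuration onto the other) to $\operatorname{Cayley}(\mathcal{A}_1,\dots,\mathcal{A}_r)=e_1\times\mathcal{A}_1\cup\dots\cup e_r\times\mathcal{A}_r\subset\mathbb{Z}^{r+d}$, where $e_1,\dots,e_r$ is the canonical basis of $\mathbb{Z}^r$. It is $r$-Cayley with respect to a partition $\Gamma_1,\dots,\Gamma_r$ of its index set if in addition the points of $\mathcal{A}$ indexed by $\Gamma_j$ correspond to $e_j\times\mathcal{A}_j$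 for every $j$.
   Formalization: The final claim that the sums of b_ℓ over Γ_j vanish is stated only for k ≥ 1; for k = 0 it fails, e.g. for the unimodular simplex in ℤ², where X = P² is 0-selfdual but each b_ℓ is alone on its line. *)

theory Defs
  imports
    "HOL-Analysis.Analysis"
    "HOL-Library.Poly_Mapping"
    "HOL-Library.Disjoint_Sets"
    "HOL-Computational_Algebra.Polynomial"
begin

section \<open>Projective varieties\<close>

text \<open>
  The homogeneous coordinates are indexed by a finite type \<open>'i\<close>, so \<open>CARD('i) = N + 1\<close>.
  A point of \<open>P^N\<close> is given by any of its nonzero coordinate vectors in \<open>'k^'i\<close>, and a subset of
  \<open>P^N\<close> by the set of all nonzero vectors representing its points. The dual space is coordinatized
  in the same way: a hyperplane is given by the coefficient vector of a nonzero linear form.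
\<close>

type_synonym ('k, 'i) mpoly = "('i \<Rightarrow>\<^sub>0 nat) \<Rightarrow>\<^sub>0 'k"

definition mpoly_eval :: "('k::field, 'i::finite) mpoly \<Rightarrow> 'k^'i \<Rightarrow> 'k" where
  "mpoly_eval p x =
     (\<Sum>m\<in>Poly_Mapping.keys p.
        Poly_Mapping.lookup p m * (\<Prod>i\<in>UNIV. x $ i ^ Poly_Mapping.lookup m i))"

text \<open>The value at \<open>x\<close> of the formal partial derivative of \<open>p\<close> with respect to the variable \<open>i\<close>.\<close>

definition mpoly_pderiv_eval :: "'i::finite \<Rightarrow> ('k::field, 'i) mpoly \<Rightarrow> 'k^'i \<Rightarrow> 'k" where
  "mpoly_pderiv_eval i p x =
     (\<Sum>m\<in>Poly_Mapping.keys p.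
        Poly_Mapping.lookup p m *
          (of_nat (Poly_Mapping.lookup m i) * x $ i ^ (Poly_Mapping.lookup m i - 1) *
           (\<Prod>l\<in>UNIV - {i}. x $ l ^ Poly_Mapping.lookup m l)))"

definition homogeneous :: "('k::field, 'i::finite) mpoly \<Rightarrow> bool" where
  "homogeneous p \<longleftrightarrow>
     (\<exists>d. \<forall>m\<in>Poly_Mapping.keys p. (\<Sum>i\<in>UNIV. Poly_Mapping.lookup m i) = d)"

definition linear_form :: "'k::field^'i::finite \<Rightarrow> ('k, 'i) mpoly" where
  "linear_form h = (\<Sum>i\<in>UNIV. Poly_Mapping.single (Poly_Mapping.single i 1) (h $ i))"

definition zariski_closed :: "('k::field^'i::finite) set \<Rightarrow> bool" where
  "zariski_closed Z \<longleftrightarrow>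
     (\<exists>F. (\<forall>p\<in>F. homogeneous p) \<and> Z = {x. x \<noteq> 0 \<and> (\<forall>p\<in>F. mpoly_eval p x = 0)})"

definition zariski_closure :: "('k::field^'i::finite) set \<Rightarrow> ('k^'i) set" where
  "zariski_closure S = \<Inter>{Z. zariski_closed Z \<and> S \<subseteq> Z}"

definition irreducible_closed :: "('k::field^'i::finite) set \<Rightarrow> bool" where
  "irreducible_closed Z \<longleftrightarrow> zariski_closed Z \<and> Z \<noteq> {} \<and>
     (\<forall>Z1 Z2. zariski_closed Z1 \<and> zariski_closed Z2 \<and> Z \<subseteq> Z1 \<union> Z2 \<longrightarrow> Z \<subseteq> Z1 \<or> Z \<subseteq> Z2)"

text \<open>Krull dimension; chains of irreducible closed subsets of \<open>P^N\<close> have length at most \<open>N\<close>, so the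
  supremum below is that of a bounded set.\<close>

definition proj_dim :: "('k::field^'i::finite) set \<Rightarrow> nat" where
  "proj_dim X = Sup {m. \<exists>Z. (\<forall>l\<le>m. irreducible_closed (Z l) \<and> Z l \<subseteq> X) \<and>
                             (\<forall>l<m. Z l \<subset> Z (Suc l))}"

definition vanishing_ideal :: "('k::field^'i::finite) set \<Rightarrow> ('k, 'i) mpoly set" where
  "vanishing_ideal S = {p. \<forall>x\<in>S. mpoly_eval p x = 0}"

definition proj_point :: "'k::field^'i::finite \<Rightarrow> ('k^'i) set" where
  "proj_point x = {c *s x | c. c \<noteq> 0}"

text \<open>Smoothness by the Jacobian criterion; \<open>tangent_cone_space X x\<close> is the Zariski tangent space
  of the affine cone over \<open>X\<close>, whose dimension exceeds that of \<open>X\<close> by one at smooth points.\<close>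

definition tangent_cone_space :: "('k::field^'i::finite) set \<Rightarrow> 'k^'i \<Rightarrow> ('k^'i) set" where
  "tangent_cone_space X x =
     {v. \<forall>p\<in>vanishing_ideal X. (\<Sum>i\<in>UNIV. mpoly_pderiv_eval i p x * v $ i) = 0}"

definition smooth_point :: "('k::field^'i::finite) set \<Rightarrow> 'k^'i \<Rightarrow> bool" where
  "smooth_point X x \<longleftrightarrow> x \<in> X \<and> vec.dim (tangent_cone_space X x) = proj_dim X + 1"


section \<open>Osculating spaces and higher dual varieties\<close>

definition ideal_mult :: "'r::comm_ring_1 set \<Rightarrow> 'r set \<Rightarrow> 'r set" where
  "ideal_mult I J = {\<Sum>l<(s::nat). f l * g l | s f g. \<forall>l<s. f l \<in> I \<and> g l \<in> J}"

definition ideal_power :: "'r::comm_ring_1 set \<Rightarrow> nat \<Rightarrow> 'r set" where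
  "ideal_power I m = (ideal_mult I ^^ m) UNIV"

text \<open>
  The local ring \<open>O\<^sub>X\<^sub>,\<^sub>x\<close> is the degree zero part of the homogeneous localization of the coordinate
  ring \<open>K[x\<^sub>i]/I(X)\<close> at the homogeneous prime \<open>I(x)\<close>, and \<open>L\<^sub>x\<close> is its degree one part. Clearing
  denominators, the germ at \<open>x\<close> of the restriction to \<open>X\<close> of the linear form with coefficients \<open>h\<close>
  lies in \<open>m\<^sub>x^m L\<^sub>x\<close> iff \<open>g h \<in> I(x)^m + I(X)\<close> for some form \<open>g\<close> with \<open>g(x) \<noteq> 0\<close>.
\<close>

definition vanishes_to_order :: "('k::field^'i::finite) set \<Rightarrow> 'k^'i \<Rightarrow> nat \<Rightarrow> 'k^'i \<Rightarrow> bool" where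
  "vanishes_to_order X x m h \<longleftrightarrow>
     (\<exists>g. homogeneous g \<and> mpoly_eval g x \<noteq> 0 \<and>
       (\<exists>q\<in>ideal_power (vanishing_ideal (proj_point x)) m. \<exists>s\<in>vanishing_ideal X.
          g * linear_form h = q + s))"

text \<open>The kernel of \<open>j\<^sub>k\<^sub>,\<^sub>x : K^(N+1) \<rightarrow> L\<^sub>x / m\<^sub>x^(k+1) L\<^sub>x\<close>, and the rank of this map.\<close>

definition jet_kernel :: "nat \<Rightarrow> ('k::field^'i::finite) set \<Rightarrow> 'k^'i \<Rightarrow> ('k^'i) set" where
  "jet_kernel k X x = {h. vanishes_to_order X x (k + 1) h}"

definition jet_rank :: "nat \<Rightarrow> ('k::field^'i::finite) set \<Rightarrow> 'k^'i \<Rightarrow> nat" where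
  "jet_rank k X x = CARD('i) - vec.dim (jet_kernel k X x)"

text \<open>\<open>P(Im j\<^sub>k\<^sub>,\<^sub>x)\<close> sits in \<open>P^N\<close> as the projectivization of the quotient \<open>Im j\<^sub>k\<^sub>,\<^sub>x\<close> of the space
  of linear forms, that is, as the common zero locus of the forms in the kernel.\<close>

definition osculating_space :: "nat \<Rightarrow> ('k::field^'i::finite) set \<Rightarrow> 'k^'i \<Rightarrow> ('k^'i) set" where
  "osculating_space k X x =
     {y. y \<noteq> 0 \<and> (\<forall>h\<in>jet_kernel k X x. (\<Sum>i\<in>UNIV. h $ i * y $ i) = 0)}"

definition hyperplane :: "'k::field^'i::finite \<Rightarrow> ('k^'i) set" where
  "hyperplane h = {y. y \<noteq> 0 \<and> (\<Sum>i\<in>UNIV. h $ i * y $ i) = 0}"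

text \<open>The largest open set of smooth points on which the rank of \<open>j\<^sub>k\<close> is locally constant; on an
  irreducible \<open>X\<close> the rank is constant there, since nonempty open subsets of \<open>X\<close> meet.\<close>

definition k_cst :: "nat \<Rightarrow> ('k::field^'i::finite) set \<Rightarrow> ('k^'i) set" where
  "k_cst k X = {x. smooth_point X x \<and>
     (\<exists>Z. zariski_closed Z \<and> x \<notin> Z \<and>
        (\<forall>y. smooth_point X y \<and> y \<notin> Z \<longrightarrow> jet_rank k X y = jet_rank k X x))}"

definition higher_dual :: "nat \<Rightarrow> ('k::field^'i::finite) set \<Rightarrow> ('k^'i) set" where
  "higher_dual k X =
     zariski_closure {h. h \<noteq> 0 \<and> (\<exists>x\<in>k_cst k X. osculating_space k X x \<subseteq> hyperplane h)}"

definition k_selfdual :: "nat \<Rightarrow> ('k::field^'i::finite) set \<Rightarrow> bool" where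
  "k_selfdual k X \<longleftrightarrow> (\<exists>M::'k^'i^'i. invertible M \<and> (\<lambda>x. M *v x) ` X = higher_dual k X)"


section \<open>Lattice configurations and toric varieties\<close>

text \<open>Vectors of length \<open>d\<close> are functions on \<open>nat\<close> that vanish from \<open>d\<close> on; this includes \<open>d = 0\<close>.\<close>

definition vecs :: "nat \<Rightarrow> (nat \<Rightarrow> 'a::zero) set" where
  "vecs d = {v. \<forall>j\<ge>d. v j = 0}"

definition lift_point :: "(nat \<Rightarrow> int) \<Rightarrow> nat \<Rightarrow> int" where
  "lift_point v = (\<lambda>m. case m of 0 \<Rightarrow> 1 | Suc j \<Rightarrow> v j)"

definition generates_lattice :: "nat \<Rightarrow> ('i::finite \<Rightarrow> nat \<Rightarrow> int) \<Rightarrow> bool" where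
  "generates_lattice d \<alpha> \<longleftrightarrow> (\<forall>v\<in>vecs d. \<exists>c::'i \<Rightarrow> int. v = (\<lambda>m. \<Sum>i\<in>UNIV. c i * \<alpha> i m))"

definition toric_variety :: "nat \<Rightarrow> ('i::finite \<Rightarrow> nat \<Rightarrow> int) \<Rightarrow> ('k::field^'i) set" where
  "toric_variety n a =
     zariski_closure {(\<chi> i. \<Prod>j<n. t j powi a i j) | t::nat \<Rightarrow> 'k. \<forall>j<n. t j \<noteq> 0}"

definition row_span_A :: "nat \<Rightarrow> ('i::finite \<Rightarrow> nat \<Rightarrow> int) \<Rightarrow> (real^'i) set" where
  "row_span_A n a = span {(\<chi> i. of_int (lift_point (a i) m)) | m. m \<le> n}"

definition row_Ak :: "nat \<Rightarrow> ('i::finite \<Rightarrow> nat \<Rightarrow> int) \<Rightarrow> (nat \<Rightarrow> nat) \<Rightarrow> 'i \<Rightarrow> int" where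
  "row_Ak n a \<beta> = (\<lambda>i. \<Prod>j<n. a i j ^ \<beta> j)"

definition exponents :: "nat \<Rightarrow> nat \<Rightarrow> (nat \<Rightarrow> nat) set" where
  "exponents n k = {\<beta> \<in> vecs n. (\<Sum>j<n. \<beta> j) \<le> k}"

definition row_span_Ak :: "nat \<Rightarrow> nat \<Rightarrow> ('i::finite \<Rightarrow> nat \<Rightarrow> int) \<Rightarrow> (real^'i) set" where
  "row_span_Ak k n a = span {(\<chi> i. of_int (row_Ak n a \<beta> i)) | \<beta>. \<beta> \<in> exponents n k}"

definition knap :: "nat \<Rightarrow> nat \<Rightarrow> ('i::finite \<Rightarrow> nat \<Rightarrow> int) \<Rightarrow> bool" where
  "knap k n a \<longleftrightarrow> (\<forall>i. axis i 1 \<notin> row_span_Ak k n a)"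

definition corank_Ak :: "nat \<Rightarrow> nat \<Rightarrow> ('i::finite \<Rightarrow> nat \<Rightarrow> int) \<Rightarrow> nat" where
  "corank_Ak k n a =
     dim {v::real^'i. \<forall>\<beta>\<in>exponents n k. (\<Sum>i\<in>UNIV. of_int (row_Ak n a \<beta> i) * v $ i) = 0}"

definition int_kernel_Ak :: "nat \<Rightarrow> nat \<Rightarrow> ('i::finite \<Rightarrow> nat \<Rightarrow> int) \<Rightarrow> ('i \<Rightarrow> int) set" where
  "int_kernel_Ak k n a = {v. \<forall>\<beta>\<in>exponents n k. (\<Sum>i\<in>UNIV. row_Ak n a \<beta> i * v i) = 0}"

text \<open>The vectors \<open>\<nu> 0, \<dots>, \<nu> (c - 1)\<close> form a basis of the free abelian group \<open>M\<close>.\<close>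

definition is_int_basis :: "nat \<Rightarrow> (nat \<Rightarrow> 'i \<Rightarrow> int) \<Rightarrow> ('i \<Rightarrow> int) set \<Rightarrow> bool" where
  "is_int_basis c \<nu> M \<longleftrightarrow>
     (\<forall>l<c. \<nu> l \<in> M) \<and> (\<forall>v\<in>M. \<exists>!w. w \<in> vecs c \<and> v = (\<lambda>i. \<Sum>l<c. w l * \<nu> l i))"

definition gale_vec :: "nat \<Rightarrow> (nat \<Rightarrow> 'i \<Rightarrow> int) \<Rightarrow> 'i \<Rightarrow> nat \<Rightarrow> real" where
  "gale_vec c \<nu> i = (\<lambda>l. if l < c then of_int (\<nu> l i) else 0)"

definition is_line :: "nat \<Rightarrow> (nat \<Rightarrow> real) set \<Rightarrow> bool" where
  "is_line c L \<longleftrightarrow> (\<exists>p\<in>vecs c. p \<noteq> (\<lambda>_. 0) \<and> L = {(\<lambda>l. s * p l) | s. True})"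

definition e_line :: "nat \<Rightarrow> (nat \<Rightarrow> 'i::finite \<Rightarrow> int) \<Rightarrow> (nat \<Rightarrow> real) set \<Rightarrow> real^'i" where
  "e_line c \<nu> L = (\<chi> i. if gale_vec c \<nu> i \<in> L then 1 else 0)"


section \<open>Cayley configurations\<close>

definition lattice_config :: "nat \<Rightarrow> (nat \<Rightarrow> int) set \<Rightarrow> bool" where
  "lattice_config d S \<longleftrightarrow> finite S \<and> S \<noteq> {} \<and> S \<subseteq> vecs d"

text \<open>The set \<open>e\<^sub>j \<times> S\<close> in \<open>\<int>^(r+d)\<close>, with \<open>e\<^sub>0, \<dots>, e\<^sub>r\<^sub>-\<^sub>1\<close> the canonical basis of \<open>\<int>^r\<close>.\<close>

definition cayley_piece :: "nat \<Rightarrow> nat \<Rightarrow> (nat \<Rightarrow> int) set \<Rightarrow> (nat \<Rightarrow> int) set" where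
  "cayley_piece r j S = (\<lambda>v m. if m < r then (if m = j then 1 else 0) else v (m - r)) ` S"

definition cayley :: "nat \<Rightarrow> (nat \<Rightarrow> (nat \<Rightarrow> int) set) \<Rightarrow> (nat \<Rightarrow> int) set" where
  "cayley r B = (\<Union>j<r. cayley_piece r j (B j))"

definition affine_lattice :: "(nat \<Rightarrow> int) set \<Rightarrow> (nat \<Rightarrow> int) set" where
  "affine_lattice S = {(\<lambda>m. \<Sum>s\<in>S. c s * s m) | c::(nat \<Rightarrow> int) \<Rightarrow> int. (\<Sum>s\<in>S. c s) = 1}"

text \<open>Affine maps between affine lattices are the maps compatible with \<open>x - y + z\<close>.\<close>

definition config_affine_iso ::
  "((nat \<Rightarrow> int) \<Rightarrow> nat \<Rightarrow> int) \<Rightarrow> (nat \<Rightarrow> int) set \<Rightarrow> (nat \<Rightarrow> int) set \<Rightarrow> bool" where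
  "config_affine_iso f S T \<longleftrightarrow>
     bij_betw f (affine_lattice S) (affine_lattice T) \<and>
     (\<forall>x\<in>affine_lattice S. \<forall>y\<in>affine_lattice S. \<forall>z\<in>affine_lattice S.
        f (\<lambda>m. x m - y m + z m) = (\<lambda>m. f x m - f y m + f z m)) \<and>
     f ` S = T"

definition cayley_wrt :: "nat \<Rightarrow> (nat \<Rightarrow> 'i set) \<Rightarrow> ('i \<Rightarrow> nat \<Rightarrow> int) \<Rightarrow> bool" where
  "cayley_wrt r \<Gamma> \<alpha> \<longleftrightarrow>
     disjoint_family_on \<Gamma> {..<r} \<and> (\<Union>j<r. \<Gamma> j) = UNIV \<and>
     (\<exists>d B f. (\<forall>j<r. lattice_config d (B j)) \<and>
        config_affine_iso f (range \<alpha>) (cayley r B) \<and>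
        (\<forall>j<r. f ` \<alpha> ` \<Gamma> j = cayley_piece r j (B j)))"

end

theory Submission
  imports Defs
begin

text \<open>
  At a point \<open>y\<close> of the torus \<open>T\<close>, a linear form \<open>h\<close> vanishes to order \<open>k + 1\<close> iff
  \<open>(h\<^sub>i y\<^sub>i)\<close> lies in \<open>Ker A^(k)\<close>: the moments of order at most \<open>k\<close> of the exponents are read off
  along one-parameter subgroups through \<open>y\<close>. Near any smooth point \<open>x\<close> the Taylor expansion in
  \<open>n\<close> local parameters bounds the rank of the jets, so equations for the jet kernels at the
  torus points extend regularly to \<open>x\<close>; where the rank is constant, jet kernels are therefore limits
  of jet kernels at torus points, and \<open>X^(k)\<close> is the closure of \<open>Ker A^(k) \<cdot> T\<close>. The dimension of
  \<open>X\<close> is bounded by counting: independent monomials attached to a chain of irreducible sets versus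
  characters of \<open>T\<close> of bounded weight.

  An element of \<open>Ker A^(k)\<close> is the vector of values of a linear form \<open>\<mu>\<close> at the Gale vectors \<open>b\<^sub>i\<close>. If the
  \<open>b\<^sub>i\<close> are nonzero and the indicator vectors of the lines are combinations of the rows of \<open>A\<close>, then
  rescaling every line separately is an action of \<open>T\<close>, so \<open>Ker A^(k) \<cdot> T\<close> is dense in a diagonal
  translate of \<open>X\<close>. Conversely, if \<open>X\<close> is selfdual, then \<open>b\<^sub>i \<noteq> 0\<close> by nondegeneracy, and for reasons of
  dimension \<open>X^(k) = v \<cdot> X\<close> for every \<open>v\<close> in \<open>Ker A^(k)\<close> without zero coordinates; hence the quotient of
  two such \<open>v\<close> satisfies every binomial equation of \<open>X\<close>. Letting \<open>\<mu>\<close> degenerate to a form that vanishes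
  at exactly the \<open>b\<^sub>i\<close> on a line \<open>L\<close>, the order of vanishing of the binomial with exponent \<open>z\<close> gives
  \<open>\<Sum>z\<^sub>i = 0\<close> over the \<open>i\<close> with \<open>b\<^sub>i \<in> L\<close>.
\<close>

section \<open>Polynomials and their evaluation\<close>

text \<open>The set \<open>k_cst\<close> admits every smooth point of locally constant rank, also
  off the torus, so knowing the jets on T is not enough: boundary points might contribute further
  hyperplanes. Excluding this shapes the middle of the proof. Local rings are replaced there by
  forms of one large degree d restricted to finitely many test points. The forms vanishing to order
  k + 1 at y then make up a subspace of a fixed finite-dimensional space, and it contains vectors
  depending polynomially on y. Taylor expansion at a smooth point bounds the jets from above,
  explicit monomials with independent jets bound them from below at torus points, and both bounds
  are binomial(n + k, k). Because they agree, vectors chosen at x still span at nearby torus points.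
  In the dimension count the two sides grow like D^m and D^n, so a chain longer than n is impossible
  for large D. Gale vectors are integral while the kernel is needed over the field; expanding
  scalars over a rational basis transports integer bases to any field of characteristic
  zero.\<close>

abbreviation lkp :: "('a \<Rightarrow>\<^sub>0 'b::zero) \<Rightarrow> 'a \<Rightarrow> 'b" where "lkp \<equiv> Poly_Mapping.lookup"
abbreviation pkeys :: "('a \<Rightarrow>\<^sub>0 'b::zero) \<Rightarrow> 'a set" where "pkeys \<equiv> Poly_Mapping.keys"

definition mdeg :: "('i::finite \<Rightarrow>\<^sub>0 nat) \<Rightarrow> nat" where
  "mdeg m = (\<Sum>i\<in>UNIV. lkp m i)"

definition meval :: "('i::finite \<Rightarrow>\<^sub>0 nat) \<Rightarrow> 'k::field^'i \<Rightarrow> 'k" where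
  "meval m x = (\<Prod>i\<in>UNIV. x $ i ^ lkp m i)"

lemma mdeg_add: "mdeg (m + m') = mdeg m + mdeg m'"
  by (simp add: mdeg_def lookup_add sum.distrib)

lemma meval_add: "meval (m + m') x = meval m x * meval m' x"
  by (simp add: meval_def lookup_add power_add prod.distrib)

lemma mdeg_zero [simp]: "mdeg 0 = 0"
  by (simp add: mdeg_def)

lemma meval_zero [simp]: "meval 0 x = 1"
  by (simp add: meval_def)

lemma mdeg_single [simp]: "mdeg (Poly_Mapping.single i n) = n"
  by (simp add: mdeg_def lookup_single when_def)

lemma meval_single [simp]: "meval (Poly_Mapping.single i n) x = x $ i ^ n"
proof -
  have "meval (Poly_Mapping.single i n) x = (\<Prod>l\<in>UNIV. if l = i then x $ i ^ n else 1)"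
    unfolding meval_def by (rule prod.cong) (auto simp: lookup_single when_def)
  then show ?thesis by simp
qed

lemma meval_scale: "meval m (c *s x) = c ^ mdeg m * meval m x"
  by (simp add: meval_def mdeg_def power_mult_distrib prod.distrib power_sum)

lemma mpoly_eval_sup:
  assumes "finite S" "pkeys p \<subseteq> S"
  shows "mpoly_eval p x = (\<Sum>m\<in>S. lkp p m * meval m x)"
  unfolding mpoly_eval_def meval_def
  by (rule sum.mono_neutral_left) (use assms in \<open>auto simp: in_keys_iff\<close>)

lemma mpoly_eval_alt: "mpoly_eval p x = (\<Sum>m\<in>pkeys p. lkp p m * meval m x)"
  by (rule mpoly_eval_sup) auto

lemma eval_zero [simp]: "mpoly_eval 0 x = 0"
  by (simp add: mpoly_eval_alt)

lemma eval_add [simp]: "mpoly_eval (p + q) x = mpoly_eval p x + mpoly_eval q x"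
proof -
  let ?S = "pkeys p \<union> pkeys q"
  have "pkeys (p + q) \<subseteq> ?S" by (rule Poly_Mapping.keys_add)
  then show ?thesis
    by (simp add: mpoly_eval_sup[of ?S] lookup_add algebra_simps sum.distrib)
qed

lemma eval_single [simp]: "mpoly_eval (Poly_Mapping.single m c) x = c * meval m x"
  by (simp add: mpoly_eval_sup[of "{m}"])

lemma eval_sum [simp]: "mpoly_eval (\<Sum>a\<in>S. f a) x = (\<Sum>a\<in>S. mpoly_eval (f a) x)"
  by (induction S rule: infinite_finite_induct) auto

lemma mpoly_sum_single: "p = (\<Sum>m\<in>pkeys p. Poly_Mapping.single m (lkp p m))"
  by (rule poly_mapping_eqI) (auto simp: lookup_sum lookup_single when_def in_keys_iff)

lemma eval_mult [simp]: "mpoly_eval (p * q) x = mpoly_eval p x * mpoly_eval q x"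
proof -
  have "p * q = (\<Sum>m\<in>pkeys p. \<Sum>l\<in>pkeys q. Poly_Mapping.single (m + l) (lkp p m * lkp q l))"
    by (subst (1) mpoly_sum_single[of p], subst (1) mpoly_sum_single[of q])
       (simp add: sum_product mult_single)
  then show ?thesis
    by (simp add: mpoly_eval_alt[of p] mpoly_eval_alt[of q] sum_product meval_add mult_ac)
qed

lemma eval_one [simp]: "mpoly_eval 1 x = 1"
proof -
  have "mpoly_eval (Poly_Mapping.single 0 1) x = 1" by (subst eval_single) simp
  then show ?thesis by simp
qed

lemma eval_prod [simp]: "mpoly_eval (\<Prod>a\<in>S. f a) x = (\<Prod>a\<in>S. mpoly_eval (f a) x)"
  by (induction S rule: infinite_finite_induct) auto

lemma eval_power [simp]: "mpoly_eval (p ^ e) x = mpoly_eval p x ^ e"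
  by (induction e) auto

lemma eval_uminus [simp]: "mpoly_eval (- p) x = - mpoly_eval p x"
proof -
  have "mpoly_eval (p + - p) x = 0" by simp
  then show ?thesis by (simp only: eval_add) (simp add: eq_neg_iff_add_eq_0 add.commute)
qed

lemma eval_minus [simp]: "mpoly_eval (p - q) x = mpoly_eval p x - mpoly_eval q x"
  using eval_add[of p "- q" x] by simp

lemma eval_linear_form [simp]: "mpoly_eval (linear_form h) x = (\<Sum>i\<in>UNIV. h $ i * x $ i)"
  by (simp add: linear_form_def)

definition cpoly :: "'k::field \<Rightarrow> ('k, 'i::finite) mpoly" where
  "cpoly c = Poly_Mapping.single 0 c"

definition vpoly :: "'i::finite \<Rightarrow> ('k::field, 'i) mpoly" where
  "vpoly i = Poly_Mapping.single (Poly_Mapping.single i 1) 1"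

lemma eval_cpoly [simp]: "mpoly_eval (cpoly c) x = c"
  by (simp add: cpoly_def)

lemma eval_vpoly [simp]: "mpoly_eval (vpoly i) x = x $ i"
  by (simp add: vpoly_def)

section \<open>Homogeneous polynomials and homogeneous components\<close>

definition hdeg :: "nat \<Rightarrow> ('k::field, 'i::finite) mpoly \<Rightarrow> bool" where
  "hdeg d p \<longleftrightarrow> (\<forall>m\<in>pkeys p. mdeg m = d)"

lemma homogeneous_iff: "homogeneous p \<longleftrightarrow> (\<exists>d. hdeg d p)"
  by (simp add: homogeneous_def hdeg_def mdeg_def)

lemma hdeg_zero [simp]: "hdeg d 0"
  by (simp add: hdeg_def)

lemma hdeg_add: "hdeg d p \<Longrightarrow> hdeg d q \<Longrightarrow> hdeg d (p + q)"
  using Poly_Mapping.keys_add[of p q] by (auto simp: hdeg_def)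

lemma hdeg_uminus: "hdeg d p \<Longrightarrow> hdeg d (- p)"
  by (simp add: hdeg_def in_keys_iff)

lemma hdeg_minus: "hdeg d p \<Longrightarrow> hdeg d q \<Longrightarrow> hdeg d (p - q)"
  using hdeg_add[of d p "- q"] hdeg_uminus[of d q] by simp

lemma hdeg_sum: "(\<And>a. a \<in> S \<Longrightarrow> hdeg d (f a)) \<Longrightarrow> hdeg d (\<Sum>a\<in>S. f a)"
  by (induction S rule: infinite_finite_induct) (auto intro: hdeg_add)

lemma hdeg_single: "mdeg m = d \<Longrightarrow> hdeg d (Poly_Mapping.single m c)"
  by (simp add: hdeg_def)

lemma hdeg_mult: "hdeg d p \<Longrightarrow> hdeg e q \<Longrightarrow> hdeg (d + e) (p * q)"
  using Poly_Mapping.keys_mult[of p q] by (fastforce simp: hdeg_def mdeg_add)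

lemma hdeg_cpoly: "hdeg 0 (cpoly c)"
  by (simp add: cpoly_def hdeg_single)

lemma hdeg_one: "hdeg 0 1"
  using hdeg_cpoly[of 1] by (simp add: cpoly_def)

lemma hdeg_vpoly: "hdeg 1 (vpoly i)"
  by (simp add: vpoly_def hdeg_single)

lemma hdeg_cmult: "hdeg d p \<Longrightarrow> hdeg d (cpoly c * p)"
  using hdeg_mult[OF hdeg_cpoly, of d p c] by simp

lemma hdeg_prod: "(\<And>a. a \<in> S \<Longrightarrow> hdeg (e a) (f a)) \<Longrightarrow> hdeg (\<Sum>a\<in>S. e a) (\<Prod>a\<in>S. f a)"
  by (induction S rule: infinite_finite_induct) (auto intro: hdeg_mult hdeg_one)

lemma hdeg_power: "hdeg e p \<Longrightarrow> hdeg (s * e) (p ^ s)"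
  by (induction s) (auto intro: hdeg_mult hdeg_one)

lemma hdeg_linear_form: "hdeg 1 (linear_form h)"
  unfolding linear_form_def by (intro hdeg_sum hdeg_single) simp

lemma eval_scale: "hdeg d p \<Longrightarrow> mpoly_eval p (c *s x) = c ^ d * mpoly_eval p x"
  by (simp add: mpoly_eval_alt hdeg_def meval_scale sum_distrib_left mult_ac)

definition hcomp :: "nat \<Rightarrow> ('k::field, 'i::finite) mpoly \<Rightarrow> ('k, 'i) mpoly" where
  "hcomp d p = (\<Sum>m\<in>{m\<in>pkeys p. mdeg m = d}. Poly_Mapping.single m (lkp p m))"

lemma hdeg_hcomp: "hdeg d (hcomp d p)"
  unfolding hcomp_def by (intro hdeg_sum hdeg_single) simp

text \<open>A crude bound for the total degree; a sum needs no special case for the zero polynomial,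
  as a maximum would.\<close>

definition maxdeg :: "('k::field, 'i::finite) mpoly \<Rightarrow> nat" where
  "maxdeg p = (\<Sum>m\<in>pkeys p. mdeg m)"

lemma mdeg_le_maxdeg: "m \<in> pkeys p \<Longrightarrow> mdeg m \<le> maxdeg p"
  unfolding maxdeg_def by (rule member_le_sum) auto

lemma sum_hcomp: "p = (\<Sum>d\<le>maxdeg p. hcomp d p)"
proof -
  have "p = (\<Sum>m\<in>pkeys p. Poly_Mapping.single m (lkp p m))"
    by (rule mpoly_sum_single)
  also have "\<dots> = (\<Sum>d\<le>maxdeg p. \<Sum>m\<in>{m\<in>pkeys p. mdeg m = d}. Poly_Mapping.single m (lkp p m))"
    by (rule sum.group[symmetric]) (auto intro: mdeg_le_maxdeg)
  finally show ?thesis by (simp add: hcomp_def)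
qed

text \<open>The exceptional set \<open>B\<close> absorbs the parameters at which a curve leaves the
  torus; the field is infinite because its characteristic is zero.\<close>

lemma poly_zero_of_infinite_zeros:
  fixes P :: "'k::field_char_0 poly"
  assumes "finite B" and "\<And>s. s \<notin> B \<Longrightarrow> poly P s = 0"
  shows "P = 0"
proof (rule ccontr)
  assume "P \<noteq> 0"
  then have "finite {s. poly P s = 0}" by (rule poly_roots_finite)
  moreover have "UNIV \<subseteq> {s. poly P s = 0} \<union> B" using assms(2) by auto
  ultimately have "finite (UNIV :: 'k set)" using assms(1) by (metis finite_UnI finite_subset)
  then show False by (simp add: infinite_UNIV_char_0)
qed

lemma poly_eq_of_infinite:
  fixes P Q :: "'k::field_char_0 poly"
  assumes "finite B" and "\<And>s. s \<notin> B \<Longrightarrow> poly P s = poly Q s"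
  shows "P = Q"
  using poly_zero_of_infinite_zeros[of B "P - Q"] assms by simp

text \<open>On the line through \<open>x\<close> the values of \<open>p\<close> form a polynomial in
  \<open>c\<close> whose coefficients are the values at \<open>x\<close> of the homogeneous
  components.\<close>

lemma eval_hcomp_zero:
  fixes p :: "('k::field_char_0, 'i::finite) mpoly"
  assumes "\<And>c. c \<noteq> 0 \<Longrightarrow> mpoly_eval p (c *s x) = 0"
  shows "mpoly_eval (hcomp d p) x = 0"
proof -
  define P where "P = (\<Sum>d\<le>maxdeg p. monom (mpoly_eval (hcomp d p) x) d)"
  have "poly P c = mpoly_eval p (c *s x)" for c
    by (subst sum_hcomp[of p])
       (simp add: P_def poly_sum poly_monom eval_scale[OF hdeg_hcomp] mult.commute)
  then have "P = 0"
    using poly_zero_of_infinite_zeros[of "{0}" P] assms by auto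
  moreover have "coeff P d = mpoly_eval (hcomp d p) x"
  proof (cases "d \<le> maxdeg p")
    case True
    then show ?thesis by (simp add: P_def coeff_sum)
  next
    case False
    then have "{m\<in>pkeys p. mdeg m = d} = {}" using mdeg_le_maxdeg by fastforce
    then have "hcomp d p = 0" by (simp only: hcomp_def) simp
    then show ?thesis using False by (simp add: P_def coeff_sum)
  qed
  ultimately show ?thesis by simp
qed

section \<open>Zariski closed sets\<close>

text \<open>Stability under nonzero scalars is what makes a set of vectors represent a set of
  projective points.\<close>

definition cone :: "('k::field^'i::finite) set \<Rightarrow> bool" where
  "cone S \<longleftrightarrow> 0 \<notin> S \<and> (\<forall>x\<in>S. \<forall>c. c \<noteq> 0 \<longrightarrow> c *s x \<in> S)"

lemma zariski_closed_nonzero: "zariski_closed Z \<Longrightarrow> 0 \<notin> Z"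
  by (auto simp: zariski_closed_def)

lemma zariski_closed_UNIV: "zariski_closed {x. x \<noteq> 0}"
  unfolding zariski_closed_def by (rule exI[of _ "{}"]) auto

lemma zariski_closed_hyper: "homogeneous p \<Longrightarrow> zariski_closed {x. x \<noteq> 0 \<and> mpoly_eval p x = 0}"
  unfolding zariski_closed_def by (rule exI[of _ "{p}"]) auto

text \<open>If \<open>S\<close> contained 0, no closed set would contain \<open>S\<close> and the
  intersection would be the whole space; hence the hypothesis.\<close>

lemma zariski_closure_iff:
  assumes "0 \<notin> S"
  shows "z \<in> zariski_closure S \<longleftrightarrow>
    z \<noteq> 0 \<and> (\<forall>p. homogeneous p \<and> (\<forall>y\<in>S. mpoly_eval p y = 0) \<longrightarrow> mpoly_eval p z = 0)"
proof (intro iffI conjI allI impI)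
  assume z: "z \<in> zariski_closure S"
  show "z \<noteq> 0"
    using z zariski_closed_UNIV assms unfolding zariski_closure_def by fastforce
  fix p :: "('a, 'b) mpoly"
  assume p: "homogeneous p \<and> (\<forall>y\<in>S. mpoly_eval p y = 0)"
  then have "S \<subseteq> {x. x \<noteq> 0 \<and> mpoly_eval p x = 0}" using assms by auto
  then show "mpoly_eval p z = 0"
    using z zariski_closed_hyper[of p] p unfolding zariski_closure_def by blast
next
  assume z: "z \<noteq> 0 \<and> (\<forall>p. homogeneous p \<and> (\<forall>y\<in>S. mpoly_eval p y = 0) \<longrightarrow> mpoly_eval p z = 0)"
  show "z \<in> zariski_closure S"
    unfolding zariski_closure_def
  proof (rule InterI)
    fix Z assume "Z \<in> {Z. zariski_closed Z \<and> S \<subseteq> Z}"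
    then show "z \<in> Z" using z unfolding zariski_closed_def by blast
  qed
qed

lemma zariski_closure_subset: "S \<subseteq> zariski_closure S"
  by (auto simp: zariski_closure_def)

lemma zariski_closure_minimal: "zariski_closed Z \<Longrightarrow> S \<subseteq> Z \<Longrightarrow> zariski_closure S \<subseteq> Z"
  by (auto simp: zariski_closure_def)

lemma zariski_closure_mono: "S \<subseteq> S' \<Longrightarrow> zariski_closure S \<subseteq> zariski_closure S'"
  by (auto simp: zariski_closure_def)

lemma zariski_closed_closure:
  fixes S :: "('k::field^'i::finite) set"
  assumes "0 \<notin> S"
  shows "zariski_closed (zariski_closure S)"
proof -
  define F where "F = {p::('k, 'i) mpoly. homogeneous p \<and> (\<forall>y\<in>S. mpoly_eval p y = 0)}"
  have "zariski_closure S = {x. x \<noteq> 0 \<and> (\<forall>p\<in>F. mpoly_eval p x = 0)}"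
    by (rule set_eqI) (simp add: zariski_closure_iff[OF assms] F_def)
  moreover have "\<forall>p\<in>F. homogeneous p" by (simp add: F_def)
  ultimately show ?thesis unfolding zariski_closed_def by (intro exI[of _ F] conjI)
qed

lemma zariski_closed_separate:
  assumes "zariski_closed Z" "x \<notin> Z" "x \<noteq> 0"
  shows "\<exists>p. homogeneous p \<and> (\<forall>y\<in>Z. mpoly_eval p y = 0) \<and> mpoly_eval p x \<noteq> 0"
  using assms unfolding zariski_closed_def by blast

text \<open>Only forms define the closure, but on a cone the homogeneous components of
  \<open>p\<close> vanish separately, so \<open>p\<close> need not be homogeneous.\<close>

lemma vanishing_closure:
  fixes p :: "('k::field_char_0, 'i::finite) mpoly"
  assumes S: "cone S" and p: "\<And>y. y \<in> S \<Longrightarrow> mpoly_eval p y = 0" and z: "z \<in> zariski_closure S"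
  shows "mpoly_eval p z = 0"
proof -
  have "mpoly_eval (hcomp d p) y = 0" if "y \<in> S" for d y
    by (rule eval_hcomp_zero) (use that p S in \<open>auto simp: cone_def\<close>)
  moreover have "homogeneous (hcomp d p)" for d using hdeg_hcomp homogeneous_iff by blast
  moreover have "0 \<notin> S" using S by (simp add: cone_def)
  ultimately have "mpoly_eval (hcomp d p) z = 0" for d
    using z zariski_closure_iff[of S z] by blast
  then show ?thesis by (subst sum_hcomp[of p]) simp
qed

text \<open>If two closed sets covered the closure and neither contained it, forms separating points
  of \<open>S\<close> from each of them would have a product vanishing on \<open>S\<close>.\<close>

lemma irreducible_closureI:
  fixes S :: "('k::field_char_0^'i::finite) set"
  assumes "0 \<notin> S" "S \<noteq> {}"
    and prime: "\<And>p q. homogeneous p \<Longrightarrow> homogeneous q \<Longrightarrow>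
      (\<And>y. y \<in> S \<Longrightarrow> mpoly_eval p y * mpoly_eval q y = 0) \<Longrightarrow>
      (\<forall>y\<in>S. mpoly_eval p y = 0) \<or> (\<forall>y\<in>S. mpoly_eval q y = 0)"
  shows "irreducible_closed (zariski_closure S)"
  unfolding irreducible_closed_def
proof (intro conjI allI impI)
  show "zariski_closed (zariski_closure S)" by (rule zariski_closed_closure[OF assms(1)])
  show "zariski_closure S \<noteq> {}" using assms(2) zariski_closure_subset[of S] by auto
  fix Z1 Z2 :: "('k^'i) set"
  assume Z: "zariski_closed Z1 \<and> zariski_closed Z2 \<and> zariski_closure S \<subseteq> Z1 \<union> Z2"
  show "zariski_closure S \<subseteq> Z1 \<or> zariski_closure S \<subseteq> Z2"
  proof (rule ccontr)
    assume "\<not> ?thesis"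
    then have "\<not> S \<subseteq> Z1" "\<not> S \<subseteq> Z2" using Z zariski_closure_minimal by blast+
    then obtain x1 x2 where x: "x1 \<in> S" "x1 \<notin> Z1" "x2 \<in> S" "x2 \<notin> Z2" by auto
    then obtain p q where p: "homogeneous p" "\<forall>y\<in>Z1. mpoly_eval p y = 0" "mpoly_eval p x1 \<noteq> 0"
      and q: "homogeneous q" "\<forall>y\<in>Z2. mpoly_eval q y = 0" "mpoly_eval q x2 \<noteq> 0"
      using zariski_closed_separate[of Z1 x1] zariski_closed_separate[of Z2 x2] Z assms(1) by metis
    have "mpoly_eval p y * mpoly_eval q y = 0" if "y \<in> S" for y
      using that Z p q zariski_closure_subset[of S] by fastforce
    then show False using prime[OF p(1) q(1)] x p q by blast
  qed
qed

lemma irreducible_prime: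
  assumes Z: "irreducible_closed Z" and p: "homogeneous p" and q: "homogeneous q"
    and pq: "\<And>y. y \<in> Z \<Longrightarrow> mpoly_eval p y * mpoly_eval q y = 0"
  shows "(\<forall>y\<in>Z. mpoly_eval p y = 0) \<or> (\<forall>y\<in>Z. mpoly_eval q y = 0)"
proof -
  let ?Z1 = "{x. x \<noteq> 0 \<and> mpoly_eval p x = 0}" and ?Z2 = "{x. x \<noteq> 0 \<and> mpoly_eval q x = 0}"
  have "0 \<notin> Z" using Z zariski_closed_nonzero by (auto simp: irreducible_closed_def)
  then have "Z \<subseteq> ?Z1 \<union> ?Z2" using pq by auto
  then have "Z \<subseteq> ?Z1 \<or> Z \<subseteq> ?Z2"
    using Z zariski_closed_hyper[OF p] zariski_closed_hyper[OF q]
    unfolding irreducible_closed_def by blast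
  then show ?thesis by auto
qed

section \<open>Substitutions\<close>

definition psubst :: "('i::finite \<Rightarrow> ('k::field, 'l::finite) mpoly) \<Rightarrow> ('k, 'i) mpoly \<Rightarrow> ('k, 'l) mpoly" where
  "psubst f p = (\<Sum>m\<in>pkeys p. cpoly (lkp p m) * (\<Prod>i\<in>UNIV. f i ^ lkp m i))"

lemma eval_psubst: "mpoly_eval (psubst f p) y = mpoly_eval p (\<chi> i. mpoly_eval (f i) y)"
  unfolding mpoly_eval_alt[of p] by (simp add: psubst_def meval_def)

lemma hdeg_psubst:
  assumes "hdeg d p" "\<And>i. hdeg 1 (f i)"
  shows "hdeg d (psubst f p)"
  unfolding psubst_def
proof (rule hdeg_sum)
  fix m assume "m \<in> pkeys p"
  then have m: "(\<Sum>i\<in>UNIV. lkp m i * 1) = d" using assms(1) by (simp add: hdeg_def mdeg_def)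
  show "hdeg d (cpoly (lkp p m) * (\<Prod>i\<in>UNIV. f i ^ lkp m i))"
    using hdeg_cmult[OF hdeg_prod[of UNIV "\<lambda>i. lkp m i * 1" "\<lambda>i. f i ^ lkp m i"]]
      hdeg_power[OF assms(2)] m by metis
qed

lemma homogeneous_linear_subst:
  fixes M :: "'k::field^'i::finite^'i"
  assumes "homogeneous p"
  shows "\<exists>q. homogeneous q \<and> (\<forall>x. mpoly_eval q x = mpoly_eval p (M *v x))"
proof -
  let ?q = "psubst (\<lambda>i. linear_form (M $ i)) p"
  have "homogeneous ?q"
    using assms hdeg_psubst[OF _ hdeg_linear_form] unfolding homogeneous_iff by metis
  moreover have "mpoly_eval ?q x = mpoly_eval p (M *v x)" for x
    by (simp add: eval_psubst matrix_vector_mult_def)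
  ultimately show ?thesis by blast
qed

text \<open>Pull-back along the polynomial curve s -> (g_i(s)): vanishing on the torus becomes an
  identity between polynomials in one variable.\<close>

definition curve :: "('i \<Rightarrow> 'k poly) \<Rightarrow> ('k::field, 'i::finite) mpoly \<Rightarrow> 'k poly" where
  "curve g p = (\<Sum>m\<in>pkeys p. smult (lkp p m) (\<Prod>i\<in>UNIV. g i ^ lkp m i))"

lemma poly_curve: "poly (curve g p) s = mpoly_eval p (\<chi> i. poly (g i) s)"
  by (simp add: curve_def mpoly_eval_alt meval_def poly_sum poly_prod)

section \<open>Invertible linear maps\<close>

lemma matrix_left_inverse:
  fixes M :: "'k::field^'i::finite^'i"
  assumes "invertible M"
  shows "\<exists>M'. invertible M' \<and> (\<forall>x. M' *v (M *v x) = x) \<and> (\<forall>x. M *v (M' *v x) = x)"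
proof -
  obtain M' where "M ** M' = mat 1" "M' ** M = mat 1" using assms by (auto simp: invertible_def)
  then show ?thesis
    by (intro exI[of _ M']) (auto simp: invertible_def matrix_vector_mul_assoc)
qed

lemma zariski_closed_image:
  fixes M :: "'k::field^'i::finite^'i"
  assumes M: "invertible M" and Z: "zariski_closed Z"
  shows "zariski_closed ((\<lambda>x. M *v x) ` Z)"
proof -
  obtain M' where M': "\<And>x. M' *v (M *v x) = x" "\<And>x. M *v (M' *v x) = x"
    using matrix_left_inverse[OF M] by blast
  obtain F where F: "\<forall>p\<in>F. homogeneous p" "Z = {x. x \<noteq> 0 \<and> (\<forall>p\<in>F. mpoly_eval p x = 0)}"
    using Z unfolding zariski_closed_def by blast
  obtain G where G: "\<And>p. p \<in> F \<Longrightarrow> homogeneous (G p)"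
    "\<And>p x. p \<in> F \<Longrightarrow> mpoly_eval (G p) x = mpoly_eval p (M' *v x)"
    using homogeneous_linear_subst[of _ M'] F(1) by metis
  have "(\<lambda>x. M *v x) ` Z = {x. x \<noteq> 0 \<and> (\<forall>p\<in>G ` F. mpoly_eval p x = 0)}"
  proof (intro set_eqI iffI)
    fix y assume "y \<in> (\<lambda>x. M *v x) ` Z"
    then show "y \<in> {x. x \<noteq> 0 \<and> (\<forall>p\<in>G ` F. mpoly_eval p x = 0)}"
      using G(2) M'(1) unfolding F(2) by (auto; metis matrix_vector_mult_0_right)
  next
    fix y assume y: "y \<in> {x. x \<noteq> 0 \<and> (\<forall>p\<in>G ` F. mpoly_eval p x = 0)}"
    then have "M' *v y \<in> Z"
      using G(2) M'(2) unfolding F(2) by (auto; metis matrix_vector_mult_0_right)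
    then show "y \<in> (\<lambda>x. M *v x) ` Z" using M'(2)[of y] by (metis imageI)
  qed
  moreover have "\<forall>p\<in>G ` F. homogeneous p" using G by auto
  ultimately show ?thesis unfolding zariski_closed_def by blast
qed

lemma irreducible_closed_image:
  fixes M :: "'k::field^'i::finite^'i"
  assumes M: "invertible M" and Z: "irreducible_closed Z"
  shows "irreducible_closed ((\<lambda>x. M *v x) ` Z)"
proof -
  obtain M' where inv: "invertible M'" and M': "\<And>x. M' *v (M *v x) = x" "\<And>x. M *v (M' *v x) = x"
    using matrix_left_inverse[OF M] by blast
  have *: "(\<lambda>x. M' *v x) ` (\<lambda>x. M *v x) ` A = A" for A by (simp add: image_image M')
  have **: "(\<lambda>x. M *v x) ` (\<lambda>x. M' *v x) ` A = A" for A by (simp add: image_image M')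
  show ?thesis
    unfolding irreducible_closed_def
  proof (intro conjI allI impI)
    show "zariski_closed ((\<lambda>x. M *v x) ` Z)"
      using Z M zariski_closed_image by (auto simp: irreducible_closed_def)
    show "(\<lambda>x. M *v x) ` Z \<noteq> {}" using Z by (auto simp: irreducible_closed_def)
    fix Z1 Z2 assume A: "zariski_closed Z1 \<and> zariski_closed Z2 \<and> (\<lambda>x. M *v x) ` Z \<subseteq> Z1 \<union> Z2"
    have irr: "zariski_closed A \<Longrightarrow> zariski_closed B \<Longrightarrow> Z \<subseteq> A \<union> B \<Longrightarrow> Z \<subseteq> A \<or> Z \<subseteq> B" for A B
      using Z unfolding irreducible_closed_def by blast
    have "(\<lambda>x. M' *v x) ` (\<lambda>x. M *v x) ` Z \<subseteq> (\<lambda>x. M' *v x) ` Z1 \<union> (\<lambda>x. M' *v x) ` Z2"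
      using A by (metis image_Un image_mono)
    then have "Z \<subseteq> (\<lambda>x. M' *v x) ` Z1 \<or> Z \<subseteq> (\<lambda>x. M' *v x) ` Z2"
      unfolding * by (intro irr zariski_closed_image[OF inv]) (use A in simp_all)
    then show "(\<lambda>x. M *v x) ` Z \<subseteq> Z1 \<or> (\<lambda>x. M *v x) ` Z \<subseteq> Z2"
      using image_mono[of Z "(\<lambda>x. M' *v x) ` Z1" "\<lambda>x. M *v x"]
        image_mono[of Z "(\<lambda>x. M' *v x) ` Z2" "\<lambda>x. M *v x"] unfolding ** by blast
  qed
qed

section \<open>Linear algebra with finite families\<close>

text \<open>Vectors are functions on a finite set \<open>P\<close>; their values off \<open>P\<close> are irrelevant.\<close>

definition pair :: "'z set \<Rightarrow> ('z \<Rightarrow> 'k::field) \<Rightarrow> ('z \<Rightarrow> 'k) \<Rightarrow> 'k" where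
  "pair P f g = (\<Sum>z\<in>P. f z * g z)"

definition indep :: "'j set \<Rightarrow> 'z set \<Rightarrow> ('j \<Rightarrow> 'z \<Rightarrow> 'k::field) \<Rightarrow> bool" where
  "indep J P v \<longleftrightarrow> (\<forall>\<kappa>. (\<forall>z\<in>P. (\<Sum>j\<in>J. \<kappa> j * v j z) = 0) \<longrightarrow> (\<forall>j\<in>J. \<kappa> j = 0))"

definition in_span :: "'j set \<Rightarrow> 'z set \<Rightarrow> ('j \<Rightarrow> 'z \<Rightarrow> 'k::field) \<Rightarrow> ('z \<Rightarrow> 'k) \<Rightarrow> bool" where
  "in_span J P v w \<longleftrightarrow> (\<exists>\<kappa>. \<forall>z\<in>P. w z = (\<Sum>j\<in>J. \<kappa> j * v j z))"

lemma indepD: "indep J P v \<Longrightarrow> (\<And>z. z \<in> P \<Longrightarrow> (\<Sum>j\<in>J. \<kappa> j * v j z) = 0) \<Longrightarrow> j \<in> J \<Longrightarrow> \<kappa> j = 0"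
  unfolding indep_def by blast

lemma pair_minus_scale: "pair P f (\<lambda>z. g z - c * h z) = pair P f g - c * pair P f h"
  by (simp add: pair_def algebra_simps sum_subtractf sum_distrib_left)

lemma pair_minus_scale_left: "pair P (\<lambda>z. g z - c * h z) f = pair P g f - c * pair P h f"
  by (simp add: pair_def algebra_simps sum_subtractf sum_distrib_left)

lemma pair_sum: "pair P f (\<lambda>z. \<Sum>j\<in>J. \<kappa> j * v j z) = (\<Sum>j\<in>J. \<kappa> j * pair P f (v j))"
  unfolding pair_def sum_distrib_left by (subst sum.swap) (simp add: mult_ac)

lemma pair_commute: "pair P f g = pair P g f"
  by (simp add: pair_def mult.commute)

lemma pair_cong: "(\<And>z. z \<in> P \<Longrightarrow> g z = h z) \<Longrightarrow> pair P f g = pair P f h"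
  unfolding pair_def by (rule sum.cong) auto

lemma pair_axis: "finite P \<Longrightarrow> z0 \<in> P \<Longrightarrow> pair P (\<lambda>z. if z = z0 then 1 else 0) w = w z0"
  by (simp add: pair_def if_distrib[of "\<lambda>c. c * _"] cong: if_cong)

text \<open>Gaussian elimination, one equation at a time.\<close>

lemma underdetermined:
  fixes v :: "'j \<Rightarrow> 'z \<Rightarrow> 'k::field"
  assumes "finite R" "finite J" "card R < card J"
  shows "\<exists>\<kappa>. (\<exists>j\<in>J. \<kappa> j \<noteq> 0) \<and> (\<forall>z\<in>R. (\<Sum>j\<in>J. \<kappa> j * v j z) = 0)"
  using assms
proof (induction R arbitrary: J v rule: finite_induct)
  case empty
  then obtain j where "j \<in> J" by fastforce
  then show ?case by (intro exI[of _ "\<lambda>_. 1"]) auto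
next
  case (insert z R)
  show ?case
  proof (cases "\<forall>j\<in>J. v j z = 0")
    case True
    moreover obtain \<kappa> where "\<exists>j\<in>J. \<kappa> j \<noteq> 0" "\<forall>z\<in>R. (\<Sum>j\<in>J. \<kappa> j * v j z) = 0"
      using insert.IH[of J v] insert.prems insert.hyps by auto
    ultimately show ?thesis by (intro exI[of _ \<kappa>]) auto
  next
    case False
    then obtain j0 where j0: "j0 \<in> J" "v j0 z \<noteq> 0" by blast
    let ?J = "J - {j0}"
    \<comment> \<open>The unknown \<open>j0\<close> is eliminated by means of equation
      \<open>z\<close>; \<open>c\<close> is its value recovered by back substitution.\<close>
    define v' where "v' = (\<lambda>j y. v j y - v j z / v j0 z * v j0 y)"
    have "card R < card ?J" using insert.prems insert.hyps j0 by simp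
    then obtain \<kappa> where \<kappa>: "\<exists>j\<in>?J. \<kappa> j \<noteq> 0" "\<forall>y\<in>R. (\<Sum>j\<in>?J. \<kappa> j * v' j y) = 0"
      using insert.IH[of ?J v'] insert.prems by auto
    define c where "c = - (\<Sum>j\<in>?J. \<kappa> j * (v j z / v j0 z))"
    define \<kappa>' where "\<kappa>' = \<kappa>(j0 := c)"
    have eq: "(\<Sum>j\<in>J. \<kappa>' j * v j y) = (\<Sum>j\<in>?J. \<kappa> j * v' j y)" for y
    proof -
      have "(\<Sum>j\<in>J. \<kappa>' j * v j y) = c * v j0 y + (\<Sum>j\<in>?J. \<kappa>' j * v j y)"
        using j0 insert.prems by (subst sum.remove[of J j0]) (auto simp: \<kappa>'_def)
      also have "(\<Sum>j\<in>?J. \<kappa>' j * v j y) = (\<Sum>j\<in>?J. \<kappa> j * v j y)"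
        by (rule sum.cong) (auto simp: \<kappa>'_def)
      finally show ?thesis
        by (simp add: c_def v'_def right_diff_distrib sum_subtractf sum_distrib_right mult.assoc)
    qed
    have "(\<Sum>j\<in>?J. \<kappa> j * v' j z) = 0" using j0 by (simp add: v'_def)
    then have "\<forall>y\<in>insert z R. (\<Sum>j\<in>J. \<kappa>' j * v j y) = 0" using \<kappa>(2) eq by auto
    moreover have "\<exists>j\<in>J. \<kappa>' j \<noteq> 0" using \<kappa>(1) by (auto simp: \<kappa>'_def)
    ultimately show ?thesis by blast
  qed
qed

lemma indep_card_le:
  assumes "finite J" "finite L" "indep J P v" "\<And>j. j \<in> J \<Longrightarrow> in_span L P w (v j)"
  shows "card J \<le> card L"
proof (rule ccontr)
  assume less: "\<not> card J \<le> card L"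
  obtain C where C: "\<And>j z. j \<in> J \<Longrightarrow> z \<in> P \<Longrightarrow> v j z = (\<Sum>l\<in>L. C j l * w l z)"
    using assms(4) unfolding in_span_def by metis
  obtain \<kappa> where \<kappa>: "\<exists>j\<in>J. \<kappa> j \<noteq> 0" "\<forall>l\<in>L. (\<Sum>j\<in>J. \<kappa> j * C j l) = 0"
    using underdetermined[of L J C] assms less by auto
  have "(\<Sum>j\<in>J. \<kappa> j * v j z) = 0" if "z \<in> P" for z
  proof -
    have "(\<Sum>j\<in>J. \<kappa> j * v j z) = (\<Sum>l\<in>L. (\<Sum>j\<in>J. \<kappa> j * C j l) * w l z)"
      using that C by (simp add: sum_distrib_left sum_distrib_right mult_ac) (rule sum.swap)
    then show ?thesis using \<kappa>(2) by simp
  qed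
  then show False using assms(3) \<kappa>(1) unfolding indep_def by blast
qed

text \<open>Induction on the spanning vectors: a functional that kills the old ones and is 1 on the
  new one projects the new vector out of \<open>w\<close> and out of later functionals. This is the
  Fredholm alternative over an arbitrary field.\<close>

lemma in_span_or_separated:
  fixes v :: "'j \<Rightarrow> 'z \<Rightarrow> 'k::field"
  assumes "finite J" "finite P"
  shows "in_span J P v w \<or> (\<exists>\<xi>. (\<forall>j\<in>J. pair P \<xi> (v j) = 0) \<and> pair P \<xi> w = 1)"
  using assms(1)
proof (induction J arbitrary: w rule: finite_induct)
  case empty
  show ?case
  proof (cases "\<forall>z\<in>P. w z = 0")
    case False
    then obtain z0 where "z0 \<in> P" "w z0 \<noteq> 0" by blast
    then have "pair P (\<lambda>z. (if z = z0 then 1 else 0) / w z0) w = 1"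
      using assms(2) pair_axis[of P z0 w] by (simp add: pair_def sum_divide_distrib[symmetric])
    then show ?thesis by blast
  qed (simp add: in_span_def)
next
  case (insert r J)
  show ?case
  proof (cases "in_span J P v (v r)")
    case True
    then obtain \<kappa> where \<kappa>: "\<forall>z\<in>P. v r z = (\<Sum>j\<in>J. \<kappa> j * v j z)" unfolding in_span_def by blast
    from insert.IH[of w] show ?thesis
    proof
      assume "in_span J P v w"
      then obtain \<kappa>' where "\<forall>z\<in>P. w z = (\<Sum>j\<in>J. \<kappa>' j * v j z)" unfolding in_span_def by blast
      then have "\<forall>z\<in>P. w z = (\<Sum>j\<in>insert r J. (\<kappa>'(r := 0)) j * v j z)"
        using insert.hyps by (auto intro!: sum.cong)
      then show ?thesis unfolding in_span_def by blast
    next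
      assume "\<exists>\<xi>. (\<forall>j\<in>J. pair P \<xi> (v j) = 0) \<and> pair P \<xi> w = 1"
      then obtain \<xi> where \<xi>: "\<forall>j\<in>J. pair P \<xi> (v j) = 0" "pair P \<xi> w = 1" by blast
      have "pair P \<xi> (v r) = pair P \<xi> (\<lambda>z. \<Sum>j\<in>J. \<kappa> j * v j z)"
        by (rule pair_cong) (use \<kappa> in simp)
      then have "pair P \<xi> (v r) = 0" using \<xi>(1) by (simp add: pair_sum)
      then show ?thesis using \<xi> by auto
    qed
  next
    case False
    then obtain \<xi> where \<xi>: "\<forall>j\<in>J. pair P \<xi> (v j) = 0" "pair P \<xi> (v r) = 1"
      using insert.IH[of "v r"] by blast
    define w' where "w' = (\<lambda>z. w z - pair P \<xi> w * v r z)"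
    from insert.IH[of w'] show ?thesis
    proof
      assume "in_span J P v w'"
      then obtain \<kappa> where "\<forall>z\<in>P. w' z = (\<Sum>j\<in>J. \<kappa> j * v j z)" unfolding in_span_def by blast
      then have "\<forall>z\<in>P. w z = pair P \<xi> w * v r z + (\<Sum>j\<in>J. \<kappa> j * v j z)"
        by (simp add: w'_def algebra_simps)
      then have "\<forall>z\<in>P. w z = (\<Sum>j\<in>insert r J. (\<kappa>(r := pair P \<xi> w)) j * v j z)"
        using insert.hyps by (auto intro!: sum.cong)
      then show ?thesis unfolding in_span_def by blast
    next
      assume "\<exists>\<xi>. (\<forall>j\<in>J. pair P \<xi> (v j) = 0) \<and> pair P \<xi> w' = 1"
      then obtain \<zeta> where \<zeta>: "\<forall>j\<in>J. pair P \<zeta> (v j) = 0" "pair P \<zeta> w' = 1" by blast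
      \<comment> \<open>The correction kills \<open>v r\<close>, and the value at \<open>w\<close>
        becomes \<open>pair P \<zeta> w' = 1\<close>.\<close>
      let ?\<zeta> = "\<lambda>z. \<zeta> z - pair P \<zeta> (v r) * \<xi> z"
      have "pair P ?\<zeta> w = 1"
        using \<zeta>(2) unfolding w'_def pair_minus_scale pair_minus_scale_left by (simp add: mult.commute)
      moreover have "\<forall>j\<in>insert r J. pair P ?\<zeta> (v j) = 0"
        using \<xi> \<zeta>(1) by (auto simp: pair_minus_scale_left)
      ultimately show ?thesis by blast
    qed
  qed
qed

lemma indep_not_in_span:
  assumes "indep J P v" "finite J" "j \<in> J"
  shows "\<not> in_span (J - {j}) P v (v j)"
proof
  assume "in_span (J - {j}) P v (v j)"
  then obtain \<kappa> where \<kappa>: "\<forall>z\<in>P. v j z = (\<Sum>l\<in>J - {j}. \<kappa> l * v l z)" unfolding in_span_def by blast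
  have "(\<Sum>l\<in>J. (\<kappa>(j := - 1)) l * v l z) = 0" if "z \<in> P" for z
  proof -
    have "(\<Sum>l\<in>J - {j}. (\<kappa>(j := - 1)) l * v l z) = (\<Sum>l\<in>J - {j}. \<kappa> l * v l z)"
      by (rule sum.cong) auto
    then show ?thesis using \<kappa> that by (subst sum.remove[OF assms(2,3)]) simp
  qed
  then have "(\<kappa>(j := - 1)) j = 0" using indepD[OF assms(1)] assms(3) by blast
  then show False by simp
qed

lemma indep_dual:
  assumes "indep J P v" "finite J" "finite P" "j \<in> J"
  shows "\<exists>\<xi>. (\<forall>l\<in>J - {j}. pair P \<xi> (v l) = 0) \<and> pair P \<xi> (v j) = 1"
  using in_span_or_separated[of "J - {j}" P v "v j"] indep_not_in_span[OF assms(1,2,4)] assms(2,3)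
  by auto

lemma indep_insert:
  assumes "finite J" "r \<notin> J" "indep J P v" "\<not> in_span J P v (v r)"
  shows "indep (insert r J) P v"
  unfolding indep_def
proof (intro allI impI)
  fix \<kappa> assume "\<forall>z\<in>P. (\<Sum>j\<in>insert r J. \<kappa> j * v j z) = 0"
  then have z: "\<And>z. z \<in> P \<Longrightarrow> \<kappa> r * v r z + (\<Sum>j\<in>J. \<kappa> j * v j z) = 0" using assms by simp
  have "\<kappa> r = 0"
  proof (rule ccontr)
    assume r: "\<kappa> r \<noteq> 0"
    have "\<forall>y\<in>P. v r y = (\<Sum>j\<in>J. (- \<kappa> j / \<kappa> r) * v j y)"
    proof
      fix y assume "y \<in> P"
      have "(\<Sum>j\<in>J. (- \<kappa> j / \<kappa> r) * v j y) = - (\<Sum>j\<in>J. \<kappa> j * v j y) / \<kappa> r"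
        by (simp add: sum_divide_distrib sum_negf)
      also have "(\<Sum>j\<in>J. \<kappa> j * v j y) = - (\<kappa> r * v r y)"
        using z[OF \<open>y \<in> P\<close>] by (simp add: add_eq_0_iff)
      finally show "v r y = (\<Sum>j\<in>J. (- \<kappa> j / \<kappa> r) * v j y)" using r by simp
    qed
    then have "in_span J P v (v r)" unfolding in_span_def by (rule exI[of _ "\<lambda>j. - \<kappa> j / \<kappa> r"])
    then show False using assms(4) by blast
  qed
  moreover have "\<forall>j\<in>J. \<kappa> j = 0"
  proof
    fix j assume "j \<in> J"
    show "\<kappa> j = 0" by (rule indepD[OF assms(3) _ \<open>j \<in> J\<close>, of \<kappa>]) (use z \<open>\<kappa> r = 0\<close> in simp)
  qed
  ultimately show "\<forall>j\<in>insert r J. \<kappa> j = 0" by simp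
qed

lemma in_span_mono:
  assumes "in_span J P v w" "J \<subseteq> J'" "finite J'"
  shows "in_span J' P v w"
proof -
  obtain \<kappa> where \<kappa>: "\<forall>z\<in>P. w z = (\<Sum>j\<in>J. \<kappa> j * v j z)" using assms(1) unfolding in_span_def by blast
  have "(\<Sum>j\<in>J. \<kappa> j * v j z) = (\<Sum>j\<in>J'. (if j \<in> J then \<kappa> j else 0) * v j z)" for z
    by (rule sum.mono_neutral_cong_left) (use assms in auto)
  then show ?thesis using \<kappa> unfolding in_span_def
    by (intro exI[of _ "\<lambda>j. if j \<in> J then \<kappa> j else 0"]) metis
qed

lemma in_span_self: "finite J \<Longrightarrow> j \<in> J \<Longrightarrow> in_span J P v (v j)"
  unfolding in_span_def
  by (rule exI[of _ "\<lambda>l. if l = j then 1 else 0"]) (simp add: if_distrib[of "\<lambda>x. x * _"] cong: if_cong)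

lemma in_span_trans:
  assumes "in_span J P v w" "\<And>j. j \<in> J \<Longrightarrow> in_span L P u (v j)"
  shows "in_span L P u w"
proof -
  obtain \<kappa> where \<kappa>: "\<forall>z\<in>P. w z = (\<Sum>j\<in>J. \<kappa> j * v j z)" using assms(1) unfolding in_span_def by blast
  obtain C where C: "\<And>j z. j \<in> J \<Longrightarrow> z \<in> P \<Longrightarrow> v j z = (\<Sum>l\<in>L. C j l * u l z)"
    using assms(2) unfolding in_span_def by metis
  have "w z = (\<Sum>l\<in>L. (\<Sum>j\<in>J. \<kappa> j * C j l) * u l z)" if "z \<in> P" for z
    using that \<kappa> C by (simp add: sum_distrib_left sum_distrib_right mult_ac) (rule sum.swap)
  then show ?thesis unfolding in_span_def by (intro exI[of _ "\<lambda>l. \<Sum>j\<in>J. \<kappa> j * C j l"]) blast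
qed

lemma maximal_indep:
  assumes "finite G"
  shows "\<exists>J\<subseteq>G. indep J P v \<and> (\<forall>g\<in>G. in_span J P v (v g))"
  using assms
proof (induction G rule: finite_induct)
  case empty
  show ?case by (intro exI[of _ "{}"]) (auto simp: indep_def)
next
  case (insert r G)
  then obtain J where J: "J \<subseteq> G" "indep J P v" "\<forall>g\<in>G. in_span J P v (v g)" by blast
  have fin: "finite J" using J(1) insert.hyps by (meson finite_subset)
  show ?case
  proof (cases "in_span J P v (v r)")
    case True
    then show ?thesis using J by (intro exI[of _ J]) auto
  next
    case False
    have "r \<notin> J" using J insert.hyps by auto
    then have "indep (insert r J) P v" using indep_insert[OF fin _ J(2)] False by blast
    moreover have "\<forall>g\<in>insert r G. in_span (insert r J) P v (v g)"
      using J(3) fin in_span_mono[of J P v _ "insert r J"] in_span_self[of "insert r J" r P v] by auto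
    ultimately show ?thesis using J(1) by (intro exI[of _ "insert r J"]) auto
  qed
qed

text \<open>A dimension count: \<open>J\<close> and \<open>F\<close> together are at least as
  numerous as the spanning family \<open>L\<close>, and a \<open>w\<close> in \<open>E\<close>
  outside the span of \<open>J\<close> would give one independent vector too many. It is applied
  with \<open>E\<close> the forms vanishing to order k + 1 at a point and \<open>F\<close> forms
  with independent jets there.\<close>

lemma exchange_in_span:
  assumes fin: "finite J" "finite F" "finite L" "J \<inter> F = {}"
    and J: "indep J P v"
    and E: "\<And>j. j \<in> J \<Longrightarrow> E (v j)" and Elin: "\<And>\<kappa> w. E w \<Longrightarrow> E (\<lambda>z. w z - (\<Sum>j\<in>J. \<kappa> j * v j z))"
    and Esc: "\<And>c w. E w \<Longrightarrow> E (\<lambda>z. c * w z)"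
    and Ecg: "\<And>w w'. E w \<Longrightarrow> (\<And>z. z \<in> P \<Longrightarrow> w z = w' z) \<Longrightarrow> E w'"
    and F: "\<And>\<kappa>. E (\<lambda>z. \<Sum>f\<in>F. \<kappa> f * v f z) \<Longrightarrow> \<forall>f\<in>F. \<kappa> f = 0"
    and span: "\<And>j. j \<in> J \<union> F \<Longrightarrow> in_span L P u (v j)" "in_span L P u w"
    and w: "E w" and card: "card L \<le> card J + card F"
  shows "in_span J P v w"
proof (rule ccontr)
  assume nw: "\<not> in_span J P v w"
  \<comment> \<open>The index \<open>None\<close> stands for the additional vector
    \<open>w\<close>.\<close>
  define v' where "v' = (\<lambda>j. case j of None \<Rightarrow> w | Some j \<Rightarrow> v j)"
  let ?K = "insert None (Some ` (J \<union> F))"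
  have split: "(\<Sum>j\<in>?K. \<kappa> j * v' j z) =
      \<kappa> None * w z + (\<Sum>j\<in>J. \<kappa> (Some j) * v j z) + (\<Sum>f\<in>F. \<kappa> (Some f) * v f z)" for \<kappa> z
    using fin by (subst sum.insert)
      (auto simp: v'_def sum.reindex sum.union_disjoint add.assoc simp del: image_Un)
  have "indep ?K P v'"
    unfolding indep_def
  proof (intro allI impI)
    fix \<kappa> assume "\<forall>z\<in>P. (\<Sum>j\<in>?K. \<kappa> j * v' j z) = 0"
    then have z: "\<kappa> None * w z + (\<Sum>j\<in>J. \<kappa> (Some j) * v j z) + (\<Sum>f\<in>F. \<kappa> (Some f) * v f z) = 0"
      if "z \<in> P" for z using that split by metis
    have "E (\<lambda>z. - \<kappa> None * w z - (\<Sum>j\<in>J. \<kappa> (Some j) * v j z))"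
      by (rule Elin) (rule Esc[OF w])
    then have "E (\<lambda>z. \<Sum>f\<in>F. \<kappa> (Some f) * v f z)"
      by (rule Ecg) (simp add: z[unfolded add_eq_0_iff])
    then have F0: "\<forall>f\<in>F. \<kappa> (Some f) = 0" by (rule F)
    then have z': "\<kappa> None * w z + (\<Sum>j\<in>J. \<kappa> (Some j) * v j z) = 0" if "z \<in> P" for z
      using z[OF that] by simp
    have N: "\<kappa> None = 0"
    proof (rule ccontr)
      assume n: "\<kappa> None \<noteq> 0"
      have "w y = (\<Sum>j\<in>J. (- \<kappa> (Some j) / \<kappa> None) * v j y)" if "y \<in> P" for y
      proof -
        have "(\<Sum>j\<in>J. (- \<kappa> (Some j) / \<kappa> None) * v j y) = - (\<Sum>j\<in>J. \<kappa> (Some j) * v j y) / \<kappa> None"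
          by (simp add: sum_divide_distrib sum_negf)
        also have "(\<Sum>j\<in>J. \<kappa> (Some j) * v j y) = - (\<kappa> None * w y)"
          using z'[OF that] by (simp add: add_eq_0_iff)
        finally show ?thesis using n by simp
      qed
      then have "in_span J P v w" unfolding in_span_def
        by (intro exI[of _ "\<lambda>j. - \<kappa> (Some j) / \<kappa> None"]) blast
      then show False using nw by blast
    qed
    have "\<forall>j\<in>J. \<kappa> (Some j) = 0"
    proof
      fix j assume "j \<in> J"
      show "\<kappa> (Some j) = 0"
        by (rule indepD[OF J _ \<open>j \<in> J\<close>, of "\<lambda>j. \<kappa> (Some j)"]) (use z' N in simp)
    qed
    then show "\<forall>j\<in>?K. \<kappa> j = 0" using F0 N by auto
  qed
  moreover have "in_span L P u (v' j)" if "j \<in> ?K" for j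
    using that span by (auto simp: v'_def)
  ultimately have "card ?K \<le> card L" using fin by (intro indep_card_le[of ?K L P v' u]) auto
  moreover have "card ?K = Suc (card J + card F)"
    using fin by (simp add: card_insert_if card_image card_Un_disjoint image_iff)
  ultimately show False using card by simp
qed

text \<open>A new test point is required only if some combination involving the new function
  vanishes on \<open>P\<close> but not on \<open>T\<close>; one such point is then enough. It makes
  forms on the infinite set \<open>T\<close> accessible to finite linear algebra.\<close>

lemma finite_test_points:
  fixes v :: "'j \<Rightarrow> 'z \<Rightarrow> 'k::field"
  assumes "finite J"
  shows "\<exists>P\<subseteq>T. finite P \<and> (\<forall>\<kappa>. (\<forall>z\<in>P. (\<Sum>j\<in>J. \<kappa> j * v j z) = 0) \<longrightarrow> (\<forall>z\<in>T. (\<Sum>j\<in>J. \<kappa> j * v j z) = 0))"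
  using assms
proof (induction J rule: finite_induct)
  case empty
  then show ?case by auto
next
  case (insert r J)
  then obtain P where P: "P \<subseteq> T" "finite P"
    "\<And>\<kappa>. (\<forall>z\<in>P. (\<Sum>j\<in>J. \<kappa> j * v j z) = 0) \<Longrightarrow> (\<forall>z\<in>T. (\<Sum>j\<in>J. \<kappa> j * v j z) = 0)" by blast
  have ins: "(\<Sum>j\<in>insert r J. \<kappa> j * v j z) = \<kappa> r * v r z + (\<Sum>j\<in>J. \<kappa> j * v j z)" for \<kappa> z
    using insert.hyps by simp
  show ?case
  proof (cases "\<exists>\<kappa>. \<kappa> r = 1 \<and> (\<forall>z\<in>P. (\<Sum>j\<in>insert r J. \<kappa> j * v j z) = 0)
      \<and> (\<exists>z\<in>T. (\<Sum>j\<in>insert r J. \<kappa> j * v j z) \<noteq> 0)")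
    case True
    then obtain \<mu> z0 where \<mu>: "\<mu> r = 1" "\<forall>z\<in>P. (\<Sum>j\<in>insert r J. \<mu> j * v j z) = 0" "z0 \<in> T"
      "(\<Sum>j\<in>insert r J. \<mu> j * v j z0) \<noteq> 0" by blast
    have main: "(\<Sum>j\<in>insert r J. \<kappa> j * v j z) = 0"
      if \<kappa>: "\<forall>z\<in>insert z0 P. (\<Sum>j\<in>insert r J. \<kappa> j * v j z) = 0" and z: "z \<in> T" for \<kappa> z
    proof -
      \<comment> \<open>Subtracting \<open>\<kappa> r\<close> times \<open>\<mu>\<close> leaves a
        combination without \<open>r\<close>, to which the test points for \<open>J\<close>
        apply.\<close>
      have eq: "(\<Sum>j\<in>J. (\<kappa> j - \<kappa> r * \<mu> j) * v j y) =
          (\<Sum>j\<in>insert r J. \<kappa> j * v j y) - \<kappa> r * (\<Sum>j\<in>insert r J. \<mu> j * v j y)" for y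
        unfolding ins using \<mu>(1)
        by (simp add: left_diff_distrib sum_subtractf sum_distrib_left distrib_left mult.assoc)
      have "\<forall>z\<in>P. (\<Sum>j\<in>J. (\<kappa> j - \<kappa> r * \<mu> j) * v j z) = 0" using \<kappa> \<mu>(2) unfolding eq by simp
      then have *: "\<forall>z\<in>T. (\<Sum>j\<in>J. (\<kappa> j - \<kappa> r * \<mu> j) * v j z) = 0" by (rule P(3))
      then have "\<kappa> r = 0" using \<mu>(3,4) \<kappa> unfolding eq by auto
      then show ?thesis using * z unfolding eq by simp
    qed
    show ?thesis
    proof (intro exI[of _ "insert z0 P"] conjI allI impI ballI)
      show "insert z0 P \<subseteq> T" "finite (insert z0 P)" using P(1,2) \<mu>(3) by auto
    qed (rule main)
  next
    case False
    have main: "(\<Sum>j\<in>insert r J. \<kappa> j * v j z) = 0"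
      if \<kappa>: "\<forall>z\<in>P. (\<Sum>j\<in>insert r J. \<kappa> j * v j z) = 0" and z: "z \<in> T" for \<kappa> z
    proof (cases "\<kappa> r = 0")
      case True
      then show ?thesis using \<kappa> P(3)[of \<kappa>] z unfolding ins by auto
    next
      case nz: False
      have eq: "(\<Sum>j\<in>insert r J. (\<kappa> j / \<kappa> r) * v j y) = (\<Sum>j\<in>insert r J. \<kappa> j * v j y) / \<kappa> r" for y
        by (simp add: sum_divide_distrib)
      have "\<forall>y\<in>P. (\<Sum>j\<in>insert r J. (\<kappa> j / \<kappa> r) * v j y) = 0" using \<kappa> unfolding eq by simp
      moreover have "\<kappa> r / \<kappa> r = 1" using nz by simp
      ultimately have "\<not> (\<exists>y\<in>T. (\<Sum>j\<in>insert r J. (\<kappa> j / \<kappa> r) * v j y) \<noteq> 0)"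
        using notE[OF False exI[of _ "\<lambda>j. \<kappa> j / \<kappa> r"]] by (intro notI) (simp only: simp_thms)
      then have "(\<Sum>j\<in>insert r J. (\<kappa> j / \<kappa> r) * v j z) = 0" using z by blast
      then show ?thesis using nz unfolding eq by simp
    qed
    show ?thesis
      by (intro exI[of _ P] conjI allI impI ballI) (rule P(1), rule P(2), rule main)
  qed
qed

section \<open>Rational families near a point of a Zariski closure\<close>

text \<open>\<open>near T x Q\<close>: \<open>Q\<close> holds on the trace on \<open>T\<close> of a Zariski neighbourhood of \<open>x\<close>;
  \<open>reg T x f v\<close>: on such a trace, \<open>f\<close> is a quotient of polynomials with value \<open>v\<close> at \<open>x\<close>.\<close>

definition near :: "('k::field^'i::finite) set \<Rightarrow> 'k^'i \<Rightarrow> ('k^'i \<Rightarrow> bool) \<Rightarrow> bool" where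
  "near T x Q \<longleftrightarrow> (\<exists>q. mpoly_eval q x \<noteq> 0 \<and> (\<forall>y\<in>T. mpoly_eval q y \<noteq> 0 \<longrightarrow> Q y))"

definition reg :: "('k::field^'i::finite) set \<Rightarrow> 'k^'i \<Rightarrow> ('k^'i \<Rightarrow> 'k) \<Rightarrow> 'k \<Rightarrow> bool" where
  "reg T x f v \<longleftrightarrow> (\<exists>p q. mpoly_eval q x \<noteq> 0 \<and> v * mpoly_eval q x = mpoly_eval p x \<and>
     (\<forall>y\<in>T. mpoly_eval q y \<noteq> 0 \<longrightarrow> f y * mpoly_eval q y = mpoly_eval p y))"

lemma regE:
  assumes "reg T x f v"
  obtains p q where "mpoly_eval q x \<noteq> 0" "v * mpoly_eval q x = mpoly_eval p x"
    "\<And>y. y \<in> T \<Longrightarrow> mpoly_eval q y \<noteq> 0 \<Longrightarrow> f y * mpoly_eval q y = mpoly_eval p y"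
  using assms unfolding reg_def by blast

lemma nearI_all: "(\<And>y. y \<in> T \<Longrightarrow> Q y) \<Longrightarrow> near T x Q"
  unfolding near_def by (rule exI[of _ 1]) auto

lemma near_conj: "near T x Q \<Longrightarrow> near T x R \<Longrightarrow> near T x (\<lambda>y. Q y \<and> R y)"
  unfolding near_def
proof (elim exE conjE)
  fix q r assume "mpoly_eval q x \<noteq> 0" "\<forall>y\<in>T. mpoly_eval q y \<noteq> 0 \<longrightarrow> Q y"
    "mpoly_eval r x \<noteq> 0" "\<forall>y\<in>T. mpoly_eval r y \<noteq> 0 \<longrightarrow> R y"
  then show "\<exists>q. mpoly_eval q x \<noteq> 0 \<and> (\<forall>y\<in>T. mpoly_eval q y \<noteq> 0 \<longrightarrow> Q y \<and> R y)"
    by (intro exI[of _ "q * r"]) auto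
qed

lemma near_mono: "near T x Q \<Longrightarrow> (\<And>y. y \<in> T \<Longrightarrow> Q y \<Longrightarrow> R y) \<Longrightarrow> near T x R"
  unfolding near_def by blast

lemma near_ball: "finite J \<Longrightarrow> (\<And>j. j \<in> J \<Longrightarrow> near T x (Q j)) \<Longrightarrow> near T x (\<lambda>y. \<forall>j\<in>J. Q j y)"
proof (induction J rule: finite_induct)
  case empty
  then show ?case by (simp add: nearI_all)
next
  case (insert j J)
  then have "near T x (\<lambda>y. Q j y \<and> (\<forall>j\<in>J. Q j y))" by (intro near_conj) auto
  then show ?case by (rule near_mono) auto
qed

text \<open>Since \<open>x\<close> is in the closure of \<open>T\<close>, a polynomial nonzero at
  \<open>x\<close> cannot vanish on all of \<open>T\<close>.\<close>

lemma near_ex: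
  fixes T :: "('k::field_char_0^'i::finite) set"
  assumes "near T x Q" "cone T" "x \<in> zariski_closure T"
  shows "\<exists>y\<in>T. Q y"
proof (rule ccontr)
  assume "\<not> ?thesis"
  then obtain q where "mpoly_eval q x \<noteq> 0" "\<forall>y\<in>T. mpoly_eval q y = 0"
    using assms(1) unfolding near_def by blast
  then show False using vanishing_closure[OF assms(2) _ assms(3)] by blast
qed

lemma reg_poly: "reg T x (mpoly_eval p) (mpoly_eval p x)"
  unfolding reg_def by (rule exI[of _ p], rule exI[of _ 1]) simp

lemma reg_const:
  fixes x :: "'k::field^'i::finite"
  shows "reg T x (\<lambda>_. c) c"
proof -
  have "mpoly_eval (cpoly c) = (\<lambda>y::'k^'i. c)" by (rule ext) simp
  then show ?thesis using reg_poly[of T x "cpoly c"] by simp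
qed

lemma reg_coord:
  fixes x :: "'k::field^'i::finite"
  shows "reg T x (\<lambda>y. y $ i) (x $ i)"
proof -
  have "mpoly_eval (vpoly i) = (\<lambda>y::'k^'i. y $ i)" by (rule ext) simp
  then show ?thesis using reg_poly[of T x "vpoly i"] by simp
qed

lemma reg_add:
  assumes "reg T x f v" "reg T x g w"
  shows "reg T x (\<lambda>y. f y + g y) (v + w)"
proof -
  from assms(1) obtain p q where *: "mpoly_eval q x \<noteq> 0" "v * mpoly_eval q x = mpoly_eval p x"
    "\<And>y. y \<in> T \<Longrightarrow> mpoly_eval q y \<noteq> 0 \<Longrightarrow> f y * mpoly_eval q y = mpoly_eval p y"
    by (rule regE) blast
  from assms(2) obtain p' q' where **: "mpoly_eval q' x \<noteq> 0" "w * mpoly_eval q' x = mpoly_eval p' x"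
    "\<And>y. y \<in> T \<Longrightarrow> mpoly_eval q' y \<noteq> 0 \<Longrightarrow> g y * mpoly_eval q' y = mpoly_eval p' y"
    by (rule regE) blast
  show ?thesis unfolding reg_def
  proof (rule exI[of _ "p * q' + p' * q"], rule exI[of _ "q * q'"], intro conjI ballI impI)
    show "mpoly_eval (q * q') x \<noteq> 0" using *(1) **(1) by simp
    show "(v + w) * mpoly_eval (q * q') x = mpoly_eval (p * q' + p' * q) x"
      by (simp add: *(2)[symmetric] **(2)[symmetric] algebra_simps)
    fix y assume "y \<in> T" "mpoly_eval (q * q') y \<noteq> 0"
    then show "(f y + g y) * mpoly_eval (q * q') y = mpoly_eval (p * q' + p' * q) y"
      by (simp add: *(3)[symmetric] **(3)[symmetric] algebra_simps)
  qed
qed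

lemma reg_mult:
  assumes "reg T x f v" "reg T x g w"
  shows "reg T x (\<lambda>y. f y * g y) (v * w)"
proof -
  from assms(1) obtain p q where *: "mpoly_eval q x \<noteq> 0" "v * mpoly_eval q x = mpoly_eval p x"
    "\<And>y. y \<in> T \<Longrightarrow> mpoly_eval q y \<noteq> 0 \<Longrightarrow> f y * mpoly_eval q y = mpoly_eval p y"
    by (rule regE) blast
  from assms(2) obtain p' q' where **: "mpoly_eval q' x \<noteq> 0" "w * mpoly_eval q' x = mpoly_eval p' x"
    "\<And>y. y \<in> T \<Longrightarrow> mpoly_eval q' y \<noteq> 0 \<Longrightarrow> g y * mpoly_eval q' y = mpoly_eval p' y"
    by (rule regE) blast
  show ?thesis unfolding reg_def
  proof (rule exI[of _ "p * p'"], rule exI[of _ "q * q'"], intro conjI ballI impI)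
    show "mpoly_eval (q * q') x \<noteq> 0" using *(1) **(1) by simp
    show "v * w * mpoly_eval (q * q') x = mpoly_eval (p * p') x"
      by (simp add: *(2)[symmetric] **(2)[symmetric] mult_ac)
    fix y assume "y \<in> T" "mpoly_eval (q * q') y \<noteq> 0"
    then show "f y * g y * mpoly_eval (q * q') y = mpoly_eval (p * p') y"
      by (simp add: *(3)[symmetric] **(3)[symmetric] mult_ac)
  qed
qed

lemma reg_sum: "(\<And>j. j \<in> J \<Longrightarrow> reg T x (f j) (v j)) \<Longrightarrow> reg T x (\<lambda>y. \<Sum>j\<in>J. f j y) (\<Sum>j\<in>J. v j)"
  by (induction J rule: infinite_finite_induct) (auto intro: reg_add reg_const)

lemma reg_prod: "(\<And>j. j \<in> J \<Longrightarrow> reg T x (f j) (v j)) \<Longrightarrow> reg T x (\<lambda>y. \<Prod>j\<in>J. f j y) (\<Prod>j\<in>J. v j)"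
  by (induction J rule: infinite_finite_induct) (auto intro: reg_mult reg_const)

lemma reg_minus: "reg T x f v \<Longrightarrow> reg T x g w \<Longrightarrow> reg T x (\<lambda>y. f y - g y) (v - w)"
  using reg_add[of T x f v "\<lambda>y. - 1 * g y" "- 1 * w"] reg_mult[OF reg_const, of T x g w "- 1"] by simp

lemma reg_power: "reg T x f v \<Longrightarrow> reg T x (\<lambda>y. f y ^ e) (v ^ e)"
  by (induction e) (auto intro: reg_mult reg_const)

lemma reg_inverse:
  assumes "reg T x f v" "v \<noteq> 0"
  shows "reg T x (\<lambda>y. inverse (f y)) (inverse v)"
proof -
  from assms(1) obtain p q where *: "mpoly_eval q x \<noteq> 0" "v * mpoly_eval q x = mpoly_eval p x"
    "\<And>y. y \<in> T \<Longrightarrow> mpoly_eval q y \<noteq> 0 \<Longrightarrow> f y * mpoly_eval q y = mpoly_eval p y"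
    by (rule regE) blast
  show ?thesis unfolding reg_def
  \<comment> \<open>The extra factor \<open>q\<close> makes the new denominator vanish wherever the
    old one does, so the equation for \<open>f\<close> is available off its zeros.\<close>
  proof (rule exI[of _ "q * q"], rule exI[of _ "p * q"], intro conjI ballI impI)
    show "mpoly_eval (p * q) x \<noteq> 0" using *(1) assms(2) by (simp add: *(2)[symmetric])
    show "inverse v * mpoly_eval (p * q) x = mpoly_eval (q * q) x"
      using assms(2) by (simp add: *(2)[symmetric])
    fix y assume "y \<in> T" "mpoly_eval (p * q) y \<noteq> 0"
    then show "inverse (f y) * mpoly_eval (p * q) y = mpoly_eval (q * q) y"
      by (auto simp add: *(3)[symmetric])
  qed
qed

lemma reg_near_nonzero:
  assumes "reg T x f v" "v \<noteq> 0"
  shows "near T x (\<lambda>y. f y \<noteq> 0)"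
proof -
  from assms(1) obtain p q where *: "mpoly_eval q x \<noteq> 0" "v * mpoly_eval q x = mpoly_eval p x"
    "\<And>y. y \<in> T \<Longrightarrow> mpoly_eval q y \<noteq> 0 \<Longrightarrow> f y * mpoly_eval q y = mpoly_eval p y"
    by (rule regE) blast
  show ?thesis unfolding near_def
  proof (intro exI[of _ "p * q"] conjI ballI impI)
    show "mpoly_eval (p * q) x \<noteq> 0" using *(1) assms(2) by (simp add: *(2)[symmetric])
    fix y assume "y \<in> T" "mpoly_eval (p * q) y \<noteq> 0"
    then show "f y \<noteq> 0" using *(3)[of y] by auto
  qed
qed

lemma reg_eval:
  assumes "\<And>i. reg T x (\<lambda>y. \<eta> y $ i) (h $ i)"
  shows "reg T x (\<lambda>y. mpoly_eval F (\<eta> y)) (mpoly_eval F h)"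
  unfolding mpoly_eval_alt meval_def
  by (intro reg_sum reg_mult reg_const reg_prod reg_power assms)

lemma reg_pair:
  assumes "\<And>z. z \<in> P \<Longrightarrow> reg T x (\<lambda>y. f y z) (f0 z)" "\<And>z. z \<in> P \<Longrightarrow> reg T x (\<lambda>y. g y z) (g0 z)"
  shows "reg T x (\<lambda>y. pair P (f y) (g y)) (pair P f0 g0)"
  unfolding pair_def using assms by (intro reg_sum reg_mult)

text \<open>Equations are added one at a time. A vector \<open>g\<close> dual to the new equation is
  extended together with the solution, and a regular multiple of it corrects the solution; the
  multiplier vanishes at \<open>x\<close>, so the value there is kept.\<close>

lemma extend_solution:
  assumes "finite J" "finite P"
    and N: "\<And>j z. j \<in> J \<Longrightarrow> z \<in> P \<Longrightarrow> reg T x (\<lambda>y. N j y z) (N0 j z)"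
    and "indep J P N0" and "\<And>j. j \<in> J \<Longrightarrow> pair P (N0 j) h0 = 0"
  shows "\<exists>\<eta>. (\<forall>z\<in>P. reg T x (\<lambda>y. \<eta> y z) (h0 z)) \<and> near T x (\<lambda>y. \<forall>j\<in>J. pair P (N j y) (\<eta> y) = 0)"
  using assms(1) N assms(4,5)
proof (induction J arbitrary: h0 rule: finite_induct)
  case empty
  show ?case by (intro exI[of _ "\<lambda>_. h0"]) (auto intro: reg_const nearI_all)
next
  case (insert r J)
  obtain g where g: "\<forall>l\<in>insert r J - {r}. pair P g (N0 l) = 0" "pair P g (N0 r) = 1"
    using indep_dual[OF insert.prems(2), of r] insert.hyps assms(2) by auto
  have indJ: "indep J P N0"
    unfolding indep_def
  proof (intro allI impI ballI)
    fix \<kappa> j assume z: "\<forall>z\<in>P. (\<Sum>j\<in>J. \<kappa> j * N0 j z) = 0" and j: "j \<in> J"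
    have eq: "(\<Sum>j\<in>insert r J. (\<kappa>(r := 0)) j * N0 j z) = (\<Sum>j\<in>J. \<kappa> j * N0 j z)" for z
      using insert.hyps by (auto intro!: sum.cong)
    have "(\<kappa>(r := 0)) j = 0"
      by (rule indepD[OF insert.prems(2), of "\<kappa>(r := 0)"], subst eq) (use z j in auto)
    then show "\<kappa> j = 0" using j insert.hyps by (auto split: if_splits)
  qed
  obtain \<eta> where \<eta>: "\<forall>z\<in>P. reg T x (\<lambda>y. \<eta> y z) (h0 z)" "near T x (\<lambda>y. \<forall>j\<in>J. pair P (N j y) (\<eta> y) = 0)"
    using insert.IH[of h0] insert.prems indJ by auto
  have "pair P (N0 j) g = 0" if "j \<in> J" for j
    using g(1) that insert.hyps pair_commute[of P g "N0 j"] by auto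
  then obtain \<gamma> where \<gamma>: "\<forall>z\<in>P. reg T x (\<lambda>y. \<gamma> y z) (g z)" "near T x (\<lambda>y. \<forall>j\<in>J. pair P (N j y) (\<gamma> y) = 0)"
    using insert.IH[of g] insert.prems(1) indJ by auto
  define A where "A y = pair P (N r y) (\<eta> y)" for y
  define B where "B y = pair P (N r y) (\<gamma> y)" for y
  have A: "reg T x A 0"
    using reg_pair[of P T x "N r" "N0 r" \<eta> h0] insert.prems(1)[of r] \<eta>(1) insert.prems(3)[of r]
    by (simp add: A_def[abs_def])
  have B: "reg T x B 1"
    using reg_pair[of P T x "N r" "N0 r" \<gamma> g] insert.prems(1)[of r] \<gamma>(1) g(2) pair_commute[of P g "N0 r"]
    by (simp add: B_def[abs_def])
  \<comment> \<open>\<open>A\<close> has value 0 and \<open>B\<close> has value 1 at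
    \<open>x\<close>, so the quotient is regular with value 0 there.\<close>
  define \<theta> where "\<theta> y z = \<eta> y z - (A y * inverse (B y)) * \<gamma> y z" for y z
  have "reg T x (\<lambda>y. \<theta> y z) (h0 z)" if "z \<in> P" for z
  proof -
    have "reg T x (\<lambda>y. \<theta> y z) (h0 z - (0 * inverse 1) * g z)"
      unfolding \<theta>_def using that \<eta>(1) \<gamma>(1) A B
      by (intro reg_minus reg_mult reg_inverse) auto
    then show ?thesis by simp
  qed
  moreover have "near T x (\<lambda>y. \<forall>j\<in>insert r J. pair P (N j y) (\<theta> y) = 0)"
  proof (rule near_mono[OF near_conj[OF near_conj[OF \<eta>(2) \<gamma>(2)] reg_near_nonzero[OF B]]])
    fix y assume "((\<forall>j\<in>J. pair P (N j y) (\<eta> y) = 0) \<and> (\<forall>j\<in>J. pair P (N j y) (\<gamma> y) = 0)) \<and> B y \<noteq> 0"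
    then show "\<forall>j\<in>insert r J. pair P (N j y) (\<theta> y) = 0"
      by (auto simp: \<theta>_def[abs_def] pair_minus_scale A_def[symmetric] B_def[symmetric])
  qed simp
  ultimately show ?case by blast
qed

lemma indep_subset:
  assumes "indep J P v" "J' \<subseteq> J" "finite J"
  shows "indep J' P v"
  unfolding indep_def
proof (intro allI impI ballI)
  fix \<kappa> j assume z: "\<forall>z\<in>P. (\<Sum>j\<in>J'. \<kappa> j * v j z) = 0" and j: "j \<in> J'"
  have eq: "(\<Sum>j\<in>J. (if j \<in> J' then \<kappa> j else 0) * v j z) = (\<Sum>j\<in>J'. \<kappa> j * v j z)" for z
    by (rule sum.mono_neutral_cong_right) (use assms in auto)
  have "(if j \<in> J' then \<kappa> j else 0) = 0"
    by (rule indepD[OF assms(1), of "\<lambda>j. if j \<in> J' then \<kappa> j else 0"], subst eq) (use z j assms in auto)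
  then show "\<kappa> j = 0" using j by simp
qed

text \<open>Independence is witnessed by a dual family; its extensions still annihilate the other
  vectors, and the diagonal pairings stay nonzero near \<open>x\<close>.\<close>

lemma indep_near:
  assumes "finite J" "finite P"
    and N: "\<And>j z. j \<in> J \<Longrightarrow> z \<in> P \<Longrightarrow> reg T x (\<lambda>y. N j y z) (N0 j z)"
    and ind: "indep J P N0"
  shows "near T x (\<lambda>y. indep J P (\<lambda>j. N j y))"
proof -
  have "\<exists>\<gamma>. near T x (\<lambda>y. (\<forall>l\<in>J - {j}. pair P (N l y) (\<gamma> y) = 0) \<and> pair P (N j y) (\<gamma> y) \<noteq> 0)"
    if j: "j \<in> J" for j
  proof -
    obtain g where g: "\<forall>l\<in>J - {j}. pair P g (N0 l) = 0" "pair P g (N0 j) = 1"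
      using indep_dual[OF ind assms(1,2) j] by blast
    have g': "pair P (N0 l) g = 0" if "l \<in> J - {j}" for l
      using g(1) that by (subst pair_commute) blast
    have "\<exists>\<gamma>. (\<forall>z\<in>P. reg T x (\<lambda>y. \<gamma> y z) (g z)) \<and> near T x (\<lambda>y. \<forall>l\<in>J - {j}. pair P (N l y) (\<gamma> y) = 0)"
    proof (rule extend_solution[of "J - {j}" P T x N N0 g])
      show "indep (J - {j}) P N0" by (rule indep_subset[OF ind _ assms(1)]) blast
    qed (use assms(1,2) N g' in auto)
    then obtain \<gamma> where \<gamma>: "\<forall>z\<in>P. reg T x (\<lambda>y. \<gamma> y z) (g z)"
      "near T x (\<lambda>y. \<forall>l\<in>J - {j}. pair P (N l y) (\<gamma> y) = 0)"
      by blast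
    have "reg T x (\<lambda>y. pair P (N j y) (\<gamma> y)) (pair P (N0 j) g)"
      using N j \<gamma>(1) by (intro reg_pair) auto
    then have "near T x (\<lambda>y. pair P (N j y) (\<gamma> y) \<noteq> 0)"
      by (rule reg_near_nonzero) (simp add: g(2) pair_commute[of P "N0 j" g])
    then show ?thesis using near_conj[OF \<gamma>(2)] by blast
  qed
  then have "\<forall>j\<in>J. \<exists>\<gamma>. near T x (\<lambda>y. (\<forall>l\<in>J - {j}. pair P (N l y) (\<gamma> y) = 0) \<and> pair P (N j y) (\<gamma> y) \<noteq> 0)"
    by blast
  from bchoice[OF this] obtain \<gamma> where \<gamma>: "\<And>j. j \<in> J \<Longrightarrow>
      near T x (\<lambda>y. (\<forall>l\<in>J - {j}. pair P (N l y) (\<gamma> j y) = 0) \<and> pair P (N j y) (\<gamma> j y) \<noteq> 0)"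
    by blast
  have "near T x (\<lambda>y. \<forall>j\<in>J. (\<forall>l\<in>J - {j}. pair P (N l y) (\<gamma> j y) = 0) \<and> pair P (N j y) (\<gamma> j y) \<noteq> 0)"
    by (rule near_ball[OF assms(1) \<gamma>])
  then show ?thesis
  proof (rule near_mono)
    fix y assume y: "\<forall>j\<in>J. (\<forall>l\<in>J - {j}. pair P (N l y) (\<gamma> j y) = 0) \<and> pair P (N j y) (\<gamma> j y) \<noteq> 0"
    show "indep J P (\<lambda>j. N j y)"
      unfolding indep_def
    proof (intro allI impI ballI)
      fix \<kappa> j assume z: "\<forall>z\<in>P. (\<Sum>j\<in>J. \<kappa> j * N j y z) = 0" and j: "j \<in> J"
      have "0 = pair P (\<gamma> j y) (\<lambda>z. \<Sum>j\<in>J. \<kappa> j * N j y z)" using z by (simp add: pair_def)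
      also have "\<dots> = (\<Sum>l\<in>J. \<kappa> l * pair P (\<gamma> j y) (N l y))" by (rule pair_sum)
      also have "\<dots> = (\<Sum>l\<in>{j}. \<kappa> l * pair P (\<gamma> j y) (N l y))"
        by (rule sum.mono_neutral_right) (use assms(1) j y in \<open>auto simp: pair_commute[of P "\<gamma> j y"]\<close>)
      finally show "\<kappa> j = 0" using y j by (simp add: pair_commute[of P "\<gamma> j y"])
    qed
  qed
qed

section \<open>Toric varieties\<close>

lemma cone_zero: "cone S \<Longrightarrow> 0 \<notin> S"
  by (simp add: cone_def)

lemma power_int_sum:
  fixes x :: "'k::field"
  assumes "x \<noteq> 0"
  shows "x powi (\<Sum>i\<in>S. f i) = (\<Prod>i\<in>S. x powi f i)"
  by (induction S rule: infinite_finite_induct) (use assms in \<open>auto simp: power_int_add\<close>)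

lemma power_int_prod:
  fixes f :: "'a \<Rightarrow> 'k::field"
  shows "(\<Prod>i\<in>S. f i) powi z = (\<Prod>i\<in>S. f i powi z)"
  by (induction S rule: infinite_finite_induct) (auto simp: power_int_mult_distrib)

section \<open>Laurent monomials and the parametrized torus\<close>

definition mono_of :: "('i::finite \<Rightarrow> nat) \<Rightarrow> ('i \<Rightarrow>\<^sub>0 nat)" where
  "mono_of f = Abs_poly_mapping f"

lemma lookup_mono_of [simp]: "lkp (mono_of f) i = f i"
  by (simp add: mono_of_def)

text \<open>\<open>pos_mono z\<close> and \<open>neg_mono z\<close> are the numerator and the denominator of the Laurent monomial
  with exponent \<open>z\<close>.\<close>

definition pos_mono :: "('i::finite \<Rightarrow> int) \<Rightarrow> ('i \<Rightarrow>\<^sub>0 nat)" where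
  "pos_mono z = mono_of (\<lambda>i. nat (z i))"

definition neg_mono :: "('i::finite \<Rightarrow> int) \<Rightarrow> ('i \<Rightarrow>\<^sub>0 nat)" where
  "neg_mono z = mono_of (\<lambda>i. nat (- z i))"

lemma meval_pos_neg:
  assumes "\<And>i. y $ i \<noteq> 0"
  shows "meval (pos_mono z) y = meval (neg_mono z) y * (\<Prod>i\<in>UNIV. y $ i powi z i)"
proof -
  have "y $ i ^ nat (z i) = y $ i ^ nat (- z i) * y $ i powi z i" for i
    using assms[of i] by (cases "z i \<ge> 0") (auto simp: power_int_def power_inverse)
  then show ?thesis by (simp add: meval_def pos_mono_def neg_mono_def prod.distrib)
qed

lemma meval_nonzero: "(\<And>i. y $ i \<noteq> 0) \<Longrightarrow> meval m y \<noteq> 0"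
  by (simp add: meval_def)

lemma mdeg_pos_neg: "int (mdeg (pos_mono z)) - int (mdeg (neg_mono z)) = (\<Sum>i\<in>UNIV. z i)"
proof -
  have "int (nat (z i)) - int (nat (- z i)) = z i" for i by simp
  then show ?thesis by (simp add: mdeg_def pos_mono_def neg_mono_def sum_subtractf[symmetric])
qed

definition mon :: "('i::finite \<Rightarrow>\<^sub>0 nat) \<Rightarrow> ('k::field, 'i) mpoly" where
  "mon m = Poly_Mapping.single m 1"

lemma eval_mon [simp]: "mpoly_eval (mon m) x = meval m x"
  by (simp add: mon_def)

lemma hdeg_mon: "hdeg (mdeg m) (mon m)"
  by (simp add: mon_def hdeg_single)

definition chi :: "nat \<Rightarrow> ('i::finite \<Rightarrow> nat \<Rightarrow> int) \<Rightarrow> (nat \<Rightarrow> 'k::field) \<Rightarrow> 'k^'i" where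
  "chi N \<alpha> \<tau> = (\<chi> i. \<Prod>m<N. \<tau> m powi \<alpha> i m)"

text \<open>The coordinates 0, ..., l are free and the others are 1. The closures of these subtori
  form the longest chain of irreducible sets in the toric variety.\<close>

definition tsub :: "nat \<Rightarrow> ('i::finite \<Rightarrow> nat \<Rightarrow> int) \<Rightarrow> nat \<Rightarrow> ('k::field^'i) set" where
  "tsub N \<alpha> l = {chi N \<alpha> \<tau> | \<tau>. (\<forall>m<N. \<tau> m \<noteq> 0) \<and> (\<forall>m<N. l < m \<longrightarrow> \<tau> m = 1)}"

definition tcone :: "nat \<Rightarrow> ('i::finite \<Rightarrow> nat \<Rightarrow> int) \<Rightarrow> ('k::field^'i) set" where
  "tcone N \<alpha> = {chi N \<alpha> \<tau> | \<tau>. \<forall>m<N. \<tau> m \<noteq> 0}"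

lemma tsub_full: "tsub N \<alpha> N = tcone N \<alpha>"
  by (auto simp: tsub_def tcone_def)

lemma tsub_mono: "l \<le> l' \<Longrightarrow> tsub N \<alpha> l \<subseteq> tsub N \<alpha> l'"
proof
  fix y assume l: "l \<le> l'" and "y \<in> tsub N \<alpha> l"
  then obtain \<tau> where "y = chi N \<alpha> \<tau>" "\<forall>m<N. \<tau> m \<noteq> 0" "\<forall>m<N. l < m \<longrightarrow> \<tau> m = 1"
    unfolding tsub_def by blast
  then show "y \<in> tsub N \<alpha> l'" unfolding tsub_def
    using l by (intro CollectI exI[of _ \<tau>]) auto
qed

lemma tsub_subset: "tsub N \<alpha> l \<subseteq> tcone N \<alpha>"
  by (auto simp: tsub_def tcone_def)

text \<open>The exponent of the parameter \<open>\<tau> l\<close> in the monomial \<open>m\<close>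
  restricted to the torus.\<close>

definition wt :: "('i::finite \<Rightarrow> nat \<Rightarrow> int) \<Rightarrow> ('i \<Rightarrow>\<^sub>0 nat) \<Rightarrow> nat \<Rightarrow> int" where
  "wt \<alpha> m l = (\<Sum>i\<in>UNIV. int (lkp m i) * \<alpha> i l)"

lemma chi_nonzero: "(\<And>m. m < N \<Longrightarrow> \<tau> m \<noteq> 0) \<Longrightarrow> chi N \<alpha> \<tau> $ i \<noteq> 0"
  by (simp add: chi_def)

lemma prod_chi:
  assumes "\<And>m. m < N \<Longrightarrow> \<tau> m \<noteq> 0"
  shows "(\<Prod>i\<in>UNIV. chi N \<alpha> \<tau> $ i powi z i) = (\<Prod>l<N. \<tau> l powi (\<Sum>i\<in>UNIV. z i * \<alpha> i l))"
proof -
  have "(\<Prod>i\<in>UNIV. chi N \<alpha> \<tau> $ i powi z i) = (\<Prod>i\<in>UNIV. \<Prod>l<N. \<tau> l powi (z i * \<alpha> i l))"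
    by (simp add: chi_def power_int_prod power_int_mult[symmetric] mult.commute)
  also have "\<dots> = (\<Prod>l<N. \<Prod>i\<in>UNIV. \<tau> l powi (z i * \<alpha> i l))"
    by (rule prod.swap)
  also have "\<dots> = (\<Prod>l<N. \<tau> l powi (\<Sum>i\<in>UNIV. z i * \<alpha> i l))"
    using assms by (intro prod.cong) (auto simp: power_int_sum)
  finally show ?thesis .
qed

lemma meval_chi:
  assumes "\<And>m. m < N \<Longrightarrow> \<tau> m \<noteq> 0"
  shows "meval m (chi N \<alpha> \<tau>) = (\<Prod>l<N. \<tau> l powi wt \<alpha> m l)"
  using prod_chi[OF assms, where \<alpha> = \<alpha> and z = "\<lambda>i. int (lkp m i)"] by (simp add: meval_def wt_def)

lemma tcone_nonzero: "y \<in> tcone N \<alpha> \<Longrightarrow> y $ i \<noteq> 0"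
  by (auto simp: tcone_def chi_nonzero)

text \<open>\<open>N = n + 1\<close>, and \<open>\<alpha> i\<close> is the point \<open>(1, a\<^sub>i)\<close>.\<close>

locale toric =
  fixes N :: nat and \<alpha> :: "'i::finite \<Rightarrow> nat \<Rightarrow> int"
  assumes alpha_0: "\<And>i. \<alpha> i 0 = 1" and N_pos: "0 < N"
    and gen: "generates_lattice N \<alpha>"
begin

text \<open>The Laurent monomial with exponent \<open>C m\<close> recovers the parameter
  \<open>\<tau> m\<close> on the torus.\<close>

definition C :: "nat \<Rightarrow> 'i \<Rightarrow> int" where
  "C m = (SOME c. (\<lambda>l. if l = m then 1 else 0) = (\<lambda>l. \<Sum>i\<in>UNIV. c i * \<alpha> i l))"

lemma C: 
  assumes "m < N" shows "(\<Sum>i\<in>UNIV. C m i * \<alpha> i l) = (if l = m then 1 else 0)"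
proof -
  have "(\<lambda>l. if l = m then 1 else (0::int)) \<in> vecs N" using assms by (auto simp: vecs_def)
  then have "\<exists>c. (\<lambda>l. if l = m then 1 else 0) = (\<lambda>l. \<Sum>i\<in>UNIV. c i * \<alpha> i l)"
    using gen unfolding generates_lattice_def by blast
  then have "(\<lambda>l. if l = m then 1 else 0) = (\<lambda>l. \<Sum>i\<in>UNIV. C m i * \<alpha> i l)"
    unfolding C_def by (rule someI_ex)
  then show ?thesis by (rule fun_cong[symmetric])
qed

text \<open>The integer relation expressing \<open>\<alpha> i\<close> through the unit vectors, hence through all points.\<close>

definition rel :: "'i \<Rightarrow> 'i \<Rightarrow> int" where
  "rel i i' = (if i' = i then 1 else 0) - (\<Sum>m<N. \<alpha> i m * C m i')"

definition relation :: "('i \<Rightarrow> int) \<Rightarrow> bool" where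
  "relation z \<longleftrightarrow> (\<forall>l<N. (\<Sum>i\<in>UNIV. z i * \<alpha> i l) = 0)"

lemma relation_rel: "relation (rel i)"
  unfolding relation_def
proof (intro allI impI)
  fix l assume l: "l < N"
  have "(\<Sum>i'\<in>UNIV. (\<Sum>m<N. \<alpha> i m * C m i') * \<alpha> i' l) = (\<Sum>m<N. \<alpha> i m * (\<Sum>i'\<in>UNIV. C m i' * \<alpha> i' l))"
    by (simp add: sum_distrib_left sum_distrib_right mult.assoc) (rule sum.swap)
  also have "\<dots> = (\<Sum>m<N. if m = l then \<alpha> i m else 0)"
    by (rule sum.cong) (auto simp: C)
  finally have "(\<Sum>i'\<in>UNIV. (\<Sum>m<N. \<alpha> i m * C m i') * \<alpha> i' l) = \<alpha> i l" using l by simp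
  moreover have "(\<Sum>i'\<in>UNIV. (if i' = i then 1 else 0) * \<alpha> i' l) = \<alpha> i l"
    by (simp add: if_distrib[of "\<lambda>c. c * _"] cong: if_cong)
  ultimately show "(\<Sum>i'\<in>UNIV. rel i i' * \<alpha> i' l) = 0"
    by (simp add: rel_def left_diff_distrib sum_subtractf)
qed

text \<open>Apply the hypothesis to \<open>rel i\<close>. The formula holds over any commutative
  ring; over the integers it yields integral coefficients for class indicators, hence characters of
  the torus.\<close>

lemma killed_by_relations:
  fixes f :: "'i \<Rightarrow> 'k::comm_ring_1"
  assumes "\<And>z. relation z \<Longrightarrow> (\<Sum>i\<in>UNIV. of_int (z i) * f i) = 0"
  shows "f i = (\<Sum>m<N. of_int (\<alpha> i m) * (\<Sum>i'\<in>UNIV. of_int (C m i') * f i'))"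
proof -
  have "0 = (\<Sum>i'\<in>UNIV. of_int (rel i i') * f i')" using assms[OF relation_rel] by simp
  also have "\<dots> = f i - (\<Sum>i'\<in>UNIV. (\<Sum>m<N. of_int (\<alpha> i m) * of_int (C m i')) * f i')"
    by (simp add: rel_def left_diff_distrib sum_subtractf if_distrib[of "\<lambda>c. of_int c * _"]
        if_distrib[of of_int] if_distrib[of "\<lambda>c. c * _"] cong: if_cong)
  also have "(\<Sum>i'\<in>UNIV. (\<Sum>m<N. of_int (\<alpha> i m) * of_int (C m i')) * f i') =
      (\<Sum>m<N. of_int (\<alpha> i m) * (\<Sum>i'\<in>UNIV. of_int (C m i') * f i'))"
    by (simp add: sum_distrib_left sum_distrib_right mult.assoc) (rule sum.swap)
  finally show ?thesis by simp
qed

abbreviation T :: "('k::field^'i) set" where "T \<equiv> tcone N \<alpha>"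
abbreviation X :: "('k::field^'i) set" where "X \<equiv> zariski_closure T"

text \<open>Every exponent of the parameter 0 is 1, so a scalar is absorbed into that
  parameter.\<close>

lemma chi_scale: 
  assumes "\<And>m. m < N \<Longrightarrow> \<tau> m \<noteq> 0" "c \<noteq> 0"
  shows "c *s chi N \<alpha> \<tau> = chi N \<alpha> (\<tau>(0 := c * \<tau> 0))"
proof -
  have split: "(\<Prod>m<N. f m) = f 0 * (\<Prod>m\<in>{..<N} - {0}. f m)" for f :: "nat \<Rightarrow> 'a"
    using N_pos by (simp add: prod.remove)
  have "(\<Prod>m\<in>{..<N} - {0}. (\<tau>(0 := c * \<tau> 0)) m powi \<alpha> i m) = (\<Prod>m\<in>{..<N} - {0}. \<tau> m powi \<alpha> i m)" for i
    by (rule prod.cong) auto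
  then show ?thesis by (simp add: vec_eq_iff chi_def split alpha_0 mult.assoc)
qed

lemma cone_tsub: "cone (tsub N \<alpha> l)"
proof -
  have "0 \<notin> tsub N \<alpha> l" using tcone_nonzero[of _ N \<alpha>] tsub_subset[of N \<alpha> l] by (metis subsetD zero_index)
  moreover have "c *s y \<in> tsub N \<alpha> l" if y: "y \<in> tsub N \<alpha> l" and c: "c \<noteq> 0" for y :: "'a^'i" and c
  proof -
    obtain \<tau> where \<tau>: "y = chi N \<alpha> \<tau>" "\<forall>m<N. \<tau> m \<noteq> 0" "\<forall>m<N. l < m \<longrightarrow> \<tau> m = 1"
      using y unfolding tsub_def by blast
    then show ?thesis
      unfolding tsub_def using c chi_scale[of \<tau> c]
      by (intro CollectI exI[of _ "\<tau>(0 := c * \<tau> 0)"]) auto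
  qed
  ultimately show ?thesis unfolding cone_def by blast
qed

lemma cone_T: "cone T"
  using cone_tsub[of N] by (simp add: tsub_full)

lemma one_in_tsub: "vec 1 \<in> tsub N \<alpha> l"
  unfolding tsub_def by (intro CollectI exI[of _ "\<lambda>_. 1"]) (simp add: chi_def vec_eq_iff)

lemma one_in_T: "vec 1 \<in> T"
  using one_in_tsub[of N] by (simp add: tsub_full)

lemma zero_notin_T: "0 \<notin> T"
  by (rule cone_zero[OF cone_T])

lemma vanishing_X:
  fixes p :: "('k::field_char_0, 'i) mpoly"
  shows "(\<forall>x\<in>X. mpoly_eval p x = 0) \<longleftrightarrow> (\<forall>y\<in>T. mpoly_eval p y = 0)"
  using vanishing_closure[OF cone_T, of p] zariski_closure_subset[of T] by blast

lemma vanishing_ideal_X: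
  "vanishing_ideal X = {p :: ('k::field_char_0, 'i) mpoly. \<forall>y\<in>T. mpoly_eval p y = 0}"
  by (simp add: vanishing_ideal_def vanishing_X)

section \<open>Binomials\<close>

definition binom :: "('i \<Rightarrow> int) \<Rightarrow> ('k::field, 'i) mpoly" where
  "binom z = mon (pos_mono z) - mon (neg_mono z)"

lemma sum_relation:
  assumes "relation z" shows "(\<Sum>i\<in>UNIV. z i) = 0"
proof -
  have "(\<Sum>i\<in>UNIV. z i * \<alpha> i 0) = 0" using assms N_pos unfolding relation_def by blast
  then show ?thesis by (simp add: alpha_0)
qed

lemma hdeg_binom:
  assumes "(\<Sum>i\<in>UNIV. z i) = 0" shows "hdeg (mdeg (pos_mono z)) (binom z)"
proof -
  have "mdeg (pos_mono z) = mdeg (neg_mono z)" using mdeg_pos_neg[of z] assms by simp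
  then show ?thesis unfolding binom_def by (metis hdeg_minus hdeg_mon)
qed

lemma binom_T:
  assumes "relation z" "y \<in> T" shows "mpoly_eval (binom z) y = 0"
proof -
  obtain \<tau> where \<tau>: "y = chi N \<alpha> \<tau>" "\<And>m. m < N \<Longrightarrow> \<tau> m \<noteq> 0" using assms(2) unfolding tcone_def by blast
  have "(\<Prod>i\<in>UNIV. y $ i powi z i) = 1"
    unfolding \<tau>(1) using prod_chi[of N \<tau> \<alpha> z] \<tau>(2) assms(1) by (simp add: relation_def)
  then show ?thesis using meval_pos_neg[of y z] tcone_nonzero[OF assms(2)] by (simp add: binom_def)
qed

lemma binom_X:
  fixes y :: "'k::field_char_0^'i"
  assumes "relation z" "y \<in> X" shows "mpoly_eval (binom z) y = 0"
  using vanishing_X[of "binom z"] binom_T[OF assms(1)] assms(2) by blast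

text \<open>The monomials with exponents \<open>C m\<close> give candidate parameters. They
  reproduce the coordinate \<open>i\<close> up to the Laurent monomial with exponent
  \<open>rel i\<close>, which is 1 by the binomial equations.\<close>

lemma X_nonzero_in_T:
  fixes y :: "'k::field_char_0^'i"
  assumes "y \<in> X" "\<And>i. y $ i \<noteq> 0"
  shows "y \<in> T"
proof -
  define \<tau> where "\<tau> m = (\<Prod>i\<in>UNIV. y $ i powi C m i)" for m
  have nz: "\<tau> m \<noteq> 0" for m using assms(2) by (simp add: \<tau>_def)
  have "chi N \<alpha> \<tau> $ i = y $ i" for i
  proof -
    have "chi N \<alpha> \<tau> $ i = (\<Prod>m<N. \<Prod>i'\<in>UNIV. y $ i' powi (\<alpha> i m * C m i'))"
      by (simp add: chi_def \<tau>_def power_int_prod power_int_mult[symmetric] mult.commute)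
    also have "\<dots> = (\<Prod>i'\<in>UNIV. \<Prod>m<N. y $ i' powi (\<alpha> i m * C m i'))" by (rule prod.swap)
    also have "\<dots> = (\<Prod>i'\<in>UNIV. y $ i' powi (\<Sum>m<N. \<alpha> i m * C m i'))"
      using assms(2) by (simp add: power_int_sum)
    also have "\<dots> = (\<Prod>i'\<in>UNIV. (if i' = i then y $ i else 1) / y $ i' powi rel i i')"
    proof (rule prod.cong)
      fix i' 
      have "(\<Sum>m<N. \<alpha> i m * C m i') = (if i' = i then 1 else 0) - rel i i'" by (simp add: rel_def)
      then show "y $ i' powi (\<Sum>m<N. \<alpha> i m * C m i') = (if i' = i then y $ i else 1) / y $ i' powi rel i i'"
        using assms(2) by (simp add: power_int_diff)
    qed simp
    also have "\<dots> = y $ i / (\<Prod>i'\<in>UNIV. y $ i' powi rel i i')"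
      by (simp add: prod_dividef)
    also have "(\<Prod>i'\<in>UNIV. y $ i' powi rel i i') = 1"
    proof -
      have "meval (pos_mono (rel i)) y = meval (neg_mono (rel i)) y"
        using binom_X[OF relation_rel assms(1), of i] by (simp add: binom_def)
      then show ?thesis
        using meval_pos_neg[of y "rel i"] meval_nonzero[of y "neg_mono (rel i)"] assms(2) by simp
    qed
    finally show ?thesis by simp
  qed
  then have "y = chi N \<alpha> \<tau>" by (simp add: vec_eq_iff)
  then show ?thesis unfolding tcone_def using nz by blast
qed

section \<open>Irreducibility and dimension\<close>

text \<open>Interpolate the torus parameters linearly. A common factor clears the negative exponents
  and only rescales the projective point.\<close>

lemma tsub_join:
  fixes y y' :: "'k::field_char_0^'i"
  assumes "y \<in> tsub N \<alpha> l" "y' \<in> tsub N \<alpha> l"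
  shows "\<exists>g B c c'. finite B \<and> c \<noteq> 0 \<and> c' \<noteq> 0 \<and> (\<chi> i. poly (g i) 0) = c *s y \<and>
    (\<chi> i. poly (g i) 1) = c' *s y' \<and> (\<forall>s. s \<notin> B \<longrightarrow> (\<chi> i. poly (g i) s) \<in> tsub N \<alpha> l)"
proof -
  obtain \<tau> where \<tau>: "y = chi N \<alpha> \<tau>" "\<forall>m<N. \<tau> m \<noteq> 0" "\<forall>m<N. l < m \<longrightarrow> \<tau> m = 1"
    using assms(1) unfolding tsub_def by blast
  obtain \<sigma> where \<sigma>: "y' = chi N \<alpha> \<sigma>" "\<forall>m<N. \<sigma> m \<noteq> 0" "\<forall>m<N. l < m \<longrightarrow> \<sigma> m = 1"
    using assms(2) unfolding tsub_def by blast
  \<comment> \<open>At least as large as every absolute exponent, so that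
    \<open>\<alpha> i m + int D\<close> is a natural exponent.\<close>
  define D where "D = (\<Sum>i\<in>UNIV. \<Sum>m<N. nat \<bar>\<alpha> i m\<bar>)"
  have D: "0 \<le> \<alpha> i m + int D" if "m < N" for i m
  proof -
    have "nat \<bar>\<alpha> i m\<bar> \<le> (\<Sum>m<N. nat \<bar>\<alpha> i m\<bar>)" by (rule member_le_sum) (use that in auto)
    also have "\<dots> \<le> D" unfolding D_def by (rule member_le_sum) auto
    finally show ?thesis by linarith
  qed
  define h where "h m = [:\<tau> m, \<sigma> m - \<tau> m:]" for m
  define g where "g i = (\<Prod>m<N. h m ^ nat (\<alpha> i m + int D))" for i
  \<comment> \<open>The common factor by which the polynomial curve differs from the torus point
    with parameters \<open>poly (h m) s\<close>.\<close>
  define u where "u s = (\<Prod>m<N. poly (h m) s ^ D)" for s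
  have g: "(\<chi> i. poly (g i) s) = u s *s chi N \<alpha> (\<lambda>m. poly (h m) s)"
    if "\<And>m. m < N \<Longrightarrow> poly (h m) s \<noteq> 0" for s
  proof -
    have "poly (g i) s = u s * (\<Prod>m<N. poly (h m) s powi \<alpha> i m)" for i
    proof -
      have "poly (g i) s = (\<Prod>m<N. poly (h m) s powi (\<alpha> i m + int D))"
        unfolding g_def poly_prod poly_power
        by (rule prod.cong) (use D in \<open>auto simp: power_int_def\<close>)
      also have "\<dots> = (\<Prod>m<N. poly (h m) s ^ D * poly (h m) s powi \<alpha> i m)"
        by (rule prod.cong) (use that in \<open>auto simp: power_int_add mult.commute\<close>)
      finally show ?thesis by (simp add: u_def prod.distrib)
    qed
    then show ?thesis by (simp add: vec_eq_iff chi_def)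
  qed
  define B where "B = {s. poly (\<Prod>m<N. h m) s = 0}"
  have "poly (\<Prod>m<N. h m) 0 \<noteq> 0" using \<tau>(2) by (simp add: poly_prod h_def)
  then have "(\<Prod>m<N. h m) \<noteq> 0" by (metis poly_0)
  then have "finite B" unfolding B_def by (rule poly_roots_finite)
  moreover have "(\<chi> i. poly (g i) s) \<in> tsub N \<alpha> l" if "s \<notin> B" for s
  proof -
    have nz: "poly (h m) s \<noteq> 0" if "m < N" for m
      using \<open>s \<notin> B\<close> that by (auto simp: B_def poly_prod)
    have "chi N \<alpha> (\<lambda>m. poly (h m) s) \<in> tsub N \<alpha> l"
      unfolding tsub_def
      by (intro CollectI exI[of _ "\<lambda>m. poly (h m) s"]) (use nz \<tau>(3) \<sigma>(3) in \<open>auto simp: h_def\<close>)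
    moreover have "u s \<noteq> 0" using nz by (simp add: u_def)
    ultimately show ?thesis using g[OF nz] cone_tsub[of l] unfolding cone_def by metis
  qed
  moreover have "(\<chi> i. poly (g i) 0) = u 0 *s y" "u 0 \<noteq> 0"
    using g[of 0] \<tau>(1,2) by (auto simp: h_def chi_def vec_eq_iff u_def)
  moreover have "(\<chi> i. poly (g i) 1) = u 1 *s y'" "u 1 \<noteq> 0"
    using g[of 1] \<sigma>(1,2) by (auto simp: h_def chi_def vec_eq_iff u_def)
  ultimately show ?thesis by blast
qed

text \<open>On a curve joining a point with \<open>p\<close> nonzero to a point with
  \<open>q\<close> nonzero, the product restricts to the zero polynomial although neither factor
  does.\<close>

lemma tsub_prime:
  fixes p q :: "('k::field_char_0, 'i) mpoly"
  assumes "homogeneous p" "homogeneous q"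
    and pq: "\<And>y. y \<in> tsub N \<alpha> l \<Longrightarrow> mpoly_eval p y * mpoly_eval q y = 0"
  shows "(\<forall>y\<in>tsub N \<alpha> l. mpoly_eval p y = 0) \<or> (\<forall>y\<in>tsub N \<alpha> l. mpoly_eval q y = 0)"
proof (rule ccontr)
  assume "\<not> ?thesis"
  then obtain y y' where y: "y \<in> tsub N \<alpha> l" "mpoly_eval p y \<noteq> 0" "y' \<in> tsub N \<alpha> l" "mpoly_eval q y' \<noteq> 0"
    by blast
  obtain g B c c' where g: "finite B" "c \<noteq> 0" "c' \<noteq> 0" "(\<chi> i. poly (g i) 0) = c *s y"
    "(\<chi> i. poly (g i) 1) = c' *s y'" "\<forall>s. s \<notin> B \<longrightarrow> (\<chi> i. poly (g i) s) \<in> tsub N \<alpha> l"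
    using tsub_join[OF y(1,3)] by blast
  obtain d e where de: "hdeg d p" "hdeg e q" using assms by (auto simp: homogeneous_iff)
  have "curve g p * curve g q = 0"
    by (rule poly_zero_of_infinite_zeros[OF g(1)]) (use g(6) pq in \<open>simp add: poly_curve\<close>)
  moreover have "poly (curve g p) 0 \<noteq> 0" using de(1) y(2) g(2) by (simp add: poly_curve g(4) eval_scale)
  moreover have "poly (curve g q) 1 \<noteq> 0" using de(2) y(4) g(3) by (simp add: poly_curve g(5) eval_scale)
  ultimately show False by (metis mult_eq_0_iff poly_0)
qed

lemma irreducible_tsub: "irreducible_closed (zariski_closure (tsub N \<alpha> l :: ('k::field_char_0^'i) set))"
proof (rule irreducible_closureI)
  show "0 \<notin> tsub N \<alpha> l" by (rule cone_zero[OF cone_tsub])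
  show "(tsub N \<alpha> l :: ('k^'i) set) \<noteq> {}" using one_in_tsub[of l] by auto
qed (rule tsub_prime)

lemma irreducible_X: "irreducible_closed (X :: ('k::field_char_0^'i) set)"
  using irreducible_tsub[of N] by (simp add: tsub_full)

text \<open>On the torus the binomial of \<open>C (Suc l)\<close> is a unit times
  \<open>\<tau> (Suc l) - 1\<close>. It is homogeneous because \<open>C (Suc l)\<close> has zero
  pairing with the row of ones.\<close>

lemma tsub_chain:
  assumes "Suc l < N"
  shows "zariski_closure (tsub N \<alpha> l :: ('k::field_char_0^'i) set) \<subset> zariski_closure (tsub N \<alpha> (Suc l))"
proof -
  let ?p = "binom (C (Suc l)) :: ('k, 'i) mpoly"
  have "(\<Sum>i\<in>UNIV. C (Suc l) i * \<alpha> i 0) = 0" using C[of "Suc l" 0] assms by simp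
  then have hom: "homogeneous ?p" using hdeg_binom by (simp add: alpha_0 homogeneous_iff) blast
  have val: "mpoly_eval ?p (chi N \<alpha> \<tau>) = meval (neg_mono (C (Suc l))) (chi N \<alpha> \<tau>) * (\<tau> (Suc l) - 1)"
    if "\<And>m. m < N \<Longrightarrow> \<tau> m \<noteq> 0" for \<tau> :: "nat \<Rightarrow> 'k"
  proof -
    have "(\<Prod>i\<in>UNIV. chi N \<alpha> \<tau> $ i powi C (Suc l) i) = (\<Prod>m<N. if m = Suc l then \<tau> m else 1)"
    proof -
      have "(\<Prod>i\<in>UNIV. chi N \<alpha> \<tau> $ i powi C (Suc l) i) =
          (\<Prod>m<N. \<tau> m powi (\<Sum>i\<in>UNIV. C (Suc l) i * \<alpha> i m))"
        by (rule prod_chi) (rule that)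
      also have "\<dots> = (\<Prod>m<N. if m = Suc l then \<tau> m else 1)"
        by (rule prod.cong) (use assms in \<open>auto simp: C\<close>)
      finally show ?thesis .
    qed
    then have "(\<Prod>i\<in>UNIV. chi N \<alpha> \<tau> $ i powi C (Suc l) i) = \<tau> (Suc l)" using assms by simp
    then show ?thesis
      using meval_pos_neg[of "chi N \<alpha> \<tau>" "C (Suc l)"] chi_nonzero[of N \<tau> \<alpha>] that
      by (simp add: binom_def right_diff_distrib)
  qed
  have zero: "mpoly_eval ?p y = 0" if "y \<in> tsub N \<alpha> l" for y
    using that assms val unfolding tsub_def by auto
  \<comment> \<open>The value 2 is nonzero in characteristic zero and differs from 1.\<close>
  define \<tau> where "\<tau> = (\<lambda>m. if m = Suc l then 2 else (1::'k))"
  have "chi N \<alpha> \<tau> \<in> tsub N \<alpha> (Suc l)" unfolding tsub_def by (intro CollectI exI[of _ \<tau>]) (auto simp: \<tau>_def)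
  then have in2: "chi N \<alpha> \<tau> \<in> zariski_closure (tsub N \<alpha> (Suc l))" using zariski_closure_subset by blast
  have "mpoly_eval ?p (chi N \<alpha> \<tau>) \<noteq> 0"
    using val[of \<tau>] meval_nonzero[of "chi N \<alpha> \<tau>"] chi_nonzero[of N \<tau> \<alpha>] by (simp add: \<tau>_def)
  moreover have "0 \<notin> tsub N \<alpha> l" by (rule cone_zero[OF cone_tsub])
  ultimately have "chi N \<alpha> \<tau> \<notin> zariski_closure (tsub N \<alpha> l)"
    using zero hom by (subst zariski_closure_iff) auto
  then show ?thesis using in2 zariski_closure_mono[OF tsub_mono[of l "Suc l" N \<alpha>]] by auto
qed

end

text \<open>The monomials \<open>f\<^sub>0^(E - \<Sum>xs) f\<^sub>1^x\<^sub>1 \<dots> f\<^sub>m^x\<^sub>m\<close> of degree \<open>E\<close> for \<open>xs = [x\<^sub>m, \<dots>, x\<^sub>1]\<close>.\<close>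

fun form_monomial :: "(nat \<Rightarrow> ('k::field, 'i::finite) mpoly) \<Rightarrow> nat list \<Rightarrow> nat \<Rightarrow> ('k, 'i) mpoly" where
  "form_monomial f [] E = f 0 ^ E"
| "form_monomial f (j # xs) E = f (Suc (length xs)) ^ j * form_monomial f xs (E - j)"

definition lbox :: "nat \<Rightarrow> nat \<Rightarrow> nat list set" where
  "lbox m D = {xs. set xs \<subseteq> {..D} \<and> length xs = m}"

lemma finite_box: "finite (lbox m D)"
  unfolding lbox_def by (rule finite_lists_length_eq) simp

lemma card_box: "card (lbox m D) = Suc D ^ m"
  unfolding lbox_def by (subst card_lists_length_eq) auto

lemma box_0: "lbox 0 D = {[]}"
  by (auto simp: lbox_def)

lemma sum_box_Suc:
  "(\<Sum>xs\<in>lbox (Suc m) D. g xs) = (\<Sum>j\<le>D. \<Sum>xs\<in>lbox m D. g (j # xs))"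
proof -
  have "lbox (Suc m) D = (\<lambda>(j, xs). j # xs) ` ({..D} \<times> lbox m D)"
    unfolding lbox_def by (subst lists_length_Suc_eq) force
  moreover have "inj_on (\<lambda>(j, xs). j # xs) ({..D} \<times> lbox m D)" by (auto simp: inj_on_def)
  ultimately have "(\<Sum>xs\<in>lbox (Suc m) D. g xs) = (\<Sum>(j, xs)\<in>{..D} \<times> lbox m D. g (j # xs))"
    by (simp add: sum.reindex case_prod_unfold comp_def)
  then show ?thesis by (simp add: sum.cartesian_product)
qed

lemma box_SucE:
  assumes "xs \<in> lbox (Suc m) D" obtains j ys where "xs = j # ys" "j \<le> D" "ys \<in> lbox m D"
  using assms by (cases xs) (auto simp: lbox_def)

lemma sum_list_box: "xs \<in> lbox m D \<Longrightarrow> sum_list xs \<le> m * D"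
proof (induction m arbitrary: xs)
  case 0
  then show ?case by (simp add: box_0)
next
  case (Suc m)
  from Suc.prems obtain j ys where "xs = j # ys" "j \<le> D" "ys \<in> lbox m D" by (rule box_SucE)
  then show ?case using Suc.IH[of ys] by simp
qed

lemma hdeg_form_monomial:
  assumes "\<And>l. l \<le> length xs \<Longrightarrow> hdeg e (f l)" "sum_list xs \<le> E"
  shows "hdeg (E * e) (form_monomial f xs E)"
  using assms
proof (induction xs arbitrary: E)
  case Nil
  then show ?case by (auto intro: hdeg_power)
next
  case (Cons j xs)
  have "hdeg ((E - j) * e) (form_monomial f xs (E - j))"
    using Cons.prems by (intro Cons.IH) auto
  moreover have "hdeg (j * e) (f (Suc (length xs)) ^ j)"
    using Cons.prems(1)[of "Suc (length xs)"] by (intro hdeg_power) simp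
  moreover have "j * e + (E - j) * e = E * e"
    using Cons.prems(2) by (simp add: add_mult_distrib[symmetric])
  ultimately show ?case using hdeg_mult[of "j * e"] by fastforce
qed

text \<open>Restricting a relation to \<open>Z m\<close> kills every term with a positive power of
  the last form; the remaining coefficients vanish by induction. On the irreducible top set the last
  form can then be cancelled, and the argument repeats for the next power.\<close>

lemma form_monomials_independent:
  fixes f :: "nat \<Rightarrow> ('k::field_char_0, 'i::finite) mpoly"
  assumes "\<And>l. l \<le> m \<Longrightarrow> irreducible_closed (Z l)" "\<And>l. l < m \<Longrightarrow> Z l \<subseteq> Z (Suc l)"
    and "\<And>l. l \<le> m \<Longrightarrow> hdeg e (f l)"
    and "\<And>l x. l < m \<Longrightarrow> x \<in> Z l \<Longrightarrow> mpoly_eval (f (Suc l)) x = 0"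
    and "\<And>l. l \<le> m \<Longrightarrow> \<exists>x\<in>Z l. mpoly_eval (f l) x \<noteq> 0"
    and "m * D \<le> E"
    and "\<And>x. x \<in> Z m \<Longrightarrow> (\<Sum>xs\<in>lbox m D. \<kappa> xs * mpoly_eval (form_monomial f xs E) x) = 0"
    and "xs \<in> lbox m D"
  shows "\<kappa> xs = 0"
  using assms
proof (induction m arbitrary: E \<kappa> xs)
  case 0
  from "0.prems"(5)[of 0] obtain x where "x \<in> Z 0" "mpoly_eval (f 0) x \<noteq> 0" by auto
  with "0.prems"(7)[of x] "0.prems"(8) show ?case by (simp add: box_0)
next
  case (Suc m)
  note IH = Suc.IH and prems = Suc.prems
  define F where "F = f (Suc m)"
  define h where "h j = (\<Sum>xs\<in>lbox m D. cpoly (\<kappa> (j # xs)) * form_monomial f xs (E - j))" for j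
  have hx: "mpoly_eval (h j) x = (\<Sum>xs\<in>lbox m D. \<kappa> (j # xs) * mpoly_eval (form_monomial f xs (E - j)) x)" for j x
    by (simp add: h_def)
  have mDE: "m * D \<le> E - j" if "j \<le> D" for j using prems(6) that by simp
  have hdeg_h: "hdeg ((E - j) * e) (h j)" if "j \<le> D" for j
    unfolding h_def
  proof (intro hdeg_sum hdeg_cmult hdeg_form_monomial)
    fix xs l assume xs: "xs \<in> lbox m D"
    show "sum_list xs \<le> E - j" using sum_list_box[OF xs] mDE[OF that] by simp
    assume "l \<le> length xs"
    then show "hdeg e (f l)" using xs by (intro prems(3)) (auto simp: lbox_def)
  qed
  \<comment> \<open>The invariant after \<open>j0\<close> rounds: the first \<open>j0\<close> layers
    of coefficients are zero, and the remaining relation has been divided by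
    \<open>F ^ j0\<close>.\<close>
  have "(\<forall>j<j0. \<forall>xs\<in>lbox m D. \<kappa> (j # xs) = 0) \<and>
      (\<forall>x\<in>Z (Suc m). (\<Sum>j\<in>{j0..D}. mpoly_eval F x ^ (j - j0) * mpoly_eval (h j) x) = 0)"
    if "j0 \<le> Suc D" for j0
    using that
  proof (induction j0)
    case 0
    have "(\<Sum>j\<in>{0..D}. mpoly_eval F x ^ (j - 0) * mpoly_eval (h j) x) = 0" if "x \<in> Z (Suc m)" for x
    proof -
      have "(\<Sum>j\<in>{0..D}. mpoly_eval F x ^ (j - 0) * mpoly_eval (h j) x) =
          (\<Sum>j\<le>D. \<Sum>xs\<in>lbox m D. \<kappa> (j # xs) * mpoly_eval (form_monomial f (j # xs) E) x)"
        unfolding atLeast0AtMost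
      proof (rule sum.cong)
        fix j
        show "mpoly_eval F x ^ (j - 0) * mpoly_eval (h j) x =
            (\<Sum>xs\<in>lbox m D. \<kappa> (j # xs) * mpoly_eval (form_monomial f (j # xs) E) x)"
          unfolding hx sum_distrib_left by (rule sum.cong) (auto simp: F_def lbox_def)
      qed simp
      then show ?thesis using prems(7)[OF that] by (simp add: sum_box_Suc)
    qed
    then show ?case by simp
  next
    case (Suc j0)
    then have j0: "j0 \<le> D" and a: "\<And>j xs. j < j0 \<Longrightarrow> xs \<in> lbox m D \<Longrightarrow> \<kappa> (j # xs) = 0"
      and b: "\<And>x. x \<in> Z (Suc m) \<Longrightarrow> (\<Sum>j\<in>{j0..D}. mpoly_eval F x ^ (j - j0) * mpoly_eval (h j) x) = 0"
      by auto
    have split: "(\<Sum>j\<in>{j0..D}. mpoly_eval F x ^ (j - j0) * mpoly_eval (h j) x) =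
        mpoly_eval (h j0) x + mpoly_eval F x *
          (\<Sum>j\<in>{Suc j0..D}. mpoly_eval F x ^ (j - Suc j0) * mpoly_eval (h j) x)" for x
    proof -
      have "(\<Sum>j\<in>{j0..D}. mpoly_eval F x ^ (j - j0) * mpoly_eval (h j) x) =
        mpoly_eval (h j0) x + (\<Sum>j\<in>{Suc j0..D}. mpoly_eval F x ^ (j - j0) * mpoly_eval (h j) x)"
        using j0 by (simp add: sum.atLeast_Suc_atMost)
      also have "(\<Sum>j\<in>{Suc j0..D}. mpoly_eval F x ^ (j - j0) * mpoly_eval (h j) x) =
          (\<Sum>j\<in>{Suc j0..D}. mpoly_eval F x * (mpoly_eval F x ^ (j - Suc j0) * mpoly_eval (h j) x))"
      proof (rule sum.cong)
        fix j assume "j \<in> {Suc j0..D}"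
        then have "j - j0 = Suc (j - Suc j0)" by auto
        then show "mpoly_eval F x ^ (j - j0) * mpoly_eval (h j) x =
            mpoly_eval F x * (mpoly_eval F x ^ (j - Suc j0) * mpoly_eval (h j) x)"
          by (metis power_Suc mult.assoc)
      qed simp
      finally show ?thesis by (simp add: sum_distrib_left)
    qed
    have F0: "mpoly_eval F x = 0" if "x \<in> Z m" for x
      unfolding F_def by (rule prems(4)[OF _ that]) simp
    have z: "\<kappa> (j0 # xs) = 0" if xs: "xs \<in> lbox m D" for xs
    proof (rule IH[where \<kappa> = "\<lambda>xs. \<kappa> (j0 # xs)" and E = "E - j0" and xs = xs])
      show "irreducible_closed (Z l)" if "l \<le> m" for l using prems(1) that by simp
      show "Z l \<subseteq> Z (Suc l)" if "l < m" for l using prems(2) that by simp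
      show "hdeg e (f l)" if "l \<le> m" for l using prems(3) that by simp
      show "mpoly_eval (f (Suc l)) x = 0" if "l < m" "x \<in> Z l" for l x
        by (rule prems(4)[OF _ that(2)]) (use that(1) in simp)
      show "\<exists>x\<in>Z l. mpoly_eval (f l) x \<noteq> 0" if "l \<le> m" for l by (rule prems(5)) (use that in simp)
      show "m * D \<le> E - j0" by (rule mDE[OF j0])
      show "xs \<in> lbox m D" by (rule xs)
      fix x assume x: "x \<in> Z m"
      then have "x \<in> Z (Suc m)" using prems(2)[of m] by auto
      from b[OF this] split[of x] F0[OF x] have "mpoly_eval (h j0) x = 0" by simp
      then show "(\<Sum>xs\<in>lbox m D. \<kappa> (j0 # xs) * mpoly_eval (form_monomial f xs (E - j0)) x) = 0"
        by (simp add: hx)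
    qed
    have hz: "mpoly_eval (h j0) x = 0" for x by (simp add: hx z)
    define q where "q = (\<Sum>j\<in>{Suc j0..D}. F ^ (j - Suc j0) * h j)"
    have q: "mpoly_eval q x = (\<Sum>j\<in>{Suc j0..D}. mpoly_eval F x ^ (j - Suc j0) * mpoly_eval (h j) x)" for x
      by (simp add: q_def)
    have homF: "homogeneous F" using prems(3)[of "Suc m"] by (auto simp: F_def homogeneous_iff)
    have "hdeg ((E - Suc j0) * e) (F ^ (j - Suc j0) * h j)" if "j \<in> {Suc j0..D}" for j
    proof -
      have "hdeg ((j - Suc j0) * e + (E - j) * e) (F ^ (j - Suc j0) * h j)"
        using that prems(3)[of "Suc m"] by (intro hdeg_mult hdeg_power hdeg_h) (auto simp: F_def)
      moreover have "(j - Suc j0) + (E - j) = E - Suc j0"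
        using that prems(6) by simp
      ultimately show ?thesis by (metis add_mult_distrib)
    qed
    then have homq: "homogeneous q" unfolding q_def homogeneous_iff by (intro exI hdeg_sum)
    have "mpoly_eval F x * mpoly_eval q x = 0" if "x \<in> Z (Suc m)" for x
      using b[OF that] hz[of x] unfolding split q by simp
    then have "(\<forall>x\<in>Z (Suc m). mpoly_eval F x = 0) \<or> (\<forall>x\<in>Z (Suc m). mpoly_eval q x = 0)"
      by (intro irreducible_prime[OF prems(1)] homF homq) auto
    then have "\<forall>x\<in>Z (Suc m). mpoly_eval q x = 0" using prems(5)[of "Suc m"] by (auto simp: F_def)
    then show ?case using z a by (auto simp: q less_Suc_eq)
  qed
  from this[of "Suc D"] have all: "\<And>j xs. j \<le> D \<Longrightarrow> xs \<in> lbox m D \<Longrightarrow> \<kappa> (j # xs) = 0" by simp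
  from prems(8) obtain j ys where "xs = j # ys" "j \<le> D" "ys \<in> lbox m D" by (rule box_SucE)
  then show ?case using all by simp
qed

lemma pderiv_sum: "pderiv (\<Sum>a\<in>S. f a) = (\<Sum>a\<in>S. pderiv (f a))"
  by (induction S rule: infinite_finite_induct) (auto simp: pderiv_add)

lemma vec_dim_span_indep:
  fixes v :: "'j \<Rightarrow> 'k::field^'i::finite"
  assumes "finite J" "indep J UNIV (\<lambda>j. vec_nth (v j))"
  shows "vec.dim (vec.span (v ` J)) = card J"
proof -
  have sum0: "\<kappa> j = 0" if "(\<Sum>j\<in>J. \<kappa> j *s v j) = 0" "j \<in> J" for \<kappa> j
    by (rule indepD[OF assms(2) _ that(2)]) (use that(1) in \<open>simp add: vec_eq_iff\<close>)
  have inj: "inj_on v J"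
  proof (rule inj_onI, rule ccontr)
    fix j l assume jl: "j \<in> J" "l \<in> J" "v j = v l" "j \<noteq> l"
    let ?\<kappa> = "(\<lambda>_. 0)(j := 1, l := - 1)"
    have "(\<Sum>h\<in>J. ?\<kappa> h *s v h) = (\<Sum>h\<in>{j, l}. ?\<kappa> h *s v h)"
      by (rule sum.mono_neutral_right) (use jl assms(1) in auto)
    then have "(\<Sum>h\<in>J. ?\<kappa> h *s v h) = 0" using jl by (simp add: vec_eq_iff)
    from sum0[OF this jl(1)] show False using jl(4) by simp
  qed
  have "vec.independent (v ` J)"
  proof (rule vec.independent_if_scalars_zero)
    fix f w assume "(\<Sum>w\<in>v ` J. f w *s w) = 0" and w: "w \<in> v ` J"
    then have "(\<Sum>j\<in>J. f (v j) *s v j) = 0" using inj by (simp add: sum.reindex)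
    then show "f w = 0" using sum0[of "\<lambda>j. f (v j)"] w by blast
  qed (use assms in simp)
  then have "vec.dim (vec.span (v ` J)) = card (v ` J)" by (rule vec.dim_span_eq_card_independent)
  then show ?thesis using inj by (simp add: card_image)
qed

context toric
begin

section \<open>Characters of bounded weight and the dimension of X\<close>

definition wt_bound :: nat where
  "wt_bound = (\<Sum>i\<in>UNIV. \<Sum>m<N. nat \<bar>\<alpha> i m\<bar>)"

lemma alpha_bound: "l < N \<Longrightarrow> \<bar>\<alpha> i l\<bar> \<le> int wt_bound"
proof -
  assume "l < N"
  then have "nat \<bar>\<alpha> i l\<bar> \<le> (\<Sum>m<N. nat \<bar>\<alpha> i m\<bar>)" by (intro member_le_sum) auto
  also have "\<dots> \<le> wt_bound" unfolding wt_bound_def by (rule member_le_sum) auto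
  finally show ?thesis by linarith
qed

lemma wt_le:
  assumes "l < N" shows "\<bar>wt \<alpha> m l\<bar> \<le> int (mdeg m * wt_bound)"
proof -
  have "\<bar>wt \<alpha> m l\<bar> \<le> (\<Sum>i\<in>UNIV. \<bar>int (lkp m i) * \<alpha> i l\<bar>)" unfolding wt_def by (rule sum_abs)
  also have "\<dots> \<le> (\<Sum>i\<in>UNIV. int (lkp m i) * int wt_bound)"
    using alpha_bound[OF assms] by (intro sum_mono) (simp add: abs_mult mult_left_mono)
  finally show ?thesis by (simp add: mdeg_def sum_distrib_right)
qed

lemma wt_0: "wt \<alpha> m 0 = int (mdeg m)"
  by (simp add: wt_def mdeg_def alpha_0)

lemma meval_chi_split:
  assumes "\<And>m. m < N \<Longrightarrow> \<tau> m \<noteq> 0"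
  shows "meval m (chi N \<alpha> \<tau>) = \<tau> 0 ^ mdeg m * (\<Prod>l\<in>{1..<N}. \<tau> l powi wt \<alpha> m l)"
proof -
  have "{..<N} = insert 0 {1..<N}" using N_pos by auto
  then show ?thesis by (simp add: meval_chi[OF assms] wt_0)
qed

text \<open>Exponents of the parameters 1, ..., N - 1 only: the exponent of the parameter 0 is the
  degree, so the growth in \<open>d\<close> has order \<open>N - 1\<close>.\<close>

definition weights :: "nat \<Rightarrow> (nat \<Rightarrow> int) set" where
  "weights d = (\<Pi>\<^sub>E l\<in>{1..<N}. {- int (d * wt_bound)..int (d * wt_bound)})"

lemma finite_weights: "finite (weights d)"
  unfolding weights_def by (rule finite_PiE) auto

lemma card_weights: "card (weights d) = (2 * d * wt_bound + 1) ^ (N - 1)"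
proof -
  have "nat (1 + 2 * (int d * int wt_bound)) = 2 * d * wt_bound + 1"
    by (simp add: nat_add_distrib nat_mult_distrib)
  then show ?thesis unfolding weights_def by (subst card_PiE) (auto simp: algebra_simps)
qed

text \<open>Monomials with equal weights agree on the torus, and the parameter 0 always carries the
  exponent \<open>d\<close>.\<close>

lemma form_in_span_characters:
  assumes "hdeg d p"
  shows "in_span (weights d) {\<tau>. \<forall>m<N. \<tau> m \<noteq> 0} (\<lambda>w \<tau>. \<tau> 0 ^ d * (\<Prod>l\<in>{1..<N}. \<tau> l powi w l))
    (\<lambda>\<tau>. mpoly_eval p (chi N \<alpha> \<tau>))"
proof -
  define r where "r m = restrict (wt \<alpha> m) {1..<N}" for m
  have r: "r m \<in> weights d" if "m \<in> pkeys p" for m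
    using that assms wt_le[of _ m] unfolding weights_def r_def hdeg_def
    by (intro restrict_PiE_iff[THEN iffD2]) fastforce
  have "mpoly_eval p (chi N \<alpha> \<tau>) =
      (\<Sum>w\<in>weights d. (\<Sum>m\<in>{m\<in>pkeys p. r m = w}. lkp p m) * (\<tau> 0 ^ d * (\<Prod>l\<in>{1..<N}. \<tau> l powi w l)))"
    if \<tau>: "\<forall>m<N. \<tau> m \<noteq> 0" for \<tau> :: "nat \<Rightarrow> 'a"
  proof -
    have "mpoly_eval p (chi N \<alpha> \<tau>) = (\<Sum>m\<in>pkeys p. lkp p m * (\<tau> 0 ^ d * (\<Prod>l\<in>{1..<N}. \<tau> l powi r m l)))"
      unfolding mpoly_eval_alt
    proof (rule sum.cong)
      fix m assume "m \<in> pkeys p"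
      then have "mdeg m = d" using assms by (simp add: hdeg_def)
      then show "lkp p m * meval m (chi N \<alpha> \<tau>) = lkp p m * (\<tau> 0 ^ d * (\<Prod>l\<in>{1..<N}. \<tau> l powi r m l))"
        using meval_chi_split[of \<tau> m] \<tau> by (simp add: r_def)
    qed simp
    also have "\<dots> = (\<Sum>w\<in>weights d. \<Sum>m\<in>{m\<in>pkeys p. r m = w}. lkp p m * (\<tau> 0 ^ d * (\<Prod>l\<in>{1..<N}. \<tau> l powi r m l)))"
      by (rule sum.group[symmetric]) (use r finite_weights in auto)
    also have "\<dots> = (\<Sum>w\<in>weights d. (\<Sum>m\<in>{m\<in>pkeys p. r m = w}. lkp p m) * (\<tau> 0 ^ d * (\<Prod>l\<in>{1..<N}. \<tau> l powi w l)))"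
      by (simp add: sum_distrib_right)
    finally show ?thesis .
  qed
  then show ?thesis unfolding in_span_def
    by (intro exI[of _ "\<lambda>w. \<Sum>m\<in>{m\<in>pkeys p. r m = w}. lkp p m"]) simp
qed

text \<open>Independent products of the \<open>f l\<close> remain independent as functions of the
  torus parameters, where they lie in the span of the characters of bounded weight.\<close>

lemma chain_count:
  fixes f :: "nat \<Rightarrow> ('k::field_char_0, 'i) mpoly"
  assumes "\<And>l. l \<le> m \<Longrightarrow> irreducible_closed (Z l)" "\<And>l. l < m \<Longrightarrow> Z l \<subseteq> Z (Suc l)" "Z m \<subseteq> X"
    and "\<And>l. l \<le> m \<Longrightarrow> hdeg e (f l)"
    and "\<And>l x. l < m \<Longrightarrow> x \<in> Z l \<Longrightarrow> mpoly_eval (f (Suc l)) x = 0"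
    and "\<And>l. l \<le> m \<Longrightarrow> \<exists>x\<in>Z l. mpoly_eval (f l) x \<noteq> 0"
  shows "Suc D ^ m \<le> (2 * (m * D * e) * wt_bound + 1) ^ (N - 1)"
proof -
  define P where "P = {\<tau> :: nat \<Rightarrow> 'k. \<forall>m<N. \<tau> m \<noteq> 0}"
  define v where "v xs \<tau> = mpoly_eval (form_monomial f xs (m * D)) (chi N \<alpha> \<tau>)" for xs \<tau>
  have "indep (lbox m D) P v"
    unfolding indep_def
  proof (intro allI impI ballI)
    fix \<kappa> xs assume z: "\<forall>\<tau>\<in>P. (\<Sum>xs\<in>lbox m D. \<kappa> xs * v xs \<tau>) = 0" and xs: "xs \<in> lbox m D"
    define p where "p = (\<Sum>xs\<in>lbox m D. cpoly (\<kappa> xs) * form_monomial f xs (m * D))"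
    have "\<forall>y\<in>T. mpoly_eval p y = 0"
      using z by (auto simp: tcone_def p_def P_def v_def)
    then have "\<forall>x\<in>X. mpoly_eval p x = 0" by (simp add: vanishing_X)
    then have p: "mpoly_eval p x = 0" if "x \<in> Z m" for x using that assms(3) by blast
    show "\<kappa> xs = 0"
      by (rule form_monomials_independent[of m Z e f D "m * D" \<kappa> xs, OF assms(1,2,4,5,6) _ _ xs])
        (use p in \<open>auto simp: p_def\<close>)
  qed
  moreover have "in_span (weights (m * D * e)) P (\<lambda>w \<tau>. \<tau> 0 ^ (m * D * e) * (\<Prod>l\<in>{1..<N}. \<tau> l powi w l)) (v xs)"
    if "xs \<in> lbox m D" for xs
    unfolding P_def v_def
  proof (rule form_in_span_characters, rule hdeg_form_monomial)
    fix l assume "l \<le> length xs"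
    then show "hdeg e (f l)" using that by (intro assms(4)) (auto simp: lbox_def)
  qed (rule sum_list_box[OF that])
  ultimately have "card (lbox m D) \<le> card (weights (m * D * e))"
    by (rule indep_card_le[OF finite_box finite_weights])
  then show ?thesis by (simp add: card_box card_weights)
qed

text \<open>Each strict inclusion supplies a form vanishing on the smaller set only. The resulting
  inequality compares order \<open>m\<close> with order \<open>N - 1\<close> in the free parameter
  \<open>D\<close>.\<close>

lemma chain_bound:
  fixes Z :: "nat \<Rightarrow> ('k::field_char_0^'i) set"
  assumes irr: "\<And>l. l \<le> m \<Longrightarrow> irreducible_closed (Z l)" and strict: "\<And>l. l < m \<Longrightarrow> Z l \<subset> Z (Suc l)"
    and sub: "Z m \<subseteq> X"
  shows "m \<le> N - 1"
proof (rule ccontr)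
  assume m: "\<not> m \<le> N - 1"
  have cl: "zariski_closed (Z l)" and ne: "Z l \<noteq> {}" if "l \<le> m" for l
    using irr[OF that] by (auto simp: irreducible_closed_def)
  have ex: "\<exists>p x i. homogeneous p \<and> x \<in> Z l \<and> x $ i \<noteq> 0 \<and> mpoly_eval p x \<noteq> 0 \<and>
      (\<forall>l'. l = Suc l' \<longrightarrow> (\<forall>y\<in>Z l'. mpoly_eval p y = 0))" if l: "l \<le> m" for l
  proof (cases l)
    case 0
    obtain x where x: "x \<in> Z l" using ne[OF l] by auto
    then have "x \<noteq> 0" using zariski_closed_nonzero[OF cl[OF l]] by auto
    then obtain i where "x $ i \<noteq> 0" by (auto simp: vec_eq_iff)
    moreover have "homogeneous (1 :: ('k, 'i) mpoly)" using hdeg_one homogeneous_iff by blast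
    ultimately show ?thesis using x 0 by (intro exI[of _ 1] exI[of _ x] exI[of _ i]) simp
  next
    case (Suc l')
    then obtain x where x: "x \<in> Z l" "x \<notin> Z l'" using strict[of l'] l by auto
    then have "x \<noteq> 0" using zariski_closed_nonzero[OF cl[OF l]] by auto
    then obtain i where "x $ i \<noteq> 0" by (auto simp: vec_eq_iff)
    moreover obtain p where "homogeneous p" "\<forall>y\<in>Z l'. mpoly_eval p y = 0" "mpoly_eval p x \<noteq> 0"
      using zariski_closed_separate[OF cl[of l'] x(2) \<open>x \<noteq> 0\<close>] Suc l by auto
    ultimately show ?thesis using x Suc by (intro exI[of _ p] exI[of _ x] exI[of _ i]) auto
  qed
  have "\<forall>l\<in>{..m}. \<exists>p x i d. hdeg d p \<and> x \<in> Z l \<and> x $ i \<noteq> 0 \<and> mpoly_eval p x \<noteq> 0 \<and>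
      (\<forall>l'. l = Suc l' \<longrightarrow> (\<forall>y\<in>Z l'. mpoly_eval p y = 0))"
  proof
    fix l assume "l \<in> {..m}"
    then have "l \<le> m" by simp
    from ex[OF this] show "\<exists>p x i d. hdeg d p \<and> x \<in> Z l \<and> x $ i \<noteq> 0 \<and> mpoly_eval p x \<noteq> 0 \<and>
      (\<forall>l'. l = Suc l' \<longrightarrow> (\<forall>y\<in>Z l'. mpoly_eval p y = 0))"
      unfolding homogeneous_iff by blast
  qed
  then obtain p x i d where p: "\<And>l. l \<le> m \<Longrightarrow> hdeg (d l) (p l)" "\<And>l. l \<le> m \<Longrightarrow> x l \<in> Z l"
    "\<And>l. l \<le> m \<Longrightarrow> x l $ i l \<noteq> 0" "\<And>l. l \<le> m \<Longrightarrow> mpoly_eval (p l) (x l) \<noteq> 0"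
    "\<And>l y. Suc l \<le> m \<Longrightarrow> y \<in> Z l \<Longrightarrow> mpoly_eval (p (Suc l)) y = 0"
    by (simp add: Ball_def) metis
  define e where "e = (\<Sum>l\<le>m. d l)"
  have de: "d l \<le> e" if "l \<le> m" for l unfolding e_def by (rule member_le_sum) (use that in auto)
  \<comment> \<open>Powers of a coordinate that is nonzero at the witness \<open>x l\<close> bring
    all forms to the same degree \<open>e\<close>.\<close>
  define f where "f l = vpoly (i l) ^ (e - d l) * p l" for l
  have count: "Suc D ^ m \<le> (2 * (m * D * e) * wt_bound + 1) ^ (N - 1)" for D
  proof (rule chain_count[where Z = Z and f = f])
    fix l assume l: "l \<le> m"
    show "hdeg e (f l)"
      using hdeg_mult[OF hdeg_power[OF hdeg_vpoly] p(1)[OF l], of "e - d l" "i l"] de[OF l] by (simp add: f_def)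
    show "\<exists>x\<in>Z l. mpoly_eval (f l) x \<noteq> 0"
      by (rule bexI[OF _ p(2)[OF l]]) (use p(3,4)[OF l] in \<open>simp add: f_def\<close>)
  next
    fix l y assume "l < m" "y \<in> Z l"
    then show "mpoly_eval (f (Suc l)) y = 0" using p(5)[of l y] by (simp add: f_def)
  qed (use irr strict sub in auto)
  define K where "K = 2 * m * e * wt_bound + 1"
  \<comment> \<open>With this \<open>D\<close> the right-hand side is at most
    \<open>D * Suc D ^ (N - 1)\<close>, which is less than \<open>Suc D ^ N\<close>.\<close>
  define D where "D = K ^ (N - 1)"
  have "Suc D ^ Suc (N - 1) \<le> Suc D ^ m" by (rule power_increasing) (use m in auto)
  also have "\<dots> \<le> (2 * (m * D * e) * wt_bound + 1) ^ (N - 1)" by (rule count)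
  also have "\<dots> \<le> (K * Suc D) ^ (N - 1)" by (rule power_mono) (auto simp: K_def algebra_simps)
  also have "\<dots> = D * Suc D ^ (N - 1)" by (simp only: power_mult_distrib D_def)
  finally show False by simp
qed

lemma proj_dim_X: "proj_dim (X :: ('k::field_char_0^'i) set) = N - 1"
  unfolding proj_dim_def
proof (rule cSup_eq_maximum)
  define Z where "Z l = zariski_closure (tsub N \<alpha> l :: ('k^'i) set)" for l
  have "\<forall>l\<le>N - 1. irreducible_closed (Z l) \<and> Z l \<subseteq> X"
    unfolding Z_def by (intro allI impI conjI irreducible_tsub zariski_closure_mono[OF tsub_subset])
  moreover have "\<forall>l<N - 1. Z l \<subset> Z (Suc l)" unfolding Z_def by (intro allI impI tsub_chain) simp
  ultimately show "N - 1 \<in> {m. \<exists>Z. (\<forall>l\<le>m. irreducible_closed (Z l) \<and> Z l \<subseteq> (X :: ('k^'i) set)) \<and>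
      (\<forall>l<m. Z l \<subset> Z (Suc l))}" by blast
next
  fix m assume "m \<in> {m. \<exists>Z. (\<forall>l\<le>m. irreducible_closed (Z l) \<and> Z l \<subseteq> (X :: ('k^'i) set)) \<and>
      (\<forall>l<m. Z l \<subset> Z (Suc l))}"
  then obtain Z where "\<forall>l\<le>m. irreducible_closed (Z l) \<and> Z l \<subseteq> (X :: ('k^'i) set)" "\<forall>l<m. Z l \<subset> Z (Suc l)"
    by blast
  then show "m \<le> N - 1" by (intro chain_bound[of m Z]) auto
qed

section \<open>Smoothness of the torus\<close>

text \<open>Apply s d/ds at s = 1 to \<open>p\<close> along the scaling of the parameter
  \<open>l\<close>. The factor \<open>s ^ D\<close> makes the restriction polynomial and contributes
  only a multiple of the value of \<open>p\<close> at \<open>x\<close>, which is 0.\<close>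

lemma log_derivative:
  fixes p :: "('k::field_char_0, 'i) mpoly"
  assumes p: "\<And>y. y \<in> T \<Longrightarrow> mpoly_eval p y = 0" and x: "x \<in> T" and l: "l < N"
  shows "(\<Sum>m\<in>pkeys p. lkp p m * meval m x * of_int (wt \<alpha> m l)) = 0"
proof -
  obtain \<tau> where \<tau>: "x = chi N \<alpha> \<tau>" "\<And>m. m < N \<Longrightarrow> \<tau> m \<noteq> 0" using x unfolding tcone_def by blast
  define D where "D = (\<Sum>m\<in>pkeys p. nat \<bar>wt \<alpha> m l\<bar>)"
  have D: "0 \<le> wt \<alpha> m l + int D" if "m \<in> pkeys p" for m
  proof -
    have "nat \<bar>wt \<alpha> m l\<bar> \<le> D" unfolding D_def by (rule member_le_sum) (use that in auto)
    then show ?thesis by linarith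
  qed
  define P where "P = (\<Sum>m\<in>pkeys p. monom (lkp p m * meval m x) (nat (wt \<alpha> m l + int D)))"
  have "poly P s = 0" if s: "s \<notin> {0}" for s
  proof -
    define \<tau>' where "\<tau>' = \<tau>(l := s * \<tau> l)"
    have nz: "\<tau>' m \<noteq> 0" if "m < N" for m using that s \<tau>(2) by (simp add: \<tau>'_def)
    have eval: "meval m (chi N \<alpha> \<tau>') = meval m x * s powi wt \<alpha> m l" for m
    proof -
      have "(\<Prod>j\<in>{..<N} - {l}. \<tau>' j powi wt \<alpha> m j) = (\<Prod>j\<in>{..<N} - {l}. \<tau> j powi wt \<alpha> m j)"
        by (rule prod.cong) (auto simp: \<tau>'_def)
      moreover have "(\<Prod>j<N. g j) = g l * (\<Prod>j\<in>{..<N} - {l}. g j)" for g :: "nat \<Rightarrow> 'k"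
        using l by (simp add: prod.remove)
      moreover have "meval m (chi N \<alpha> \<tau>') = (\<Prod>j<N. \<tau>' j powi wt \<alpha> m j)"
        by (rule meval_chi) (rule nz)
      moreover have "meval m x = (\<Prod>j<N. \<tau> j powi wt \<alpha> m j)"
        unfolding \<tau>(1) by (rule meval_chi) (rule \<tau>(2))
      ultimately show ?thesis by (simp add: \<tau>'_def power_int_mult_distrib)
    qed
    have "chi N \<alpha> \<tau>' \<in> T" unfolding tcone_def using nz by blast
    then have "(\<Sum>m\<in>pkeys p. lkp p m * (meval m x * s powi wt \<alpha> m l)) = 0"
      using p[of "chi N \<alpha> \<tau>'"] by (simp add: mpoly_eval_alt eval)
    then have "s ^ D * (\<Sum>m\<in>pkeys p. lkp p m * (meval m x * s powi wt \<alpha> m l)) = 0" by simp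
    also have "s ^ D * (\<Sum>m\<in>pkeys p. lkp p m * (meval m x * s powi wt \<alpha> m l)) = poly P s"
      unfolding P_def poly_sum poly_monom sum_distrib_left
    proof (rule sum.cong)
      fix m assume "m \<in> pkeys p"
      then have "s ^ nat (wt \<alpha> m l + int D) = s powi (wt \<alpha> m l + int D)"
        using D[of m] by (auto simp: power_int_def)
      then show "s ^ D * (lkp p m * (meval m x * s powi wt \<alpha> m l)) =
          lkp p m * meval m x * s ^ nat (wt \<alpha> m l + int D)"
        using s by (simp add: power_int_add mult_ac)
    qed simp
    finally show ?thesis .
  qed
  then have "P = 0" by (intro poly_zero_of_infinite_zeros[of "{0}"]) auto
  then have 1: "poly P 1 = 0" and 2: "poly (pderiv P) 1 = 0" by auto
  from 1 have 1: "(\<Sum>m\<in>pkeys p. lkp p m * meval m x) = 0" by (simp add: P_def poly_sum poly_monom)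
  have "(\<Sum>m\<in>pkeys p. of_nat (nat (wt \<alpha> m l + int D)) * (lkp p m * meval m x)) = 0"
    using 2 by (simp add: P_def poly_sum poly_monom pderiv_sum pderiv_monom)
  also have "(\<Sum>m\<in>pkeys p. of_nat (nat (wt \<alpha> m l + int D)) * (lkp p m * meval m x)) =
      (\<Sum>m\<in>pkeys p. lkp p m * meval m x * of_int (wt \<alpha> m l) + of_nat D * (lkp p m * meval m x))"
  proof (rule sum.cong)
    fix m assume "m \<in> pkeys p"
    then have "of_nat (nat (wt \<alpha> m l + int D)) = (of_int (wt \<alpha> m l + int D) :: 'k)"
      using D[of m] by (metis of_int_of_nat_eq int_nat_eq)
    then show "of_nat (nat (wt \<alpha> m l + int D)) * (lkp p m * meval m x) =
        lkp p m * meval m x * of_int (wt \<alpha> m l) + of_nat D * (lkp p m * meval m x)"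
      by (simp add: algebra_simps)
  qed simp
  also have "\<dots> = (\<Sum>m\<in>pkeys p. lkp p m * meval m x * of_int (wt \<alpha> m l))"
    using 1 by (simp add: sum.distrib sum_distrib_left[symmetric])
  finally show ?thesis .
qed

lemma pderiv_eval_times:
  fixes x :: "'k::field^'i"
  shows "mpoly_pderiv_eval i p x * x $ i = (\<Sum>m\<in>pkeys p. lkp p m * (of_nat (lkp m i) * meval m x))"
  unfolding mpoly_pderiv_eval_def sum_distrib_right
proof (rule sum.cong)
  fix m :: "'i \<Rightarrow>\<^sub>0 nat"
  have m: "meval m x = x $ i ^ lkp m i * (\<Prod>l\<in>UNIV - {i}. x $ l ^ lkp m l)"
    unfolding meval_def by (rule prod.remove) auto
  have d: "of_nat (lkp m i) * x $ i ^ (lkp m i - 1) * x $ i = of_nat (lkp m i) * x $ i ^ lkp m i"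
    by (cases "lkp m i") (auto simp: mult_ac)
  have "lkp p m * (of_nat (lkp m i) * x $ i ^ (lkp m i - 1) * (\<Prod>l\<in>UNIV - {i}. x $ l ^ lkp m l)) * x $ i =
      lkp p m * ((of_nat (lkp m i) * x $ i ^ (lkp m i - 1) * x $ i) * (\<Prod>l\<in>UNIV - {i}. x $ l ^ lkp m l))"
    by (simp only: mult_ac)
  then show "lkp p m * (of_nat (lkp m i) * x $ i ^ (lkp m i - 1) * (\<Prod>l\<in>UNIV - {i}. x $ l ^ lkp m l)) * x $ i =
      lkp p m * (of_nat (lkp m i) * meval m x)"
    unfolding d m by (simp only: mult_ac)
qed simp

text \<open>The binomials bound the tangent space from above; logarithmic derivatives in the torus
  parameters show that the bound is attained.\<close>

lemma tangent_T:
  fixes x :: "'k::field_char_0^'i"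
  assumes x: "x \<in> T"
  shows "tangent_cone_space X x = {v. \<exists>\<omega>. \<forall>i. v $ i = x $ i * (\<Sum>m<N. of_int (\<alpha> i m) * \<omega> m)}" (is "?L = ?R")
proof (intro set_eqI iffI)
  fix v assume v: "v \<in> ?L"
  define u where "u i = v $ i / x $ i" for i
  have vu: "v $ i = u i * x $ i" for i using tcone_nonzero[OF x] by (simp add: u_def)
  have "(\<Sum>i\<in>UNIV. of_int (z i) * u i) = 0" if z: "relation z" for z
  proof -
    let ?p = "binom z :: ('k, 'i) mpoly"
    have "?p \<in> vanishing_ideal X" by (simp add: vanishing_ideal_X binom_T[OF z])
    then have "(\<Sum>i\<in>UNIV. mpoly_pderiv_eval i ?p x * v $ i) = 0"
      using v by (simp add: tangent_cone_space_def)
    also have "(\<Sum>i\<in>UNIV. mpoly_pderiv_eval i ?p x * v $ i) =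
        (\<Sum>i\<in>UNIV. u i * (mpoly_pderiv_eval i ?p x * x $ i))"
      by (rule sum.cong) (auto simp: vu)
    also have "\<dots> = (\<Sum>i\<in>UNIV. u i * of_int (z i) * meval (pos_mono z) x)"
    proof (rule sum.cong)
      fix i
      have sub: "pkeys ?p \<subseteq> {pos_mono z, neg_mono z}"
        using keys_diff[of "mon (pos_mono z)" "mon (neg_mono z)"] by (auto simp: binom_def mon_def)
      have eq: "meval (pos_mono z) x = meval (neg_mono z) x"
        using binom_T[OF z x] by (simp add: binom_def)
      have "mpoly_pderiv_eval i ?p x * x $ i =
          (\<Sum>m\<in>{pos_mono z, neg_mono z}. lkp ?p m * (of_nat (lkp m i) * meval m x))"
        unfolding pderiv_eval_times
        by (rule sum.mono_neutral_left) (use sub in \<open>auto simp: in_keys_iff\<close>)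
      also have "\<dots> = of_int (z i) * meval (pos_mono z) x"
      proof (cases "pos_mono z = neg_mono z")
        case True
        then have "lkp (pos_mono z) i = lkp (neg_mono z) i" by simp
        then have "z i = 0" by (simp add: pos_mono_def neg_mono_def)
        then show ?thesis using True by (simp add: binom_def)
      next
        case False
        have "of_nat (lkp (pos_mono z) i) - of_nat (lkp (neg_mono z) i) = (of_int (z i) :: 'k)"
          by (cases "z i \<ge> 0") (auto simp: pos_mono_def neg_mono_def)
        then show ?thesis using False eq
          by (simp add: binom_def lookup_minus mon_def lookup_single left_diff_distrib[symmetric])
      qed
      finally show "u i * (mpoly_pderiv_eval i ?p x * x $ i) = u i * of_int (z i) * meval (pos_mono z) x"
        by simp
    qed simp
    also have "\<dots> = (\<Sum>i\<in>UNIV. of_int (z i) * u i) * meval (pos_mono z) x"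
      unfolding sum_distrib_right by (simp add: mult_ac)
    finally have "(\<Sum>i\<in>UNIV. of_int (z i) * u i) * meval (pos_mono z) x = 0" .
    then show ?thesis using meval_nonzero[of x] tcone_nonzero[OF x] by simp
  qed
  from killed_by_relations[of u, OF this]
  have "\<forall>i. u i = (\<Sum>m<N. of_int (\<alpha> i m) * (\<Sum>i'\<in>UNIV. of_int (C m i') * u i'))" by blast
  then have "\<forall>i. v $ i = x $ i * (\<Sum>m<N. of_int (\<alpha> i m) * (\<Sum>i'\<in>UNIV. of_int (C m i') * u i'))"
    using vu by (metis mult.commute)
  then show "v \<in> ?R" by (intro CollectI exI[of _ "\<lambda>m. \<Sum>i'\<in>UNIV. of_int (C m i') * u i'"])
next
  fix v assume "v \<in> ?R"
  then obtain \<omega> where v: "\<And>i. v $ i = x $ i * (\<Sum>m<N. of_int (\<alpha> i m) * \<omega> m)" by blast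
  have "(\<Sum>i\<in>UNIV. mpoly_pderiv_eval i p x * v $ i) = 0" if "p \<in> vanishing_ideal X" for p
  proof -
    have p: "\<And>y. y \<in> T \<Longrightarrow> mpoly_eval p y = 0" using that by (simp add: vanishing_ideal_X)
    have "(\<Sum>i\<in>UNIV. mpoly_pderiv_eval i p x * v $ i) =
        (\<Sum>i\<in>UNIV. (mpoly_pderiv_eval i p x * x $ i) * (\<Sum>l<N. of_int (\<alpha> i l) * \<omega> l))"
      by (simp add: v mult_ac)
    also have "\<dots> = (\<Sum>i\<in>UNIV. \<Sum>l<N. \<Sum>m\<in>pkeys p. lkp p m * (of_nat (lkp m i) * meval m x) * (of_int (\<alpha> i l) * \<omega> l))"
      unfolding pderiv_eval_times
      by (simp add: sum_distrib_left sum_distrib_right)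
    also have "\<dots> = (\<Sum>l<N. \<Sum>i\<in>UNIV. \<Sum>m\<in>pkeys p. lkp p m * (of_nat (lkp m i) * meval m x) * (of_int (\<alpha> i l) * \<omega> l))"
      by (rule sum.swap)
    also have "\<dots> = (\<Sum>l<N. \<Sum>m\<in>pkeys p. \<Sum>i\<in>UNIV. lkp p m * (of_nat (lkp m i) * meval m x) * (of_int (\<alpha> i l) * \<omega> l))"
      by (intro sum.cong refl sum.swap)
    also have "\<dots> = (\<Sum>l<N. \<omega> l * (\<Sum>m\<in>pkeys p. lkp p m * meval m x * of_int (wt \<alpha> m l)))"
      by (simp add: wt_def sum_distrib_left sum_distrib_right mult_ac)
    also have "\<dots> = 0" using log_derivative[OF p x] by simp
    finally show ?thesis .
  qed
  then show "v \<in> ?L" by (simp add: tangent_cone_space_def)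
qed

lemma dim_tangent_T:
  fixes x :: "'k::field_char_0^'i"
  assumes x: "x \<in> T"
  shows "vec.dim (tangent_cone_space X x) = N"
proof -
  define t :: "nat \<Rightarrow> 'k^'i" where "t m = (\<chi> i. x $ i * of_int (\<alpha> i m))" for m
  have "tangent_cone_space X x = vec.span (t ` {..<N})"
  proof
    show "tangent_cone_space X x \<subseteq> vec.span (t ` {..<N})"
    proof
      fix v assume "v \<in> tangent_cone_space X x"
      then obtain \<omega> where v: "\<And>i. v $ i = x $ i * (\<Sum>m<N. of_int (\<alpha> i m) * \<omega> m)" 
        unfolding tangent_T[OF x] by blast
      have "v = (\<Sum>m<N. \<omega> m *s t m)"
        by (simp add: vec_eq_iff v t_def sum_distrib_left mult_ac)
      then show "v \<in> vec.span (t ` {..<N})"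
        by (simp only:) (intro vec.span_sum vec.span_scale vec.span_base imageI)
    qed
    have "vec.subspace (tangent_cone_space X x)"
      unfolding vec.subspace_def tangent_cone_space_def
      by (auto simp: distrib_left sum.distrib mult.left_commute[of _ "_::'k"] sum_distrib_left[symmetric])
    moreover have "t m \<in> tangent_cone_space X x" if "m < N" for m
      unfolding tangent_T[OF x]
      by (intro CollectI exI[of _ "\<lambda>l. if l = m then 1 else 0"])
         (use that in \<open>simp add: t_def if_distrib cong: if_cong\<close>)
    ultimately show "vec.span (t ` {..<N}) \<subseteq> tangent_cone_space X x"
      by (intro vec.span_minimal) auto
  qed
  moreover have "indep {..<N} UNIV (\<lambda>m. vec_nth (t m))"
    unfolding indep_def
  proof (intro allI impI ballI)
    fix \<kappa> m assume "\<forall>i\<in>UNIV. (\<Sum>m<N. \<kappa> m * t m $ i) = 0" and m: "m \<in> {..<N}"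
    then have "x $ i * (\<Sum>m<N. of_int (\<alpha> i m) * \<kappa> m) = 0" for i
      by (simp add: t_def sum_distrib_left mult_ac)
    then have z: "(\<Sum>m<N. of_int (\<alpha> i m) * \<kappa> m) = 0" for i using tcone_nonzero[OF x] by simp
    have "0 = (\<Sum>i\<in>UNIV. of_int (C m i) * (\<Sum>l<N. of_int (\<alpha> i l) * \<kappa> l))" by (simp add: z)
    also have "\<dots> = (\<Sum>l<N. of_int (\<Sum>i\<in>UNIV. C m i * \<alpha> i l) * \<kappa> l)"
      by (simp add: sum_distrib_left sum_distrib_right mult.assoc) (rule sum.swap)
    also have "\<dots> = \<kappa> m" using m by (simp add: C if_distrib[of of_int] if_distrib[of "\<lambda>c. c * _"] cong: if_cong)
    finally show "\<kappa> m = 0" by simp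
  qed
  then have "vec.dim (vec.span (t ` {..<N})) = N"
    using vec_dim_span_indep[of "{..<N}" t] by simp
  ultimately show ?thesis by simp
qed

lemma smooth_T:
  fixes x :: "'k::field_char_0^'i"
  assumes "x \<in> T" shows "smooth_point X x"
  unfolding smooth_point_def
proof
  show "x \<in> X" using assms zariski_closure_subset by blast
  show "vec.dim (tangent_cone_space X x) = proj_dim (X :: ('k^'i) set) + 1"
    using dim_tangent_T[OF assms] N_pos by (simp add: proj_dim_X)
qed

end

section \<open>Moments\<close>

text \<open>The operator s d/ds multiplies monomials by their exponents, and it lowers the order of
  vanishing at 1 by at most one by the product rule.\<close>

lemma euler_operator_dvd:
  fixes P :: "'k::field_char_0 poly"
  assumes "[:- 1, 1:] ^ Suc r dvd P"
  shows "[:- 1, 1:] ^ r dvd [:0, 1:] * pderiv P"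
proof -
  obtain Q where Q: "P = [:- 1, 1:] ^ Suc r * Q" using assms by (elim dvdE)
  have "pderiv P = [:- 1, 1:] ^ r * ([:- 1, 1:] * pderiv Q + of_nat (Suc r) * Q)"
    unfolding Q pderiv_mult pderiv_power_Suc
    by (simp add: pderiv_pCons algebra_simps of_nat_poly smult_add_left)
  then show ?thesis by (metis dvd_mult dvd_triv_left)
qed

lemma euler_operator_monom: "[:0, 1:] * pderiv (monom c e) = monom (of_nat e * c) e"
  for c :: "'k::field_char_0"
proof -
  have "[:0, 1:] = monom (1::'k) 1" by (simp add: monom_altdef)
  then show ?thesis unfolding pderiv_monom by (cases e) (simp_all only: mult_monom, auto)
qed

text \<open>Applying s d/ds \<open>r\<close> times and evaluating at 1 produces the moment of order
  \<open>r\<close> of the exponents.\<close>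

lemma moments_of_dvd:
  fixes c :: "'m \<Rightarrow> 'k::field_char_0"
  assumes "[:- 1, 1:] ^ Suc k dvd (\<Sum>m\<in>S. monom (c m) (e m))" "r \<le> k"
  shows "(\<Sum>m\<in>S. c m * of_nat (e m) ^ r) = 0"
  using assms
proof (induction r arbitrary: c k)
  case 0
  then have "[:- 1, 1:] dvd (\<Sum>m\<in>S. monom (c m) (e m))"
    by (metis dvd_mult_left power_Suc)
  then have "poly (\<Sum>m\<in>S. monom (c m) (e m)) 1 = 0" by (simp add: poly_eq_0_iff_dvd)
  then show ?case by (simp add: poly_sum poly_monom)
next
  case (Suc r)
  then obtain k' where k: "k = Suc k'" by (cases k) auto
  have "[:- 1, 1:] ^ Suc k' dvd [:0, 1:] * pderiv (\<Sum>m\<in>S. monom (c m) (e m))"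
    using Suc.prems(1) unfolding k by (rule euler_operator_dvd)
  also have "[:0, 1:] * pderiv (\<Sum>m\<in>S. monom (c m) (e m)) = (\<Sum>m\<in>S. monom (of_nat (e m) * c m) (e m))"
    unfolding pderiv_sum sum_distrib_left euler_operator_monom ..
  finally have "(\<Sum>m\<in>S. (of_nat (e m) * c m) * of_nat (e m) ^ r) = 0"
    using Suc.prems(2) k by (intro Suc.IH) auto
  then show ?case by (simp add: mult_ac)
qed

lemma moments_shift:
  fixes c :: "'m \<Rightarrow> 'k::comm_ring_1"
  assumes "\<And>r. r \<le> k \<Longrightarrow> (\<Sum>m\<in>S. c m * (A + f m) ^ r) = 0" "r \<le> k"
  shows "(\<Sum>m\<in>S. c m * f m ^ r) = 0"
proof -
  have "f m ^ r = (\<Sum>l\<le>r. of_nat (r choose l) * (A + f m) ^ l * (- A) ^ (r - l))" for m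
    using binomial_ring[of "A + f m" "- A" r] by simp
  then have "(\<Sum>m\<in>S. c m * f m ^ r) =
      (\<Sum>m\<in>S. \<Sum>l\<le>r. of_nat (r choose l) * (- A) ^ (r - l) * (c m * (A + f m) ^ l))"
    by (simp add: sum_distrib_left mult_ac)
  also have "\<dots> = (\<Sum>l\<le>r. of_nat (r choose l) * (- A) ^ (r - l) * (\<Sum>m\<in>S. c m * (A + f m) ^ l))"
    unfolding sum_distrib_left by (rule sum.swap)
  also have "\<dots> = 0" using assms by (intro sum.neutral) auto
  finally show ?thesis .
qed

lemma poly_zero_of_int_zeros:
  fixes P :: "'k::field_char_0 poly"
  assumes "\<And>t::int. poly P (of_int t) = 0"
  shows "P = 0"
proof (rule ccontr)
  assume "P \<noteq> 0"
  then have "finite {s. poly P s = 0}" by (rule poly_roots_finite)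
  moreover have "range (of_int :: int \<Rightarrow> 'k) \<subseteq> {s. poly P s = 0}" using assms by auto
  ultimately have "finite (range (of_int :: int \<Rightarrow> 'k))" by (metis finite_subset)
  moreover have "inj (of_int :: int \<Rightarrow> 'k)" by (simp add: inj_def)
  ultimately show False by (simp add: finite_image_iff)
qed

text \<open>The power moment is a polynomial in the last weight and vanishes at all integers. Its
  coefficient of degree \<open>\<beta> n\<close> is a moment in one variable less, up to a nonzero
  binomial coefficient.\<close>

lemma polarization:
  fixes c :: "'m \<Rightarrow> 'k::field_char_0"
  assumes "\<And>w :: nat \<Rightarrow> int. (\<Sum>m\<in>S. c m * (\<Sum>j<n. of_int (w j) * f m j) ^ r) = 0"
    and "(\<Sum>j<n. \<beta> j) = r"
  shows "(\<Sum>m\<in>S. c m * (\<Prod>j<n. f m j ^ \<beta> j)) = 0"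
  using assms
proof (induction n arbitrary: c r)
  case 0
  then show ?case by simp
next
  case (Suc n)
  define b where "b = \<beta> n"
  have br: "b \<le> r" "(\<Sum>j<n. \<beta> j) = r - b" using Suc.prems(2) by (auto simp: b_def)
  have "(\<Sum>m\<in>S. (c m * f m n ^ b) * (\<Sum>j<n. of_int (w j) * f m j) ^ (r - b)) = 0" for w :: "nat \<Rightarrow> int"
  proof -
    define g where "g m = (\<Sum>j<n. of_int (w j) * f m j)" for m
    define P where "P = (\<Sum>l\<le>r. monom (of_nat (r choose l) * (\<Sum>m\<in>S. c m * f m n ^ l * g m ^ (r - l))) l)"
    have "poly P (of_int t) = 0" for t :: int
    proof -
      have "(\<Sum>m\<in>S. c m * (of_int t * f m n + g m) ^ r) = 0"
        using Suc.prems(1)[of "w(n := t)"] by (simp add: g_def add.commute)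
      also have "(\<Sum>m\<in>S. c m * (of_int t * f m n + g m) ^ r) =
          (\<Sum>m\<in>S. \<Sum>l\<le>r. of_nat (r choose l) * (c m * f m n ^ l * g m ^ (r - l)) * of_int t ^ l)"
        by (simp add: binomial_ring sum_distrib_left power_mult_distrib mult_ac)
      also have "\<dots> = (\<Sum>l\<le>r. \<Sum>m\<in>S. of_nat (r choose l) * (c m * f m n ^ l * g m ^ (r - l)) * of_int t ^ l)"
        by (rule sum.swap)
      also have "\<dots> = poly P (of_int t)"
        by (simp add: P_def poly_sum poly_monom sum_distrib_left sum_distrib_right)
      finally show ?thesis by simp
    qed
    then have "P = 0" by (rule poly_zero_of_int_zeros)
    then have "coeff P b = 0" by simp
    then have "of_nat (r choose b) * (\<Sum>m\<in>S. c m * f m n ^ b * g m ^ (r - b)) = 0"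
      using br(1) by (simp add: P_def coeff_sum)
    then show ?thesis using br(1) by (simp add: g_def)
  qed
  then have "(\<Sum>m\<in>S. (c m * f m n ^ b) * (\<Prod>j<n. f m j ^ \<beta> j)) = 0"
    using br(2) by (rule Suc.IH)
  then show ?case by (simp add: b_def mult_ac)
qed

text \<open>Expanding the product gives monomials of total degree at most the sum of the degrees of
  the factors.\<close>

lemma killed_polynomials:
  fixes c :: "'m \<Rightarrow> 'k::field_char_0"
  assumes c: "\<And>\<beta>. \<beta> \<in> exponents n k \<Longrightarrow> (\<Sum>m\<in>S. c m * (\<Prod>j<n. f m j ^ \<beta> j)) = 0"
    and F: "(\<Sum>j<n. degree (F j)) \<le> k"
  shows "(\<Sum>m\<in>S. c m * (\<Prod>j<n. poly (F j) (f m j))) = 0"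
proof -
  have "(\<Prod>j<n. poly (F j) (f m j)) =
      (\<Sum>\<phi>\<in>(\<Pi>\<^sub>E j\<in>{..<n}. {..degree (F j)}). (\<Prod>j<n. coeff (F j) (\<phi> j)) * (\<Prod>j<n. f m j ^ \<phi> j))" for m
    unfolding poly_altdef by (subst prod_sum_PiE) (auto simp: prod.distrib)
  then have "(\<Sum>m\<in>S. c m * (\<Prod>j<n. poly (F j) (f m j))) =
      (\<Sum>m\<in>S. \<Sum>\<phi>\<in>(\<Pi>\<^sub>E j\<in>{..<n}. {..degree (F j)}).
        (\<Prod>j<n. coeff (F j) (\<phi> j)) * (c m * (\<Prod>j<n. f m j ^ \<phi> j)))"
    by (simp add: sum_distrib_left mult_ac)
  also have "\<dots> = (\<Sum>\<phi>\<in>(\<Pi>\<^sub>E j\<in>{..<n}. {..degree (F j)}).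
      (\<Prod>j<n. coeff (F j) (\<phi> j)) * (\<Sum>m\<in>S. c m * (\<Prod>j<n. f m j ^ \<phi> j)))"
    unfolding sum_distrib_left by (rule sum.swap)
  also have "\<dots> = 0"
  proof (rule sum.neutral, rule ballI)
    fix \<phi> assume \<phi>: "\<phi> \<in> (\<Pi>\<^sub>E j\<in>{..<n}. {..degree (F j)})"
    define \<beta> where "\<beta> j = (if j < n then \<phi> j else 0)" for j
    have "(\<Sum>j<n. \<beta> j) \<le> (\<Sum>j<n. degree (F j))"
      using \<phi> by (intro sum_mono) (auto simp: \<beta>_def PiE_iff)
    then have "\<beta> \<in> exponents n k" using F by (auto simp: exponents_def vecs_def \<beta>_def)
    from c[OF this] have "(\<Sum>m\<in>S. c m * (\<Prod>j<n. f m j ^ \<phi> j)) = 0" by (simp add: \<beta>_def)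
    then show "(\<Prod>j<n. coeff (F j) (\<phi> j)) * (\<Sum>m\<in>S. c m * (\<Prod>j<n. f m j ^ \<phi> j)) = 0" by simp
  qed
  finally show ?thesis .
qed

section \<open>Powers of ideals\<close>

lemma ideal_power_0: "ideal_power I 0 = UNIV"
  by (simp add: ideal_power_def)

lemma ideal_power_Suc: "ideal_power I (Suc m) = ideal_mult I (ideal_power I m)"
  by (simp add: ideal_power_def)

lemma ideal_mult_single: "f \<in> I \<Longrightarrow> g \<in> J \<Longrightarrow> f * g \<in> ideal_mult I J"
  unfolding ideal_mult_def
  by (intro CollectI exI[of _ 1] exI[of _ "\<lambda>_. f"] exI[of _ "\<lambda>_. g"]) simp

lemma ideal_mult_mono: "J \<subseteq> J' \<Longrightarrow> ideal_mult I J \<subseteq> ideal_mult I J'"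
  unfolding ideal_mult_def by blast

lemma ideal_power_antimono: "ideal_power I (Suc m) \<subseteq> ideal_power I m"
proof (induction m)
  case 0
  then show ?case by (simp add: ideal_power_0)
next
  case (Suc m)
  from ideal_mult_mono[OF this] show ?case by (simp only: ideal_power_Suc)
qed

lemma ideal_power_le: "m \<le> m' \<Longrightarrow> ideal_power I m' \<subseteq> ideal_power I m"
  by (rule lift_Suc_antimono_le[of "ideal_power I"]) (rule ideal_power_antimono)

lemma ideal_mult_zero: "0 \<in> ideal_mult I J"
  unfolding ideal_mult_def by (intro CollectI exI[of _ 0]) simp

lemma ideal_mult_add_single:
  assumes "p \<in> ideal_mult I J" "f \<in> I" "g \<in> J"
  shows "p + f * g \<in> ideal_mult I J"
proof -
  obtain s :: nat and F G where p: "p = (\<Sum>l<s. F l * G l)" "\<forall>l<s. F l \<in> I \<and> G l \<in> J"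
    using assms(1) unfolding ideal_mult_def by blast
  have "p + f * g = (\<Sum>l<Suc s. (F(s := f)) l * (G(s := g)) l)"
    unfolding p(1) by (simp add: sum.lessThan_Suc)
  moreover have "\<forall>l<Suc s. (F(s := f)) l \<in> I \<and> (G(s := g)) l \<in> J"
    using p(2) assms by (auto simp: less_Suc_eq)
  ultimately show ?thesis unfolding ideal_mult_def by blast
qed

lemma ideal_mult_add:
  assumes "p \<in> ideal_mult I J" "q \<in> ideal_mult I J"
  shows "p + q \<in> ideal_mult I J"
proof -
  obtain s :: nat and F G where q: "q = (\<Sum>l<s. F l * G l)" "\<forall>l<s. F l \<in> I \<and> G l \<in> J"
    using assms(2) unfolding ideal_mult_def by blast
  have "t \<le> s \<Longrightarrow> p + (\<Sum>l<t. F l * G l) \<in> ideal_mult I J" for t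
  proof (induction t)
    case 0
    then show ?case using assms(1) by simp
  next
    case (Suc t)
    then have "p + (\<Sum>l<t. F l * G l) + F t * G t \<in> ideal_mult I J"
      using q(2) by (intro ideal_mult_add_single) auto
    then show ?case by (simp add: add.assoc)
  qed
  then show ?thesis using q(1) by blast
qed

lemma ideal_power_add: "p \<in> ideal_power I m \<Longrightarrow> q \<in> ideal_power I m \<Longrightarrow> p + q \<in> ideal_power I m"
  by (cases m) (auto simp: ideal_power_0 ideal_power_Suc intro: ideal_mult_add)

lemma ideal_power_zero: "0 \<in> ideal_power I m"
  by (cases m) (auto simp: ideal_power_0 ideal_power_Suc intro: ideal_mult_zero)

lemma ideal_power_sum: "(\<And>a. a \<in> S \<Longrightarrow> p a \<in> ideal_power I m) \<Longrightarrow> (\<Sum>a\<in>S. p a) \<in> ideal_power I m"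
  by (induction S rule: infinite_finite_induct) (auto intro: ideal_power_add ideal_power_zero)

lemma ideal_power_lmult: "p \<in> ideal_power I m \<Longrightarrow> r * p \<in> ideal_power I m"
proof (induction m arbitrary: p)
  case 0
  then show ?case by (simp add: ideal_power_0)
next
  case (Suc m)
  then obtain s :: nat and F G where p: "p = (\<Sum>l<s. F l * G l)" "\<forall>l<s. F l \<in> I \<and> G l \<in> ideal_power I m"
    unfolding ideal_power_Suc ideal_mult_def by blast
  have eq: "r * p = (\<Sum>l<s. F l * (r * G l))" by (simp add: p(1) sum_distrib_left mult_ac)
  have "F l * (r * G l) \<in> ideal_power I (Suc m)" if "l < s" for l
    using p(2) Suc.IH that unfolding ideal_power_Suc by (intro ideal_mult_single) auto
  then show ?case unfolding eq by (intro ideal_power_sum) simp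
qed

lemma ideal_power_mult_single: "f \<in> I \<Longrightarrow> g \<in> ideal_power I m \<Longrightarrow> f * g \<in> ideal_power I (Suc m)"
  unfolding ideal_power_Suc by (rule ideal_mult_single)

lemma ideal_power_power: "f \<in> I \<Longrightarrow> g \<in> ideal_power I m \<Longrightarrow> f ^ e * g \<in> ideal_power I (e + m)"
  by (induction e) (auto simp: mult.assoc intro: ideal_power_mult_single)

lemma ideal_power_prod:
  "(\<And>j. j \<in> S \<Longrightarrow> D j \<in> I) \<Longrightarrow> (\<Prod>j\<in>S. D j ^ \<phi> j) \<in> ideal_power I (\<Sum>j\<in>S. \<phi> j)"
  by (induction S rule: infinite_finite_induct) (auto simp: ideal_power_0 intro: ideal_power_power)

section \<open>Order of vanishing along one-parameter subgroups\<close>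

lemma curve_mult: "curve g (p * q) = curve g p * curve g q"
  for g :: "'i::finite \<Rightarrow> 'k::field_char_0 poly"
  by (rule poly_eq_of_infinite[of "{}"]) (auto simp: poly_curve)

lemma curve_add: "curve g (p + q) = curve g p + curve g q"
  for g :: "'i::finite \<Rightarrow> 'k::field_char_0 poly"
  by (rule poly_eq_of_infinite[of "{}"]) (auto simp: poly_curve)

lemma curve_zero: "curve g 0 = 0"
  by (simp add: curve_def)

lemma prod_monom: "(\<Prod>i\<in>S. monom (c i) (e i)) = monom (\<Prod>i\<in>S. c i) (\<Sum>i\<in>S. e i)"
  for c :: "'i \<Rightarrow> 'k::field"
  by (induction S rule: infinite_finite_induct) (auto simp: mult_monom monom_0)

context toric
begin

text \<open>The orbit s -> s^w y of a one-parameter subgroup, passing through \<open>y\<close> at s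
  = 1. It is polynomial only for weights with nonnegative exponents, which is why those are singled
  out below.\<close>

definition onepar :: "'k::field^'i \<Rightarrow> (nat \<Rightarrow> int) \<Rightarrow> 'i \<Rightarrow> 'k poly" where
  "onepar y w i = monom (y $ i) (nat (\<Sum>l<N. w l * \<alpha> i l))"

text \<open>Order of vanishing tested on one-parameter orbits only. It is implied by membership in a
  power of the ideal of \<open>y\<close>, yet strong enough to determine all moments up to that
  order.\<close>

definition ordc :: "nat \<Rightarrow> 'k::field^'i \<Rightarrow> ('k, 'i) mpoly \<Rightarrow> bool" where
  "ordc m y p \<longleftrightarrow> (\<forall>w. (\<forall>i. 0 \<le> (\<Sum>l<N. w l * \<alpha> i l)) \<longrightarrow> [:- 1, 1:] ^ m dvd curve (onepar y w) p)"

lemma ordc_add: "ordc m y p \<Longrightarrow> ordc m y q \<Longrightarrow> ordc m y (p + q)"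
  for y :: "'k::field_char_0^'i"
  by (simp add: ordc_def curve_add)

lemma ordc_zero: "ordc m y 0"
  by (simp add: ordc_def curve_zero)

lemma ordc_sum: "(\<And>a. a \<in> S \<Longrightarrow> ordc m y (f a)) \<Longrightarrow> ordc m y (\<Sum>a\<in>S. f a)"
  for y :: "'k::field_char_0^'i"
  by (induction S rule: infinite_finite_induct) (auto intro: ordc_add ordc_zero)

lemma ordc_lmult: "ordc m y p \<Longrightarrow> ordc m y (q * p)"
  for y :: "'k::field_char_0^'i"
  by (simp add: ordc_def curve_mult)

lemma ordc_mult: "ordc a y p \<Longrightarrow> ordc b y q \<Longrightarrow> ordc (a + b) y (p * q)"
  for y :: "'k::field_char_0^'i"
  by (simp add: ordc_def curve_mult power_add mult_dvd_mono)

lemma ordc_0: "ordc 0 y p"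
  by (simp add: ordc_def)

lemma onepar_1: "(\<chi> i. poly (onepar y w i) 1) = y"
  by (simp add: onepar_def poly_monom vec_eq_iff)

lemma ordc_1: "mpoly_eval p y = 0 \<Longrightarrow> ordc 1 y p"
  by (simp add: ordc_def poly_eq_0_iff_dvd[symmetric] poly_curve onepar_1)

lemma onepar_T:
  assumes y: "y \<in> T" and w: "\<And>i. 0 \<le> (\<Sum>l<N. w l * \<alpha> i l)" and s: "s \<noteq> 0"
  shows "(\<chi> i. poly (onepar y w i) s) \<in> T"
proof -
  obtain \<tau> where \<tau>: "y = chi N \<alpha> \<tau>" "\<forall>m<N. \<tau> m \<noteq> 0" using y unfolding tcone_def by blast
  have "poly (onepar y w i) s = chi N \<alpha> (\<lambda>m. \<tau> m * s powi w m) $ i" for i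
  proof -
    have "poly (onepar y w i) s = y $ i * s powi (\<Sum>l<N. w l * \<alpha> i l)"
      using w[of i] by (simp add: onepar_def poly_monom power_int_def)
    also have "s powi (\<Sum>l<N. w l * \<alpha> i l) = (\<Prod>l<N. (s powi w l) powi \<alpha> i l)"
      using s by (simp add: power_int_sum power_int_mult)
    finally show ?thesis by (simp add: \<tau>(1) chi_def power_int_mult_distrib prod.distrib)
  qed
  then have "(\<chi> i. poly (onepar y w i) s) = chi N \<alpha> (\<lambda>m. \<tau> m * s powi w m)" by (simp add: vec_eq_iff)
  moreover have "\<forall>m<N. \<tau> m * s powi w m \<noteq> 0" using \<tau>(2) s by simp
  ultimately show ?thesis unfolding tcone_def by blast
qed

lemma ordc_vanishing:
  fixes y :: "'k::field_char_0^'i"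
  assumes "\<And>z. z \<in> T \<Longrightarrow> mpoly_eval p z = 0" "y \<in> T"
  shows "ordc m y p"
  unfolding ordc_def
proof (intro allI impI)
  fix w assume w: "\<forall>i. 0 \<le> (\<Sum>l<N. w l * \<alpha> i l)"
  have "curve (onepar y w) p = 0"
    by (rule poly_zero_of_infinite_zeros[of "{0}"])
       (use onepar_T[OF assms(2)] w assms(1) in \<open>auto simp: poly_curve\<close>)
  then show "[:- 1, 1:] ^ m dvd curve (onepar y w) p" by simp
qed

text \<open>Multiplicities at 1 add, and \<open>g\<close> contributes none.\<close>

lemma ordc_cancel:
  fixes y :: "'k::field_char_0^'i"
  assumes "ordc m y (g * p)" "mpoly_eval g y \<noteq> 0"
  shows "ordc m y p"
  unfolding ordc_def
proof (intro allI impI)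
  fix w assume w: "\<forall>i. 0 \<le> (\<Sum>l<N. w l * \<alpha> i l)"
  let ?G = "curve (onepar y w) g" and ?P = "curve (onepar y w) p"
  have dvd: "[:- 1, 1:] ^ m dvd ?G * ?P" using assms(1) w unfolding ordc_def curve_mult by blast
  have G: "poly ?G 1 \<noteq> 0" using assms(2) by (simp add: poly_curve onepar_1)
  show "[:- 1, 1:] ^ m dvd ?P"
  proof (cases "?P = 0")
    case False
    have "?G \<noteq> 0" using G by auto
    then have nz: "?G * ?P \<noteq> 0" using False by simp
    then have "m \<le> order 1 (?G * ?P)" using dvd by (simp add: order_divides)
    also have "\<dots> = order 1 ?P" using nz G order_root[of ?G 1] by (simp add: order_mult)
    finally show ?thesis by (simp add: order_divides)
  qed simp
qed

lemma ordc_ideal_power: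
  fixes y :: "'k::field_char_0^'i"
  assumes "p \<in> ideal_power (vanishing_ideal (proj_point y)) m"
  shows "ordc m y p"
  using assms
proof (induction m arbitrary: p)
  case 0
  then show ?case by (simp add: ordc_0)
next
  case (Suc m)
  then obtain s :: nat and F G where p: "p = (\<Sum>l<(s::nat). F l * G l)"
    "\<forall>l<s. F l \<in> vanishing_ideal (proj_point y) \<and> G l \<in> ideal_power (vanishing_ideal (proj_point y)) m"
    unfolding ideal_power_Suc ideal_mult_def by blast
  have "y \<in> proj_point y" unfolding proj_point_def by (intro CollectI exI[of _ 1]) simp
  then have "ordc 1 y (F l)" if "l < s" for l
    using p(2) that by (intro ordc_1) (auto simp: vanishing_ideal_def)
  then have "ordc (Suc m) y (F l * G l)" if "l < s" for l
    using ordc_mult[of 1 y "F l" m "G l"] that p(2) Suc.IH by simp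
  then show ?case unfolding p(1) by (intro ordc_sum) simp
qed

text \<open>The exponents \<open>a\<^sub>i\<close> of the affine parametrization.\<close>

definition pt :: "'i \<Rightarrow> nat \<Rightarrow> int" where
  "pt i j = \<alpha> i (Suc j)"

lemma sum_split_0: "(\<Sum>l<N. f l) = f 0 + (\<Sum>j<N - 1. f (Suc j))" for f :: "nat \<Rightarrow> 'b::comm_monoid_add"
proof -
  have "N = Suc (N - 1)" using N_pos by simp
  then show ?thesis by (metis sum.lessThan_Suc_shift)
qed

lemma prod_split_0: "(\<Prod>l<N. f l) = f 0 * (\<Prod>j<N - 1. f (Suc j))" for f :: "nat \<Rightarrow> 'b::comm_monoid_mult"
proof -
  have "N = Suc (N - 1)" using N_pos by simp
  then show ?thesis by (metis prod.lessThan_Suc_shift)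
qed

lemma curve_onepar:
  assumes "\<And>i. 0 \<le> (\<Sum>l<N. w l * \<alpha> i l)"
  shows "curve (onepar y w) p = (\<Sum>m\<in>pkeys p. monom (lkp p m * meval m y) (nat (\<Sum>l<N. w l * wt \<alpha> m l)))"
  unfolding curve_def
proof (rule sum.cong)
  fix m :: "'i \<Rightarrow>\<^sub>0 nat"
  have "int (\<Sum>i\<in>UNIV. nat (\<Sum>l<N. w l * \<alpha> i l) * lkp m i) = (\<Sum>i\<in>UNIV. (\<Sum>l<N. w l * \<alpha> i l) * int (lkp m i))"
    using assms by simp
  also have "\<dots> = (\<Sum>l<N. w l * wt \<alpha> m l)"
    by (simp add: wt_def sum_distrib_left sum_distrib_right mult_ac) (rule sum.swap)
  finally have "(\<Sum>i\<in>UNIV. nat (\<Sum>l<N. w l * \<alpha> i l) * lkp m i) = nat (\<Sum>l<N. w l * wt \<alpha> m l)" by linarith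
  then show "smult (lkp p m) (\<Prod>i\<in>UNIV. onepar y w i ^ lkp m i) =
      monom (lkp p m * meval m y) (nat (\<Sum>l<N. w l * wt \<alpha> m l))"
    by (simp add: onepar_def monom_power prod_monom meval_def smult_monom)
qed simp

text \<open>Along a one-parameter orbit the exponents of \<open>p\<close> depend linearly on the
  weight. Order k + 1 at s = 1 kills their power moments, and varying the weight separates the mixed
  ones.\<close>

lemma ordc_moments:
  fixes y :: "'k::field_char_0^'i"
  assumes ord: "ordc (Suc k) y p" and hom: "hdeg d p" and \<beta>: "(\<Sum>j<N - 1. \<beta> j) \<le> k"
  shows "(\<Sum>m\<in>pkeys p. lkp p m * meval m y * (\<Prod>j<N - 1. of_int (wt \<alpha> m (Suc j)) ^ \<beta> j)) = 0"
proof (rule polarization[OF _ refl])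
  fix w :: "nat \<Rightarrow> int"
  \<comment> \<open>A multiple of the degree coordinate large enough to make all exponents
    nonnegative; on a form of degree \<open>d\<close> it adds the constant \<open>A * d\<close>,
    which \<open>moments_shift\<close> removes.\<close>
  define A where "A = (\<Sum>i\<in>UNIV. nat \<bar>\<Sum>j<N - 1. w j * \<alpha> i (Suc j)\<bar>)"
  define w' where "w' l = (case l of 0 \<Rightarrow> int A | Suc j \<Rightarrow> w j)" for l
  have w': "(\<Sum>l<N. w' l * u l) = int A * u 0 + (\<Sum>j<N - 1. w j * u (Suc j))" for u
    by (simp add: sum_split_0 w'_def)
  have "0 \<le> (\<Sum>l<N. w' l * \<alpha> i l)" for i
  proof -
    have "nat \<bar>\<Sum>j<N - 1. w j * \<alpha> i (Suc j)\<bar> \<le> A" unfolding A_def by (rule member_le_sum) auto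
    then show ?thesis unfolding w' alpha_0 by linarith
  qed
  then have nn: "\<forall>i. 0 \<le> (\<Sum>l<N. w' l * \<alpha> i l)" by blast
  have nn': "0 \<le> (\<Sum>l<N. w' l * wt \<alpha> m l)" for m
  proof -
    have "(\<Sum>l<N. w' l * wt \<alpha> m l) = (\<Sum>i\<in>UNIV. int (lkp m i) * (\<Sum>l<N. w' l * \<alpha> i l))"
      by (simp add: wt_def sum_distrib_left mult_ac) (rule sum.swap)
    then show ?thesis using nn by (simp add: sum_nonneg)
  qed
  have "[:- 1, 1:] ^ Suc k dvd curve (onepar y w') p" using ord nn unfolding ordc_def by blast
  also have "curve (onepar y w') p =
      (\<Sum>m\<in>pkeys p. monom (lkp p m * meval m y) (nat (\<Sum>l<N. w' l * wt \<alpha> m l)))"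
    by (rule curve_onepar) (use nn in blast)
  finally have "[:- 1, 1:] ^ Suc k dvd
      (\<Sum>m\<in>pkeys p. monom (lkp p m * meval m y) (nat (\<Sum>l<N. w' l * wt \<alpha> m l)))" .
  from moments_of_dvd[OF this]
  have mom: "(\<Sum>m\<in>pkeys p. lkp p m * meval m y * of_nat (nat (\<Sum>l<N. w' l * wt \<alpha> m l)) ^ r) = 0" if "r \<le> k" for r
    using that by blast
  have "of_nat (nat (\<Sum>l<N. w' l * wt \<alpha> m l)) =
      (of_nat (A * d) + (\<Sum>j<N - 1. of_int (w j) * of_int (wt \<alpha> m (Suc j))) :: 'k)" if "m \<in> pkeys p" for m
  proof -
    have "of_nat (nat (\<Sum>l<N. w' l * wt \<alpha> m l)) = (of_int (\<Sum>l<N. w' l * wt \<alpha> m l) :: 'k)"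
      using nn'[of m] by (metis of_int_of_nat_eq int_nat_eq)
    moreover have "mdeg m = d" using that hom by (simp add: hdeg_def)
    ultimately show ?thesis by (simp add: w' wt_0)
  qed
  then have "(\<Sum>m\<in>pkeys p. lkp p m * meval m y *
      (of_nat (A * d) + (\<Sum>j<N - 1. of_int (w j) * of_int (wt \<alpha> m (Suc j)))) ^ r) = 0" if "r \<le> k" for r
    using mom[OF that] by simp
  from moments_shift[OF this \<beta>]
  show "(\<Sum>m\<in>pkeys p. lkp p m * meval m y *
      (\<Sum>j<N - 1. of_int (w j) * of_int (wt \<alpha> m (Suc j))) ^ (\<Sum>j<N - 1. \<beta> j)) = 0" by blast
qed

text \<open>Stated over an arbitrary field, because it is used over the reals as well as over
  \<open>'k\<close>.\<close>

definition kerK :: "nat \<Rightarrow> ('k::field^'i) set" where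
  "kerK k = {v. \<forall>\<beta>\<in>exponents (N - 1) k. (\<Sum>i\<in>UNIV. of_int (row_Ak (N - 1) pt \<beta> i) * v $ i) = 0}"

lemma single_one_inject [simp]:
  "Poly_Mapping.single i (Suc 0) = Poly_Mapping.single j (Suc 0) \<longleftrightarrow> i = j"
  by (metis lookup_single_eq lookup_single_not_eq nat.distinct(1))

lemma sum_linear_form:
  "(\<Sum>m\<in>pkeys (linear_form h). lkp (linear_form h) m * F m) = (\<Sum>i\<in>UNIV. h $ i * F (Poly_Mapping.single i 1))"
  for h :: "'k::field^'i"
proof -
  let ?e = "\<lambda>i. Poly_Mapping.single i (1::nat)"
  have inj: "inj ?e" by (rule inj_onI) simp
  have lk: "lkp (linear_form h) (?e i) = h $ i" for i
  proof -
    have "lkp (linear_form h) (?e i) = (\<Sum>j\<in>UNIV. if j = i then h $ j else 0)"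
      unfolding linear_form_def lookup_sum
      by (rule sum.cong) (auto simp: lookup_single when_def)
    then show ?thesis by simp
  qed
  have sub: "pkeys (linear_form h) \<subseteq> range ?e"
    unfolding linear_form_def using keys_sum[of "\<lambda>i. Poly_Mapping.single (?e i) (h $ i)" UNIV]
    by (auto split: if_splits)
  have "(\<Sum>m\<in>pkeys (linear_form h). lkp (linear_form h) m * F m) = (\<Sum>m\<in>range ?e. lkp (linear_form h) m * F m)"
    by (rule sum.mono_neutral_left) (use sub in \<open>auto simp: in_keys_iff\<close>)
  also have "\<dots> = (\<Sum>i\<in>UNIV. h $ i * F (?e i))"
    using inj by (subst sum.reindex) (simp_all add: lk del: One_nat_def)
  finally show ?thesis .
qed

lemma wt_single: "wt \<alpha> (Poly_Mapping.single i 1) l = \<alpha> i l"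
  by (simp add: wt_def lookup_single when_def if_distrib[of int] if_distrib[of "\<lambda>c. c * _"] cong: if_cong)

lemma ordc_linear_form:
  fixes y :: "'k::field_char_0^'i"
  assumes "ordc (Suc k) y (linear_form h)"
  shows "(\<chi> i. h $ i * y $ i) \<in> kerK k"
  unfolding kerK_def
proof (intro CollectI ballI)
  fix \<beta> assume "\<beta> \<in> exponents (N - 1) k"
  then have "(\<Sum>j<N - 1. \<beta> j) \<le> k" by (simp add: exponents_def)
  from ordc_moments[OF assms hdeg_linear_form this]
  have "(\<Sum>i\<in>UNIV. h $ i * (y $ i * (\<Prod>j<N - 1. of_int (\<alpha> i (Suc j)) ^ \<beta> j))) = 0"
    using sum_linear_form[of h "\<lambda>m. meval m y * (\<Prod>j<N - 1. of_int (wt \<alpha> m (Suc j)) ^ \<beta> j)"]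
    by (simp add: mult.assoc wt_single del: One_nat_def)
  then show "(\<Sum>i\<in>UNIV. of_int (row_Ak (N - 1) pt \<beta> i) * (\<chi> i. h $ i * y $ i) $ i) = 0"
    by (simp add: row_Ak_def pt_def mult_ac)
qed

lemma jet_kernel_imp_ordc:
  fixes y :: "'k::field_char_0^'i"
  assumes "h \<in> jet_kernel k X y" "y \<in> T"
  shows "ordc (Suc k) y (linear_form h)"
proof -
  obtain g q s where "mpoly_eval g y \<noteq> 0" and q: "q \<in> ideal_power (vanishing_ideal (proj_point y)) (Suc k)"
    and s: "s \<in> vanishing_ideal X" and eq: "g * linear_form h = q + s"
    using assms(1) by (auto simp: jet_kernel_def vanishes_to_order_def)
  have "ordc (Suc k) y s"
    using s assms(2) by (intro ordc_vanishing) (auto simp: vanishing_ideal_X)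
  then have "ordc (Suc k) y (g * linear_form h)"
    unfolding eq using ordc_ideal_power[OF q] by (intro ordc_add)
  then show ?thesis using \<open>mpoly_eval g y \<noteq> 0\<close> by (rule ordc_cancel)
qed

end

section \<open>Jets at points of the torus\<close>

lemma cpoly_mult: "cpoly (a * b) = cpoly a * cpoly b"
  by (simp add: cpoly_def mult_single)

lemma cpoly_add: "cpoly (a + b) = cpoly a + cpoly b"
  by (simp add: cpoly_def single_add)

lemma cpoly_0: "cpoly 0 = 0"
  by (simp add: cpoly_def)

lemma cpoly_1: "cpoly 1 = 1"
  by (simp add: cpoly_def)

lemma cpoly_of_nat: "cpoly (of_nat e) = of_nat e"
  by (induction e) (auto simp: cpoly_0 cpoly_1 cpoly_add)

lemma cpoly_power: "cpoly (a ^ e) = cpoly a ^ e"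
  by (induction e) (auto simp: cpoly_1 cpoly_mult)

lemma cpoly_sum: "cpoly (\<Sum>a\<in>S. f a) = (\<Sum>a\<in>S. cpoly (f a))"
  by (induction S rule: infinite_finite_induct) (auto simp: cpoly_0 cpoly_add)

lemma cpoly_prod: "cpoly (\<Prod>a\<in>S. f a) = (\<Prod>a\<in>S. cpoly (f a))"
  by (induction S rule: infinite_finite_induct) (auto simp: cpoly_1 cpoly_mult)

text \<open>A homogenized binomial expansion around t. Summing up to \<open>E\<close> gives one
  range for all exponents; the terms with b > a vanish through the binomial coefficient, not through
  the truncated \<open>a - b\<close>.\<close>

lemma shifted_binomial:
  fixes d q :: "('k::field, 'i::finite) mpoly"
  assumes "a \<le> E"
  shows "(d + cpoly t * q) ^ a * q ^ (E - a) =
    (\<Sum>b\<le>E. cpoly (of_nat (a choose b) * t ^ (a - b)) * (d ^ b * q ^ (E - b)))"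
proof -
  have "(d + cpoly t * q) ^ a * q ^ (E - a) =
      (\<Sum>b\<le>a. of_nat (a choose b) * d ^ b * (cpoly t * q) ^ (a - b) * q ^ (E - a))"
    by (simp add: binomial_ring sum_distrib_right)
  also have "\<dots> = (\<Sum>b\<le>a. cpoly (of_nat (a choose b) * t ^ (a - b)) * (d ^ b * q ^ (E - b)))"
  proof (rule sum.cong)
    fix b assume "b \<in> {..a}"
    then have "E - b = (a - b) + (E - a)" using assms by simp
    then have "q ^ (E - b) = q ^ (a - b) * q ^ (E - a)" by (metis power_add)
    then show "of_nat (a choose b) * d ^ b * (cpoly t * q) ^ (a - b) * q ^ (E - a) =
        cpoly (of_nat (a choose b) * t ^ (a - b)) * (d ^ b * q ^ (E - b))"
      by (simp add: cpoly_mult cpoly_of_nat cpoly_power power_mult_distrib mult_ac)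
  qed simp
  also have "\<dots> = (\<Sum>b\<le>E. cpoly (of_nat (a choose b) * t ^ (a - b)) * (d ^ b * q ^ (E - b)))"
    by (rule sum.mono_neutral_left) (use assms in \<open>auto simp: cpoly_0 not_le binomial_eq_0\<close>)
  finally show ?thesis .
qed

text \<open>The polynomial x -> binomial(x + B, b).\<close>

definition binomial_poly :: "nat \<Rightarrow> nat \<Rightarrow> 'k::field_char_0 poly" where
  "binomial_poly B b = smult (1 / fact b) (\<Prod>l<b. [:of_nat B - of_nat l, 1:])"

lemma degree_binomial_poly: "degree (binomial_poly B b :: 'k::field_char_0 poly) \<le> b"
proof -
  have "degree (\<Prod>l<b. [:of_nat B - of_nat l, 1:] :: 'k poly) \<le> (\<Sum>l<b. 1)"
    by (rule order_trans[OF degree_prod_sum_le]) auto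
  then show ?thesis
    unfolding binomial_poly_def by (intro order_trans[OF degree_smult_le]) simp
qed

lemma poly_binomial_poly:
  "x + of_nat B = of_nat a \<Longrightarrow> poly (binomial_poly B b) x = of_nat (a choose b)"
  for x :: "'k::field_char_0"
proof -
  assume "x + of_nat B = of_nat a"
  then have "poly (binomial_poly B b) x = (\<Prod>l<b. of_nat a - of_nat l) / fact b"
    by (simp add: binomial_poly_def poly_prod algebra_simps)
  then show ?thesis by (simp add: binomial_gbinomial gbinomial_prod_rev lessThan_atLeast0)
qed

context toric
begin

lemma prod_chi_C:
  assumes "\<And>m. m < N \<Longrightarrow> \<sigma> m \<noteq> 0" "m < N"
  shows "(\<Prod>i\<in>UNIV. chi N \<alpha> \<sigma> $ i powi C m i) = \<sigma> m"
proof -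
  have "(\<Prod>i\<in>UNIV. chi N \<alpha> \<sigma> $ i powi C m i) = (\<Prod>l<N. \<sigma> l powi (\<Sum>i\<in>UNIV. C m i * \<alpha> i l))"
    by (rule prod_chi) (rule assms(1))
  also have "\<dots> = (\<Prod>l<N. if l = m then \<sigma> l else 1)"
    by (rule prod.cong) (use assms(2) in \<open>auto simp: C\<close>)
  finally show ?thesis using assms(2) by simp
qed

lemma chi_component: "chi N \<alpha> \<sigma> $ i = \<sigma> 0 * (\<Prod>j<N - 1. \<sigma> (Suc j) powi pt i j)"
  by (simp add: chi_def prod_split_0 alpha_0 pt_def)

text \<open>The forms \<open>D j\<close> are local parameters at \<open>y\<close>. After clearing
  denominators the linear form is a combination of products of the \<open>D j\<close>. The
  coefficient of a product of total degree at most k is, up to a constant, the pairing of (h_i y_i)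
  with a polynomial of that degree in the exponents, so it vanishes on the kernel.\<close>

lemma kerK_imp_jet_kernel:
  fixes y :: "'k::field_char_0^'i"
  assumes y: "y \<in> T" and ker: "(\<chi> i. h $ i * y $ i) \<in> kerK k"
  shows "h \<in> jet_kernel k X y"
proof -
  obtain \<tau> where \<tau>: "y = chi N \<alpha> \<tau>" "\<And>m. m < N \<Longrightarrow> \<tau> m \<noteq> 0" using y unfolding tcone_def by blast
  define n where "n = N - 1"
  define B where "B = wt_bound"
  \<comment> \<open>Shifting the exponents by \<open>B\<close> makes them natural numbers between 0
    and \<open>2 * B\<close>.\<close>
  define E where "E = 2 * B"
  define a where "a i j = nat (pt i j + int B)" for i j
  have a: "int (a i j) = pt i j + int B" "a i j \<le> E" if "j < n" for i j
  proof -
    have "\<bar>pt i j\<bar> \<le> int B" using alpha_bound[of "Suc j" i] that by (simp add: pt_def B_def n_def)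
    then show "int (a i j) = pt i j + int B" "a i j \<le> E" unfolding a_def E_def by linarith+
  qed
  define P :: "nat \<Rightarrow> ('k, 'i) mpoly" where "P j = mon (pos_mono (C (Suc j)))" for j
  define Q :: "nat \<Rightarrow> ('k, 'i) mpoly" where "Q j = mon (neg_mono (C (Suc j)))" for j
  define D where "D j = P j - cpoly (\<tau> (Suc j)) * Q j" for j
  \<comment> \<open>The monomial with this exponent restricts to the parameter 0 times the power -B
    of every other parameter, so it undoes the shift and restores degree one.\<close>
  define cs where "cs i = C 0 i - int B * (\<Sum>j<n. C (Suc j) i)" for i
  define g where "g = mon (neg_mono cs) * (\<Prod>j<n. Q j ^ E)"
  define q where "q = mon (pos_mono cs) * (\<Sum>i\<in>UNIV. cpoly (h $ i) * (\<Prod>j<n. P j ^ a i j * Q j ^ (E - a i j)))"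
  have PQ: "mpoly_eval (P j) (chi N \<alpha> \<sigma>) = \<sigma> (Suc j) * mpoly_eval (Q j) (chi N \<alpha> \<sigma>)"
    if "\<And>m. m < N \<Longrightarrow> \<sigma> m \<noteq> 0" "j < n" for \<sigma> j
    using that prod_chi_C[of \<sigma> "Suc j"] meval_pos_neg[of "chi N \<alpha> \<sigma>" "C (Suc j)"] chi_nonzero[of N \<sigma> \<alpha>]
    by (simp add: P_def Q_def n_def mult.commute)
  have star: "meval (pos_mono cs) (chi N \<alpha> \<sigma>) =
      meval (neg_mono cs) (chi N \<alpha> \<sigma>) * (\<sigma> 0 * (\<Prod>j<n. \<sigma> (Suc j) powi (- int B)))"
    if nz: "\<And>m. m < N \<Longrightarrow> \<sigma> m \<noteq> 0" for \<sigma> :: "nat \<Rightarrow> 'k"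
  proof -
    have cs: "(\<Sum>i\<in>UNIV. cs i * \<alpha> i l) = (if l = 0 then 1 else - int B)" if "l < N" for l
    proof -
      have "(\<Sum>i\<in>UNIV. cs i * \<alpha> i l) =
          (\<Sum>i\<in>UNIV. C 0 i * \<alpha> i l) - int B * (\<Sum>j<n. \<Sum>i\<in>UNIV. C (Suc j) i * \<alpha> i l)"
        unfolding cs_def by (simp add: left_diff_distrib sum_subtractf sum_distrib_left sum_distrib_right mult.assoc)
          (rule sum.swap)
      also have "(\<Sum>j<n. \<Sum>i\<in>UNIV. C (Suc j) i * \<alpha> i l) = (\<Sum>j<n. if l = Suc j then 1 else 0)"
        by (rule sum.cong) (auto simp: C n_def)
      also have "\<dots> = (if l = 0 then 0 else 1)"
        using that by (cases l) (auto simp: n_def)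
      finally show ?thesis using N_pos by (simp add: C)
    qed
    have "(\<Prod>i\<in>UNIV. chi N \<alpha> \<sigma> $ i powi cs i) = (\<Prod>l<N. \<sigma> l powi (\<Sum>i\<in>UNIV. cs i * \<alpha> i l))"
      by (rule prod_chi) (rule nz)
    also have "\<dots> = (\<Prod>l<N. \<sigma> l powi (if l = 0 then 1 else - int B))"
      by (rule prod.cong) (auto simp: cs)
    also have "\<dots> = \<sigma> 0 * (\<Prod>j<n. \<sigma> (Suc j) powi (- int B))"
      by (simp add: prod_split_0 n_def)
    finally show ?thesis using meval_pos_neg[of "chi N \<alpha> \<sigma>" cs] chi_nonzero[of N \<sigma> \<alpha>] nz by simp
  qed
  have eval_eq: "mpoly_eval (g * linear_form h) z = mpoly_eval q z" if z: "z \<in> T" for z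
  proof -
    obtain \<sigma> where \<sigma>: "z = chi N \<alpha> \<sigma>" "\<And>m. m < N \<Longrightarrow> \<sigma> m \<noteq> 0" using z unfolding tcone_def by blast
    have "meval (neg_mono cs) z * (\<Prod>j<n. mpoly_eval (Q j) z ^ E) * z $ i =
        meval (pos_mono cs) z * (\<Prod>j<n. mpoly_eval (P j) z ^ a i j * mpoly_eval (Q j) z ^ (E - a i j))" for i
    proof -
      have "(\<Prod>j<n. mpoly_eval (P j) z ^ a i j * mpoly_eval (Q j) z ^ (E - a i j)) =
          (\<Prod>j<n. \<sigma> (Suc j) ^ a i j * mpoly_eval (Q j) z ^ E)"
      proof (rule prod.cong)
        fix j assume "j \<in> {..<n}"
        then have j: "j < n" by simp
        have "E = a i j + (E - a i j)" using a(2)[OF j, of i] by simp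
        then have "mpoly_eval (Q j) z ^ E = mpoly_eval (Q j) z ^ a i j * mpoly_eval (Q j) z ^ (E - a i j)"
          by (metis power_add)
        then show "mpoly_eval (P j) z ^ a i j * mpoly_eval (Q j) z ^ (E - a i j) =
            \<sigma> (Suc j) ^ a i j * mpoly_eval (Q j) z ^ E"
          unfolding \<sigma>(1) using PQ[OF \<sigma>(2) j] by (simp add: power_mult_distrib)
      qed simp
      moreover have "meval (pos_mono cs) z =
          meval (neg_mono cs) z * (\<sigma> 0 * (\<Prod>j<n. \<sigma> (Suc j) powi (- int B)))"
        unfolding \<sigma>(1) by (rule star) (rule \<sigma>(2))
      ultimately have "meval (pos_mono cs) z * (\<Prod>j<n. mpoly_eval (P j) z ^ a i j * mpoly_eval (Q j) z ^ (E - a i j)) =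
          meval (neg_mono cs) z * (\<Prod>j<n. mpoly_eval (Q j) z ^ E) *
            (\<sigma> 0 * (\<Prod>j<n. \<sigma> (Suc j) powi (- int B) * \<sigma> (Suc j) ^ a i j))"
        by (simp only: prod.distrib mult_ac)
      also have "(\<Prod>j<n. \<sigma> (Suc j) powi (- int B) * \<sigma> (Suc j) ^ a i j) = (\<Prod>j<n. \<sigma> (Suc j) powi pt i j)"
      proof (rule prod.cong)
        fix j assume "j \<in> {..<n}"
        then have j: "j < n" by simp
        then have nz: "\<sigma> (Suc j) \<noteq> 0" using \<sigma>(2)[of "Suc j"] by (simp add: n_def)
        have "\<sigma> (Suc j) ^ a i j = \<sigma> (Suc j) powi (pt i j + int B)"
          by (metis a(1)[OF j] power_int_of_nat)
        then show "\<sigma> (Suc j) powi (- int B) * \<sigma> (Suc j) ^ a i j = \<sigma> (Suc j) powi pt i j"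
          using nz by (simp add: power_int_add[symmetric])
      qed simp
      also have "\<sigma> 0 * (\<Prod>j<n. \<sigma> (Suc j) powi pt i j) = z $ i"
        by (simp add: \<sigma>(1) chi_component n_def)
      finally show ?thesis by simp
    qed
    then have *: "h $ i * (meval (neg_mono cs) z * (\<Prod>j<n. mpoly_eval (Q j) z ^ E) * z $ i) =
        h $ i * (meval (pos_mono cs) z * (\<Prod>j<n. mpoly_eval (P j) z ^ a i j * mpoly_eval (Q j) z ^ (E - a i j)))" for i
      by simp
    have "mpoly_eval (g * linear_form h) z =
        (\<Sum>i\<in>UNIV. h $ i * (meval (neg_mono cs) z * (\<Prod>j<n. mpoly_eval (Q j) z ^ E) * z $ i))"
      by (simp add: g_def sum_distrib_left sum_distrib_right mult_ac)
    also have "\<dots> = mpoly_eval q z"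
      unfolding * by (simp add: q_def sum_distrib_left mult_ac)
    finally show ?thesis .
  qed
  have "q \<in> ideal_power (vanishing_ideal (proj_point y)) (k + 1)"
  proof -
    let ?\<Phi> = "(\<Pi>\<^sub>E j\<in>{..<n}. {..E})"
    \<comment> \<open>The coefficient of the product of the \<open>D j ^ \<phi> j\<close>.\<close>
    define K where "K \<phi> = (\<Sum>i\<in>UNIV. h $ i * (\<Prod>j<n. of_nat (a i j choose \<phi> j) * \<tau> (Suc j) ^ (a i j - \<phi> j)))" for \<phi>
    have "(\<Prod>j<n. P j ^ a i j * Q j ^ (E - a i j)) =
        (\<Sum>\<phi>\<in>?\<Phi>. cpoly (\<Prod>j<n. of_nat (a i j choose \<phi> j) * \<tau> (Suc j) ^ (a i j - \<phi> j)) *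
          ((\<Prod>j<n. D j ^ \<phi> j) * (\<Prod>j<n. Q j ^ (E - \<phi> j))))" for i
    proof -
      have "(\<Prod>j<n. P j ^ a i j * Q j ^ (E - a i j)) =
          (\<Prod>j<n. \<Sum>b\<le>E. cpoly (of_nat (a i j choose b) * \<tau> (Suc j) ^ (a i j - b)) * (D j ^ b * Q j ^ (E - b)))"
      proof (rule prod.cong)
        fix j assume "j \<in> {..<n}"
        then have "a i j \<le> E" using a(2) by simp
        moreover have "P j = D j + cpoly (\<tau> (Suc j)) * Q j" by (simp add: D_def)
        ultimately show "P j ^ a i j * Q j ^ (E - a i j) =
            (\<Sum>b\<le>E. cpoly (of_nat (a i j choose b) * \<tau> (Suc j) ^ (a i j - b)) * (D j ^ b * Q j ^ (E - b)))"
          using shifted_binomial[of "a i j" E "D j" "\<tau> (Suc j)" "Q j"] by simp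
      qed simp
      also have "\<dots> = (\<Sum>\<phi>\<in>?\<Phi>. \<Prod>j<n. cpoly (of_nat (a i j choose \<phi> j) * \<tau> (Suc j) ^ (a i j - \<phi> j)) *
          (D j ^ \<phi> j * Q j ^ (E - \<phi> j)))"
        by (rule prod_sum_PiE) auto
      also have "\<dots> = (\<Sum>\<phi>\<in>?\<Phi>. (\<Prod>j<n. cpoly (of_nat (a i j choose \<phi> j) * \<tau> (Suc j) ^ (a i j - \<phi> j))) *
          ((\<Prod>j<n. D j ^ \<phi> j) * (\<Prod>j<n. Q j ^ (E - \<phi> j))))"
        by (simp only: prod.distrib)
      finally show ?thesis by (simp only: cpoly_prod)
    qed
    then have "q = mon (pos_mono cs) * (\<Sum>i\<in>UNIV. \<Sum>\<phi>\<in>?\<Phi>.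
        cpoly (h $ i * (\<Prod>j<n. of_nat (a i j choose \<phi> j) * \<tau> (Suc j) ^ (a i j - \<phi> j))) *
          ((\<Prod>j<n. D j ^ \<phi> j) * (\<Prod>j<n. Q j ^ (E - \<phi> j))))"
      unfolding q_def by (simp add: sum_distrib_left cpoly_mult mult.assoc)
    also have "\<dots> = mon (pos_mono cs) * (\<Sum>\<phi>\<in>?\<Phi>. cpoly (K \<phi>) *
        ((\<Prod>j<n. D j ^ \<phi> j) * (\<Prod>j<n. Q j ^ (E - \<phi> j))))"
      unfolding K_def cpoly_sum sum_distrib_right by (subst sum.swap) (rule refl)
    finally have q: "q = mon (pos_mono cs) * (\<Sum>\<phi>\<in>?\<Phi>. cpoly (K \<phi>) *
        ((\<Prod>j<n. D j ^ \<phi> j) * (\<Prod>j<n. Q j ^ (E - \<phi> j))))" .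
    have K0: "K \<phi> = 0" if small: "(\<Sum>j<n. \<phi> j) \<le> k" for \<phi>
    proof -
      \<comment> \<open>Collects the powers of the parameters that do not depend on
        \<open>i\<close>; what remains is h_i y_i times a polynomial in the exponents of degree at
        most the sum of the \<open>\<phi> j\<close>.\<close>
      define cst where "cst = (\<Prod>j<n. \<tau> (Suc j) powi (int B - int (\<phi> j))) / \<tau> 0"
      have term_eq: "h $ i * (\<Prod>j<n. of_nat (a i j choose \<phi> j) * \<tau> (Suc j) ^ (a i j - \<phi> j)) =
          cst * ((h $ i * y $ i) * (\<Prod>j<n. poly (binomial_poly B (\<phi> j)) (of_int (pt i j))))" for i
      proof -
        have "(\<Prod>j<n. of_nat (a i j choose \<phi> j) * \<tau> (Suc j) ^ (a i j - \<phi> j)) =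
            (\<Prod>j<n. \<tau> (Suc j) powi (int B - int (\<phi> j)) * \<tau> (Suc j) powi pt i j *
              poly (binomial_poly B (\<phi> j)) (of_int (pt i j)))"
        proof (rule prod.cong)
          fix j assume "j \<in> {..<n}"
          then have j: "j < n" by simp
          have nz: "\<tau> (Suc j) \<noteq> 0" using \<tau>(2)[of "Suc j"] j by (simp add: n_def)
          have "of_int (pt i j) + of_nat B = (of_nat (a i j) :: 'k)"
            using a(1)[OF j, of i] by (metis of_int_add of_int_of_nat_eq)
          then have bp: "poly (binomial_poly B (\<phi> j)) (of_int (pt i j)) = (of_nat (a i j choose \<phi> j) :: 'k)"
            by (rule poly_binomial_poly)
          show "of_nat (a i j choose \<phi> j) * \<tau> (Suc j) ^ (a i j - \<phi> j) =
              \<tau> (Suc j) powi (int B - int (\<phi> j)) * \<tau> (Suc j) powi pt i j *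
              poly (binomial_poly B (\<phi> j)) (of_int (pt i j))"
          proof (cases "\<phi> j \<le> a i j")
            case True
            then have "int (a i j - \<phi> j) = (int B - int (\<phi> j)) + pt i j" using a(1)[OF j, of i] by simp
            then have "\<tau> (Suc j) ^ (a i j - \<phi> j) = \<tau> (Suc j) powi ((int B - int (\<phi> j)) + pt i j)"
              by (metis power_int_of_nat)
            then show ?thesis using nz by (simp add: bp power_int_add)
          next
            case False
            then show ?thesis by (simp add: bp binomial_eq_0)
          qed
        qed simp
        moreover have "y $ i = \<tau> 0 * (\<Prod>j<n. \<tau> (Suc j) powi pt i j)"
          by (simp add: \<tau>(1) chi_component n_def)
        moreover have "\<tau> 0 \<noteq> 0" using \<tau>(2) N_pos by simp
        ultimately show ?thesis by (simp add: cst_def prod.distrib)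
      qed
      have "K \<phi> = cst * (\<Sum>i\<in>UNIV. (h $ i * y $ i) * (\<Prod>j<n. poly (binomial_poly B (\<phi> j)) (of_int (pt i j))))"
        unfolding K_def term_eq sum_distrib_left ..
      also have "(\<Sum>i\<in>UNIV. (h $ i * y $ i) * (\<Prod>j<n. poly (binomial_poly B (\<phi> j)) (of_int (pt i j)))) = 0"
      proof (rule killed_polynomials)
        show "(\<Sum>j<n. degree (binomial_poly B (\<phi> j) :: 'k poly)) \<le> k"
          using small by (rule order_trans[OF sum_mono[OF degree_binomial_poly]])
        fix \<beta> assume "\<beta> \<in> exponents n k"
        then have "(\<Sum>i\<in>UNIV. of_int (row_Ak (N - 1) pt \<beta> i) * (\<chi> i. h $ i * y $ i) $ i) = 0"
          using ker unfolding kerK_def n_def by blast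
        then show "(\<Sum>i\<in>UNIV. h $ i * y $ i * (\<Prod>j<n. of_int (pt i j) ^ \<beta> j)) = 0"
          by (simp add: row_Ak_def n_def mult_ac)
      qed
      finally show ?thesis by simp
    qed
    have D0: "D j \<in> vanishing_ideal (proj_point y)" if j: "j < n" for j
    proof -
      have "(\<Sum>i\<in>UNIV. C (Suc j) i * \<alpha> i 0) = 0" using C[of "Suc j" 0] j by (simp add: n_def)
      then have "mdeg (pos_mono (C (Suc j))) = mdeg (neg_mono (C (Suc j)))"
        using mdeg_pos_neg[of "C (Suc j)"] by (simp add: alpha_0)
      then have "hdeg (mdeg (pos_mono (C (Suc j)))) (D j)"
        unfolding D_def P_def Q_def by (metis hdeg_minus hdeg_cmult hdeg_mon)
      moreover have "mpoly_eval (D j) y = 0"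
        unfolding D_def \<tau>(1) using PQ[OF \<tau>(2) j] by simp
      ultimately show ?thesis by (auto simp: vanishing_ideal_def proj_point_def eval_scale)
    qed
    have "cpoly (K \<phi>) * ((\<Prod>j<n. D j ^ \<phi> j) * (\<Prod>j<n. Q j ^ (E - \<phi> j))) \<in>
        ideal_power (vanishing_ideal (proj_point y)) (k + 1)" for \<phi>
    proof (cases "(\<Sum>j<n. \<phi> j) \<le> k")
      case True
      then show ?thesis using K0 by (simp add: cpoly_0 ideal_power_zero)
    next
      case False
      have "(\<Prod>j<n. D j ^ \<phi> j) \<in> ideal_power (vanishing_ideal (proj_point y)) (\<Sum>j<n. \<phi> j)"
        using D0 by (intro ideal_power_prod) simp
      then have "(\<Prod>j<n. D j ^ \<phi> j) \<in> ideal_power (vanishing_ideal (proj_point y)) (k + 1)"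
        using False by (intro subsetD[OF ideal_power_le[of "k + 1" "\<Sum>j<n. \<phi> j"]]) simp
      then have "cpoly (K \<phi>) * ((\<Prod>j<n. Q j ^ (E - \<phi> j)) * (\<Prod>j<n. D j ^ \<phi> j)) \<in>
          ideal_power (vanishing_ideal (proj_point y)) (k + 1)"
        by (intro ideal_power_lmult)
      then show ?thesis by (simp only: mult.commute)
    qed
    then show ?thesis unfolding q by (intro ideal_power_lmult[OF ideal_power_sum])
  qed
  moreover have "g * linear_form h - q \<in> vanishing_ideal X"
    using eval_eq by (simp add: vanishing_ideal_X)
  moreover have "homogeneous g"
  proof -
    have "hdeg (mdeg (neg_mono cs) + (\<Sum>j<n. E * mdeg (neg_mono (C (Suc j))))) g"
      unfolding g_def Q_def by (intro hdeg_mult hdeg_mon hdeg_prod hdeg_power)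
    then show ?thesis using homogeneous_iff by blast
  qed
  moreover have "mpoly_eval g y \<noteq> 0"
    using tcone_nonzero[OF y] by (simp add: g_def Q_def meval_nonzero)
  moreover have "g * linear_form h = q + (g * linear_form h - q)" by simp
  ultimately show ?thesis unfolding jet_kernel_def vanishes_to_order_def by blast
qed

lemma jet_kernel_T:
  fixes y :: "'k::field_char_0^'i"
  assumes y: "y \<in> T"
  shows "jet_kernel k X y = {h. (\<chi> i. h $ i * y $ i) \<in> kerK k}"
  using kerK_imp_jet_kernel[OF y] ordc_linear_form jet_kernel_imp_ordc[OF _ y] by blast

end

section \<open>Jet kernels as linear spaces and osculating spaces as their annihilators\<close>

lemma linear_form_add: "linear_form (h + h') = linear_form h + linear_form h'"
  by (simp add: linear_form_def single_add sum.distrib)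

lemma linear_form_scale: "linear_form (c *s h) = cpoly c * linear_form h"
  by (simp add: linear_form_def cpoly_def sum_distrib_left mult_single)

lemma linear_form_0: "linear_form 0 = 0"
  by (simp add: linear_form_def)

lemma vanishing_ideal_lmult: "s \<in> vanishing_ideal S \<Longrightarrow> r * s \<in> vanishing_ideal S"
  by (simp add: vanishing_ideal_def)

lemma subspace_jet_kernel: "vec.subspace (jet_kernel k Y x)"
  for x :: "'k::field^'i::finite"
  unfolding vec.subspace_def
proof (intro conjI ballI allI)
  let ?I = "ideal_power (vanishing_ideal (proj_point x)) (k + 1)"
  have "homogeneous (1 :: ('k, 'i) mpoly)" using hdeg_one homogeneous_iff by blast
  moreover have "(0 :: ('k, 'i) mpoly) \<in> vanishing_ideal Y" by (simp add: vanishing_ideal_def)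
  moreover have "1 * linear_form 0 = (0 :: ('k, 'i) mpoly) + 0" by (simp add: linear_form_0)
  ultimately show "0 \<in> jet_kernel k Y x"
    unfolding jet_kernel_def vanishes_to_order_def mem_Collect_eq
    using ideal_power_zero by (intro exI[of _ 1] conjI bexI[of _ 0]) auto
  fix h assume "h \<in> jet_kernel k Y x"
  then obtain g q s where h: "homogeneous g" "mpoly_eval g x \<noteq> 0" "q \<in> ?I" "s \<in> vanishing_ideal Y"
    "g * linear_form h = q + s"
    by (auto simp: jet_kernel_def vanishes_to_order_def)
  { fix c
    have "g * linear_form (c *s h) = cpoly c * (g * linear_form h)"
      by (simp add: linear_form_scale mult_ac)
    then have "g * linear_form (c *s h) = cpoly c * q + cpoly c * s" by (simp only: h(5) distrib_left)
    then show "c *s h \<in> jet_kernel k Y x"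
      unfolding jet_kernel_def vanishes_to_order_def mem_Collect_eq
      using h ideal_power_lmult vanishing_ideal_lmult by (intro exI[of _ g] conjI bexI) }
  fix h' assume "h' \<in> jet_kernel k Y x"
  then obtain g' q' s' where h': "homogeneous g'" "mpoly_eval g' x \<noteq> 0" "q' \<in> ?I" "s' \<in> vanishing_ideal Y"
    "g' * linear_form h' = q' + s'"
    by (auto simp: jet_kernel_def vanishes_to_order_def)
  have "g * g' * linear_form (h + h') = g' * (g * linear_form h) + g * (g' * linear_form h')"
    by (simp add: linear_form_add algebra_simps)
  also have "\<dots> = (g' * q + g * q') + (g' * s + g * s')" unfolding h(5) h'(5) by (simp add: algebra_simps)
  finally have "g * g' * linear_form (h + h') = (g' * q + g * q') + (g' * s + g * s')" .
  moreover have "g' * q + g * q' \<in> ?I" using h(3) h'(3) by (intro ideal_power_add ideal_power_lmult)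
  moreover have "g' * s + g * s' \<in> vanishing_ideal Y" using h(4) h'(4) by (simp add: vanishing_ideal_def)
  moreover have "homogeneous (g * g')" using h(1) h'(1) hdeg_mult unfolding homogeneous_iff by blast
  moreover have "mpoly_eval (g * g') x \<noteq> 0" using h(2) h'(2) by simp
  ultimately show "h + h' \<in> jet_kernel k Y x"
    unfolding jet_kernel_def vanishes_to_order_def mem_Collect_eq by (intro exI[of _ "g * g'"] conjI bexI)
qed

lemma double_annihilator:
  fixes h :: "'k::field^'i::finite"
  assumes V: "vec.subspace V"
    and h: "\<And>y. (\<And>v. v \<in> V \<Longrightarrow> (\<Sum>i\<in>UNIV. v $ i * y $ i) = 0) \<Longrightarrow> (\<Sum>i\<in>UNIV. h $ i * y $ i) = 0"
  shows "h \<in> V"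
proof -
  obtain B where B: "B \<subseteq> V" "vec.independent B" "V \<subseteq> vec.span B" by (rule vec.basis_exists[of V]) auto
  have fin: "finite B" using B(2) by (rule vec.finiteI_independent)
  from in_span_or_separated[OF fin finite, of UNIV vec_nth "vec_nth h"] show ?thesis
  proof
    assume "in_span B UNIV vec_nth (vec_nth h)"
    then obtain \<kappa> where "\<forall>i. h $ i = (\<Sum>b\<in>B. \<kappa> b * b $ i)" unfolding in_span_def by auto
    then have "h = (\<Sum>b\<in>B. \<kappa> b *s b)" by (simp add: vec_eq_iff)
    moreover have "(\<Sum>b\<in>B. \<kappa> b *s b) \<in> V"
      using B(1) by (intro vec.subspace_sum[OF V] vec.subspace_scale[OF V]) auto
    ultimately show ?thesis by simp
  next
    assume "\<exists>\<xi>. (\<forall>b\<in>B. pair UNIV \<xi> (vec_nth b) = 0) \<and> pair UNIV \<xi> (vec_nth h) = 1"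
    then obtain \<xi> where \<xi>: "\<And>b. b \<in> B \<Longrightarrow> pair UNIV \<xi> (vec_nth b) = 0" "pair UNIV \<xi> (vec_nth h) = 1" by blast
    have sub: "vec.subspace {v. pair UNIV \<xi> (vec_nth v) = 0}"
      unfolding vec.subspace_def pair_def
      by (auto simp: distrib_left sum.distrib mult.left_commute[of _ "_::'k"] sum_distrib_left[symmetric])
    have "vec.span B \<subseteq> {v. pair UNIV \<xi> (vec_nth v) = 0}"
      using \<xi>(1) by (intro vec.span_minimal sub) auto
    then have "pair UNIV \<xi> (vec_nth v) = 0" if "v \<in> V" for v using that B(3) by blast
    then have "(\<Sum>i\<in>UNIV. h $ i * (\<chi> i. \<xi> i) $ i) = 0"
      by (intro h) (simp add: pair_def mult.commute)
    then show ?thesis using \<xi>(2) by (simp add: pair_def mult.commute)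
  qed
qed

text \<open>The jet kernel is a linear subspace, hence equal to its double annihilator.\<close>

lemma osculating_subset_hyperplane:
  "osculating_space k Y x \<subseteq> hyperplane h \<longleftrightarrow> h \<in> jet_kernel k Y x"
  for x :: "'k::field^'i::finite"
proof
  assume sub: "osculating_space k Y x \<subseteq> hyperplane h"
  show "h \<in> jet_kernel k Y x"
  proof (rule double_annihilator[OF subspace_jet_kernel])
    fix y assume "\<And>v. v \<in> jet_kernel k Y x \<Longrightarrow> (\<Sum>i\<in>UNIV. v $ i * y $ i) = 0"
    then have "y \<noteq> 0 \<Longrightarrow> y \<in> osculating_space k Y x" by (simp add: osculating_space_def)
    then show "(\<Sum>i\<in>UNIV. h $ i * y $ i) = 0"
      using sub by (cases "y = 0") (auto simp: hyperplane_def)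
  qed
next
  assume "h \<in> jet_kernel k Y x"
  then show "osculating_space k Y x \<subseteq> hyperplane h"
    by (auto simp: osculating_space_def hyperplane_def)
qed

lemma vec_dim_scaling:
  fixes y :: "'k::field^'i::finite"
  assumes y: "\<And>i. y $ i \<noteq> 0"
  shows "vec.dim {h. (\<chi> i. h $ i * y $ i) \<in> V} = vec.dim V"
proof -
  let ?f = "\<lambda>v. (\<chi> i. v $ i / y $ i) :: 'k^'i"
  have eq: "{h. (\<chi> i. h $ i * y $ i) \<in> V} = ?f ` V"
  proof (intro set_eqI iffI)
    fix h assume "h \<in> {h. (\<chi> i. h $ i * y $ i) \<in> V}"
    moreover have "h = ?f (\<chi> i. h $ i * y $ i)" using y by (simp add: vec_eq_iff)
    ultimately show "h \<in> ?f ` V" by blast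
  next
    fix h assume "h \<in> ?f ` V"
    then show "h \<in> {h. (\<chi> i. h $ i * y $ i) \<in> V}" using y by auto
  qed
  have "Vector_Spaces.linear (*s) (*s) ?f"
    by unfold_locales (auto simp: vec_eq_iff add_divide_distrib)
  moreover have "inj_on ?f (vec.span V)" using y by (auto simp: inj_on_def vec_eq_iff)
  ultimately show ?thesis unfolding eq by (rule vec.dim_image_eq)
qed

section \<open>The locus of constant jet rank\<close>

context toric
begin

lemma dim_jet_kernel_T:
  fixes y :: "'k::field_char_0^'i"
  assumes y: "y \<in> T"
  shows "vec.dim (jet_kernel k X y) = vec.dim (kerK k :: ('k^'i) set)"
  unfolding jet_kernel_T[OF y] by (rule vec_dim_scaling[OF tcone_nonzero[OF y]])

text \<open>Off the coordinate hyperplanes every point of X lies in T, and there coordinatewise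
  multiplication by the point identifies the jet kernel with the same space
  \<open>kerK k\<close>.\<close>

lemma T_subset_k_cst: "(T :: ('k::field_char_0^'i) set) \<subseteq> k_cst k X"
proof
  fix x :: "'k^'i" assume x: "x \<in> T"
  define p :: "('k, 'i) mpoly" where "p = (\<Prod>i\<in>UNIV. vpoly i)"
  have "hdeg (\<Sum>i\<in>(UNIV :: 'i set). 1) p" unfolding p_def by (rule hdeg_prod) (rule hdeg_vpoly)
  then have "homogeneous p" using homogeneous_iff by blast
  then have closed: "zariski_closed {y. y \<noteq> 0 \<and> mpoly_eval p y = 0}" by (rule zariski_closed_hyper)
  have "jet_rank k X y = jet_rank k X x"
    if "smooth_point X y" "y \<notin> {y. y \<noteq> 0 \<and> mpoly_eval p y = 0}" for y
  proof -
    have yX: "y \<in> X" using that(1) by (simp add: smooth_point_def)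
    then have "y \<noteq> 0" using zariski_closed_nonzero[OF zariski_closed_closure[OF zero_notin_T]] by auto
    then have "\<And>i. y $ i \<noteq> 0" using that(2) by (auto simp: p_def)
    then have "y \<in> T" by (rule X_nonzero_in_T[OF yX])
    then show ?thesis by (simp add: jet_rank_def dim_jet_kernel_T x)
  qed
  moreover have "x \<notin> {y. y \<noteq> 0 \<and> mpoly_eval p y = 0}" using tcone_nonzero[OF x] by (simp add: p_def)
  ultimately show "x \<in> k_cst k X" unfolding k_cst_def using smooth_T[OF x] closed by blast
qed

text \<open>T is dense, so it meets the neighbourhood on which the rank agrees with that at
  \<open>x\<close>. Dimensions are at most \<open>CARD('i)\<close>, so the truncated subtraction in
  \<open>jet_rank\<close> can be undone.\<close>

lemma dim_jet_kernel_k_cst: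
  fixes x :: "'k::field_char_0^'i"
  assumes x: "x \<in> k_cst k X"
  shows "vec.dim (jet_kernel k X x) = vec.dim (kerK k :: ('k^'i) set)"
proof -
  obtain Z where Z: "smooth_point X x" "zariski_closed Z" "x \<notin> Z"
    "\<And>y. smooth_point X y \<Longrightarrow> y \<notin> Z \<Longrightarrow> jet_rank k X y = jet_rank k X x"
    using x unfolding k_cst_def by blast
  have "x \<in> X" using Z(1) by (simp add: smooth_point_def)
  then have "\<not> T \<subseteq> Z" using zariski_closure_minimal[OF Z(2)] Z(3) by blast
  then obtain y where y: "y \<in> T" "y \<notin> Z" by blast
  then have "jet_rank k X y = jet_rank k X x" using Z(4) smooth_T by blast
  moreover have "vec.dim V \<le> CARD('i)" for V :: "('k^'i) set"
    by (metis vec.dim_subset subset_UNIV vec_dim_card)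
  ultimately have "vec.dim (jet_kernel k X x) = vec.dim (jet_kernel k X y)"
    unfolding jet_rank_def by (metis diff_diff_cancel)
  then show ?thesis using dim_jet_kernel_T[OF y(1)] by simp
qed

end

section \<open>Local structure at a smooth point\<close>

text \<open>Functions on \<open>T\<close> spanned by the degree \<open>d\<close> products of \<open>z\<^sub>e\<close> and functions \<open>D j\<close>, with the number
  of factors \<open>D j\<close> in \<open>M\<close>.\<close>

definition gx :: "'j set \<Rightarrow> nat set \<Rightarrow> nat \<Rightarrow> ('j \<Rightarrow> nat) set" where
  "gx J M d = {\<gamma>. (\<forall>j. j \<notin> J \<longrightarrow> \<gamma> j = 0) \<and> (\<Sum>j\<in>J. \<gamma> j) \<in> M \<and> (\<Sum>j\<in>J. \<gamma> j) \<le> d}"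

definition gm :: "'i::finite \<Rightarrow> 'j set \<Rightarrow> ('j \<Rightarrow> 'k::field^'i \<Rightarrow> 'k) \<Rightarrow> nat \<Rightarrow> ('j \<Rightarrow> nat) \<Rightarrow> 'k^'i \<Rightarrow> 'k" where
  "gm e J D d \<gamma> z = z $ e ^ (d - (\<Sum>j\<in>J. \<gamma> j)) * (\<Prod>j\<in>J. D j z ^ \<gamma> j)"

definition gspan :: "('k::field^'i::finite) set \<Rightarrow> 'i \<Rightarrow> 'j set \<Rightarrow> ('j \<Rightarrow> 'k^'i \<Rightarrow> 'k) \<Rightarrow> nat set \<Rightarrow> nat
    \<Rightarrow> ('k^'i \<Rightarrow> 'k) \<Rightarrow> bool" where
  "gspan T e J D M d f \<longleftrightarrow> in_span (gx J M d) T (gm e J D d) f"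

lemma finite_gx:
  assumes "finite J" shows "finite (gx J M d)"
proof (rule finite_subset)
  show "gx J M d \<subseteq> {f. \<forall>x. (x \<in> J \<longrightarrow> f x \<in> {..d}) \<and> (x \<notin> J \<longrightarrow> f x = 0)}"
  proof
    fix \<gamma> assume \<gamma>: "\<gamma> \<in> gx J M d"
    have "\<gamma> j \<le> d" if "j \<in> J" for j
    proof -
      have "\<gamma> j \<le> (\<Sum>j\<in>J. \<gamma> j)" by (rule member_le_sum) (use that assms in auto)
      also have "\<dots> \<le> d" using \<gamma> by (simp add: gx_def)
      finally show ?thesis .
    qed
    then show "\<gamma> \<in> {f. \<forall>x. (x \<in> J \<longrightarrow> f x \<in> {..d}) \<and> (x \<notin> J \<longrightarrow> f x = 0)}"
      using \<gamma> by (simp add: gx_def)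
  qed
  show "finite {f. \<forall>x. (x \<in> J \<longrightarrow> f x \<in> {..d}) \<and> (x \<notin> J \<longrightarrow> f x = 0)}"
    by (rule finite_set_of_finite_funs) (use assms in auto)
qed

lemma in_span_cong: "in_span J P v f \<Longrightarrow> (\<And>z. z \<in> P \<Longrightarrow> g z = f z) \<Longrightarrow> in_span J P v g"
  unfolding in_span_def by simp

lemma in_span_zero: "in_span J P v (\<lambda>_. 0)"
  unfolding in_span_def by (intro exI[of _ "\<lambda>_. 0"]) simp

lemma in_span_add:
  assumes "in_span J P v f" "in_span J P v g"
  shows "in_span J P v (\<lambda>z. f z + g z)"
proof -
  obtain \<kappa> \<mu> where "\<forall>z\<in>P. f z = (\<Sum>j\<in>J. \<kappa> j * v j z)" "\<forall>z\<in>P. g z = (\<Sum>j\<in>J. \<mu> j * v j z)"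
    using assms unfolding in_span_def by blast
  then show ?thesis unfolding in_span_def
    by (intro exI[of _ "\<lambda>j. \<kappa> j + \<mu> j"]) (simp add: distrib_right sum.distrib)
qed

lemma in_span_scale:
  assumes "in_span J P v f" shows "in_span J P v (\<lambda>z. c * f z)"
proof -
  obtain \<kappa> where "\<forall>z\<in>P. f z = (\<Sum>j\<in>J. \<kappa> j * v j z)"
    using assms unfolding in_span_def by blast
  then show ?thesis unfolding in_span_def
    by (intro exI[of _ "\<lambda>j. c * \<kappa> j"]) (simp add: sum_distrib_left mult.assoc)
qed

lemma in_span_sum:
  "(\<And>a. a \<in> A \<Longrightarrow> in_span J P v (f a)) \<Longrightarrow> in_span J P v (\<lambda>z. \<Sum>a\<in>A. f a z)"
  by (induction A rule: infinite_finite_induct) (auto intro: in_span_zero in_span_add)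

lemmas gspan_cong = in_span_cong[of "gx J M d" T "gm e J D d" for J M d T e D, folded gspan_def]
lemmas gspan_zero = in_span_zero[of "gx J M d" T "gm e J D d" for J M d T e D, folded gspan_def]
lemmas gspan_add = in_span_add[of "gx J M d" T "gm e J D d" for J M d T e D, folded gspan_def]
lemmas gspan_scale = in_span_scale[of "gx J M d" T "gm e J D d" for J M d T e D, folded gspan_def]
lemmas gspan_sum = in_span_sum[where J = "gx J M d" and P = T and v = "gm e J D d" for J M d T e D, folded gspan_def]

lemma gspan_base: "finite J \<Longrightarrow> \<gamma> \<in> gx J M d \<Longrightarrow> gspan T e J D M d (gm e J D d \<gamma>)"
  unfolding gspan_def by (rule in_span_self) (auto simp: finite_gx)

lemma gspan_mono: "gspan T e J D M d f \<Longrightarrow> M \<subseteq> M' \<Longrightarrow> finite J \<Longrightarrow> gspan T e J D M' d f"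
  unfolding gspan_def by (rule in_span_mono[OF _ _ finite_gx]) (auto simp: gx_def)

lemma gspanE:
  assumes "gspan T e J D M d f"
  obtains \<kappa> where "\<forall>z\<in>T. f z = (\<Sum>\<gamma>\<in>gx J M d. \<kappa> \<gamma> * gm e J D d \<gamma> z)"
  using assms unfolding gspan_def in_span_def by blast

lemma gm_mult:
  assumes "(\<Sum>j\<in>J. \<gamma> j) \<le> d" "(\<Sum>j\<in>J. \<gamma>' j) \<le> d'"
  shows "gm e J D d \<gamma> z * gm e J D d' \<gamma>' z = gm e J D (d + d') (\<lambda>j. \<gamma> j + \<gamma>' j) z"
proof -
  have "d + d' - (\<Sum>j\<in>J. \<gamma> j + \<gamma>' j) = (d - (\<Sum>j\<in>J. \<gamma> j)) + (d' - (\<Sum>j\<in>J. \<gamma>' j))"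
    using assms by (simp add: sum.distrib)
  then show ?thesis by (simp add: gm_def power_add prod.distrib mult_ac)
qed

lemma gspan_mult:
  assumes J: "finite J" and M: "\<And>a b. a \<in> M \<Longrightarrow> b \<in> M' \<Longrightarrow> a + b \<in> M''"
    and f: "gspan T e J D M d f" and g: "gspan T e J D M' d' g"
  shows "gspan T e J D M'' (d + d') (\<lambda>z. f z * g z)"
proof -
  obtain \<kappa> where \<kappa>: "\<forall>z\<in>T. f z = (\<Sum>\<gamma>\<in>gx J M d. \<kappa> \<gamma> * gm e J D d \<gamma> z)" using f by (rule gspanE)
  obtain \<mu> where \<mu>: "\<forall>z\<in>T. g z = (\<Sum>\<gamma>\<in>gx J M' d'. \<mu> \<gamma> * gm e J D d' \<gamma> z)" using g by (rule gspanE)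
  have "gspan T e J D M'' (d + d') (\<lambda>z. \<Sum>\<gamma>\<in>gx J M d. \<Sum>\<gamma>'\<in>gx J M' d'.
      (\<kappa> \<gamma> * \<mu> \<gamma>') * gm e J D (d + d') (\<lambda>j. \<gamma> j + \<gamma>' j) z)"
  proof (intro gspan_sum gspan_scale gspan_base J)
    fix \<gamma> \<gamma>' assume "\<gamma> \<in> gx J M d" "\<gamma>' \<in> gx J M' d'"
    then show "(\<lambda>j. \<gamma> j + \<gamma>' j) \<in> gx J M'' (d + d')"
      using M by (auto simp: gx_def sum.distrib)
  qed
  then show ?thesis
  proof (rule gspan_cong)
    fix z assume z: "z \<in> T"
    have term_eq: "(\<kappa> \<gamma> * \<mu> \<gamma>') * gm e J D (d + d') (\<lambda>j. \<gamma> j + \<gamma>' j) z =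
        (\<kappa> \<gamma> * gm e J D d \<gamma> z) * (\<mu> \<gamma>' * gm e J D d' \<gamma>' z)"
      if "\<gamma> \<in> gx J M d" "\<gamma>' \<in> gx J M' d'" for \<gamma> \<gamma>'
      using that by (subst gm_mult[symmetric]) (auto simp: gx_def mult_ac)
    show "f z * g z = (\<Sum>\<gamma>\<in>gx J M d. \<Sum>\<gamma>'\<in>gx J M' d'.
      (\<kappa> \<gamma> * \<mu> \<gamma>') * gm e J D (d + d') (\<lambda>j. \<gamma> j + \<gamma>' j) z)"
      using z by (simp only: \<kappa> \<mu> sum_product) (intro sum.cong refl, simp only: term_eq)
  qed
qed

lemma gspan_coord: "finite J \<Longrightarrow> 0 \<in> M \<Longrightarrow> gspan T e J D M 1 (\<lambda>z. z $ e)"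
proof (rule gspan_cong)
  show "finite J \<Longrightarrow> 0 \<in> M \<Longrightarrow> gspan T e J D M 1 (gm e J D 1 (\<lambda>_. 0))" by (rule gspan_base) (auto simp: gx_def)
qed (simp add: gm_def)

lemma gspan_D: "finite J \<Longrightarrow> 1 \<in> M \<Longrightarrow> j \<in> J \<Longrightarrow> gspan T e J D M 1 (D j)"
proof (rule gspan_cong)
  assume J: "finite J" "1 \<in> M" "j \<in> J"
  show "gspan T e J D M 1 (gm e J D 1 (\<lambda>l. if l = j then 1 else 0))"
    by (rule gspan_base) (use J in \<open>auto simp: gx_def\<close>)
  show "D j z = gm e J D 1 (\<lambda>l. if l = j then 1 else 0) z" for z
  proof -
    have "(\<Prod>l\<in>J. D l z ^ (if l = j then 1 else 0)) = (\<Prod>l\<in>J. if l = j then D j z else 1)"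
      by (rule prod.cong) auto
    then show ?thesis using J by (simp add: gm_def)
  qed
qed

lemma gspan_const: "finite J \<Longrightarrow> 0 \<in> M \<Longrightarrow> gspan T e J D M 0 (\<lambda>_. c)"
proof (rule gspan_cong)
  show "finite J \<Longrightarrow> 0 \<in> M \<Longrightarrow> gspan T e J D M 0 (\<lambda>z. c * gm e J D 0 (\<lambda>_. 0) z)"
    by (intro gspan_scale gspan_base) (auto simp: gx_def)
qed (simp add: gm_def)

lemma gspan_power:
  "finite J \<Longrightarrow> gspan T e J D {a..} d f \<Longrightarrow> gspan T e J D {a * r..} (d * r) (\<lambda>z. f z ^ r)"
proof (induction r)
  case 0
  then show ?case by (simp add: gspan_const)
next
  case (Suc r)
  have "gspan T e J D {a * Suc r..} (d + d * r) (\<lambda>z. f z * f z ^ r)"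
    by (rule gspan_mult[OF Suc.prems(1) _ Suc.prems(2) Suc.IH[OF Suc.prems]]) auto
  then show ?case by simp
qed

lemma gspan_prod:
  assumes "finite J" "\<And>a. a \<in> A \<Longrightarrow> gspan T e J D {m a..} (d a) (f a)"
  shows "gspan T e J D {\<Sum>a\<in>A. m a..} (\<Sum>a\<in>A. d a) (\<lambda>z. \<Prod>a\<in>A. f a z)"
  using assms(2)
proof (induction A rule: infinite_finite_induct)
  case (insert a A)
  have "gspan T e J D {m a + (\<Sum>a\<in>A. m a)..} (d a + (\<Sum>a\<in>A. d a)) (\<lambda>z. f a z * (\<Prod>a\<in>A. f a z))"
    by (rule gspan_mult[OF assms(1), where M = "{m a..}" and M' = "{\<Sum>a\<in>A. m a..}"])
      (use insert in auto)
  then show ?case using insert.hyps by simp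
qed (use assms(1) in \<open>simp_all add: gspan_const\<close>)

lemma gspan_coord_power0: "finite J \<Longrightarrow> gspan T e J D {0} r (\<lambda>z. z $ e ^ r)"
proof (rule gspan_cong)
  show "finite J \<Longrightarrow> gspan T e J D {0} r (gm e J D r (\<lambda>_. 0))" by (rule gspan_base) (auto simp: gx_def)
qed (simp add: gm_def)

lemma gspan_coord_power: "finite J \<Longrightarrow> gspan T e J D {0..} r (\<lambda>z. z $ e ^ r)"
  using gspan_power[OF _ gspan_coord[where M = "{0..}" and T = T and e = e and D = D and J = J], where r = r]
  by simp

text \<open>Substituting functions of order at least one does not lower the order.\<close>

lemma gspan_trans:
  assumes J: "finite J" "finite J'" and D: "\<And>j. j \<in> J' \<Longrightarrow> gspan T e J D {1..} 1 (D' j)"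
    and f: "gspan T e J' D' M d f" and M: "M \<subseteq> {m..}"
  shows "gspan T e J D {m..} d f"
proof -
  obtain \<kappa> where \<kappa>: "\<forall>z\<in>T. f z = (\<Sum>\<gamma>\<in>gx J' M d. \<kappa> \<gamma> * gm e J' D' d \<gamma> z)" using f by (rule gspanE)
  have "gspan T e J D {m..} d (\<lambda>z. \<Sum>\<gamma>\<in>gx J' M d. \<kappa> \<gamma> * gm e J' D' d \<gamma> z)"
  proof (intro gspan_sum gspan_scale)
    fix \<gamma> assume "\<gamma> \<in> gx J' M d"
    then have \<gamma>: "m \<le> (\<Sum>j\<in>J'. \<gamma> j)" "(\<Sum>j\<in>J'. \<gamma> j) \<le> d" using M by (auto simp: gx_def)
    have "gspan T e J D {\<Sum>j\<in>J'. 1 * \<gamma> j..} (\<Sum>j\<in>J'. 1 * \<gamma> j) (\<lambda>z. \<Prod>j\<in>J'. D' j z ^ \<gamma> j)"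
      by (intro gspan_prod[OF J(1)] gspan_power[OF J(1)] D)
    from gspan_mult[OF J(1) _ gspan_coord_power[OF J(1), of T e D "d - (\<Sum>j\<in>J'. \<gamma> j)"] this, where M'' = "{m..}"]
    show "gspan T e J D {m..} d (\<lambda>z. gm e J' D' d \<gamma> z)"
      using \<gamma> by (simp add: gm_def)
  qed
  then show ?thesis by (rule gspan_cong) (simp add: \<kappa>)
qed

section \<open>Taylor expansion\<close>

definition pdm :: "'i::finite \<Rightarrow> ('i \<Rightarrow>\<^sub>0 nat) \<Rightarrow> 'k::field^'i \<Rightarrow> 'k" where
  "pdm j m x = of_nat (lkp m j) * x $ j ^ (lkp m j - 1) * (\<Prod>l\<in>UNIV - {j}. x $ l ^ lkp m l)"

lemma pderiv_eval_sup:
  assumes "finite S" "pkeys p \<subseteq> S"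
  shows "mpoly_pderiv_eval j p x = (\<Sum>m\<in>S. lkp p m * pdm j m x)"
  unfolding mpoly_pderiv_eval_def pdm_def
  by (rule sum.mono_neutral_left) (use assms in \<open>auto simp: in_keys_iff\<close>)

lemma pderiv_eval_add: "mpoly_pderiv_eval j (p + q) x = mpoly_pderiv_eval j p x + mpoly_pderiv_eval j q x"
proof -
  let ?S = "pkeys p \<union> pkeys q"
  have "pkeys (p + q) \<subseteq> ?S" by (rule Poly_Mapping.keys_add)
  then show ?thesis
    by (simp add: pderiv_eval_sup[of ?S] lookup_add distrib_right sum.distrib)
qed

lemma pderiv_eval_zero: "mpoly_pderiv_eval j 0 x = 0"
  by (simp add: mpoly_pderiv_eval_def)

lemma pderiv_eval_sum: "mpoly_pderiv_eval j (\<Sum>a\<in>S. f a) x = (\<Sum>a\<in>S. mpoly_pderiv_eval j (f a) x)"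
  by (induction S rule: infinite_finite_induct) (auto simp: pderiv_eval_add pderiv_eval_zero)

lemma pdm_zero: "pdm j 0 x = 0"
  by (simp add: pdm_def)

lemma pdm_add_single:
  "pdm j (m + Poly_Mapping.single i 1) x = x $ i * pdm j m x + (if i = j then meval m x else 0)"
proof (cases "i = j")
  case True
  have "meval m x = x $ j ^ lkp m j * (\<Prod>l\<in>UNIV - {j}. x $ l ^ lkp m l)"
    unfolding meval_def by (rule prod.remove) auto
  moreover have "(\<Prod>l\<in>UNIV - {j}. x $ l ^ lkp (m + Poly_Mapping.single j 1) l) = (\<Prod>l\<in>UNIV - {j}. x $ l ^ lkp m l)"
    by (rule prod.cong) (auto simp: lookup_add lookup_single)
  moreover have "of_nat (lkp m j) * x $ j ^ lkp m j = x $ j * (of_nat (lkp m j) * x $ j ^ (lkp m j - 1))"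
    by (cases "lkp m j") auto
  ultimately show ?thesis using True
    by (simp add: pdm_def lookup_add distrib_right mult.assoc[symmetric])
next
  case False
  then have i: "i \<in> UNIV - {j}" by auto
  have "(\<Prod>l\<in>UNIV - {j}. x $ l ^ lkp (m + Poly_Mapping.single i 1) l) =
      x $ i ^ Suc (lkp m i) * (\<Prod>l\<in>UNIV - {j} - {i}. x $ l ^ lkp m l)"
  proof -
    have "(\<Prod>l\<in>UNIV - {j} - {i}. x $ l ^ lkp (m + Poly_Mapping.single i 1) l) =
        (\<Prod>l\<in>UNIV - {j} - {i}. x $ l ^ lkp m l)"
      by (rule prod.cong) (auto simp: lookup_add lookup_single)
    moreover have "lkp (m + Poly_Mapping.single i 1) i = Suc (lkp m i)" by (simp add: lookup_add)
    ultimately show ?thesis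
      using prod.remove[OF _ i, of "\<lambda>l. x $ l ^ lkp (m + Poly_Mapping.single i 1) l"] by simp
  qed
  moreover have "(\<Prod>l\<in>UNIV - {j}. x $ l ^ lkp m l) = x $ i ^ lkp m i * (\<Prod>l\<in>UNIV - {j} - {i}. x $ l ^ lkp m l)"
    using prod.remove[OF _ i, of "\<lambda>l. x $ l ^ lkp m l"] by simp
  ultimately show ?thesis using False by (simp add: pdm_def lookup_add lookup_single when_def mult_ac)
qed

lemma monomial_induct [case_names zero add]:
  fixes m :: "'i::finite \<Rightarrow>\<^sub>0 nat"
  assumes "P 0" "\<And>m i. P m \<Longrightarrow> P (m + Poly_Mapping.single i 1)"
  shows "P m"
proof (induction "mdeg m" arbitrary: m)
  case 0
  then have "m = 0" by (auto simp: mdeg_def intro: poly_mapping_eqI)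
  then show ?case using assms(1) by simp
next
  case (Suc d)
  then have "mdeg m \<noteq> 0" by simp
  then obtain i where "lkp m i \<noteq> 0" unfolding mdeg_def by (metis sum.neutral)
  then have i: "lkp m i > 0" by simp
  define m' where "m' = m - Poly_Mapping.single i 1"
  have m: "m = m' + Poly_Mapping.single i 1"
    unfolding m'_def by (rule poly_mapping_eqI) (use i in \<open>auto simp: lookup_add lookup_minus lookup_single when_def\<close>)
  then have "d = mdeg m'" using Suc.hyps(2) by (simp add: mdeg_add)
  then show ?case using Suc.hyps(1)[of m'] assms(2) m by simp
qed

text \<open>The homogeneous version of the local function z_j / z_e - y_j / y_e at a point with y_e
  nonzero.\<close>

definition dev :: "'i \<Rightarrow> 'k::field^'i \<Rightarrow> 'i \<Rightarrow> 'k^'i \<Rightarrow> 'k" where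
  "dev e y j z = y $ e * z $ j - y $ j * z $ e"

text \<open>First-order Taylor expansion in the local functions \<open>dev e x j\<close>, with
  denominators cleared by powers of x_e and z_e; the remainder has order at least two. One variable
  is multiplied on at a time.\<close>

lemma taylor_monomial:
  fixes x :: "'k::field^'i::finite"
  shows "gspan T e UNIV (dev e x) {2..} (mdeg m) (\<lambda>z. x $ e ^ mdeg m * meval m z - z $ e ^ mdeg m * meval m x
    - z $ e ^ (mdeg m - 1) * (\<Sum>j\<in>UNIV. pdm j m x * dev e x j z))"
proof (induction m rule: monomial_induct)
  case zero
  show ?case by (simp add: pdm_zero gspan_zero)
next
  case (add m i)
  define d where "d = mdeg m"
  define G where "G z = (\<Sum>j\<in>UNIV. pdm j m x * dev e x j z)" for z
  define F where "F z = x $ e ^ d * meval m z - z $ e ^ d * meval m x - z $ e ^ (d - 1) * G z" for z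
  have F: "gspan T e UNIV (dev e x) {2..} d F"
    using add.IH by (simp add: F_def[abs_def] d_def G_def)
  \<comment> \<open>In degree 0 the exponent \<open>d - 1\<close> is truncated, which is harmless
    because the linear term vanishes.\<close>
  have G0: "d = 0 \<Longrightarrow> G z = 0" for z
  proof -
    assume "d = 0"
    then have "m = 0" by (auto simp: d_def mdeg_def intro: poly_mapping_eqI)
    then show ?thesis by (simp add: G_def pdm_zero)
  qed
  have G1: "gspan T e UNIV (dev e x) {1..} 1 G"
    unfolding G_def[abs_def] by (intro gspan_sum gspan_scale gspan_D) auto
  have DG: "gspan T e UNIV (dev e x) {2..} (d + 1) (\<lambda>z. z $ e ^ (d - 1) * (G z * dev e x i z))"
  proof (cases d)
    case 0
    then show ?thesis by (simp add: G0 gspan_zero)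
  next
    case (Suc d')
    have "gspan T e UNIV (dev e x) {2..} (1 + 1) (\<lambda>z. G z * dev e x i z)"
      by (rule gspan_mult[OF _ _ G1 gspan_D[of UNIV "{1..}"]]) auto
    from gspan_mult[OF _ _ gspan_coord_power[of UNIV T e "dev e x" d'] this, where M'' = "{2..}"]
    show ?thesis using Suc by simp
  qed
  have "gspan T e UNIV (dev e x) {2..} (1 + d) (\<lambda>z. dev e x i z * F z)"
    by (rule gspan_mult[OF _ _ gspan_D[of UNIV "{1..}"] F]) auto
  moreover have "gspan T e UNIV (dev e x) {2..} (1 + d) (\<lambda>z. z $ e * F z)"
    by (rule gspan_mult[OF _ _ gspan_coord[of UNIV "{0..}"] F]) auto
  ultimately have "gspan T e UNIV (dev e x) {2..} (d + 1)
      (\<lambda>z. dev e x i z * F z + x $ i * (z $ e * F z) + z $ e ^ (d - 1) * (G z * dev e x i z))"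
    using DG by (intro gspan_add gspan_scale) simp_all
  moreover have "x $ e ^ mdeg (m + Poly_Mapping.single i 1) * meval (m + Poly_Mapping.single i 1) z -
      z $ e ^ mdeg (m + Poly_Mapping.single i 1) * meval (m + Poly_Mapping.single i 1) x -
      z $ e ^ (mdeg (m + Poly_Mapping.single i 1) - 1) *
        (\<Sum>j\<in>UNIV. pdm j (m + Poly_Mapping.single i 1) x * dev e x j z) =
      dev e x i z * F z + x $ i * (z $ e * F z) + z $ e ^ (d - 1) * (G z * dev e x i z)" for z
  proof -
    have sum: "(\<Sum>j\<in>UNIV. pdm j (m + Poly_Mapping.single i 1) x * dev e x j z) =
        x $ i * G z + meval m x * dev e x i z"
      unfolding pdm_add_single G_def distrib_right sum.distrib sum_distrib_left
      by (simp add: if_distrib[of "\<lambda>c. c * _"] mult.assoc cong: if_cong)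
    have xz: "x $ e * z $ i = dev e x i z + x $ i * z $ e" by (simp add: dev_def)
    have zG: "z $ e * (z $ e ^ (d - 1) * G z) = z $ e ^ d * G z"
      by (cases d) (auto simp: G0)
    have "x $ e ^ Suc d * (meval m z * z $ i) = (x $ e * z $ i) * (x $ e ^ d * meval m z)" by (simp add: mult_ac)
    also have "x $ e ^ d * meval m z = F z + z $ e ^ d * meval m x + z $ e ^ (d - 1) * G z" by (simp add: F_def)
    finally have "x $ e ^ Suc d * (meval m z * z $ i) =
        (dev e x i z + x $ i * z $ e) * (F z + z $ e ^ d * meval m x + z $ e ^ (d - 1) * G z)"
      by (simp only: xz)
    also have "\<dots> = dev e x i z * F z + x $ i * (z $ e * F z) + z $ e ^ (d - 1) * (G z * dev e x i z)
        + z $ e ^ d * (meval m x * dev e x i z) + x $ i * (z $ e ^ Suc d * meval m x)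
        + x $ i * (z $ e * (z $ e ^ (d - 1) * G z))"
      by (simp add: algebra_simps)
    finally have "x $ e ^ Suc d * (meval m z * z $ i) =
        dev e x i z * F z + x $ i * (z $ e * F z) + z $ e ^ (d - 1) * (G z * dev e x i z)
        + z $ e ^ d * (meval m x * dev e x i z) + x $ i * (z $ e ^ Suc d * meval m x)
        + x $ i * (z $ e ^ d * G z)"
      by (simp only: zG)
    then show ?thesis
      unfolding sum by (simp add: mdeg_add meval_add d_def[symmetric] algebra_simps)
  qed
  ultimately show ?case
    by (subst mdeg_add, subst mdeg_single, fold d_def) (rule gspan_cong, assumption, simp add: mdeg_add d_def)
qed

lemma taylor:
  fixes x :: "'k::field^'i::finite"
  assumes "hdeg d p"
  shows "gspan T e UNIV (dev e x) {2..} d (\<lambda>z. x $ e ^ d * mpoly_eval p z - z $ e ^ d * mpoly_eval p x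
    - z $ e ^ (d - 1) * (\<Sum>j\<in>UNIV. mpoly_pderiv_eval j p x * dev e x j z))"
proof -
  let ?t = "\<lambda>m z. x $ e ^ d * meval m z - z $ e ^ d * meval m x - z $ e ^ (d - 1) * (\<Sum>j\<in>UNIV. pdm j m x * dev e x j z)"
  have "gspan T e UNIV (dev e x) {2..} d (\<lambda>z. \<Sum>m\<in>pkeys p. lkp p m * ?t m z)"
  proof (intro gspan_sum gspan_scale)
    fix m assume "m \<in> pkeys p"
    then have "mdeg m = d" using assms by (simp add: hdeg_def)
    then show "gspan T e UNIV (dev e x) {2..} d (?t m)" using taylor_monomial[of T e x m] by simp
  qed
  then show ?thesis
  proof (rule gspan_cong)
    fix z
    have "(\<Sum>m\<in>pkeys p. lkp p m * (z $ e ^ (d - 1) * (\<Sum>j\<in>UNIV. pdm j m x * dev e x j z))) =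
        z $ e ^ (d - 1) * (\<Sum>j\<in>UNIV. mpoly_pderiv_eval j p x * dev e x j z)"
      unfolding pderiv_eval_sup[OF finite_keys order_refl] sum_distrib_left sum_distrib_right
      by (subst sum.swap) (simp add: mult_ac)
    then show "x $ e ^ d * mpoly_eval p z - z $ e ^ d * mpoly_eval p x
        - z $ e ^ (d - 1) * (\<Sum>j\<in>UNIV. mpoly_pderiv_eval j p x * dev e x j z) = (\<Sum>m\<in>pkeys p. lkp p m * ?t m z)"
      by (simp add: mpoly_eval_alt right_diff_distrib sum_subtractf sum_distrib_left mult_ac)
  qed
qed

lemma form_in_gspan:
  fixes x :: "'k::field^'i::finite"
  assumes "hdeg d p" "x $ e \<noteq> 0"
  shows "gspan T e UNIV (dev e x) {0..} d (mpoly_eval p)"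
proof -
  have coord: "gspan T e UNIV (dev e x) {0..} 1 (\<lambda>z. z $ j)" for j
  proof (rule gspan_cong)
    show "gspan T e UNIV (dev e x) {0..} 1 (\<lambda>z. inverse (x $ e) * (dev e x j z + x $ j * z $ e))"
      by (intro gspan_scale gspan_add gspan_D gspan_coord) auto
    show "z $ j = inverse (x $ e) * (dev e x j z + x $ j * z $ e)" for z
      using assms(2) by (simp add: dev_def field_simps)
  qed
  have "gspan T e UNIV (dev e x) {0..} d (\<lambda>z. \<Sum>m\<in>pkeys p. lkp p m * meval m z)"
  proof (intro gspan_sum gspan_scale)
    fix m assume "m \<in> pkeys p"
    then have "mdeg m = d" using assms by (simp add: hdeg_def)
    have "gspan T e UNIV (dev e x) {\<Sum>j\<in>UNIV. 0 * lkp m j..} (\<Sum>j\<in>UNIV. 1 * lkp m j) (\<lambda>z. \<Prod>j\<in>UNIV. z $ j ^ lkp m j)"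
      by (intro gspan_prod gspan_power coord) auto
    then show "gspan T e UNIV (dev e x) {0..} d (\<lambda>z. meval m z)"
      using \<open>mdeg m = d\<close> by (simp add: meval_def mdeg_def)
  qed
  then show ?thesis by (rule gspan_cong) (simp add: mpoly_eval_alt)
qed

context toric
begin

text \<open>Gradients of forms vanishing on X cut out the tangent space \<open>V\<close>, of
  dimension \<open>N\<close> by smoothness. Taylor expansion of such a form says that its gradient
  applied to the deviations is of second order. Normalizing the coordinate \<open>e\<close> leaves
  at most \<open>N - 1\<close> independent first-order deviations.\<close>

lemma smooth_expansion:
  fixes x :: "'k::field_char_0^'i"
  assumes smooth: "smooth_point X x" and xe: "x $ e \<noteq> 0"
  shows "\<exists>(q :: nat \<Rightarrow> 'k^'i) u E0. (\<forall>l. gspan T e UNIV (dev e x) {1..} 1 (u l)) \<and>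
    (\<forall>j. gspan T e UNIV (dev e x) {2..} (E0 + 1)
      (\<lambda>z. z $ e ^ E0 * (dev e x j z - (\<Sum>l<N - 1. q l $ j * u l z))))"
proof -
  define grad where "grad p = (\<chi> j. mpoly_pderiv_eval j p x)" for p :: "('k, 'i) mpoly"
  define H where "H = {p \<in> vanishing_ideal (X :: ('k^'i) set). \<exists>d. hdeg d p}"
  define V where "V = tangent_cone_space X x"
  have xX: "x \<in> X" and dimV: "vec.dim V = N"
    using smooth N_pos by (auto simp: smooth_point_def proj_dim_X V_def)
  have VI: "v \<in> V" if v: "\<And>p. p \<in> H \<Longrightarrow> (\<Sum>i\<in>UNIV. grad p $ i * v $ i) = 0" for v
    unfolding V_def tangent_cone_space_def
  proof (intro CollectI ballI)
    fix p assume p: "p \<in> vanishing_ideal (X :: ('k^'i) set)"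
    have "hcomp d p \<in> H" for d
    proof -
      have "mpoly_eval (hcomp d p) y = 0" if "y \<in> T" for y
        by (rule eval_hcomp_zero) (use that p cone_T in \<open>auto simp: vanishing_ideal_X cone_def\<close>)
      then show ?thesis using hdeg_hcomp by (auto simp: H_def vanishing_ideal_X)
    qed
    then have 0: "(\<Sum>i\<in>UNIV. mpoly_pderiv_eval i (hcomp d p) x * v $ i) = 0" for d
      using v[of "hcomp d p"] by (simp add: grad_def)
    have "mpoly_pderiv_eval i p x = (\<Sum>d\<le>maxdeg p. mpoly_pderiv_eval i (hcomp d p) x)" for i
      by (subst sum_hcomp[of p]) (rule pderiv_eval_sum)
    then have "(\<Sum>i\<in>UNIV. mpoly_pderiv_eval i p x * v $ i) =
        (\<Sum>i\<in>UNIV. \<Sum>d\<le>maxdeg p. mpoly_pderiv_eval i (hcomp d p) x * v $ i)"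
      by (simp add: sum_distrib_right)
    also have "\<dots> = (\<Sum>d\<le>maxdeg p. \<Sum>i\<in>UNIV. mpoly_pderiv_eval i (hcomp d p) x * v $ i)"
      by (rule sum.swap)
    finally show "(\<Sum>i\<in>UNIV. mpoly_pderiv_eval i p x * v $ i) = 0" by (simp add: 0)
  qed
  \<comment> \<open>Euler's identity for forms.\<close>
  have "x \<in> V"
  proof (rule VI)
    fix p assume p: "p \<in> H"
    then obtain d where d: "hdeg d p" by (auto simp: H_def)
    have "(\<Sum>i\<in>UNIV. grad p $ i * x $ i) = (\<Sum>i\<in>UNIV. \<Sum>m\<in>pkeys p. lkp p m * (of_nat (lkp m i) * meval m x))"
      by (simp add: grad_def pderiv_eval_times)
    also have "\<dots> = (\<Sum>m\<in>pkeys p. lkp p m * (of_nat (mdeg m) * meval m x))"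
      by (subst sum.swap) (simp add: mdeg_def sum_distrib_left sum_distrib_right)
    also have "\<dots> = of_nat d * mpoly_eval p x"
      using d by (simp add: mpoly_eval_alt hdeg_def sum_distrib_left mult_ac)
    also have "mpoly_eval p x = 0" using p xX by (simp add: H_def vanishing_ideal_def)
    finally show "(\<Sum>i\<in>UNIV. grad p $ i * x $ i) = 0" by simp
  qed
  define Q where "Q = {v \<in> V. v $ e = 0}"
  have subV: "vec.subspace V"
    unfolding vec.subspace_def V_def tangent_cone_space_def
    by (auto simp: distrib_left sum.distrib mult.left_commute[of _ "_::'k"] sum_distrib_left[symmetric])
  then have subQ: "vec.subspace Q" by (auto simp: Q_def vec.subspace_def)
  obtain B where B: "B \<subseteq> Q" "vec.independent B" "Q \<subseteq> vec.span B" by (rule vec.basis_exists[of Q]) auto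
  have fin: "finite B" using B(2) by (rule vec.finiteI_independent)
  have "vec.span B \<subseteq> Q" by (rule vec.span_minimal[OF B(1) subQ])
  then have xB: "x \<notin> vec.span B" using xe by (auto simp: Q_def)
  then have "vec.independent (insert x B)" using B(2) by (simp add: vec.independent_insert)
  moreover have "insert x B \<subseteq> V" using B(1) \<open>x \<in> V\<close> by (auto simp: Q_def)
  ultimately have "card (insert x B) \<le> N" using vec.independent_card_le_dim[of "insert x B" V] dimV by simp
  moreover have "x \<notin> B" using xB vec.span_base by blast
  ultimately have cardB: "card B \<le> N - 1" using fin by simp
  have indB: "indep B UNIV vec_nth"
    unfolding indep_def
  proof (intro allI impI ballI)
    fix \<kappa> b assume z: "\<forall>i\<in>UNIV. (\<Sum>b\<in>B. \<kappa> b * b $ i) = 0" and b: "b \<in> B"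
    then have "(\<Sum>b\<in>B. \<kappa> b *s b) = 0" by (simp add: vec_eq_iff)
    then show "\<kappa> b = 0" using vec.independentD[OF B(2) fin order_refl _ b] by blast
  qed
  have "\<forall>b\<in>B. \<exists>\<xi>. (\<forall>b'\<in>B - {b}. pair UNIV \<xi> (vec_nth b') = 0) \<and> pair UNIV \<xi> (vec_nth b) = 1"
    using indep_dual[OF indB fin finite] by blast
  from bchoice[OF this] obtain \<Lambda> where \<Lambda>0: "\<forall>b\<in>B. (\<forall>b'\<in>B - {b}. pair UNIV (\<Lambda> b) (vec_nth b') = 0) \<and>
      pair UNIV (\<Lambda> b) (vec_nth b) = 1" by blast
  have \<Lambda>: "pair UNIV (\<Lambda> b) (vec_nth b') = (if b' = b then 1 else 0)" if "b \<in> B" "b' \<in> B" for b b'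
    using \<Lambda>0 that by auto
  \<comment> \<open>The coordinate \<open>j\<close> minus its interpolation through the basis
    \<open>B\<close>. It annihilates \<open>Q\<close>, so it is a combination of gradients and of
    the coordinate \<open>e\<close>.\<close>
  define w where "w j = (\<chi> i. (if i = j then 1 else 0) - (\<Sum>b\<in>B. b $ j * \<Lambda> b i))" for j :: 'i
  define W where "W = vec.span (insert (axis e 1) (grad ` H))"
  have wW: "w j \<in> W" for j
    unfolding W_def
  proof (rule double_annihilator[OF vec.subspace_span])
    fix y assume ann: "\<And>v. v \<in> vec.span (insert (axis e 1) (grad ` H)) \<Longrightarrow> (\<Sum>i\<in>UNIV. v $ i * y $ i) = 0"
    have "(\<Sum>i\<in>UNIV. axis e 1 $ i * y $ i) = 0" by (rule ann) (simp add: vec.span_base)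
    then have "y $ e = 0" by (simp add: axis_def if_distrib[of "\<lambda>c. c * _"] cong: if_cong)
    moreover have "y \<in> V" by (rule VI) (rule ann, simp add: vec.span_base)
    ultimately have "y \<in> vec.span B" using B(3) by (auto simp: Q_def)
    then obtain c where c: "y = (\<Sum>b\<in>B. c b *s b)" using vec.span_finite[OF fin] by auto
    have "(\<Sum>i\<in>UNIV. w j $ i * y $ i) = y $ j - (\<Sum>i\<in>UNIV. \<Sum>b\<in>B. b $ j * \<Lambda> b i * y $ i)"
      by (simp add: w_def left_diff_distrib sum_subtractf sum_distrib_right
          if_distrib[of "\<lambda>c. c * _"] cong: if_cong)
    also have "(\<Sum>i\<in>UNIV. \<Sum>b\<in>B. b $ j * \<Lambda> b i * y $ i) = (\<Sum>b\<in>B. b $ j * pair UNIV (\<Lambda> b) (vec_nth y))"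
      by (subst sum.swap) (simp add: pair_def sum_distrib_left mult.assoc)
    also have "\<dots> = (\<Sum>b\<in>B. b $ j * c b)"
    proof (rule sum.cong)
      fix b assume b: "b \<in> B"
      have "pair UNIV (\<Lambda> b) (vec_nth y) = pair UNIV (\<Lambda> b) (\<lambda>i. \<Sum>b'\<in>B. c b' * b' $ i)"
        by (rule pair_cong) (simp add: c)
      also have "\<dots> = (\<Sum>b'\<in>B. c b' * pair UNIV (\<Lambda> b) (vec_nth b'))" by (rule pair_sum)
      also have "\<dots> = (\<Sum>b'\<in>B. if b' = b then c b' else 0)" by (rule sum.cong) (auto simp: \<Lambda>[OF b])
      also have "\<dots> = c b" using fin b by simp
      finally show "b $ j * pair UNIV (\<Lambda> b) (vec_nth y) = b $ j * c b" by simp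
    qed simp
    also have "\<dots> = y $ j" by (simp add: c mult.commute)
    finally show "(\<Sum>i\<in>UNIV. w j $ i * y $ i) = 0" by simp
  qed
  \<comment> \<open>The power of z_e makes degrees uniform. Requiring this for all large
    \<open>E\<close> lets contributions of different degrees be added.\<close>
  define good where "good v E \<longleftrightarrow> gspan T e UNIV (dev e x) {2..} (E + 1)
      (\<lambda>z. z $ e ^ E * (\<Sum>i\<in>UNIV. v $ i * dev e x i z))" for v E
  have "vec.subspace {v. \<exists>E0. \<forall>E\<ge>E0. good v E}"
    unfolding vec.subspace_def
  proof (intro conjI ballI allI)
    show "0 \<in> {v. \<exists>E0. \<forall>E\<ge>E0. good v E}" by (simp add: good_def gspan_zero)
    fix v assume "v \<in> {v. \<exists>E0. \<forall>E\<ge>E0. good v E}"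
    then obtain E1 where v: "\<And>E. E \<ge> E1 \<Longrightarrow> good v E" by blast
    { fix c
      have "good (c *s v) E" if "E \<ge> E1" for E
        using gspan_scale[OF v[OF that, unfolded good_def], of c]
        by (simp add: good_def sum_distrib_left mult_ac)
      then show "c *s v \<in> {v. \<exists>E0. \<forall>E\<ge>E0. good v E}" by blast }
    fix v' assume "v' \<in> {v. \<exists>E0. \<forall>E\<ge>E0. good v E}"
    then obtain E2 where v': "\<And>E. E \<ge> E2 \<Longrightarrow> good v' E" by blast
    have "good (v + v') E" if "E \<ge> max E1 E2" for E
      using gspan_add[OF v[of E, unfolded good_def] v'[of E, unfolded good_def]] that
      by (simp add: good_def distrib_left distrib_right sum.distrib)
    then show "v + v' \<in> {v. \<exists>E0. \<forall>E\<ge>E0. good v E}" by blast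
  qed
  moreover have "insert (axis e 1) (grad ` H) \<subseteq> {v. \<exists>E0. \<forall>E\<ge>E0. good v E}"
  proof
    fix v assume "v \<in> insert (axis e 1) (grad ` H)"
    then consider "v = axis e 1" | p where "p \<in> H" "v = grad p" by blast
    then show "v \<in> {v. \<exists>E0. \<forall>E\<ge>E0. good v E}"
    proof cases
      case 1
      have "(\<Sum>i\<in>UNIV. v $ i * dev e x i z) = 0" for z
        by (simp add: 1 axis_def dev_def if_distrib[of "\<lambda>c. c * _"] cong: if_cong)
      then show ?thesis by (simp add: good_def gspan_zero)
    next
      case (2 p)
      then obtain d where d: "hdeg d p" by (auto simp: H_def)
      show ?thesis
      proof (cases d)
        case 0
        have "m = 0" if "m \<in> pkeys p" for m
          using that d 0 by (auto simp: hdeg_def mdeg_def intro: poly_mapping_eqI)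
        then have "mpoly_pderiv_eval j p x = 0" for j
          unfolding pderiv_eval_sup[OF finite_keys order_refl]
        proof (intro sum.neutral ballI)
          fix m assume "m \<in> pkeys p"
          with \<open>\<And>m. m \<in> pkeys p \<Longrightarrow> m = 0\<close> have "m = 0" .
          then show "lkp p m * pdm j m x = 0" by (simp add: pdm_zero)
        qed
        then show ?thesis by (simp add: good_def 2 grad_def gspan_zero)
      next
        case (Suc d')
        have px: "mpoly_eval p x = 0" using 2 xX by (simp add: H_def vanishing_ideal_def)
        have pT: "mpoly_eval p z = 0" if "z \<in> T" for z using 2 that by (simp add: H_def vanishing_ideal_X)
        have tay: "gspan T e UNIV (dev e x) {2..} d (\<lambda>z. z $ e ^ d' * (\<Sum>i\<in>UNIV. v $ i * dev e x i z))"
          by (rule gspan_cong[OF gspan_scale[OF taylor[OF d, of T e x], of "- 1"]])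
             (simp add: px pT Suc 2 grad_def)
        have "good v E" if "E \<ge> d'" for E
        proof -
          have "gspan T e UNIV (dev e x) {2..} ((E - d') + d)
              (\<lambda>z. z $ e ^ (E - d') * (z $ e ^ d' * (\<Sum>i\<in>UNIV. v $ i * dev e x i z)))"
            by (rule gspan_mult[OF _ _ gspan_coord_power tay]) auto
          moreover have "z $ e ^ (E - d') * (z $ e ^ d' * c) = z $ e ^ E * c" for z :: "'k^'i" and c
            using that by (simp add: mult.assoc[symmetric] power_add[symmetric])
          ultimately show ?thesis using that Suc by (simp add: good_def)
        qed
        then show ?thesis by blast
      qed
    qed
  qed
  ultimately have "W \<subseteq> {v. \<exists>E0. \<forall>E\<ge>E0. good v E}" unfolding W_def by (intro vec.span_minimal)
  then have "\<forall>j. \<exists>E0. \<forall>E\<ge>E0. good (w j) E" using wW by blast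
  then obtain E1 where E1: "\<And>j E. E \<ge> E1 j \<Longrightarrow> good (w j) E" by metis
  define E0 where "E0 = (\<Sum>j\<in>UNIV. E1 j)"
  have "E1 j \<le> E0" for j unfolding E0_def by (rule member_le_sum) auto
  then have gw: "good (w j) E0" for j by (rule E1)
  obtain h where h: "bij_betw h {0..<card B} B" using ex_bij_betw_nat_finite[OF fin] by blast
  \<comment> \<open>Padding by zero gives exactly \<open>N - 1\<close> functions, whatever the size
    of \<open>B\<close>.\<close>
  define q where "q l = (if l < card B then h l else 0)" for l
  define u where "u l z = (if l < card B then \<Sum>i\<in>UNIV. \<Lambda> (h l) i * dev e x i z else 0)" for l z
  have u: "gspan T e UNIV (dev e x) {1..} 1 (u l)" for l
  proof (cases "l < card B")
    case True
    have "gspan T e UNIV (dev e x) {1..} 1 (\<lambda>z. \<Sum>i\<in>UNIV. \<Lambda> (h l) i * dev e x i z)"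
      by (intro gspan_sum gspan_scale gspan_D) simp_all
    then show ?thesis using True by (simp add: u_def[abs_def])
  qed (simp add: u_def[abs_def] gspan_zero)
  have "(\<Sum>l<N - 1. q l $ j * u l z) = (\<Sum>b\<in>B. b $ j * (\<Sum>i\<in>UNIV. \<Lambda> b i * dev e x i z))" for j z
  proof -
    have "(\<Sum>l<N - 1. q l $ j * u l z) = (\<Sum>l\<in>{0..<card B}. q l $ j * u l z)"
      by (rule sum.mono_neutral_right) (use cardB in \<open>auto simp: u_def\<close>)
    also have "\<dots> = (\<Sum>l\<in>{0..<card B}. h l $ j * (\<Sum>i\<in>UNIV. \<Lambda> (h l) i * dev e x i z))"
      by (rule sum.cong) (auto simp: q_def u_def)
    also have "\<dots> = (\<Sum>b\<in>B. b $ j * (\<Sum>i\<in>UNIV. \<Lambda> b i * dev e x i z))"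
      by (rule sum.reindex_bij_betw[OF h])
    finally show ?thesis .
  qed
  moreover have "(\<Sum>i\<in>UNIV. w j $ i * dev e x i z) =
      dev e x j z - (\<Sum>b\<in>B. b $ j * (\<Sum>i\<in>UNIV. \<Lambda> b i * dev e x i z))" for j z
  proof -
    have "(\<Sum>i\<in>UNIV. w j $ i * dev e x i z) = dev e x j z - (\<Sum>i\<in>UNIV. \<Sum>b\<in>B. b $ j * \<Lambda> b i * dev e x i z)"
      by (simp add: w_def left_diff_distrib sum_subtractf sum_distrib_right
          if_distrib[of "\<lambda>c. c * _"] cong: if_cong)
    also have "(\<Sum>i\<in>UNIV. \<Sum>b\<in>B. b $ j * \<Lambda> b i * dev e x i z) = (\<Sum>b\<in>B. b $ j * (\<Sum>i\<in>UNIV. \<Lambda> b i * dev e x i z))"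
      by (subst sum.swap) (simp add: sum_distrib_left mult.assoc)
    finally show ?thesis .
  qed
  ultimately have "gspan T e UNIV (dev e x) {2..} (E0 + 1)
      (\<lambda>z. z $ e ^ E0 * (dev e x j z - (\<Sum>l<N - 1. q l $ j * u l z)))" for j
    using gw[of j] by (simp add: good_def)
  then show ?thesis using u by blast
qed

end

text \<open>Each factor \<open>D i\<close> is replaced by its linear part in the \<open>u l\<close>;
  every replacement costs a factor \<open>z $ e ^ E\<close> and leaves an error of one order
  more.\<close>

lemma gspan_monomial_reduction:
  fixes u :: "nat \<Rightarrow> 'k::field^'i::finite \<Rightarrow> 'k" and q :: "nat \<Rightarrow> 'k^'i"
  assumes u: "\<And>l. gspan T e UNIV D {1..} 1 (u l)"
    and q: "\<And>j. gspan T e UNIV D {2..} (E + 1) (\<lambda>z. z $ e ^ E * (D j z - (\<Sum>l<n. q l $ j * u l z)))"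
  shows "\<exists>A F. gspan T e {..<n} u {mdeg m} (mdeg m * (E + 1)) A \<and>
    gspan T e (UNIV :: 'i set) D {Suc (mdeg m)..} (mdeg m * (E + 1)) F \<and>
    (\<forall>z\<in>T. z $ e ^ (mdeg m * E) * (\<Prod>j\<in>UNIV. D j z ^ lkp m j) = A z + F z)"
proof (induction m rule: monomial_induct)
  case zero
  show ?case
    by (intro exI[of _ "\<lambda>_. 1"] exI[of _ "\<lambda>_. 0"]) (auto intro!: gspan_const gspan_zero)
next
  case (add m i)
  then obtain A F where AF: "gspan T e {..<n} u {mdeg m} (mdeg m * (E + 1)) A"
    "gspan T e UNIV D {Suc (mdeg m)..} (mdeg m * (E + 1)) F"
    "\<forall>z\<in>T. z $ e ^ (mdeg m * E) * (\<Prod>j\<in>UNIV. D j z ^ lkp m j) = A z + F z" by blast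
  define d where "d = mdeg m * (E + 1)"
  define L where "L z = z $ e ^ E * (\<Sum>l<n. q l $ i * u l z)" for z
  define f where "f z = z $ e ^ E * (D i z - (\<Sum>l<n. q l $ i * u l z))" for z
  have f: "gspan T e UNIV D {2..} (E + 1) f" unfolding f_def[abs_def] by (rule q)
  have "gspan T e {..<n} u {1} 1 (\<lambda>z. \<Sum>l<n. q l $ i * u l z)"
    by (intro gspan_sum gspan_scale gspan_D) simp_all
  from gspan_mult[OF _ _ gspan_coord_power0 this, of "{1}" E]
  have L: "gspan T e {..<n} u {1} (E + 1) L"
    unfolding L_def[abs_def] by simp
  have A': "gspan T e UNIV D {mdeg m..} d A"
    by (rule gspan_trans[OF _ _ u AF(1)[folded d_def]]) auto
  have L': "gspan T e UNIV D {1..} (E + 1) L"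
    by (rule gspan_trans[OF _ _ u L]) auto
  have "gspan T e {..<n} u {Suc (mdeg m)} (d + (E + 1)) (\<lambda>z. A z * L z)"
    by (rule gspan_mult[OF _ _ AF(1)[folded d_def] L]) auto
  moreover have "gspan T e UNIV D {Suc (Suc (mdeg m))..} (d + (E + 1)) (\<lambda>z. A z * f z + F z * (L z + f z))"
  proof (rule gspan_add)
    show "gspan T e UNIV D {Suc (Suc (mdeg m))..} (d + (E + 1)) (\<lambda>z. A z * f z)"
      by (rule gspan_mult[OF _ _ A' f]) auto
    have "gspan T e UNIV D {1..} (E + 1) (\<lambda>z. L z + f z)"
      by (rule gspan_add[OF L' gspan_mono[OF f]]) auto
    then show "gspan T e UNIV D {Suc (Suc (mdeg m))..} (d + (E + 1)) (\<lambda>z. F z * (L z + f z))"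
      by (rule gspan_mult[OF _ _ AF(2)[folded d_def], rotated 2]) auto
  qed
  moreover have "z $ e ^ (Suc (mdeg m) * E) * (\<Prod>j\<in>UNIV. D j z ^ lkp (m + Poly_Mapping.single i 1) j) =
      A z * L z + (A z * f z + F z * (L z + f z))" if "z \<in> T" for z
  proof -
    have "(\<Prod>j\<in>UNIV. D j z ^ lkp (m + Poly_Mapping.single i 1) j) =
        (\<Prod>j\<in>UNIV. D j z ^ lkp m j) * (\<Prod>j\<in>UNIV. if j = i then D i z else 1)"
      unfolding prod.distrib[symmetric] by (rule prod.cong) (auto simp: lookup_add lookup_single)
    then have "z $ e ^ (Suc (mdeg m) * E) * (\<Prod>j\<in>UNIV. D j z ^ lkp (m + Poly_Mapping.single i 1) j) =
        (z $ e ^ (mdeg m * E) * (\<Prod>j\<in>UNIV. D j z ^ lkp m j)) * (z $ e ^ E * D i z)"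
      by (simp add: power_add mult_ac)
    also have "\<dots> = (A z + F z) * (L z + f z)"
      using AF(3) that by (simp add: L_def f_def right_diff_distrib)
    finally show ?thesis by (simp add: algebra_simps)
  qed
  moreover have deg: "mdeg (m + Poly_Mapping.single i 1) = Suc (mdeg m)" by (simp add: mdeg_add)
  moreover have deg': "d + (E + 1) = Suc (mdeg m) * (E + 1)" by (simp add: d_def)
  ultimately show ?case unfolding deg deg'
    by (intro exI[of _ "\<lambda>z. A z * L z"] exI[of _ "\<lambda>z. A z * f z + F z * (L z + f z)"] conjI ballI)
qed

lemma gspan_reduction_step:
  fixes u :: "nat \<Rightarrow> 'k::field^'i::finite \<Rightarrow> 'k" and q :: "nat \<Rightarrow> 'k^'i"
  assumes u: "\<And>l. gspan T e UNIV D {1..} 1 (u l)"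
    and q: "\<And>j. gspan T e UNIV D {2..} (E + 1) (\<lambda>z. z $ e ^ E * (D j z - (\<Sum>l<n. q l $ j * u l z)))"
    and d: "m * (E + 1) \<le> d" and f: "gspan T e (UNIV :: 'i set) D {m..} d f"
  shows "\<exists>A F. gspan T e {..<n} u {m} d A \<and> gspan T e UNIV D {Suc m..} d F \<and> (\<forall>z\<in>T. f z = A z + F z)"
proof -
  obtain \<kappa> where \<kappa>: "\<forall>z\<in>T. f z = (\<Sum>\<gamma>\<in>gx UNIV {m..} d. \<kappa> \<gamma> * gm e UNIV D d \<gamma> z)" using f by (rule gspanE)
  have "\<exists>A F. gspan T e {..<n} u {m} d A \<and> gspan T e UNIV D {Suc m..} d F \<and>
      (\<forall>z\<in>T. gm e UNIV D d \<gamma> z = A z + F z)" if \<gamma>: "\<gamma> \<in> gx UNIV {m..} d" for \<gamma>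
  proof (cases "(\<Sum>j\<in>UNIV. \<gamma> j) = m")
    case True
    have m: "mdeg (mono_of \<gamma>) = m" using True by (simp add: mdeg_def)
    from gspan_monomial_reduction[where m = "mono_of \<gamma>", OF u q]
    obtain A F where AF: "gspan T e {..<n} u {m} (m * (E + 1)) A"
      "gspan T e (UNIV :: 'i set) D {Suc m..} (m * (E + 1)) F"
      "\<forall>z\<in>T. z $ e ^ (m * E) * (\<Prod>j\<in>UNIV. D j z ^ \<gamma> j) = A z + F z" unfolding m by auto
    define r where "r = d - m * (E + 1)"
    have d: "r + m * (E + 1) = d" using d by (simp add: r_def)
    have "gspan T e {..<n} u {m} (r + m * (E + 1)) (\<lambda>z. z $ e ^ r * A z)"
      by (rule gspan_mult[OF _ _ gspan_coord_power0 AF(1)]) simp_all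
    moreover have "gspan T e UNIV D {Suc m..} (r + m * (E + 1)) (\<lambda>z. z $ e ^ r * F z)"
      by (rule gspan_mult[OF _ _ gspan_coord_power AF(2)]) auto
    moreover have "gm e UNIV D d \<gamma> z = z $ e ^ r * A z + z $ e ^ r * F z" if "z \<in> T" for z
    proof -
      have "d - m = r + m * E" using d by (simp add: algebra_simps)
      then have "gm e UNIV D d \<gamma> z = z $ e ^ r * (z $ e ^ (m * E) * (\<Prod>j\<in>UNIV. D j z ^ \<gamma> j))"
        by (simp add: gm_def True power_add)
      then show ?thesis using AF(3) that by (simp add: distrib_left)
    qed
    ultimately show ?thesis unfolding d by (intro exI[of _ "\<lambda>z. z $ e ^ r * A z"] exI[of _ "\<lambda>z. z $ e ^ r * F z"]) simp
  next
    case False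
    then have "\<gamma> \<in> gx UNIV {Suc m..} d" using \<gamma> by (auto simp: gx_def)
    then have "gspan T e UNIV D {Suc m..} d (gm e UNIV D d \<gamma>)" by (intro gspan_base) auto
    then show ?thesis
      by (intro exI[of _ "\<lambda>_. 0"] exI[of _ "gm e UNIV D d \<gamma>"]) (auto intro: gspan_zero)
  qed
  then have "\<forall>\<gamma>\<in>gx UNIV {m..} d. \<exists>A F. gspan T e {..<n} u {m} d A \<and> gspan T e UNIV D {Suc m..} d F \<and>
      (\<forall>z\<in>T. gm e UNIV D d \<gamma> z = A z + F z)" by blast
  from bchoice[OF this] obtain A where "\<forall>\<gamma>\<in>gx UNIV {m..} d. \<exists>F. gspan T e {..<n} u {m} d (A \<gamma>) \<and>
      gspan T e UNIV D {Suc m..} d F \<and> (\<forall>z\<in>T. gm e UNIV D d \<gamma> z = A \<gamma> z + F z)" by blast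
  from bchoice[OF this] obtain F where AF: "\<forall>\<gamma>\<in>gx UNIV {m..} d. gspan T e {..<n} u {m} d (A \<gamma>) \<and>
      gspan T e UNIV D {Suc m..} d (F \<gamma>) \<and> (\<forall>z\<in>T. gm e UNIV D d \<gamma> z = A \<gamma> z + F \<gamma> z)" by blast
  have "gspan T e {..<n} u {m} d (\<lambda>z. \<Sum>\<gamma>\<in>gx UNIV {m..} d. \<kappa> \<gamma> * A \<gamma> z)"
    by (intro gspan_sum gspan_scale) (use AF in blast)
  moreover have "gspan T e UNIV D {Suc m..} d (\<lambda>z. \<Sum>\<gamma>\<in>gx UNIV {m..} d. \<kappa> \<gamma> * F \<gamma> z)"
    by (intro gspan_sum gspan_scale) (use AF in blast)
  moreover have "f z = (\<Sum>\<gamma>\<in>gx UNIV {m..} d. \<kappa> \<gamma> * A \<gamma> z) + (\<Sum>\<gamma>\<in>gx UNIV {m..} d. \<kappa> \<gamma> * F \<gamma> z)"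
    if z: "z \<in> T" for z
  proof -
    have "f z = (\<Sum>\<gamma>\<in>gx UNIV {m..} d. \<kappa> \<gamma> * A \<gamma> z + \<kappa> \<gamma> * F \<gamma> z)"
      unfolding \<kappa>[rule_format, OF z]
      by (rule sum.cong) (use AF z in \<open>simp_all add: distrib_left\<close>)
    then show ?thesis by (simp add: sum.distrib)
  qed
  ultimately show ?thesis by blast
qed

text \<open>Iterating over the orders 0, ..., k leaves a polynomial of degree at most k in the
  \<open>u l\<close> modulo order k + 1. This is the upper bound for the space of jets.\<close>

lemma gspan_reduction:
  fixes u :: "nat \<Rightarrow> 'k::field^'i::finite \<Rightarrow> 'k" and q :: "nat \<Rightarrow> 'k^'i"
  assumes u: "\<And>l. gspan T e UNIV D {1..} 1 (u l)"
    and q: "\<And>j. gspan T e UNIV D {2..} (E + 1) (\<lambda>z. z $ e ^ E * (D j z - (\<Sum>l<n. q l $ j * u l z)))"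
    and d: "k * (E + 1) \<le> d" and f: "gspan T e (UNIV :: 'i set) D {0..} d f" and m: "m \<le> Suc k"
  shows "\<exists>A F. gspan T e {..<n} u {..k} d A \<and> gspan T e UNIV D {m..} d F \<and> (\<forall>z\<in>T. f z = A z + F z)"
  using m
proof (induction m)
  case 0
  show ?case by (intro exI[of _ "\<lambda>_. 0"] exI[of _ f]) (use f in \<open>auto intro: gspan_zero\<close>)
next
  case (Suc m)
  then obtain A F where AF: "gspan T e {..<n} u {..k} d A" "gspan T e (UNIV :: 'i set) D {m..} d F"
    "\<forall>z\<in>T. f z = A z + F z" by auto
  have "m * (E + 1) \<le> k * (E + 1)" using Suc.prems by (intro mult_le_mono1) simp
  then have "m * (E + 1) \<le> d" using d by simp
  from gspan_reduction_step[OF u q this AF(2)] obtain A' F' where AF': "gspan T e {..<n} u {m} d A'"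
    "gspan T e UNIV D {Suc m..} d F'" "\<forall>z\<in>T. F z = A' z + F' z" by blast
  have "gspan T e {..<n} u {..k} d (\<lambda>z. A z + A' z)"
    by (rule gspan_add[OF AF(1) gspan_mono[OF AF'(1)]]) (use Suc.prems in auto)
  then show ?case using AF' AF(3)
    by (intro exI[of _ "\<lambda>z. A z + A' z"] exI[of _ F']) (simp add: add.assoc)
qed

section \<open>Forms with independent jets\<close>

lemma exponents_gx: "exponents n k = gx {..<n} {..k} k"
  by (auto simp: exponents_def gx_def vecs_def not_less)

lemma gx_exponents: "k \<le> d \<Longrightarrow> gx {..<n} {..k} d = exponents n k"
  by (auto simp: exponents_def gx_def vecs_def not_less)

lemma finite_exponents: "finite (exponents n k)"
  by (simp add: exponents_gx finite_gx)

text \<open>The map \<open>\<mu>\<close> need not be injective, so coefficients of coinciding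
  monomials are collected first.\<close>

lemma sum_keys_combination:
  fixes \<mu> :: "'s \<Rightarrow> ('i::finite \<Rightarrow>\<^sub>0 nat)" and \<kappa> :: "'s \<Rightarrow> 'k::field"
  shows "(\<Sum>m\<in>pkeys (\<Sum>a\<in>S. cpoly (\<kappa> a) * mon (\<mu> a)). lkp (\<Sum>a\<in>S. cpoly (\<kappa> a) * mon (\<mu> a)) m * G m)
    = (\<Sum>a\<in>S. \<kappa> a * G (\<mu> a))"
proof (cases "finite S")
  case True
  let ?p = "\<Sum>a\<in>S. cpoly (\<kappa> a) * mon (\<mu> a)"
  have single: "cpoly (\<kappa> a) * mon (\<mu> a) = Poly_Mapping.single (\<mu> a) (\<kappa> a)" for a
    by (simp add: cpoly_def mon_def mult_single)
  have "pkeys ?p \<subseteq> \<mu> ` S"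
    using keys_sum[of "\<lambda>a. cpoly (\<kappa> a) * mon (\<mu> a)" S] unfolding single by (auto split: if_splits)
  then have "(\<Sum>m\<in>pkeys ?p. lkp ?p m * G m) = (\<Sum>m\<in>\<mu> ` S. lkp ?p m * G m)"
    using True by (intro sum.mono_neutral_left) (auto simp: in_keys_iff)
  also have "\<dots> = (\<Sum>m\<in>\<mu> ` S. \<Sum>a\<in>{a\<in>S. \<mu> a = m}. \<kappa> a * G (\<mu> a))"
  proof (rule sum.cong)
    fix m
    have "lkp ?p m = (\<Sum>a\<in>S. if \<mu> a = m then \<kappa> a else 0)"
      unfolding single lookup_sum by (rule sum.cong) (auto simp: lookup_single when_def)
    also have "\<dots> = (\<Sum>a\<in>{a\<in>S. \<mu> a = m}. \<kappa> a)" using True by (simp add: sum.inter_filter)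
    finally show "lkp ?p m * G m = (\<Sum>a\<in>{a\<in>S. \<mu> a = m}. \<kappa> a * G (\<mu> a))"
      by (simp add: sum_distrib_right)
  qed simp
  also have "\<dots> = (\<Sum>a\<in>S. \<kappa> a * G (\<mu> a))" by (rule sum.group) (use True in auto)
  finally show ?thesis .
qed simp

text \<open>The unisolvence of the simplex grid: evaluate products of binomial polynomials at an exponent
  of maximal size.\<close>

lemma grid_unisolvent:
  fixes \<kappa> :: "(nat \<Rightarrow> nat) \<Rightarrow> 'k::field_char_0" and c :: "nat \<Rightarrow> int"
  assumes zero: "\<And>\<beta>. \<beta> \<in> exponents n k \<Longrightarrow>
      (\<Sum>\<gamma>\<in>exponents n k. \<kappa> \<gamma> * (\<Prod>l<n. of_int (c l + int (\<gamma> l)) ^ \<beta> l)) = 0"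
    and \<gamma>: "\<gamma> \<in> exponents n k"
  shows "\<kappa> \<gamma> = 0"
proof (rule ccontr)
  assume "\<kappa> \<gamma> \<noteq> 0"
  define S where "S = {\<gamma> \<in> exponents n k. \<kappa> \<gamma> \<noteq> 0}"
  have S: "finite S" "S \<noteq> {}" using \<open>\<kappa> \<gamma> \<noteq> 0\<close> \<gamma> finite_exponents by (auto simp: S_def)
  define r where "r \<gamma> = (\<Sum>l<n. \<gamma> l)" for \<gamma> :: "nat \<Rightarrow> nat"
  have "Max (r ` S) \<in> r ` S" using S by (intro Max_in) auto
  then obtain \<gamma>0 where \<gamma>0S: "\<gamma>0 \<in> S" "Max (r ` S) = r \<gamma>0" by blast
  have "r \<gamma> \<le> r \<gamma>0" if "\<gamma> \<in> S" for \<gamma>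
    unfolding \<gamma>0S(2)[symmetric] using S(1) that by (intro Max_ge) auto
  note \<gamma>0 = \<gamma>0S(1) this
  \<comment> \<open>The polynomial x -> binomial(x - c_l, \<open>\<gamma>0 l\<close>), which
    vanishes at every grid point whose coordinate \<open>l\<close> is below
    \<open>\<gamma>0 l\<close>.\<close>
  define F :: "nat \<Rightarrow> 'k poly" where "F l = pcompose (binomial_poly 0 (\<gamma>0 l)) [:- of_int (c l), 1:]" for l
  have F: "poly (F l) (of_int (c l + int a)) = of_nat (a choose \<gamma>0 l)" for l a
    unfolding F_def poly_pcompose by (rule poly_binomial_poly) simp
  have "(\<Sum>l<n. degree (F l)) \<le> (\<Sum>l<n. \<gamma>0 l)"
    unfolding F_def by (intro sum_mono) (simp add: degree_pcompose degree_binomial_poly)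
  then have "(\<Sum>l<n. degree (F l)) \<le> k" using \<gamma>0(1) by (simp add: S_def exponents_def)
  with zero have "(\<Sum>\<gamma>\<in>exponents n k. \<kappa> \<gamma> * (\<Prod>l<n. poly (F l) (of_int (c l + int (\<gamma> l))))) = 0"
    by (rule killed_polynomials)
  then have "(\<Sum>\<gamma>\<in>exponents n k. \<kappa> \<gamma> * (\<Prod>l<n. of_nat (\<gamma> l choose \<gamma>0 l))) = 0" unfolding F .
  moreover have "(\<Sum>\<gamma>\<in>exponents n k. \<kappa> \<gamma> * (\<Prod>l<n. of_nat (\<gamma> l choose \<gamma>0 l))) =
      (\<Sum>\<gamma>\<in>{\<gamma>0}. \<kappa> \<gamma> * (\<Prod>l<n. of_nat (\<gamma> l choose \<gamma>0 l)))"
  proof (rule sum.mono_neutral_right)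
    show "\<forall>\<gamma>\<in>exponents n k - {\<gamma>0}. \<kappa> \<gamma> * (\<Prod>l<n. of_nat (\<gamma> l choose \<gamma>0 l)) = 0"
    proof (rule ballI, rule ccontr)
      fix \<gamma> assume \<gamma>: "\<gamma> \<in> exponents n k - {\<gamma>0}" and nz: "\<kappa> \<gamma> * (\<Prod>l<n. of_nat (\<gamma> l choose \<gamma>0 l)) \<noteq> 0"
      then have le: "\<gamma>0 l \<le> \<gamma> l" if "l < n" for l using that by (auto simp: not_le[symmetric] binomial_eq_0)
      have "\<gamma> \<in> S" using \<gamma> nz by (auto simp: S_def)
      then have "(\<Sum>l<n. \<gamma> l) \<le> (\<Sum>l<n. \<gamma>0 l)" using \<gamma>0(2) by (simp add: r_def)
      moreover have "(\<Sum>l<n. \<gamma>0 l) \<le> (\<Sum>l<n. \<gamma> l)" by (rule sum_mono) (use le in simp)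
      ultimately have sum_eq: "(\<Sum>l<n. \<gamma>0 l) = (\<Sum>l<n. \<gamma> l)" by simp
      have "\<gamma>0 l = \<gamma> l" if "l < n" for l
        by (rule sum_mono_inv[OF sum_eq]) (use le that in auto)
      then have "\<gamma> l = \<gamma>0 l" for l
        using \<gamma> \<gamma>0(1) by (cases "l < n") (auto simp: S_def exponents_def vecs_def)
      then have "\<gamma> = \<gamma>0" by (rule ext)
      then show False using \<gamma> by simp
    qed
  qed (use \<gamma>0(1) finite_exponents in \<open>auto simp: S_def\<close>)
  ultimately show False using \<gamma>0(1) by (simp add: S_def)
qed

context toric
begin

text \<open>The monomials are chosen so that their weights form a translated simplex grid; vanishing
  moments up to order k then force all coefficients to be zero by \<open>grid_unisolvent\<close>.
  This is the lower bound for jets at torus points.\<close>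

lemma independent_jets:
  "\<exists>d1. \<forall>d\<ge>d1. \<exists>\<mu> :: (nat \<Rightarrow> nat) \<Rightarrow> ('i \<Rightarrow>\<^sub>0 nat).
    (\<forall>\<gamma>\<in>exponents (N - 1) k. mdeg (\<mu> \<gamma>) = d) \<and>
    (\<forall>(y::'k::field_char_0^'i)\<in>T. \<forall>\<kappa>. ordc (Suc k) y (\<Sum>\<gamma>\<in>exponents (N - 1) k. cpoly (\<kappa> \<gamma>) * mon (\<mu> \<gamma>)) \<longrightarrow>
      (\<forall>\<gamma>\<in>exponents (N - 1) k. \<kappa> \<gamma> = 0))"
proof -
  define n where "n = N - 1"
  define e :: 'i where "e = undefined"
  define pm where "pm j = pos_mono (C (Suc j))" for j
  define nm where "nm j = neg_mono (C (Suc j))" for j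
  define d1 where "d1 = (\<Sum>j<n. k * mdeg (pm j))"
  have deg: "mdeg (pm j) = mdeg (nm j)" if "j < n" for j
  proof -
    have "(\<Sum>i\<in>UNIV. C (Suc j) i * \<alpha> i 0) = 0" using C[of "Suc j" 0] that by (simp add: n_def)
    then show ?thesis using mdeg_pos_neg[of "C (Suc j)"] by (simp add: alpha_0 pm_def nm_def)
  qed
  have w: "wt \<alpha> (pm j) (Suc l) - wt \<alpha> (nm j) (Suc l) = (if l = j then 1 else 0)" if "j < n" for j l
  proof -
    have "wt \<alpha> (pm j) (Suc l) - wt \<alpha> (nm j) (Suc l) = (\<Sum>i\<in>UNIV. C (Suc j) i * \<alpha> i (Suc l))"
      unfolding wt_def pm_def nm_def pos_mono_def neg_mono_def sum_subtractf[symmetric] left_diff_distrib[symmetric]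
      by (rule sum.cong) auto
    then show ?thesis using C[of "Suc j" "Suc l"] that by (simp add: n_def)
  qed
  have "\<exists>\<mu> :: (nat \<Rightarrow> nat) \<Rightarrow> ('i \<Rightarrow>\<^sub>0 nat). (\<forall>\<gamma>\<in>exponents n k. mdeg (\<mu> \<gamma>) = d) \<and>
      (\<forall>(y::'k^'i)\<in>T. \<forall>\<kappa>. ordc (Suc k) y (\<Sum>\<gamma>\<in>exponents n k. cpoly (\<kappa> \<gamma>) * mon (\<mu> \<gamma>)) \<longrightarrow>
        (\<forall>\<gamma>\<in>exponents n k. \<kappa> \<gamma> = 0))" if d: "d \<ge> d1" for d
  proof -
    \<comment> \<open>Numerators \<open>\<gamma> j\<close> times and denominators
      \<open>k - \<gamma> j\<close> times give the same total degree for all exponents; the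
      arbitrary variable \<open>e\<close> fills up to \<open>d\<close>.\<close>
    define \<mu> where "\<mu> \<gamma> = mono_of (\<lambda>i. (\<Sum>j<n. \<gamma> j * lkp (pm j) i + (k - \<gamma> j) * lkp (nm j) i) +
      (if i = e then d - d1 else 0))" for \<gamma> :: "nat \<Rightarrow> nat"
    define c where "c l = (\<Sum>j<n. int k * wt \<alpha> (nm j) (Suc l)) + int (d - d1) * \<alpha> e (Suc l)" for l
    have le: "\<gamma> j \<le> k" if "\<gamma> \<in> exponents n k" "j < n" for \<gamma> j
      using that member_le_sum[of j "{..<n}" \<gamma>] by (auto simp: exponents_def)
    have mdeg: "mdeg (\<mu> \<gamma>) = d" if \<gamma>: "\<gamma> \<in> exponents n k" for \<gamma>
    proof -
      have "mdeg (\<mu> \<gamma>) = (\<Sum>i\<in>UNIV. \<Sum>j<n. \<gamma> j * lkp (pm j) i + (k - \<gamma> j) * lkp (nm j) i) + (d - d1)"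
        by (simp add: mdeg_def \<mu>_def sum.distrib)
      also have "(\<Sum>i\<in>UNIV. \<Sum>j<n. \<gamma> j * lkp (pm j) i + (k - \<gamma> j) * lkp (nm j) i) =
          (\<Sum>j<n. \<gamma> j * mdeg (pm j) + (k - \<gamma> j) * mdeg (nm j))"
        by (subst sum.swap) (simp add: mdeg_def sum.distrib sum_distrib_left)
      also have "\<dots> = d1"
        unfolding d1_def
        by (rule sum.cong) (use le[OF \<gamma>] deg in \<open>auto simp: add_mult_distrib[symmetric]\<close>)
      finally show ?thesis using d by simp
    qed
    have wt: "wt \<alpha> (\<mu> \<gamma>) (Suc l) = c l + int (\<gamma> l)" if \<gamma>: "\<gamma> \<in> exponents n k" and l: "l < n" for \<gamma> l
    proof -
      have t: "int (lkp (\<mu> \<gamma>) i) = (\<Sum>j<n. int (\<gamma> j * lkp (pm j) i + (k - \<gamma> j) * lkp (nm j) i)) +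
          (if i = e then int (d - d1) else 0)" for i by (simp add: \<mu>_def)
      have "wt \<alpha> (\<mu> \<gamma>) (Suc l) =
          (\<Sum>i\<in>UNIV. (\<Sum>j<n. int (\<gamma> j * lkp (pm j) i + (k - \<gamma> j) * lkp (nm j) i)) * \<alpha> i (Suc l)) +
          (\<Sum>i\<in>UNIV. (if i = e then int (d - d1) else 0) * \<alpha> i (Suc l))"
        by (simp only: wt_def t distrib_right sum.distrib)
      also have "(\<Sum>i\<in>UNIV. (if i = e then int (d - d1) else 0) * \<alpha> i (Suc l)) = int (d - d1) * \<alpha> e (Suc l)"
        by (simp add: if_distrib[of "\<lambda>c. c * _"] cong: if_cong)
      also have "(\<Sum>i\<in>UNIV. (\<Sum>j<n. int (\<gamma> j * lkp (pm j) i + (k - \<gamma> j) * lkp (nm j) i)) * \<alpha> i (Suc l)) =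
          (\<Sum>j<n. int (\<gamma> j) * wt \<alpha> (pm j) (Suc l) + int (k - \<gamma> j) * wt \<alpha> (nm j) (Suc l))"
        unfolding sum_distrib_right
        by (subst sum.swap) (simp add: wt_def sum.distrib sum_distrib_left distrib_right mult.assoc)
      also have "\<dots> = (\<Sum>j<n. int k * wt \<alpha> (nm j) (Suc l) + (if j = l then int (\<gamma> l) else 0))"
      proof (rule sum.cong)
        fix j assume "j \<in> {..<n}"
        then have j: "j < n" by simp
        have k: "int (k - \<gamma> j) = int k - int (\<gamma> j)" using le[OF \<gamma> j] by simp
        have p: "wt \<alpha> (pm j) (Suc l) = wt \<alpha> (nm j) (Suc l) + (if l = j then 1 else 0)" using w[OF j, of l] by simp
        show "int (\<gamma> j) * wt \<alpha> (pm j) (Suc l) + int (k - \<gamma> j) * wt \<alpha> (nm j) (Suc l) =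
            int k * wt \<alpha> (nm j) (Suc l) + (if j = l then int (\<gamma> l) else 0)"
          unfolding k p by (auto simp: algebra_simps)
      qed simp
      finally show ?thesis using l by (simp add: c_def sum.distrib)
    qed
    have "\<kappa> \<gamma> = 0"
      if y: "y \<in> T" and ord: "ordc (Suc k) y (\<Sum>\<gamma>\<in>exponents n k. cpoly (\<kappa> \<gamma>) * mon (\<mu> \<gamma>))"
        and \<gamma>: "\<gamma> \<in> exponents n k" for y :: "'k^'i" and \<kappa> \<gamma>
    proof -
      have hom: "hdeg d (\<Sum>\<gamma>\<in>exponents n k. cpoly (\<kappa> \<gamma>) * mon (\<mu> \<gamma>))"
        by (intro hdeg_sum hdeg_cmult) (use mdeg hdeg_mon in metis)
      have "\<kappa> \<gamma> * meval (\<mu> \<gamma>) y = 0"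
      proof (rule grid_unisolvent[OF _ \<gamma>, where \<kappa> = "\<lambda>\<gamma>. \<kappa> \<gamma> * meval (\<mu> \<gamma>) y" and c = c])
        fix \<beta> assume "\<beta> \<in> exponents n k"
        then have "(\<Sum>j<N - 1. \<beta> j) \<le> k" by (simp add: exponents_def n_def)
        from ordc_moments[OF ord hom this]
        have "(\<Sum>\<gamma>\<in>exponents n k. \<kappa> \<gamma> * (meval (\<mu> \<gamma>) y * (\<Prod>l<n. of_int (wt \<alpha> (\<mu> \<gamma>) (Suc l)) ^ \<beta> l))) = 0"
          using sum_keys_combination[of \<kappa> \<mu> "exponents n k" "\<lambda>m. meval m y * (\<Prod>l<n. of_int (wt \<alpha> m (Suc l)) ^ \<beta> l)"]
          by (simp add: mult.assoc n_def)
        moreover have "(\<Prod>l<n. of_int (wt \<alpha> (\<mu> \<gamma>) (Suc l)) ^ \<beta> l) = (\<Prod>l<n. (of_int (c l + int (\<gamma> l)) :: 'k) ^ \<beta> l)"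
          if "\<gamma> \<in> exponents n k" for \<gamma>
          by (rule prod.cong) (use wt[OF that] in simp_all)
        ultimately show "(\<Sum>\<gamma>\<in>exponents n k. \<kappa> \<gamma> * meval (\<mu> \<gamma>) y * (\<Prod>l<n. of_int (c l + int (\<gamma> l)) ^ \<beta> l)) = 0"
          by (simp add: mult.assoc)
      qed
      then show ?thesis using meval_nonzero[of y "\<mu> \<gamma>"] tcone_nonzero[OF y] by simp
    qed
    then show ?thesis using mdeg by blast
  qed
  then show ?thesis unfolding n_def by blast
qed

end

section \<open>Jet kernels near a smooth point\<close>

definition dev_form :: "'i::finite \<Rightarrow> 'k::field^'i \<Rightarrow> nat \<Rightarrow> ('i \<Rightarrow> nat) \<Rightarrow> ('k, 'i) mpoly" where
  "dev_form e y d \<gamma> = vpoly e ^ (d - (\<Sum>j\<in>UNIV. \<gamma> j)) *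
    (\<Prod>j\<in>UNIV. (cpoly (y $ e) * vpoly j - cpoly (y $ j) * vpoly e) ^ \<gamma> j)"

lemma eval_dev_form: "mpoly_eval (dev_form e y d \<gamma>) z = gm e UNIV (dev e y) d \<gamma> z"
  by (simp add: dev_form_def gm_def dev_def)

lemma hdeg_dev_form:
  assumes "(\<Sum>j\<in>UNIV. \<gamma> j) \<le> d" shows "hdeg d (dev_form e y d \<gamma>)"
proof -
  have "hdeg ((d - (\<Sum>j\<in>UNIV. \<gamma> j)) * 1 + (\<Sum>j\<in>UNIV. \<gamma> j * 1)) (dev_form e y d \<gamma>)"
    unfolding dev_form_def
    by (intro hdeg_mult hdeg_power hdeg_vpoly hdeg_prod hdeg_minus hdeg_cmult)
  then show ?thesis using assms by simp
qed

lemma dev_form_ideal_power: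
  assumes "m \<le> (\<Sum>j\<in>UNIV. \<gamma> j)"
  shows "dev_form e y d \<gamma> \<in> ideal_power (vanishing_ideal (proj_point y)) m"
proof -
  have "(\<Prod>j\<in>UNIV. (cpoly (y $ e) * vpoly j - cpoly (y $ j) * vpoly e) ^ \<gamma> j) \<in>
      ideal_power (vanishing_ideal (proj_point y)) (\<Sum>j\<in>UNIV. \<gamma> j)"
    by (rule ideal_power_prod) (auto simp: vanishing_ideal_def proj_point_def)
  then show ?thesis unfolding dev_form_def
    by (intro ideal_power_lmult subsetD[OF ideal_power_le[OF assms]])
qed

lemma reg_dev_form: "reg T x (\<lambda>y. gm e UNIV (dev e y) d \<gamma> z) (gm e UNIV (dev e x) d \<gamma> z)"
  unfolding gm_def dev_def
  by (intro reg_mult reg_const reg_prod reg_power reg_minus reg_coord)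

text \<open>The span of a dual family is a complement of the annihilator.\<close>

lemma dim_annihilator:
  fixes v :: "'j \<Rightarrow> 'i::finite \<Rightarrow> 'k::field"
  assumes J: "finite J" and ind: "indep J UNIV v"
  shows "vec.dim {h :: 'k^'i. \<forall>j\<in>J. pair UNIV (v j) (vec_nth h) = 0} + card J = CARD('i)"
proof -
  have "\<forall>j\<in>J. \<exists>\<xi>. (\<forall>l\<in>J - {j}. pair UNIV \<xi> (v l) = 0) \<and> pair UNIV \<xi> (v j) = 1"
    using indep_dual[OF ind J finite] by blast
  from bchoice[OF this] obtain \<xi> where \<xi>0: "\<forall>j\<in>J. (\<forall>l\<in>J - {j}. pair UNIV (\<xi> j) (v l) = 0) \<and> pair UNIV (\<xi> j) (v j) = 1"
    by blast
  have \<xi>: "pair UNIV (v l) (\<xi> j) = (if l = j then 1 else 0)" if "j \<in> J" "l \<in> J" for j l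
    using \<xi>0 that by (subst pair_commute) auto
  define g :: "'j \<Rightarrow> 'k^'i" where "g j = (\<chi> i. \<xi> j i)" for j
  have g: "pair UNIV (v l) (vec_nth (g j)) = (if l = j then 1 else 0)" if "j \<in> J" "l \<in> J" for j l
    using \<xi>[OF that] by (simp add: g_def pair_def)
  define S where "S = {h :: 'k^'i. \<forall>j\<in>J. pair UNIV (v j) (vec_nth h) = 0}"
  define V where "V = vec.span (g ` J)"
  have psum: "pair UNIV (v l) (vec_nth (\<Sum>j\<in>J. c j *s g j)) = c l" if "l \<in> J" for c l
  proof -
    have "pair UNIV (v l) (vec_nth (\<Sum>j\<in>J. c j *s g j)) = pair UNIV (v l) (\<lambda>i. \<Sum>j\<in>J. c j * g j $ i)"
      by (rule pair_cong) simp
    also have "\<dots> = (\<Sum>j\<in>J. c j * pair UNIV (v l) (vec_nth (g j)))" by (rule pair_sum)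
    also have "\<dots> = (\<Sum>j\<in>J. if j = l then c j else 0)" by (rule sum.cong) (auto simp: g that)
    finally show ?thesis using J that by simp
  qed
  have inV: "(\<Sum>j\<in>J. c j *s g j) \<in> V" for c
    unfolding V_def by (intro vec.span_sum vec.span_scale vec.span_base imageI)
  have indg: "indep J UNIV (\<lambda>j. vec_nth (g j))"
    unfolding indep_def
  proof (intro allI impI ballI)
    fix \<kappa> j assume "\<forall>i\<in>UNIV. (\<Sum>j\<in>J. \<kappa> j * g j $ i) = 0" and j: "j \<in> J"
    then have "(\<Sum>j\<in>J. \<kappa> j *s g j) = 0" by (simp add: vec_eq_iff)
    then show "\<kappa> j = 0" using psum[OF j, of \<kappa>] by (simp add: pair_def)
  qed
  have V_repr: "\<exists>c. h = (\<Sum>j\<in>J. c j *s g j)" if "h \<in> V" for h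
  proof -
    have "vec.subspace (range (\<lambda>c. \<Sum>j\<in>J. c j *s g j))"
      unfolding vec.subspace_def
    proof (intro conjI ballI allI)
      show "0 \<in> range (\<lambda>c. \<Sum>j\<in>J. c j *s g j)" by (rule image_eqI[of _ _ "\<lambda>_. 0"]) auto
      fix a assume "a \<in> range (\<lambda>c. \<Sum>j\<in>J. c j *s g j)"
      then obtain c where a: "a = (\<Sum>j\<in>J. c j *s g j)" by blast
      { fix s show "s *s a \<in> range (\<lambda>c. \<Sum>j\<in>J. c j *s g j)"
          by (rule image_eqI[of _ _ "\<lambda>j. s * c j"]) (auto simp: a vec_eq_iff sum_distrib_left mult.assoc) }
      fix b assume "b \<in> range (\<lambda>c. \<Sum>j\<in>J. c j *s g j)"
      then obtain c' where b: "b = (\<Sum>j\<in>J. c' j *s g j)" by blast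
      show "a + b \<in> range (\<lambda>c. \<Sum>j\<in>J. c j *s g j)"
        by (rule image_eqI[of _ _ "\<lambda>j. c j + c' j"]) (auto simp: a b vec_eq_iff sum.distrib distrib_right)
    qed
    moreover have "g j \<in> range (\<lambda>c. \<Sum>j\<in>J. c j *s g j)" if "j \<in> J" for j
      by (rule image_eqI[of _ _ "\<lambda>l. if l = j then 1 else 0"])
         (use that J in \<open>auto simp: vec_eq_iff if_distrib[of "\<lambda>c. c * _"] cong: if_cong\<close>)
    ultimately have "V \<subseteq> range (\<lambda>c. \<Sum>j\<in>J. c j *s g j)" unfolding V_def by (intro vec.span_minimal) auto
    then show ?thesis using that by blast
  qed
  have subS: "vec.subspace S"
    unfolding vec.subspace_def S_def pair_def
    by (auto simp: distrib_left sum.distrib mult.left_commute[of _ "_::'k"] sum_distrib_left[symmetric])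
  have "S \<inter> V = {0}"
  proof
    show "S \<inter> V \<subseteq> {0}"
    proof
      fix h assume h: "h \<in> S \<inter> V"
      then obtain c where c: "h = (\<Sum>j\<in>J. c j *s g j)" using V_repr by blast
      have "c j = 0" if "j \<in> J" for j using psum[OF that, of c] h that by (simp add: S_def c[symmetric])
      then show "h \<in> {0}" by (simp add: c)
    qed
    show "{0} \<subseteq> S \<inter> V" using vec.subspace_0[OF subS] by (simp add: V_def vec.span_zero)
  qed
  moreover have "{a + b | a b. a \<in> S \<and> b \<in> V} = UNIV"
  proof (intro equalityI subsetI UNIV_I CollectI)
    fix h :: "'k^'i"
    define b where "b = (\<Sum>j\<in>J. pair UNIV (v j) (vec_nth h) *s g j)"
    have "h - b \<in> S"
      unfolding S_def
    proof (intro CollectI ballI)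
      fix j assume j: "j \<in> J"
      have "pair UNIV (v j) (vec_nth (h - b)) = pair UNIV (v j) (vec_nth h) - pair UNIV (v j) (vec_nth b)"
        by (simp add: pair_def right_diff_distrib sum_subtractf)
      then show "pair UNIV (v j) (vec_nth (h - b)) = 0" using psum[OF j] by (simp add: b_def)
    qed
    then show "\<exists>a c. h = a + c \<and> a \<in> S \<and> c \<in> V" using inV
      by (intro exI[of _ "h - b"] exI[of _ b]) (simp add: b_def)
  qed
  ultimately have "vec.dim (UNIV :: ('k^'i) set) + vec.dim {0 :: 'k^'i} = vec.dim S + vec.dim V"
    using vec.dim_sums_Int[OF subS, of V] by (simp add: V_def vec.subspace_span)
  moreover have "vec.dim V = card J" unfolding V_def by (rule vec_dim_span_indep[OF J indg])
  moreover have "vec.dim {0 :: 'k^'i} = 0" by simp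
  ultimately have "vec.dim (UNIV :: ('k^'i) set) = vec.dim S + card J" by simp
  then show ?thesis by (simp only: S_def vec_dim_card)
qed

lemma in_span_subset: "in_span J T v w \<Longrightarrow> P \<subseteq> T \<Longrightarrow> in_span J P v w"
  unfolding in_span_def by blast

lemma in_span_reindex:
  assumes "inj_on f J" shows "in_span (f ` J) P v w \<longleftrightarrow> in_span J P (\<lambda>j. v (f j)) w"
proof
  assume "in_span (f ` J) P v w"
  then obtain \<kappa> where "\<forall>z\<in>P. w z = (\<Sum>j\<in>f ` J. \<kappa> j * v j z)" unfolding in_span_def by blast
  then show "in_span J P (\<lambda>j. v (f j)) w"
    unfolding in_span_def using assms by (intro exI[of _ "\<lambda>j. \<kappa> (f j)"]) (simp add: sum.reindex)
next
  assume "in_span J P (\<lambda>j. v (f j)) w"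
  then obtain \<kappa> where "\<forall>z\<in>P. w z = (\<Sum>j\<in>J. \<kappa> j * v (f j) z)" unfolding in_span_def by blast
  then show "in_span (f ` J) P v w"
    unfolding in_span_def using assms
    by (intro exI[of _ "\<lambda>j. \<kappa> (inv_into J f j)"]) (simp add: sum.reindex)
qed

lemma indep_reindex:
  assumes f: "inj_on f J" and ind: "indep J P (\<lambda>j. v (f j))"
  shows "indep (f ` J) P v"
  unfolding indep_def
proof (intro allI impI ballI)
  fix \<kappa> l assume z: "\<forall>z\<in>P. (\<Sum>j\<in>f ` J. \<kappa> j * v j z) = 0" and "l \<in> f ` J"
  then obtain j where j: "l = f j" "j \<in> J" by blast
  have "\<kappa> (f j) = 0"
    by (rule indepD[OF ind _ j(2), of "\<lambda>j. \<kappa> (f j)"]) (use z f in \<open>simp add: sum.reindex\<close>)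
  then show "\<kappa> l = 0" by (simp add: j)
qed

lemma indep_of_independent:
  fixes B :: "('k::field^'i::finite) set"
  assumes "vec.independent B" shows "indep B UNIV vec_nth"
  unfolding indep_def
proof (intro allI impI ballI)
  fix \<kappa> b assume z: "\<forall>i\<in>UNIV. (\<Sum>b\<in>B. \<kappa> b * b $ i) = 0" and b: "b \<in> B"
  then have "(\<Sum>b\<in>B. \<kappa> b *s b) = 0" by (simp add: vec_eq_iff)
  then show "\<kappa> b = 0"
    using vec.independentD[OF assms vec.finiteI_independent[OF assms] order_refl _ b] by blast
qed

context toric
begin

text \<open>An equation \<open>N0\<close> at \<open>x\<close> that extends to a regular family of
  equations holding on the jet kernels at nearby torus points.\<close>

definition admissible :: "nat \<Rightarrow> 'k::field_char_0^'i \<Rightarrow> ('i \<Rightarrow> 'k) \<Rightarrow> bool" where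
  "admissible k x N0 \<longleftrightarrow> (\<exists>Nf. (\<forall>i. reg T x (\<lambda>y. Nf y i) (N0 i)) \<and>
     near T x (\<lambda>y. \<forall>h\<in>jet_kernel k X y. pair UNIV (Nf y) (vec_nth h) = 0))"

text \<open>Let \<open>J\<close> index a maximal independent part, on the test points, of the
  products of order above k at \<open>x\<close>. A functional killing it extends regularly to one
  killing the corresponding products at y. By the count in \<open>key\<close> these span all forms
  vanishing to order k + 1 at y, so the extension gives equations of the jet kernels at y. Hence if
  \<open>h\<close> satisfies all admissible equations, no functional separates \<open>ph h\<close>
  from the span at \<open>x\<close>.\<close>

lemma jet_kernel_separation:
  fixes x :: "'k::field_char_0^'i"
  assumes smooth: "smooth_point X x"
    and h: "\<And>N0. admissible k x N0 \<Longrightarrow> pair UNIV N0 (vec_nth h) = 0"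
  shows "h \<in> jet_kernel k X x"
proof -
  have xX: "x \<in> X" using smooth by (simp add: smooth_point_def)
  then have "x \<noteq> 0" using zariski_closed_nonzero[OF zariski_closed_closure[OF zero_notin_T]] by auto
  then obtain e where xe: "x $ e \<noteq> 0" by (auto simp: vec_eq_iff)
  obtain q :: "nat \<Rightarrow> 'k^'i" and u E0 where
    u: "\<forall>l. gspan T e UNIV (dev e x) {1..} 1 (u l)" and
    q: "\<forall>j. gspan T e UNIV (dev e x) {2..} (E0 + 1)
      (\<lambda>z. z $ e ^ E0 * (dev e x j z - (\<Sum>l<N - 1. q l $ j * u l z)))"
    using smooth_expansion[OF smooth xe] by blast
  define \<Phi> where "\<Phi> = exponents (N - 1) k"
  have "\<exists>d1. \<forall>d\<ge>d1. \<exists>\<mu> :: (nat \<Rightarrow> nat) \<Rightarrow> ('i \<Rightarrow>\<^sub>0 nat). (\<forall>\<gamma>\<in>\<Phi>. mdeg (\<mu> \<gamma>) = d) \<and>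
    (\<forall>(y::'k^'i)\<in>T. \<forall>\<kappa>. ordc (Suc k) y (\<Sum>\<gamma>\<in>\<Phi>. cpoly (\<kappa> \<gamma>) * mon (\<mu> \<gamma>)) \<longrightarrow> (\<forall>\<gamma>\<in>\<Phi>. \<kappa> \<gamma> = 0))"
    unfolding \<Phi>_def by (rule independent_jets)
  then obtain d1 where
    d1: "\<forall>d\<ge>d1. \<exists>\<mu> :: (nat \<Rightarrow> nat) \<Rightarrow> ('i \<Rightarrow>\<^sub>0 nat). (\<forall>\<gamma>\<in>\<Phi>. mdeg (\<mu> \<gamma>) = d) \<and>
    (\<forall>(y::'k^'i)\<in>T. \<forall>\<kappa>. ordc (Suc k) y (\<Sum>\<gamma>\<in>\<Phi>. cpoly (\<kappa> \<gamma>) * mon (\<mu> \<gamma>)) \<longrightarrow> (\<forall>\<gamma>\<in>\<Phi>. \<kappa> \<gamma> = 0))"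
    by (rule exE)
  \<comment> \<open>Large enough for the reduction modulo order k + 1, for the monomials with
    independent jets, for every exponent of size k, and for the factor of degree
    \<open>d - 1\<close> in \<open>ph\<close>.\<close>
  define d where "d = k * (E0 + 1) + d1 + k + 1"
  have "d1 \<le> d" and dk: "k * (E0 + 1) \<le> d" "k \<le> d" "1 \<le> d" by (simp_all add: d_def)
  from d1[rule_format, OF \<open>d1 \<le> d\<close>] obtain \<mu> where \<mu>_conj: "(\<forall>\<gamma>\<in>\<Phi>. mdeg (\<mu> \<gamma>) = d) \<and>
    (\<forall>(y::'k^'i)\<in>T. \<forall>\<kappa>. ordc (Suc k) y (\<Sum>\<gamma>\<in>\<Phi>. cpoly (\<kappa> \<gamma>) * mon (\<mu> \<gamma>)) \<longrightarrow> (\<forall>\<gamma>\<in>\<Phi>. \<kappa> \<gamma> = 0))"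
    by (rule exE)
  note \<mu> = \<mu>_conj[THEN conjunct1] \<mu>_conj[THEN conjunct2]
  have fin\<Phi>: "finite \<Phi>" by (simp add: \<Phi>_def finite_exponents)
  define G where "G = gx (UNIV :: 'i set) {Suc k..} d"
  have finG: "finite G" by (simp add: G_def finite_gx)
  define b where "b y \<gamma> = gm e UNIV (dev e y) d \<gamma>" for y :: "'k^'i" and \<gamma>
  have "\<exists>P\<subseteq>T. finite P \<and> (\<forall>\<kappa>. (\<forall>z\<in>P. (\<Sum>\<gamma>\<in>gx UNIV {0..} d. \<kappa> \<gamma> * b x \<gamma> z) = 0) \<longrightarrow>
      (\<forall>z\<in>T. (\<Sum>\<gamma>\<in>gx UNIV {0..} d. \<kappa> \<gamma> * b x \<gamma> z) = 0))"
    by (rule finite_test_points[OF finite_gx[OF finite]])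
  then obtain P where P_conj: "P \<subseteq> T \<and> finite P \<and> (\<forall>\<kappa>. (\<forall>z\<in>P. (\<Sum>\<gamma>\<in>gx UNIV {0..} d. \<kappa> \<gamma> * b x \<gamma> z) = 0) \<longrightarrow>
      (\<forall>z\<in>T. (\<Sum>\<gamma>\<in>gx UNIV {0..} d. \<kappa> \<gamma> * b x \<gamma> z) = 0))"
    by (rule exE)
  note P = P_conj[THEN conjunct1] P_conj[THEN conjunct2, THEN conjunct1]
    and test0 = P_conj[THEN conjunct2, THEN conjunct2]
  have test: "mpoly_eval p z = 0" if p: "hdeg d p" "\<And>z. z \<in> P \<Longrightarrow> mpoly_eval p z = 0" and z: "z \<in> T" for p z
  proof -
    from form_in_gspan[OF p(1) xe, of T] obtain \<kappa> where
      \<kappa>: "\<forall>z\<in>T. mpoly_eval p z = (\<Sum>\<gamma>\<in>gx UNIV {0..} d. \<kappa> \<gamma> * b x \<gamma> z)"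
      unfolding b_def by (rule gspanE)
    then have "\<forall>z\<in>P. (\<Sum>\<gamma>\<in>gx UNIV {0..} d. \<kappa> \<gamma> * b x \<gamma> z) = 0" using p(2) P(1) by (metis subsetD)
    then show ?thesis using test0 \<kappa> z by simp
  qed
  obtain J where J: "J \<subseteq> G" "indep J P (b x)" "\<forall>g\<in>G. in_span J P (b x) (b x g)"
    using maximal_indep[OF finG, of P "b x"] by blast
  have finJ: "finite J" using J(1) finG by (rule finite_subset)
  have Jsum: "Suc k \<le> (\<Sum>j\<in>UNIV. \<gamma> j)" "(\<Sum>j\<in>UNIV. \<gamma> j) \<le> d" if "\<gamma> \<in> J" for \<gamma>
    using J(1) that by (auto simp: G_def gx_def)
  \<comment> \<open>Products of order above k indexed by \<open>J\<close>, and polynomials of degree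
    at most k in the \<open>u l\<close>; by the reduction they span all forms of degree
    \<open>d\<close> on the test points.\<close>
  define L where "L = Inl ` J \<union> Inr ` \<Phi>"
  define uu where "uu s = (case s of Inl \<gamma> \<Rightarrow> b x \<gamma> | Inr \<beta> \<Rightarrow> gm e {..<N - 1} u d \<beta>)" for s
  have spanning: "in_span L P uu (mpoly_eval p)" if p: "hdeg d p" for p
  proof -
    obtain A F where AF: "gspan T e {..<N - 1} u {..k} d A" "gspan T e UNIV (dev e x) {Suc k..} d F"
      "\<forall>z\<in>T. mpoly_eval p z = A z + F z"
      using gspan_reduction[OF u[rule_format] q[rule_format] dk(1) form_in_gspan[OF p xe] order_refl] by blast
    have "in_span \<Phi> P (gm e {..<N - 1} u d) A"
      using AF(1) P(1) gx_exponents[OF dk(2), of "N - 1"] by (simp add: gspan_def \<Phi>_def in_span_subset)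
    then have "in_span (Inr ` \<Phi>) P uu A" by (subst in_span_reindex) (auto simp: uu_def)
    then have 1: "in_span L P uu A" by (rule in_span_mono) (use finJ fin\<Phi> in \<open>auto simp: L_def\<close>)
    have "in_span G P (b x) F"
      using AF(2) P(1) unfolding gspan_def G_def b_def by (rule in_span_subset)
    then have "in_span J P (b x) F" by (rule in_span_trans) (use J(3) in blast)
    then have "in_span (Inl ` J) P uu F" by (subst in_span_reindex) (auto simp: uu_def)
    then have 2: "in_span L P uu F" by (rule in_span_mono) (use finJ fin\<Phi> in \<open>auto simp: L_def\<close>)
    show ?thesis by (rule in_span_cong[OF in_span_add[OF 1 2]]) (use AF(3) P(1) in blast)
  qed
  \<comment> \<open>The exchange argument at y: the products indexed by \<open>J\<close> and the
    monomials with independent jets are together as many as the spanning family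
    \<open>L\<close>.\<close>
  have key: "in_span J P (b y) (mpoly_eval p)"
    if y: "y \<in> T" and ind: "indep J P (b y)" and p: "hdeg d p" "ordc (Suc k) y p" for y p
  proof -
    define v where "v s = (case s of Inl \<gamma> \<Rightarrow> b y \<gamma> | Inr \<beta> \<Rightarrow> mpoly_eval (mon (\<mu> \<beta>)))" for s
    define E where "E w \<longleftrightarrow> (\<exists>p. hdeg d p \<and> ordc (Suc k) y p \<and> (\<forall>z\<in>P. w z = mpoly_eval p z))" for w
    have ordb: "ordc (Suc k) y (dev_form e y d \<gamma>)" if "\<gamma> \<in> J" for \<gamma>
      by (rule ordc_ideal_power, rule dev_form_ideal_power, rule Jsum(1)[OF that])
    have "in_span (Inl ` J) P v (mpoly_eval p)"
    proof (rule exchange_in_span[where E = E and F = "Inr ` \<Phi>" and L = L and u = uu])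
      show "finite (Inl ` J)" "finite (Inr ` \<Phi>)" "finite L" "Inl ` J \<inter> Inr ` \<Phi> = {}"
        using finJ fin\<Phi> by (auto simp: L_def)
      show "indep (Inl ` J) P v" by (rule indep_reindex) (use ind in \<open>auto simp: v_def\<close>)
      show "E (v j)" if "j \<in> Inl ` J" for j
      proof -
        from that obtain \<gamma> where \<gamma>: "j = Inl \<gamma>" "\<gamma> \<in> J" by blast
        then show ?thesis unfolding E_def
          by (intro exI[of _ "dev_form e y d \<gamma>"])
             (simp add: hdeg_dev_form Jsum ordb v_def b_def eval_dev_form)
      qed
      show "E (\<lambda>z. w z - (\<Sum>j\<in>Inl ` J. \<kappa> j * v j z))" if "E w" for \<kappa> w
      proof -
        obtain p' where p': "hdeg d p'" "ordc (Suc k) y p'" "\<forall>z\<in>P. w z = mpoly_eval p' z"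
          using \<open>E w\<close> unfolding E_def by blast
        define r where "r = p' + (\<Sum>\<gamma>\<in>J. cpoly (- \<kappa> (Inl \<gamma>)) * dev_form e y d \<gamma>)"
        have "hdeg d r" unfolding r_def
          by (intro hdeg_add hdeg_sum hdeg_cmult hdeg_dev_form p'(1) Jsum)
        moreover have "ordc (Suc k) y r" unfolding r_def
          by (intro ordc_add ordc_sum ordc_lmult ordb p'(2))
        moreover have "\<forall>z\<in>P. w z - (\<Sum>j\<in>Inl ` J. \<kappa> j * v j z) = mpoly_eval r z"
          using p'(3) by (simp add: r_def sum.reindex v_def b_def eval_dev_form sum_negf)
        ultimately show ?thesis unfolding E_def by blast
      qed
      show "E (\<lambda>z. c * w z)" if "E w" for c w
      proof -
        obtain p' where p': "hdeg d p'" "ordc (Suc k) y p'" "\<forall>z\<in>P. w z = mpoly_eval p' z"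
          using \<open>E w\<close> unfolding E_def by blast
        then show ?thesis unfolding E_def
          by (intro exI[of _ "cpoly c * p'"]) (simp add: hdeg_cmult ordc_lmult)
      qed
      show "E w'" if "E w" "\<And>z. z \<in> P \<Longrightarrow> w z = w' z" for w w'
        using that unfolding E_def by (metis (no_types, lifting))
      show "\<forall>f\<in>Inr ` \<Phi>. \<kappa> f = 0" if E: "E (\<lambda>z. \<Sum>f\<in>Inr ` \<Phi>. \<kappa> f * v f z)" for \<kappa>
      proof -
        define S where "S = (\<Sum>\<gamma>\<in>\<Phi>. cpoly (\<kappa> (Inr \<gamma>)) * mon (\<mu> \<gamma>))"
        obtain p' where p': "hdeg d p'" "ordc (Suc k) y p'"
          "\<forall>z\<in>P. (\<Sum>f\<in>Inr ` \<Phi>. \<kappa> f * v f z) = mpoly_eval p' z"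
          using E unfolding E_def by blast
        have S: "hdeg d S" unfolding S_def
        proof (intro hdeg_sum hdeg_cmult)
          fix \<gamma> assume "\<gamma> \<in> \<Phi>"
          then have "mdeg (\<mu> \<gamma>) = d" using \<mu>(1) by blast
          then show "hdeg d (mon (\<mu> \<gamma>))" using hdeg_mon[of "\<mu> \<gamma>"] by simp
        qed
        have "mpoly_eval (S - p') z = 0" if "z \<in> P" for z
          using p'(3)[rule_format, OF that] by (simp add: S_def sum.reindex v_def)
        then have "mpoly_eval (S - p') z = 0" if "z \<in> T" for z
          by (rule test[OF hdeg_minus[OF S p'(1)] _ that])
        then have "ordc (Suc k) y (S - p')" by (rule ordc_vanishing[OF _ y])
        then have "ordc (Suc k) y ((S - p') + p')" by (rule ordc_add[OF _ p'(2)])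
        then have "ordc (Suc k) y S" by simp
        then have "\<forall>\<gamma>\<in>\<Phi>. \<kappa> (Inr \<gamma>) = 0" unfolding S_def by (rule \<mu>(2)[rule_format, OF y, THEN ballI])
        then show ?thesis by blast
      qed
      show "in_span L P uu (v j)" if "j \<in> Inl ` J \<union> Inr ` \<Phi>" for j
      proof (cases j)
        case (Inl \<gamma>)
        then have "\<gamma> \<in> J" using that by auto
        moreover have "v j = mpoly_eval (dev_form e y d \<gamma>)"
          by (rule ext) (simp add: Inl v_def b_def eval_dev_form)
        ultimately show ?thesis using spanning[OF hdeg_dev_form] Jsum(2) by simp
      next
        case (Inr \<beta>)
        then have "mdeg (\<mu> \<beta>) = d" using that \<mu>(1) by auto
        then have "hdeg d (mon (\<mu> \<beta>) :: ('k, 'i) mpoly)" using hdeg_mon[of "\<mu> \<beta>"] by simp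
        then show ?thesis using spanning by (simp add: v_def Inr)
      qed
      show "in_span L P uu (mpoly_eval p)" by (rule spanning[OF p(1)])
      show "E (mpoly_eval p)" unfolding E_def using p by blast
      show "card L \<le> card (Inl ` J :: (('i \<Rightarrow> nat) + (nat \<Rightarrow> nat)) set) +
          card (Inr ` \<Phi> :: (('i \<Rightarrow> nat) + (nat \<Rightarrow> nat)) set)"
        unfolding L_def by (rule card_Un_le)
    qed
    then show ?thesis by (subst (asm) in_span_reindex) (auto simp: v_def)
  qed
  \<comment> \<open>Raises the linear form to degree \<open>d\<close> by a factor that is nonzero at
    \<open>x\<close>.\<close>
  define ph where "ph h = vpoly e ^ (d - 1) * linear_form h" for h :: "'k^'i"
  have ph: "hdeg d (ph h)" for h
    using hdeg_mult[OF hdeg_power[OF hdeg_vpoly] hdeg_linear_form, of "d - 1" e h] dk(3) by (simp add: ph_def)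
  have near_ind: "near T x (\<lambda>y. indep J P (b y))"
    by (rule indep_near[OF finJ P(2), of T x "\<lambda>\<gamma> y. b y \<gamma>" "b x"])
       (use J(2) in \<open>auto simp: b_def reg_dev_form\<close>)
  have kill: "pair P \<xi>0 (mpoly_eval (ph h)) = 0" if \<xi>0: "\<And>\<gamma>. \<gamma> \<in> J \<Longrightarrow> pair P \<xi>0 (b x \<gamma>) = 0" for \<xi>0
  proof -
    have expand: "pair P \<xi> (mpoly_eval (ph h)) = pair UNIV (\<lambda>i. pair P \<xi> (\<lambda>z. z $ e ^ (d - 1) * z $ i)) (vec_nth h)" for \<xi> h
      unfolding pair_def ph_def
      by (simp add: sum_distrib_left sum_distrib_right mult_ac) (rule sum.swap)
    have "\<exists>\<xi>. (\<forall>z\<in>P. reg T x (\<lambda>y. \<xi> y z) (\<xi>0 z)) \<and> near T x (\<lambda>y. \<forall>\<gamma>\<in>J. pair P (b y \<gamma>) (\<xi> y) = 0)"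
      by (rule extend_solution[OF finJ P(2), where N = "\<lambda>\<gamma> y. b y \<gamma>" and ?N0.0 = "b x", OF _ J(2)])
         (use \<xi>0 in \<open>auto simp: b_def reg_dev_form pair_commute[of P _ \<xi>0]\<close>)
    then obtain \<xi> where \<xi>: "\<forall>z\<in>P. reg T x (\<lambda>y. \<xi> y z) (\<xi>0 z)"
      "near T x (\<lambda>y. \<forall>\<gamma>\<in>J. pair P (b y \<gamma>) (\<xi> y) = 0)" by blast
    have "admissible k x (\<lambda>i. pair P \<xi>0 (\<lambda>z. z $ e ^ (d - 1) * z $ i))"
      unfolding admissible_def
    proof (intro exI[of _ "\<lambda>y i. pair P (\<xi> y) (\<lambda>z. z $ e ^ (d - 1) * z $ i)"] conjI allI)
      show "reg T x (\<lambda>y. pair P (\<xi> y) (\<lambda>z. z $ e ^ (d - 1) * z $ i)) (pair P \<xi>0 (\<lambda>z. z $ e ^ (d - 1) * z $ i))" for i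
        using \<xi>(1) by (intro reg_pair reg_const) auto
      show "near T x (\<lambda>y. \<forall>h\<in>jet_kernel k X y.
          pair UNIV (\<lambda>i. pair P (\<xi> y) (\<lambda>z. z $ e ^ (d - 1) * z $ i)) (vec_nth h) = 0)"
      proof (rule near_mono[OF near_conj[OF near_ind \<xi>(2)]], intro ballI)
        fix y h assume y: "y \<in> T" and *: "indep J P (b y) \<and> (\<forall>\<gamma>\<in>J. pair P (b y \<gamma>) (\<xi> y) = 0)"
          and h: "h \<in> jet_kernel k X y"
        have "ordc (Suc k) y (ph h)" unfolding ph_def by (intro ordc_lmult jet_kernel_imp_ordc[OF h y])
        then have "in_span J P (b y) (mpoly_eval (ph h))" using key[OF y _ ph] * by blast
        then obtain \<kappa> where \<kappa>: "\<forall>z\<in>P. mpoly_eval (ph h) z = (\<Sum>j\<in>J. \<kappa> j * b y j z)"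
          unfolding in_span_def by blast
        have "pair P (\<xi> y) (mpoly_eval (ph h)) = pair P (\<xi> y) (\<lambda>z. \<Sum>j\<in>J. \<kappa> j * b y j z)"
          by (rule pair_cong) (use \<kappa> in simp)
        also have "\<dots> = (\<Sum>j\<in>J. \<kappa> j * pair P (\<xi> y) (b y j))" by (rule pair_sum)
        also have "\<dots> = 0" using * by (intro sum.neutral) (auto simp: pair_commute[of P "\<xi> y"])
        finally show "pair UNIV (\<lambda>i. pair P (\<xi> y) (\<lambda>z. z $ e ^ (d - 1) * z $ i)) (vec_nth h) = 0"
          unfolding expand .
      qed
    qed
    then show ?thesis unfolding expand by (rule h)
  qed
  from in_span_or_separated[OF finJ P(2), of "b x" "mpoly_eval (ph h)"]
  have "in_span J P (b x) (mpoly_eval (ph h))"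
  proof
    assume "\<exists>\<xi>. (\<forall>j\<in>J. pair P \<xi> (b x j) = 0) \<and> pair P \<xi> (mpoly_eval (ph h)) = 1"
    then show ?thesis using kill by force
  qed
  then obtain \<kappa> where \<kappa>: "\<forall>z\<in>P. mpoly_eval (ph h) z = (\<Sum>j\<in>J. \<kappa> j * b x j z)"
    unfolding in_span_def by blast
  define qq where "qq = (\<Sum>\<gamma>\<in>J. cpoly (\<kappa> \<gamma>) * dev_form e x d \<gamma>)"
  have hqq: "hdeg d qq" unfolding qq_def by (intro hdeg_sum hdeg_cmult hdeg_dev_form Jsum)
  have "mpoly_eval (ph h - qq) z = 0" if "z \<in> P" for z
    using \<kappa> that by (simp add: qq_def eval_dev_form b_def)
  then have "mpoly_eval (ph h - qq) z = 0" if "z \<in> T" for z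
    by (rule test[OF hdeg_minus[OF ph hqq] _ that])
  then have "ph h - qq \<in> vanishing_ideal X" by (simp add: vanishing_ideal_X)
  moreover have "qq \<in> ideal_power (vanishing_ideal (proj_point x)) (k + 1)"
    unfolding qq_def
    by (intro ideal_power_sum, rule ideal_power_lmult, rule dev_form_ideal_power) (use Jsum in simp)
  moreover have "vpoly e ^ (d - 1) * linear_form h = qq + (ph h - qq)" by (simp add: ph_def)
  moreover have "homogeneous (vpoly e ^ (d - 1) :: ('k, 'i) mpoly)"
    using hdeg_power[OF hdeg_vpoly] homogeneous_iff by blast
  moreover have "mpoly_eval (vpoly e ^ (d - 1)) x \<noteq> 0" using xe by simp
  ultimately show ?thesis unfolding jet_kernel_def vanishes_to_order_def by blast
qed

text \<open>A basis of the admissible equations has a solution space inside the jet kernel at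
  \<open>x\<close>; constancy of the rank forces equality there and at nearby torus points.
  Therefore \<open>h0\<close> extends to a regular family of jet kernel elements, on which a
  polynomial nonzero at \<open>h0\<close> cannot vanish.\<close>

lemma jet_kernel_limit:
  fixes x :: "'k::field_char_0^'i"
  assumes x: "x \<in> k_cst k X" and h0: "h0 \<in> jet_kernel k X x" "h0 \<noteq> 0"
    and F: "\<And>y h. y \<in> T \<Longrightarrow> h \<in> jet_kernel k X y \<Longrightarrow> h \<noteq> 0 \<Longrightarrow> mpoly_eval F h = 0"
  shows "mpoly_eval F h0 = 0"
proof (rule ccontr)
  assume Fh0: "mpoly_eval F h0 \<noteq> 0"
  have smooth: "smooth_point X x" using x by (simp add: k_cst_def)
  then have xX: "x \<in> X" by (simp add: smooth_point_def)
  define A where "A = {v :: 'k^'i. admissible k x (vec_nth v)}"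
  obtain B where B: "B \<subseteq> A" "vec.independent B" "A \<subseteq> vec.span B" by (rule vec.basis_exists[of A]) auto
  have fin: "finite B" using B(2) by (rule vec.finiteI_independent)
  have ind: "indep B UNIV vec_nth" by (rule indep_of_independent[OF B(2)])
  define S where "S = {h :: 'k^'i. \<forall>b\<in>B. pair UNIV (vec_nth b) (vec_nth h) = 0}"
  have dimS: "vec.dim S + card B = CARD('i)" unfolding S_def by (rule dim_annihilator[OF fin ind])
  have subS: "vec.subspace S"
    unfolding vec.subspace_def S_def pair_def
    by (auto simp: distrib_left sum.distrib mult.left_commute[of _ "_::'k"] sum_distrib_left[symmetric])
  have "S \<subseteq> jet_kernel k X x"
  proof
    fix h assume h: "h \<in> S"
    show "h \<in> jet_kernel k X x"
    proof (rule jet_kernel_separation[OF smooth])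
      fix N0 assume "admissible k x N0"
      moreover have "vec_nth (\<chi> i. N0 i) = N0" by (rule ext) simp
      ultimately have "(\<chi> i. N0 i) \<in> A" by (simp add: A_def)
      then have "(\<chi> i. N0 i) \<in> vec.span B" using B(3) by blast
      moreover have "vec.subspace {v. pair UNIV (vec_nth v) (vec_nth h) = 0}"
        unfolding vec.subspace_def pair_def
        by (auto simp: distrib_right sum.distrib mult.assoc sum_distrib_left[symmetric])
      then have "vec.span B \<subseteq> {v. pair UNIV (vec_nth v) (vec_nth h) = 0}"
        using h by (intro vec.span_minimal) (auto simp: S_def)
      ultimately have "pair UNIV (vec_nth (\<chi> i. N0 i)) (vec_nth h) = 0" by blast
      then show "pair UNIV N0 (vec_nth h) = 0" by (simp add: pair_def)
    qed
  qed
  have "\<forall>b\<in>B. \<exists>Nf. (\<forall>i. reg T x (\<lambda>y. Nf y i) (b $ i)) \<and>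
     near T x (\<lambda>y. \<forall>h\<in>jet_kernel k X y. pair UNIV (Nf y) (vec_nth h) = 0)"
    using B(1) unfolding A_def admissible_def by blast
  from bchoice[OF this] obtain Nf where Nf: "\<forall>b\<in>B. (\<forall>i. reg T x (\<lambda>y. Nf b y i) (b $ i)) \<and>
     near T x (\<lambda>y. \<forall>h\<in>jet_kernel k X y. pair UNIV (Nf b y) (vec_nth h) = 0)" by blast
  have near1: "near T x (\<lambda>y. indep B UNIV (\<lambda>b. Nf b y))"
    by (rule indep_near[OF fin finite, where T = T and x = x and N = Nf and ?N0.0 = vec_nth]) (use Nf ind in auto)
  have near2: "near T x (\<lambda>y. \<forall>b\<in>B. \<forall>h\<in>jet_kernel k X y. pair UNIV (Nf b y) (vec_nth h) = 0)"
    by (rule near_ball[OF fin]) (use Nf in blast)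
  define D where "D = vec.dim (kerK k :: ('k^'i) set)"
  define ann where "ann y = {h :: 'k^'i. \<forall>b\<in>B. pair UNIV (Nf b y) (vec_nth h) = 0}" for y
  have sub_ann: "jet_kernel k X y \<subseteq> ann y" if "\<forall>b\<in>B. \<forall>h\<in>jet_kernel k X y. pair UNIV (Nf b y) (vec_nth h) = 0" for y
    using that by (auto simp: ann_def)
  have dim_ann: "vec.dim (ann y) + card B = CARD('i)" if "indep B UNIV (\<lambda>b. Nf b y)" for y
    unfolding ann_def by (rule dim_annihilator[OF fin that])
  have subspace_ann: "vec.subspace (ann y)" for y
    unfolding vec.subspace_def ann_def pair_def
    by (auto simp: distrib_left sum.distrib mult.left_commute[of _ "_::'k"] sum_distrib_left[symmetric])
  obtain y0 where y0: "y0 \<in> T" "indep B UNIV (\<lambda>b. Nf b y0)"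
    "\<forall>b\<in>B. \<forall>h\<in>jet_kernel k X y0. pair UNIV (Nf b y0) (vec_nth h) = 0"
    using near_ex[OF near_conj[OF near1 near2] cone_T xX] by blast
  \<comment> \<open>Near \<open>x\<close> the equations remain independent and still hold on the jet
    kernel, so the solution space at \<open>x\<close> has at least its dimension.\<close>
  have "D \<le> vec.dim (ann y0)"
    using vec.dim_subset[OF sub_ann[OF y0(3)]] dim_jet_kernel_T[OF y0(1)] by (simp add: D_def)
  then have "D \<le> vec.dim S" using dim_ann[OF y0(2)] dimS by simp
  then have "S = jet_kernel k X x"
    using dim_jet_kernel_k_cst[OF x]
    by (intro vec.subspace_dim_equal subS subspace_jet_kernel \<open>S \<subseteq> jet_kernel k X x\<close>) (simp add: D_def)
  then have h0S: "h0 \<in> S" and dimSD: "vec.dim S = D" using h0(1) dim_jet_kernel_k_cst[OF x] by (auto simp: D_def)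
  have "\<exists>\<eta>. (\<forall>i\<in>UNIV. reg T x (\<lambda>y. \<eta> y i) (h0 $ i)) \<and> near T x (\<lambda>y. \<forall>b\<in>B. pair UNIV (Nf b y) (\<eta> y) = 0)"
    by (rule extend_solution[OF fin finite, where N = Nf and ?N0.0 = vec_nth, OF _ ind])
       (use Nf h0S in \<open>auto simp: S_def\<close>)
  then obtain \<eta> where \<eta>: "\<And>i. reg T x (\<lambda>y. \<eta> y i) (h0 $ i)"
    "near T x (\<lambda>y. \<forall>b\<in>B. pair UNIV (Nf b y) (\<eta> y) = 0)" by blast
  define \<theta> where "\<theta> y = (\<chi> i. \<eta> y i)" for y
  have \<theta>: "reg T x (\<lambda>y. \<theta> y $ i) (h0 $ i)" for i using \<eta>(1) by (simp add: \<theta>_def)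
  have near3: "near T x (\<lambda>y. mpoly_eval F (\<theta> y) \<noteq> 0)" by (rule reg_near_nonzero[OF reg_eval[OF \<theta>] Fh0])
  obtain i where "h0 $ i \<noteq> 0" using h0(2) by (auto simp: vec_eq_iff)
  then have near4: "near T x (\<lambda>y. \<theta> y $ i \<noteq> 0)" by (rule reg_near_nonzero[OF \<theta>])
  obtain y where y: "y \<in> T" "indep B UNIV (\<lambda>b. Nf b y)"
    "\<forall>b\<in>B. \<forall>h\<in>jet_kernel k X y. pair UNIV (Nf b y) (vec_nth h) = 0"
    "\<forall>b\<in>B. pair UNIV (Nf b y) (\<eta> y) = 0" "mpoly_eval F (\<theta> y) \<noteq> 0" "\<theta> y $ i \<noteq> 0"
    using near_ex[OF near_conj[OF near_conj[OF near_conj[OF near1 near2] \<eta>(2)] near_conj[OF near3 near4]] cone_T xX]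
    by blast
  have "jet_kernel k X y = ann y"
    using dim_ann[OF y(2)] dimS dimSD dim_jet_kernel_T[OF y(1)]
    by (intro vec.subspace_dim_equal subspace_jet_kernel subspace_ann sub_ann[OF y(3)]) (simp add: D_def)
  moreover have "\<theta> y \<in> ann y" using y(4) by (simp add: ann_def \<theta>_def pair_def)
  moreover have "\<theta> y \<noteq> 0" using y(6) by auto
  ultimately show False using F[OF y(1)] y(5) by blast
qed

text \<open>The nonzero part of \<open>Ker A^(k)\<close> times T; writing the factor on the other
  side is harmless because T is a group.\<close>

definition dual_torus :: "nat \<Rightarrow> ('k::field_char_0^'i) set" where
  "dual_torus k = {h. h \<noteq> 0 \<and> (\<exists>y\<in>T. (\<chi> i. h $ i * y $ i) \<in> kerK k)}"

lemma higher_dual_X: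
  "higher_dual k (X :: ('k::field_char_0^'i) set) = zariski_closure (dual_torus k)"
proof
  have nz: "0 \<notin> (dual_torus k :: ('k^'i) set)" by (simp add: dual_torus_def)
  show "higher_dual k (X :: ('k^'i) set) \<subseteq> zariski_closure (dual_torus k)"
    unfolding higher_dual_def osculating_subset_hyperplane
  proof (rule zariski_closure_minimal[OF zariski_closed_closure[OF nz]], rule subsetI)
    fix h :: "'k^'i" assume "h \<in> {h. h \<noteq> 0 \<and> (\<exists>x\<in>k_cst k X. h \<in> jet_kernel k X x)}"
    then obtain x where x: "h \<noteq> 0" "x \<in> k_cst k X" "h \<in> jet_kernel k X x" by blast
    show "h \<in> zariski_closure (dual_torus k)"
      unfolding zariski_closure_iff[OF nz]
    proof (intro conjI allI impI x(1))
      fix p :: "('k, 'i) mpoly" assume p: "homogeneous p \<and> (\<forall>y\<in>dual_torus k. mpoly_eval p y = 0)"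
      show "mpoly_eval p h = 0"
        by (rule jet_kernel_limit[OF x(2,3,1)]) (use p in \<open>auto simp: dual_torus_def jet_kernel_T\<close>)
    qed
  qed
  show "zariski_closure (dual_torus k) \<subseteq> higher_dual k (X :: ('k^'i) set)"
    unfolding higher_dual_def osculating_subset_hyperplane
  proof (rule zariski_closure_mono, rule subsetI)
    fix h :: "'k^'i" assume "h \<in> dual_torus k"
    then obtain y where "h \<noteq> 0" "y \<in> T" "(\<chi> i. h $ i * y $ i) \<in> kerK k" by (auto simp: dual_torus_def)
    then show "h \<in> {h. h \<noteq> 0 \<and> (\<exists>x\<in>k_cst k X. h \<in> jet_kernel k X x)}"
      using jet_kernel_T[of y k] T_subset_k_cst by blast
  qed
qed

end

section \<open>Integer kernels over fields of characteristic zero\<close>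

text \<open>The field is a rational vector space, and \<open>W\<close> is a basis of the span of the
  finitely many values.\<close>

lemma rational_coordinates:
  fixes x :: "'a \<Rightarrow> 'k::field_char_0"
  assumes "finite I"
  shows "\<exists>W q. finite W \<and> (\<forall>i\<in>I. x i = (\<Sum>w\<in>W. of_rat (q w i) * w)) \<and>
    (\<forall>p. (\<Sum>w\<in>W. of_rat (p w) * w) = 0 \<longrightarrow> (\<forall>w\<in>W. p w = 0))"
proof -
  interpret Q: vector_space "\<lambda>q (y::'k). of_rat q * y"
    by unfold_locales (simp_all add: algebra_simps of_rat_add of_rat_mult)
  obtain W where W: "W \<subseteq> x ` I" "Q.independent W" "x ` I \<subseteq> Q.span W"
    by (rule Q.maximal_independent_subset)
  have fin: "finite W" using W(1) assms by (metis finite_imageI finite_subset)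
  have "\<forall>i\<in>I. \<exists>u. x i = (\<Sum>w\<in>W. of_rat (u w) * w)"
    using W(3) unfolding Q.span_finite[OF fin] by auto
  from bchoice[OF this] obtain u where u: "\<forall>i\<in>I. x i = (\<Sum>w\<in>W. of_rat (u i w) * w)" by blast
  have "p w = 0" if "(\<Sum>w\<in>W. of_rat (p w) * w) = 0" "w \<in> W" for p w
    using Q.independentD[OF W(2) fin order_refl that] .
  then show ?thesis using fin u by (intro exI[of _ W] exI[of _ "\<lambda>w i. u i w"]) auto
qed

lemma common_denominator:
  fixes q :: "'a \<Rightarrow> rat"
  assumes "finite I"
  shows "\<exists>D z. D > 0 \<and> (\<forall>i\<in>I. of_int D * q i = of_int (z i))"
  using assms
proof (induction I rule: finite_induct)
  case empty
  show ?case by (intro exI[of _ 1]) simp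
next
  case (insert a I)
  obtain D z where D: "D > 0" "\<forall>i\<in>I. of_int D * q i = of_int (z i)"
    using insert.IH by - (elim exE conjE, rule that)
  obtain r s where rs: "q a = Fract r s" "s > 0" by (cases "q a") auto
  have "of_int (s * D) * q i = of_int ((if i = a then D * r else s * z i))" if "i \<in> insert a I" for i
  proof (cases "i = a")
    case True
    then show ?thesis using rs by (simp add: Fract_of_int_quotient)
  next
    case False
    then have "of_int D * q i = of_int (z i)" using D(2) that by auto
    then show ?thesis using False by (simp add: mult.assoc)
  qed
  moreover have "s * D > 0" using D(1) rs(2) by simp
  ultimately show ?case by (intro exI conjI ballI)
qed

definition int_orth :: "('i::finite \<Rightarrow> int) set \<Rightarrow> ('i \<Rightarrow> int) set" where
  "int_orth R = {v. \<forall>r\<in>R. (\<Sum>i\<in>UNIV. r i * v i) = 0}"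

lemma int_basis_unique:
  assumes B: "is_int_basis c \<nu> (int_orth R)" and y: "\<And>i. (\<Sum>l<c. y l * \<nu> l i) = 0" and "l < c"
  shows "y l = 0"
proof -
  have "(\<lambda>_. 0) \<in> int_orth R" by (simp add: int_orth_def)
  then have ex1: "\<exists>!w. w \<in> vecs c \<and> (\<lambda>_. 0) = (\<lambda>i. \<Sum>l<c. w l * \<nu> l i)"
    using B unfolding is_int_basis_def by blast
  have "(\<lambda>_. 0) \<in> vecs c \<and> (\<lambda>_. 0) = (\<lambda>i. \<Sum>l<c. 0 * \<nu> l i)" by (simp add: vecs_def)
  moreover have "(\<lambda>l. if l < c then y l else 0) \<in> vecs c \<and>
      (\<lambda>_. 0) = (\<lambda>i. \<Sum>l<c. (if l < c then y l else 0) * \<nu> l i)"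
    using y by (simp add: vecs_def)
  ultimately have "(\<lambda>l. if l < c then y l else 0) = (\<lambda>_. 0)"
    by (intro trans[OF sym[OF the1_equality[OF ex1]] the1_equality[OF ex1]])
  from fun_cong[OF this, of l] show ?thesis using \<open>l < c\<close> by simp
qed

text \<open>Expanding the coefficients over a rational basis gives a rational relation in each
  component; clearing denominators reduces it to the uniqueness of integer coordinates.\<close>

lemma int_basis_independent:
  fixes \<mu> :: "nat \<Rightarrow> 'k::field_char_0"
  assumes B: "is_int_basis c \<nu> (int_orth R)"
    and zero: "\<And>i. (\<Sum>l<c. \<mu> l * of_int (\<nu> l i)) = 0" and l: "l < c"
  shows "\<mu> l = 0"
proof -
  obtain W q where W: "finite W" "\<forall>l\<in>{..<c}. \<mu> l = (\<Sum>w\<in>W. of_rat (q w l) * w)"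
    "\<forall>p. (\<Sum>w\<in>W. of_rat (p w) * w) = 0 \<longrightarrow> (\<forall>w\<in>W. p w = 0)"
    using rational_coordinates[OF finite_lessThan, of c \<mu>] by - (elim exE conjE, rule that)
  have q0: "q w l' = 0" if w: "w \<in> W" and l': "l' < c" for w l'
  proof -
    have "(\<Sum>w\<in>W. of_rat (\<Sum>l<c. q w l * of_int (\<nu> l i)) * w) = 0" for i
    proof -
      have "(\<Sum>w\<in>W. of_rat (\<Sum>l<c. q w l * of_int (\<nu> l i)) * w) =
          (\<Sum>w\<in>W. \<Sum>l<c. of_rat (q w l) * w * of_int (\<nu> l i))"
        by (simp add: of_rat_sum of_rat_mult sum_distrib_left sum_distrib_right mult_ac)
      also have "\<dots> = (\<Sum>l<c. (\<Sum>w\<in>W. of_rat (q w l) * w) * of_int (\<nu> l i))"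
        by (subst sum.swap) (simp add: sum_distrib_right)
      also have "\<dots> = (\<Sum>l<c. \<mu> l * of_int (\<nu> l i))" using W(2) by simp
      finally show ?thesis using zero by simp
    qed
    then have rel: "(\<Sum>l<c. q w l * of_int (\<nu> l i)) = 0" for i
      by (rule W(3)[rule_format, OF _ w])
    obtain D z where D: "D > 0" "\<forall>l\<in>{..<c}. of_int D * q w l = of_int (z l)"
      using common_denominator[OF finite_lessThan, of c "q w"] by - (elim exE conjE, rule that)
    have "(of_int (\<Sum>l<c. z l * \<nu> l i) :: rat) = of_int D * (\<Sum>l<c. q w l * of_int (\<nu> l i))" for i
      using D(2) by (simp add: sum_distrib_left mult.assoc[symmetric])
    then have "(of_int (\<Sum>l<c. z l * \<nu> l i) :: rat) = of_int 0" for i using rel by simp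
    then have "(\<Sum>l<c. z l * \<nu> l i) = 0" for i by (simp only: of_int_eq_iff)
    then have "z l' = 0" by (rule int_basis_unique[OF B _ l'])
    then have "of_int D * q w l' = 0" using D(2) l' by simp
    then show ?thesis using D(1) by simp
  qed
  show ?thesis using W(2) l q0 by simp
qed

text \<open>Every rational component of \<open>x\<close> lies in the integer kernel after clearing
  denominators, and there the integer basis applies.\<close>

lemma int_basis_spans:
  fixes x :: "'i::finite \<Rightarrow> 'k::field_char_0"
  assumes B: "is_int_basis c \<nu> (int_orth R)"
    and x: "\<And>r. r \<in> R \<Longrightarrow> (\<Sum>i\<in>UNIV. of_int (r i) * x i) = 0"
  shows "\<exists>\<mu>. \<forall>i. x i = (\<Sum>l<c. \<mu> l * of_int (\<nu> l i))"
proof -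
  obtain W q where W: "finite W" "\<forall>i\<in>UNIV. x i = (\<Sum>w\<in>W. of_rat (q w i) * w)"
    "\<forall>p. (\<Sum>w\<in>W. of_rat (p w) * w) = 0 \<longrightarrow> (\<forall>w\<in>W. p w = 0)"
    using rational_coordinates[OF finite, of UNIV x] by - (elim exE conjE, rule that)
  have "\<exists>\<omega> :: nat \<Rightarrow> rat. \<forall>i. q w i = (\<Sum>l<c. \<omega> l * of_int (\<nu> l i))" if w: "w \<in> W" for w
  proof -
    have rel: "(\<Sum>i\<in>UNIV. of_int (r i) * q w i) = 0" if r: "r \<in> R" for r
    proof -
      have "(\<Sum>w\<in>W. of_rat (\<Sum>i\<in>UNIV. of_int (r i) * q w i) * w) =
          (\<Sum>w\<in>W. \<Sum>i\<in>UNIV. of_int (r i) * (of_rat (q w i) * w))"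
        by (simp add: of_rat_sum of_rat_mult sum_distrib_left sum_distrib_right mult_ac)
      also have "\<dots> = (\<Sum>i\<in>UNIV. of_int (r i) * x i)"
        using W(2) by (subst sum.swap) (simp add: sum_distrib_left)
      finally have "(\<Sum>w\<in>W. of_rat (\<Sum>i\<in>UNIV. of_int (r i) * q w i) * w) = 0" using x[OF r] by simp
      then show ?thesis by (rule W(3)[rule_format, OF _ w])
    qed
    obtain D z where D: "D > 0" "\<forall>i\<in>UNIV. of_int D * q w i = of_int (z i)"
      using common_denominator[OF finite, of UNIV "q w"] by - (elim exE conjE, rule that)
    have "(of_int (\<Sum>i\<in>UNIV. r i * z i) :: rat) = of_int D * (\<Sum>i\<in>UNIV. of_int (r i) * q w i)" for r
      by (simp add: D(2)[rule_format, OF UNIV_I, symmetric] sum_distrib_left mult.left_commute)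
    then have "(of_int (\<Sum>i\<in>UNIV. r i * z i) :: rat) = of_int 0" if "r \<in> R" for r using rel[OF that] by simp
    then have "z \<in> int_orth R" unfolding int_orth_def by (simp only: of_int_eq_iff) blast
    then have "\<exists>!w. w \<in> vecs c \<and> z = (\<lambda>i. \<Sum>l<c. w l * \<nu> l i)"
      using B unfolding is_int_basis_def by blast
    then obtain y where y: "z = (\<lambda>i. \<Sum>l<c. y l * \<nu> l i)" by - (elim ex1E conjE, rule that)
    have "q w i = (\<Sum>l<c. (of_int (y l) / of_int D) * of_int (\<nu> l i))" for i
    proof -
      have "of_int D * q w i = of_int (\<Sum>l<c. y l * \<nu> l i)" using D(2) y by simp
      then have "q w i = of_int (\<Sum>l<c. y l * \<nu> l i) / of_int D" using D(1) by (simp add: field_simps)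
      then show ?thesis by (simp add: sum_divide_distrib)
    qed
    then show ?thesis by (intro exI allI)
  qed
  then have "\<forall>w\<in>W. \<exists>\<omega> :: nat \<Rightarrow> rat. \<forall>i. q w i = (\<Sum>l<c. \<omega> l * of_int (\<nu> l i))" by (rule ballI)
  from bchoice[OF this] obtain \<omega> :: "'k \<Rightarrow> nat \<Rightarrow> rat"
    where \<omega>: "\<forall>w\<in>W. \<forall>i. q w i = (\<Sum>l<c. \<omega> w l * of_int (\<nu> l i))" by (rule exE)
  have "x i = (\<Sum>l<c. (\<Sum>w\<in>W. of_rat (\<omega> w l) * w) * of_int (\<nu> l i))" for i
  proof -
    have "x i = (\<Sum>w\<in>W. \<Sum>l<c. of_rat (\<omega> w l) * w * of_int (\<nu> l i))"
      using W(2) \<omega> by (simp add: of_rat_sum of_rat_mult sum_distrib_left sum_distrib_right mult_ac)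
    then show ?thesis by (subst (asm) sum.swap) (simp add: sum_distrib_right)
  qed
  then show ?thesis by (intro exI allI)
qed

section \<open>Linear forms in general position\<close>

text \<open>Move from \<open>v\<close> towards \<open>w\<close> by a parameter avoiding the roots of
  a nonzero product polynomial. The family \<open>V\<close> is abstract so that it can be the forms
  vanishing at one Gale vector.\<close>

lemma generic_combination:
  fixes f :: "'a \<Rightarrow> 'b \<Rightarrow> 'k::field_char_0"
  assumes "finite S" and comb: "\<And>v w t. v \<in> V \<Longrightarrow> w \<in> V \<Longrightarrow> \<exists>u\<in>V. \<forall>i. f u i = f v i + t * f w i"
    and V: "v0 \<in> V" and nz: "\<And>i. i \<in> S \<Longrightarrow> \<exists>v\<in>V. f v i \<noteq> 0"
  shows "\<exists>v\<in>V. \<forall>i\<in>S. f v i \<noteq> 0"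
  using assms(1) nz
proof (induction S rule: finite_induct)
  case empty
  then show ?case using V by blast
next
  case (insert a S)
  then obtain v w where v: "v \<in> V" "\<forall>i\<in>S. f v i \<noteq> 0" and w: "w \<in> V" "f w a \<noteq> 0" by (metis insert_iff)
  have fin: "finite (insert a S)" using insert.hyps by simp
  define P where "P = (\<Prod>i\<in>insert a S. [:f v i, f w i:])"
  have "[:f v i, f w i:] \<noteq> 0" if "i \<in> insert a S" for i using that v w by auto
  then have "P \<noteq> 0" unfolding P_def prod_zero_iff[OF fin] by blast
  then obtain t where t: "poly P t \<noteq> 0" using poly_zero_of_infinite_zeros[of "{}" P] by auto
  obtain u where u: "u \<in> V" "\<forall>i. f u i = f v i + t * f w i" using comb[OF v(1) w(1)] by blast
  have "poly P t = (\<Prod>i\<in>insert a S. f u i)"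
    unfolding P_def poly_prod by (rule prod.cong) (simp_all add: u(2))
  then have "f u i \<noteq> 0" if "i \<in> insert a S" for i
    using t that prod_zero_iff[OF fin, of "f u"] by auto
  then show ?case using u(1) by blast
qed

section \<open>Diagonal maps\<close>

definition diagm :: "('i::finite \<Rightarrow> 'k::field) \<Rightarrow> 'k^'i^'i" where
  "diagm s = (\<chi> i j. if i = j then s i else 0)"

lemma diagm_mult: "diagm s *v x = (\<chi> i. s i * x $ i)"
  by (simp add: diagm_def matrix_vector_mult_def vec_eq_iff if_distrib[of "\<lambda>c. c * _"] cong: if_cong)

lemma invertible_diagm:
  assumes "\<And>i. s i \<noteq> 0" shows "invertible (diagm s)"
proof -
  have 1: "diagm s ** diagm t = mat 1" if "\<And>i. s i * t i = 1" for s t :: "'i::finite \<Rightarrow> 'k::field"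
    unfolding matrix_eq matrix_vector_mul_assoc[symmetric] diagm_mult matrix_vector_mul_lid
    using that by (simp add: vec_eq_iff mult.assoc[symmetric])
  show ?thesis unfolding invertible_def
    by (intro exI[of _ "diagm (\<lambda>i. inverse (s i))"] conjI 1) (use assms in simp_all)
qed

lemma zariski_closure_image:
  fixes M :: "'k::field^'i::finite^'i"
  assumes M: "invertible M" and S: "0 \<notin> S"
  shows "zariski_closure ((\<lambda>x. M *v x) ` S) = (\<lambda>x. M *v x) ` zariski_closure S"
proof
  obtain M' where inv: "invertible M'" and M': "\<And>x. M' *v (M *v x) = x" "\<And>x. M *v (M' *v x) = x"
    using matrix_left_inverse[OF M] by blast
  have "0 \<notin> (\<lambda>x. M *v x) ` S"
  proof
    assume "0 \<in> (\<lambda>x. M *v x) ` S"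
    then obtain x where "x \<in> S" "M *v x = 0" by auto
    then have "x = 0" using M'(1)[of x] by simp
    then show False using S \<open>x \<in> S\<close> by simp
  qed
  then have "zariski_closed ((\<lambda>x. M' *v x) ` zariski_closure ((\<lambda>x. M *v x) ` S))"
    by (intro zariski_closed_image[OF inv] zariski_closed_closure)
  moreover have "S \<subseteq> (\<lambda>x. M' *v x) ` zariski_closure ((\<lambda>x. M *v x) ` S)"
  proof
    fix x assume "x \<in> S"
    then have "M *v x \<in> zariski_closure ((\<lambda>x. M *v x) ` S)" by (intro subsetD[OF zariski_closure_subset] imageI)
    then have "M' *v (M *v x) \<in> (\<lambda>x. M' *v x) ` zariski_closure ((\<lambda>x. M *v x) ` S)" by (rule imageI)
    then show "x \<in> (\<lambda>x. M' *v x) ` zariski_closure ((\<lambda>x. M *v x) ` S)" by (simp only: M'(1))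
  qed
  ultimately have "zariski_closure S \<subseteq> (\<lambda>x. M' *v x) ` zariski_closure ((\<lambda>x. M *v x) ` S)"
    by (rule zariski_closure_minimal)
  then show "(\<lambda>x. M *v x) ` zariski_closure S \<subseteq> zariski_closure ((\<lambda>x. M *v x) ` S)"
    using M'(2) by fastforce
  show "zariski_closure ((\<lambda>x. M *v x) ` S) \<subseteq> (\<lambda>x. M *v x) ` zariski_closure S"
    by (rule zariski_closure_minimal[OF zariski_closed_image[OF M zariski_closed_closure[OF S]]])
       (use zariski_closure_subset in blast)
qed

section \<open>The torus as a group, and nondegeneracy\<close>

context toric
begin

lemma T_mult:
  assumes "y \<in> T" "y' \<in> T" shows "(\<chi> i. y $ i * y' $ i) \<in> T"
proof -
  obtain \<tau> \<sigma> where "y = chi N \<alpha> \<tau>" "\<forall>m<N. \<tau> m \<noteq> 0" "y' = chi N \<alpha> \<sigma>" "\<forall>m<N. \<sigma> m \<noteq> 0"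
    using assms unfolding tcone_def by blast
  then show ?thesis unfolding tcone_def
    by (intro CollectI exI[of _ "\<lambda>m. \<tau> m * \<sigma> m"])
       (simp add: chi_def vec_eq_iff power_int_mult_distrib prod.distrib)
qed

lemma T_inverse:
  assumes "y \<in> T" shows "(\<chi> i. inverse (y $ i)) \<in> T"
proof -
  obtain \<tau> where "y = chi N \<alpha> \<tau>" "\<forall>m<N. \<tau> m \<noteq> 0" using assms unfolding tcone_def by blast
  then show ?thesis unfolding tcone_def
    by (intro CollectI exI[of _ "\<lambda>m. inverse (\<tau> m)"])
       (simp add: chi_def vec_eq_iff power_int_inverse prod_inversef[symmetric] comp_def)
qed

text \<open>Characters are separated by products of affine functions of the exponents.\<close>

lemma nondegenerate:
  fixes h :: "'k::field_char_0^'i"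
  assumes inj: "inj \<alpha>" and supp: "\<And>i. \<alpha> i \<in> vecs N"
    and zero: "\<And>y. y \<in> T \<Longrightarrow> (\<Sum>i\<in>UNIV. h $ i * y $ i) = 0"
  shows "h = 0"
proof -
  have "h $ i0 = 0" for i0
  proof -
    have "\<exists>j<N - 1. pt i j \<noteq> pt i0 j" if "i \<noteq> i0" for i
    proof (rule ccontr)
      assume "\<not> ?thesis"
      then have eq: "pt i j = pt i0 j" if "j < N - 1" for j using that by blast
      have "\<alpha> i m = \<alpha> i0 m" for m
      proof (cases m)
        case (Suc j)
        show ?thesis
        proof (cases "m < N")
          case True
          then show ?thesis using eq[of j] Suc by (simp add: pt_def)
        next
          case False
          then show ?thesis using supp[of i] supp[of i0] by (simp add: vecs_def)
        qed
      qed (simp add: alpha_0)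
      then have "\<alpha> i = \<alpha> i0" by (rule ext)
      then show False using inj that by (simp add: inj_eq)
    qed
    then have "\<forall>i. \<exists>j. i \<noteq> i0 \<longrightarrow> j < N - 1 \<and> pt i j \<noteq> pt i0 j" by blast
    from choice[OF this] obtain j where j: "\<forall>i. i \<noteq> i0 \<longrightarrow> j i < N - 1 \<and> pt i (j i) \<noteq> pt i0 (j i)" by (rule exE)
    \<comment> \<open>Each \<open>i\<close> other than \<open>i0\<close> contributes a factor
      vanishing at the coordinate \<open>j i\<close> that tells it from \<open>i0\<close>;
      \<open>k\<close> is the order needed for these degrees.\<close>
    define F :: "nat \<Rightarrow> 'k poly" where "F l = (\<Prod>i\<in>{i. i \<noteq> i0 \<and> j i = l}. [:- of_int (pt i l), 1:])" for l
    define k where "k = (\<Sum>l<N - 1. degree (F l))"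
    have "ordc (Suc k) (vec 1) (linear_form h)"
      by (rule ordc_vanishing[OF _ one_in_T]) (simp add: zero)
    then have ker: "(\<chi> i. h $ i * vec 1 $ i) \<in> kerK k" by (rule ordc_linear_form)
    have "(\<Sum>i\<in>UNIV. h $ i * (\<Prod>l<N - 1. poly (F l) (of_int (pt i l)))) = 0"
    proof (rule killed_polynomials)
      fix \<beta> assume "\<beta> \<in> exponents (N - 1) k"
      then show "(\<Sum>i\<in>UNIV. h $ i * (\<Prod>j<N - 1. of_int (pt i j) ^ \<beta> j)) = 0"
        using ker by (simp add: kerK_def row_Ak_def mult.commute)
    qed (simp add: k_def)
    moreover have "(\<Prod>l<N - 1. poly (F l) (of_int (pt i l))) = 0" if "i \<noteq> i0" for i
    proof -
      have "poly (F (j i)) (of_int (pt i (j i))) = 0"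
        unfolding F_def poly_prod by (rule prod_zero) (use that in auto)
      then show ?thesis using j that by (intro prod_zero) auto
    qed
    then have "(\<Sum>i\<in>UNIV. h $ i * (\<Prod>l<N - 1. poly (F l) (of_int (pt i l)))) =
        (\<Sum>i\<in>{i0}. h $ i * (\<Prod>l<N - 1. poly (F l) (of_int (pt i l))))"
      by (intro sum.mono_neutral_right) auto
    moreover have "(\<Prod>l<N - 1. poly (F l) (of_int (pt i0 l))) \<noteq> 0"
      using j by (auto simp: F_def poly_prod)
    ultimately show "h $ i0 = 0" by simp
  qed
  then show ?thesis by (simp add: vec_eq_iff)
qed

end

section \<open>The criterion for selfduality\<close>

lemma int_kernel_orth: "int_kernel_Ak k n a = int_orth (row_Ak n a ` exponents n k)"
  by (simp add: int_kernel_Ak_def int_orth_def)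

lemma meval_times: "meval m (\<chi> i. x $ i * y $ i) = meval m x * meval m y"
  by (simp add: meval_def power_mult_distrib prod.distrib)

lemma power_X_times_eq:
  fixes A B :: "'k::field poly"
  assumes eq: "[:0, 1:] ^ p * A = [:0, 1:] ^ q * B" and "poly A 0 \<noteq> 0" "poly B 0 \<noteq> 0"
  shows "p = q"
proof -
  have le: "q \<le> p" if "[:0, 1:] ^ p * A = [:0, 1:] ^ q * B" "poly A 0 \<noteq> 0" for p q and A B :: "'k poly"
  proof (rule ccontr)
    assume "\<not> ?thesis"
    then obtain e where e: "q = p + Suc e" by (metis less_natE not_le add_Suc_right)
    have "[:0, 1:] ^ p * A = [:0, 1:] ^ p * ([:0, 1:] ^ Suc e * B)"
      using that(1) by (simp only: e power_add mult.assoc)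
    moreover have nz: "[:0, 1:] ^ p \<noteq> (0 :: 'k poly)" by simp
    ultimately have "A = [:0, 1:] ^ Suc e * B" using mult_left_cancel[OF nz] by blast
    then show False using that(2) by simp
  qed
  show ?thesis using le[OF eq assms(2)] le[OF eq[symmetric] assms(3)] by simp
qed

locale gale = toric N \<alpha> for N and \<alpha> :: "'i::finite \<Rightarrow> nat \<Rightarrow> int" +
  fixes k c :: nat and \<nu> :: "nat \<Rightarrow> 'i \<Rightarrow> int"
  assumes inj: "inj \<alpha>" and supp: "\<And>i. \<alpha> i \<in> vecs N"
    and basis: "is_int_basis c \<nu> (int_kernel_Ak k (N - 1) pt)"
begin

text \<open>The value at the Gale vector of \<open>i\<close> of the linear form with coefficients
  \<open>\<mu>\<close>. The field is left open because rational and real values are used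
  too.\<close>

definition gv :: "(nat \<Rightarrow> 'k::field_char_0) \<Rightarrow> 'i \<Rightarrow> 'k" where
  "gv \<mu> i = (\<Sum>l<c. \<mu> l * of_int (\<nu> l i))"

lemma gv_combination: "gv (\<lambda>l. \<mu> l + t * \<mu>' l) i = gv \<mu> i + t * gv \<mu>' i"
  by (simp add: gv_def distrib_right sum.distrib sum_distrib_left mult.assoc)

lemma gv_kerK: "(\<chi> i. gv \<mu> i) \<in> (kerK k :: ('k::field_char_0^'i) set)"
  unfolding kerK_def
proof (intro CollectI ballI)
  fix \<beta> assume \<beta>: "\<beta> \<in> exponents (N - 1) k"
  have "(\<Sum>i\<in>UNIV. row_Ak (N - 1) pt \<beta> i * \<nu> l i) = 0" if "l < c" for l
    using basis that \<beta> unfolding is_int_basis_def int_kernel_Ak_def by blast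
  then have "(\<Sum>l<c. \<mu> l * of_int (\<Sum>i\<in>UNIV. row_Ak (N - 1) pt \<beta> i * \<nu> l i)) = 0" by simp
  then have "(\<Sum>l<c. \<Sum>i\<in>UNIV. of_int (row_Ak (N - 1) pt \<beta> i) * (\<mu> l * of_int (\<nu> l i))) = 0"
    by (simp add: sum_distrib_left mult_ac)
  then show "(\<Sum>i\<in>UNIV. of_int (row_Ak (N - 1) pt \<beta> i) * (\<chi> i. gv \<mu> i) $ i) = 0"
    by (subst (asm) sum.swap) (simp add: gv_def sum_distrib_left)
qed

lemma kerK_gv:
  assumes "v \<in> (kerK k :: ('k::field_char_0^'i) set)" shows "\<exists>\<mu>. v = (\<chi> i. gv \<mu> i)"
proof -
  have "\<exists>\<mu>. \<forall>i. v $ i = (\<Sum>l<c. \<mu> l * of_int (\<nu> l i))"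
  proof (rule int_basis_spans)
    show "is_int_basis c \<nu> (int_orth (row_Ak (N - 1) pt ` exponents (N - 1) k))"
      using basis by (simp add: int_kernel_orth)
  qed (use assms in \<open>auto simp: kerK_def\<close>)
  then show ?thesis by (simp add: vec_eq_iff gv_def)
qed

lemma dual_torus_gv:
  fixes h :: "'k::field_char_0^'i"
  shows "h \<in> dual_torus k \<longleftrightarrow> h \<noteq> 0 \<and> (\<exists>y\<in>T. \<exists>\<mu>. \<forall>i. h $ i = gv \<mu> i * y $ i)"
proof -
  have "(\<exists>y\<in>T. (\<chi> i. h $ i * y $ i) \<in> kerK k) \<longleftrightarrow> (\<exists>y\<in>T. \<exists>\<mu>. \<forall>i. h $ i = gv \<mu> i * y $ i)"
  proof
    assume "\<exists>y\<in>T. (\<chi> i. h $ i * y $ i) \<in> kerK k"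
    then obtain y where y: "y \<in> T" "(\<chi> i. h $ i * y $ i) \<in> kerK k" by blast
    obtain \<mu> where "(\<chi> i. h $ i * y $ i) = (\<chi> i. gv \<mu> i)" using kerK_gv[OF y(2)] by blast
    then have "h $ i * y $ i = gv \<mu> i" for i by (simp add: vec_eq_iff)
    then have "h $ i = gv \<mu> i * (\<chi> i. inverse (y $ i)) $ i" for i
      using tcone_nonzero[OF y(1), of i] by (metis (no_types) vec_lambda_beta divide_inverse nonzero_mult_div_cancel_right)
    then show "\<exists>y\<in>T. \<exists>\<mu>. \<forall>i. h $ i = gv \<mu> i * y $ i" using T_inverse[OF y(1)] by blast
  next
    assume "\<exists>y\<in>T. \<exists>\<mu>. \<forall>i. h $ i = gv \<mu> i * y $ i"
    then obtain y \<mu> where y: "y \<in> T" "\<forall>i. h $ i = gv \<mu> i * y $ i" by blast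
    then have "(\<chi> i. h $ i * (\<chi> i. inverse (y $ i)) $ i) = (\<chi> i. gv \<mu> i)"
      using tcone_nonzero[OF y(1)] by (simp add: vec_eq_iff)
    then have "(\<chi> i. h $ i * (\<chi> i. inverse (y $ i)) $ i) \<in> kerK k" using gv_kerK by metis
    then show "\<exists>y\<in>T. (\<chi> i. h $ i * y $ i) \<in> kerK k" using T_inverse[OF y(1)] by blast
  qed
  then show ?thesis by (simp add: dual_torus_def)
qed

text \<open>Vanishing 2x2 minors express parallelism over the integers. A zero vector is parallel to
  every vector, so transitivity is available only for nonzero Gale vectors.\<close>

definition par :: "'i \<Rightarrow> 'i \<Rightarrow> bool" where
  "par i j \<longleftrightarrow> (\<forall>l<c. \<forall>m<c. \<nu> l i * \<nu> m j = \<nu> m i * \<nu> l j)"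

definition cls :: "'i \<Rightarrow> 'i set" where
  "cls i = {j. par i j}"

text \<open>No Gale vector is zero: the dual form of \<open>knap\<close>.\<close>

definition pyramidless :: bool where
  "pyramidless \<longleftrightarrow> (\<forall>i. \<exists>l<c. \<nu> l i \<noteq> 0)"

text \<open>The indicators of the parallel classes lie in the row span of A, expressed through the
  orthogonal complement of that span.\<close>

definition cayley_relations :: bool where
  "cayley_relations \<longleftrightarrow> (\<forall>i z. relation z \<longrightarrow> (\<Sum>j\<in>cls i. z j) = 0)"

lemma par_refl: "par i i"
  by (simp add: par_def mult.commute)

lemma par_sym: "par i j \<Longrightarrow> par j i"
  by (simp add: par_def mult.commute)

lemma par_ratio:
  assumes nz: pyramidless and "par i j"
  shows "\<exists>s::'k::field_char_0. s \<noteq> 0 \<and> (\<forall>\<mu>. gv \<mu> i = s * gv \<mu> j)"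
proof -
  obtain l where l: "l < c" "\<nu> l j \<noteq> 0" using nz unfolding pyramidless_def by blast
  obtain m where m: "m < c" "\<nu> m i \<noteq> 0" using nz unfolding pyramidless_def by blast
  define s :: 'k where "s = of_int (\<nu> l i) / of_int (\<nu> l j)"
  have eq: "of_int (\<nu> m i) = s * of_int (\<nu> m j)" if "m < c" for m
  proof -
    have "(of_int (\<nu> m i * \<nu> l j) :: 'k) = of_int (\<nu> l i * \<nu> m j)"
      using assms(2) l(1) that unfolding par_def by (metis mult.commute)
    then show ?thesis using l(2) by (simp add: s_def field_simps)
  qed
  have "gv \<mu> i = s * gv \<mu> j" for \<mu> :: "nat \<Rightarrow> 'k"
    unfolding gv_def sum_distrib_left by (rule sum.cong) (simp_all add: eq mult_ac)
  moreover have "s \<noteq> 0" using eq[OF m(1)] m(2) by auto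
  ultimately show ?thesis by blast
qed

lemma gv_unit: "l < c \<Longrightarrow> gv (\<lambda>m. if m = l then 1 else 0) i = of_int (\<nu> l i)"
  by (simp add: gv_def if_distrib[of "\<lambda>c. c * _"] cong: if_cong)

text \<open>The ratios of parallel nonzero vectors multiply; rational ratios suffice and are
  compared through the unit forms.\<close>

lemma par_trans:
  assumes nz: pyramidless and "par i j" "par j h"
  shows "par i h"
proof -
  obtain s t :: rat where s: "\<forall>\<mu>. gv \<mu> i = s * gv \<mu> j" "\<forall>\<mu>. gv \<mu> j = t * gv \<mu> h"
    using par_ratio[OF nz assms(2)] par_ratio[OF nz assms(3)] by blast
  have eq: "(of_int (\<nu> l i) :: rat) = s * t * of_int (\<nu> l h)" if "l < c" for l
    using s gv_unit[OF that, where 'a = rat] by (metis mult.assoc)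
  have "(of_int (\<nu> l i * \<nu> m h) :: rat) = of_int (\<nu> m i * \<nu> l h)" if "l < c" "m < c" for l m
    using eq[OF that(1)] eq[OF that(2)] by simp
  then show ?thesis unfolding par_def by (simp only: of_int_eq_iff) blast
qed

lemma generic_gv:
  assumes nz: pyramidless shows "\<exists>\<mu>::nat \<Rightarrow> 'k::field_char_0. \<forall>i. gv \<mu> i \<noteq> 0"
proof -
  have "\<exists>\<mu>\<in>UNIV. \<forall>i\<in>UNIV. gv (\<mu> :: nat \<Rightarrow> 'k) i \<noteq> 0"
  proof (rule generic_combination[OF finite])
    fix v w :: "nat \<Rightarrow> 'k" and t
    show "\<exists>u\<in>UNIV. \<forall>i. gv u i = gv v i + t * gv w i"
      by (rule bexI[of _ "\<lambda>l. v l + t * w l"]) (simp_all add: gv_combination)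
  next
    fix i
    obtain l where "l < c" "\<nu> l i \<noteq> 0" using nz unfolding pyramidless_def by blast
    then show "\<exists>v\<in>UNIV. gv v i \<noteq> (0 :: 'k)"
      by (intro bexI[of _ "\<lambda>m. if m = l then 1 else 0"]) (simp_all add: gv_unit)
  qed simp
  then show ?thesis by simp
qed

lemma dual_torus_generic:
  fixes \<mu> :: "nat \<Rightarrow> 'k::field_char_0"
  assumes \<mu>: "\<And>i. gv \<mu> i \<noteq> 0" and y: "y \<in> T"
  shows "diagm (gv \<mu>) *v y \<in> dual_torus k"
proof -
  have "diagm (gv \<mu>) *v y \<noteq> 0"
    using \<mu> tcone_nonzero[OF y] by (simp add: diagm_mult vec_eq_iff)
  then show ?thesis unfolding dual_torus_gv using y by (auto simp: diagm_mult)
qed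

text \<open>Each class of parallel Gale vectors contributes one free character to the torus.\<close>

lemma class_values_in_T:
  fixes g :: "'i \<Rightarrow> 'k::field_char_0"
  assumes nz: pyramidless and cr: cayley_relations and g: "\<And>i. g i \<noteq> 0"
  shows "(\<chi> i. g (SOME j. par i j)) \<in> T"
proof -
  define rp where "rp i = (SOME j. par i j)" for i
  have rp_par: "par i (rp i)" for i unfolding rp_def by (rule someI[of "par i"]) (rule par_refl)
  have rp_eq: "rp i = rp j" if "par i j" for i j
  proof -
    have "par i = par j" using that par_trans[OF nz] par_sym by blast
    then show ?thesis by (simp add: rp_def)
  qed
  \<comment> \<open>The indicator of a class is an integral combination of the rows, so
    \<open>g \<rho>\<close> enters \<open>\<tau>\<close> with integer exponents and no roots are
    taken.\<close>
  define W :: "'i \<Rightarrow> nat \<Rightarrow> int" where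
    "W \<rho> m = (\<Sum>i'\<in>UNIV. of_int (C m i') * (if par \<rho> i' then 1 else 0))" for \<rho> m
  have W: "(\<Sum>m<N. W \<rho> m * \<alpha> i m) = (if par \<rho> i then 1 else 0)" for \<rho> i
  proof -
    have "(\<Sum>i\<in>UNIV. of_int (z i) * (if par \<rho> i then 1 else 0 :: int)) = 0" if "relation z" for z
      using cr that unfolding cayley_relations_def cls_def
      by (simp add: sum.If_cases if_distrib[of "\<lambda>c. _ * c"] cong: if_cong)
    from killed_by_relations[of "\<lambda>i. if par \<rho> i then 1 else 0 :: int" i, OF this]
    show ?thesis by (simp add: W_def mult.commute)
  qed
  define \<tau> where "\<tau> m = (\<Prod>\<rho>\<in>range rp. g \<rho> powi W \<rho> m)" for m
  have "chi N \<alpha> \<tau> $ i = g (rp i)" for i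
  proof -
    have "chi N \<alpha> \<tau> $ i = (\<Prod>m<N. \<Prod>\<rho>\<in>range rp. g \<rho> powi (W \<rho> m * \<alpha> i m))"
      by (simp add: chi_def \<tau>_def power_int_prod power_int_mult)
    also have "\<dots> = (\<Prod>\<rho>\<in>range rp. g \<rho> powi (\<Sum>m<N. W \<rho> m * \<alpha> i m))"
      by (subst prod.swap) (simp add: power_int_sum g)
    also have "\<dots> = (\<Prod>\<rho>\<in>range rp. if \<rho> = rp i then g \<rho> else 1)"
    proof (rule prod.cong[OF refl])
      fix \<rho> assume "\<rho> \<in> range rp"
      then obtain j where "\<rho> = rp j" by blast
      then have "par \<rho> i \<longleftrightarrow> \<rho> = rp i"
        using rp_eq rp_par par_sym par_trans[OF nz] by metis
      then show "g \<rho> powi (\<Sum>m<N. W \<rho> m * \<alpha> i m) = (if \<rho> = rp i then g \<rho> else 1)" by (simp add: W)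
    qed
    also have "\<dots> = g (rp i)" by simp
    finally show ?thesis .
  qed
  then have "(\<chi> i. g (rp i)) = chi N \<alpha> \<tau>" by (simp add: vec_eq_iff)
  moreover have "\<tau> m \<noteq> 0" for m using g by (simp add: \<tau>_def)
  ultimately show ?thesis unfolding tcone_def rp_def by blast
qed

text \<open>The factor \<open>s i\<close> is the ratio of the Gale vector of \<open>i\<close> to
  that of the chosen representative of its class. A kernel vector without zeros is \<open>s\<close>
  times a vector constant on classes, and the latter is a torus point; the other kernel vectors are
  limits of these.\<close>

lemma selfdual_if:
  assumes nz: pyramidless and cr: cayley_relations
  shows "k_selfdual k (X :: ('k::field_char_0^'i) set)"
proof -
  have "\<forall>i. \<exists>s::'k. s \<noteq> 0 \<and> (\<forall>\<mu>. gv \<mu> i = s * gv \<mu> (SOME j. par i j))"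
    by (intro allI par_ratio[OF nz] someI[of "par _", OF par_refl])
  from choice[OF this] obtain s :: "'i \<Rightarrow> 'k" where
    s_conj: "\<forall>i. s i \<noteq> 0 \<and> (\<forall>\<mu>. gv \<mu> i = s i * gv \<mu> (SOME j. par i j))" by (rule exE)
  have s: "s i \<noteq> 0" "gv \<mu> i = s i * gv \<mu> (SOME j. par i j)" for i \<mu>
    using s_conj by blast+
  obtain \<mu>0 :: "nat \<Rightarrow> 'k" where \<mu>0: "\<And>i. gv \<mu>0 i \<noteq> 0" using generic_gv[OF nz] by blast
  have inv: "invertible (diagm s)" by (rule invertible_diagm) (rule s(1))
  have X: "(\<lambda>x. diagm s *v x) ` X = zariski_closure ((\<lambda>x. diagm s *v x) ` T)"
    by (rule zariski_closure_image[OF inv zero_notin_T, symmetric])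
  have sub: "(\<lambda>x. diagm s *v x) ` T \<subseteq> dual_torus k"
  proof (rule image_subsetI)
    fix y :: "'k^'i" assume y: "y \<in> T"
    define y0 :: "'k^'i" where "y0 = (\<chi> i. gv \<mu>0 (SOME j. par i j))"
    have y0: "y0 \<in> T" unfolding y0_def by (rule class_values_in_T[OF nz cr \<mu>0])
    have "s i = gv \<mu>0 i * inverse (y0 $ i)" for i
      using tcone_nonzero[OF y0, of i] by (subst s(2)) (simp add: y0_def)
    then have "diagm s *v y = diagm (gv \<mu>0) *v (\<chi> i. y $ i * (\<chi> i. inverse (y0 $ i)) $ i)"
      by (simp add: diagm_mult vec_eq_iff)
    then show "diagm s *v y \<in> dual_torus k"
      using dual_torus_generic[OF \<mu>0 T_mult[OF y T_inverse[OF y0]]] by simp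
  qed
  have "dual_torus k \<subseteq> (\<lambda>x. diagm s *v x) ` X"
  proof
    fix h :: "'k^'i" assume h: "h \<in> dual_torus k"
    then have "h \<noteq> 0" by (simp add: dual_torus_gv)
    obtain y \<mu> where y: "y \<in> T" "\<forall>i. h $ i = gv \<mu> i * y $ i" using h unfolding dual_torus_gv by blast
    have closed: "zariski_closed ((\<lambda>x. diagm s *v x) ` X)"
      by (rule zariski_closed_image[OF inv zariski_closed_closure[OF zero_notin_T]])
    show "h \<in> (\<lambda>x. diagm s *v x) ` X"
    proof (rule ccontr)
      assume "h \<notin> (\<lambda>x. diagm s *v x) ` X"
      then obtain p where p: "\<forall>z\<in>(\<lambda>x. diagm s *v x) ` X. mpoly_eval p z = 0" "mpoly_eval p h \<noteq> 0"
        using zariski_closed_separate[OF closed _ \<open>h \<noteq> 0\<close>] by blast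
      \<comment> \<open>The form \<open>\<mu>\<close> may vanish at some Gale vectors; on the line
        from it in the direction of the generic form \<open>\<mu>0\<close> almost every form
        vanishes at none.\<close>
      define g where "g i = [:gv \<mu> i * y $ i, gv \<mu>0 i * y $ i:]" for i
      have "curve g p = 0"
      proof (rule poly_zero_of_infinite_zeros)
        show "finite (range (\<lambda>i. - gv \<mu> i / gv \<mu>0 i))" by simp
        fix t assume t: "t \<notin> range (\<lambda>i. - gv \<mu> i / gv \<mu>0 i)"
        define \<mu>t where "\<mu>t l = \<mu> l + t * \<mu>0 l" for l
        have gvt: "gv \<mu>t i = gv \<mu> i + t * gv \<mu>0 i" for i
          by (simp add: gv_def \<mu>t_def distrib_right sum.distrib sum_distrib_left mult.assoc)
        have nzt: "gv \<mu>t i \<noteq> 0" for i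
        proof
          assume "gv \<mu>t i = 0"
          then have "gv \<mu> i + t * gv \<mu>0 i = 0" by (simp only: gvt)
          then have "t * gv \<mu>0 i = - gv \<mu> i" by (simp add: eq_neg_iff_add_eq_0 add.commute)
          then have "t = - gv \<mu> i / gv \<mu>0 i" using \<mu>0[of i] by (metis nonzero_mult_div_cancel_right)
          then show False using t by blast
        qed
        have "(\<chi> i. (\<chi> i. gv \<mu>t (SOME j. par i j)) $ i * y $ i) \<in> X"
          by (rule subsetD[OF zariski_closure_subset T_mult[OF class_values_in_T[OF nz cr nzt] y(1)]])
        moreover have "(\<chi> i. poly (g i) t) = diagm s *v (\<chi> i. (\<chi> i. gv \<mu>t (SOME j. par i j)) $ i * y $ i)"
          using s(2)[of \<mu>t, symmetric]
          by (simp add: diagm_mult vec_eq_iff g_def mult.assoc[symmetric]) (simp add: gvt algebra_simps)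
        ultimately have "(\<chi> i. poly (g i) t) \<in> (\<lambda>x. diagm s *v x) ` X" by (simp only: imageI)
        then show "poly (curve g p) t = 0" unfolding poly_curve by (rule bspec[OF p(1)])
      qed
      then have "poly (curve g p) 0 = 0" by simp
      moreover have "(\<chi> i. poly (g i) 0) = h" using y(2) by (simp add: g_def vec_eq_iff)
      ultimately show False using p(2) by (simp add: poly_curve)
    qed
  qed
  then have "zariski_closure (dual_torus k) \<subseteq> (\<lambda>x. diagm s *v x) ` X"
    by (intro zariski_closure_minimal zariski_closed_image[OF inv] zariski_closed_closure[OF zero_notin_T])
  moreover have "(\<lambda>x. diagm s *v x) ` X \<subseteq> zariski_closure (dual_torus k)"
    unfolding X by (rule zariski_closure_mono[OF sub])
  ultimately have "(\<lambda>x. diagm s *v x) ` X = zariski_closure (dual_torus k)" by (intro subset_antisym)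
  then show ?thesis unfolding k_selfdual_def higher_dual_X using inv by blast
qed

text \<open>A zero Gale vector would put the whole dual into a coordinate hyperplane, whereas an
  invertible image of X lies in no hyperplane.\<close>

lemma selfdual_pyramidless:
  assumes sd: "k_selfdual k (X :: ('k::field_char_0^'i) set)"
  shows pyramidless
proof (rule ccontr)
  assume "\<not> pyramidless"
  then obtain i0 where i0: "\<forall>l<c. \<nu> l i0 = 0" unfolding pyramidless_def by blast
  obtain M :: "'k^'i^'i" where M: "invertible M" "(\<lambda>x. M *v x) ` X = zariski_closure (dual_torus k)"
    using sd unfolding k_selfdual_def higher_dual_X by blast
  have "homogeneous (vpoly i0 :: ('k, 'i) mpoly)" using hdeg_vpoly homogeneous_iff by blast
  then have "zariski_closed {h :: 'k^'i. h \<noteq> 0 \<and> mpoly_eval (vpoly i0) h = 0}"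
    by (rule zariski_closed_hyper)
  moreover have "dual_torus k \<subseteq> {h :: 'k^'i. h \<noteq> 0 \<and> mpoly_eval (vpoly i0) h = 0}"
    using i0 by (auto simp: dual_torus_gv gv_def)
  ultimately have sub: "zariski_closure (dual_torus k) \<subseteq> {h :: 'k^'i. h \<noteq> 0 \<and> mpoly_eval (vpoly i0) h = 0}"
    by (rule zariski_closure_minimal)
  have "M $ i0 = 0"
  proof (rule nondegenerate[OF inj supp])
    fix y :: "'k^'i" assume "y \<in> T"
    then have "M *v y \<in> zariski_closure (dual_torus k)" using M(2) zariski_closure_subset by blast
    then have "(M *v y) $ i0 = 0" using sub by auto
    then show "(\<Sum>i\<in>UNIV. M $ i0 $ i * y $ i) = 0" by (simp add: matrix_vector_mult_def)
  qed
  then have zero: "(M *v x) $ i0 = 0" for x by (simp add: matrix_vector_mult_def)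
  obtain M' where "M *v (M' *v axis i0 1) = axis i0 1" using matrix_left_inverse[OF M(1)] by blast
  then show False using zero[of "M' *v axis i0 1"] by simp
qed

text \<open>The linear automorphism \<open>E\<close> maps X into X. If its image were smaller, a
  chain of irreducible sets in that image could be prolonged by X beyond the dimension.\<close>

lemma translate_eq_dual:
  fixes \<mu> :: "nat \<Rightarrow> 'k::field_char_0" and M :: "'k^'i^'i"
  assumes M: "invertible M" "(\<lambda>x. M *v x) ` X = zariski_closure (dual_torus k)"
    and \<mu>: "\<And>i. gv \<mu> i \<noteq> 0"
  shows "(\<lambda>x. diagm (gv \<mu>) *v x) ` X = zariski_closure (dual_torus k)"
proof -
  have inv: "invertible (diagm (gv \<mu>))" by (rule invertible_diagm) (rule \<mu>)
  have X: "(\<lambda>x. diagm (gv \<mu>) *v x) ` X = zariski_closure ((\<lambda>x. diagm (gv \<mu>) *v x) ` T)"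
    by (rule zariski_closure_image[OF inv zero_notin_T, symmetric])
  have sub: "(\<lambda>x. diagm (gv \<mu>) *v x) ` X \<subseteq> zariski_closure (dual_torus k)"
    unfolding X by (rule zariski_closure_mono) (use dual_torus_generic[OF \<mu>] in blast)
  obtain M' where M': "invertible M'" "\<forall>x. M' *v (M *v x) = x" "\<forall>x. M *v (M' *v x) = x"
    using matrix_left_inverse[OF M(1)] by blast
  obtain D' where D': "\<forall>x. D' *v (diagm (gv \<mu>) *v x) = x"
    using matrix_left_inverse[OF inv] by blast
  define E where "E x = M' *v (diagm (gv \<mu>) *v x)" for x
  have injE: "inj E" unfolding E_def by (rule injI) (metis M'(3) D')
  have EX: "E ` X \<subseteq> X"
  proof (rule image_subsetI)
    fix x :: "'k^'i" assume "x \<in> X"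
    then have "diagm (gv \<mu>) *v x \<in> (\<lambda>x. M *v x) ` X" using sub M(2) by blast
    then show "E x \<in> X" unfolding E_def using M'(2) by auto
  qed
  have "E ` X = X"
  proof (rule ccontr)
    assume "E ` X \<noteq> X"
    then have strict: "E ` X \<subset> X" using EX by blast
    \<comment> \<open>The closures of the subtori are carried over by \<open>E\<close>, and X is put
      on top: a chain of length \<open>N\<close> in a variety of dimension
      \<open>N - 1\<close>.\<close>
    define Z :: "nat \<Rightarrow> ('k^'i) set" where
      "Z l = (if l < N then E ` zariski_closure (tsub N \<alpha> l) else X)" for l
    have irr: "irreducible_closed (E ` zariski_closure (tsub N \<alpha> l))" for l
    proof -
      have "E ` zariski_closure (tsub N \<alpha> l) =
          (\<lambda>x. M' *v x) ` (\<lambda>x. diagm (gv \<mu>) *v x) ` zariski_closure (tsub N \<alpha> l)"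
        by (simp add: E_def image_image)
      then show ?thesis
        using irreducible_closed_image[OF M'(1) irreducible_closed_image[OF inv irreducible_tsub]] by simp
    qed
    have top: "(tsub N \<alpha> (N - 1) :: ('k^'i) set) = T" by (auto simp: tsub_def tcone_def)
    have "N \<le> N - 1"
    proof (rule chain_bound)
      show "irreducible_closed (Z l)" if "l \<le> N" for l
        by (simp add: Z_def irr irreducible_X)
      show "Z l \<subset> Z (Suc l)" if "l < N" for l
      proof (cases "Suc l < N")
        case True
        then show ?thesis using tsub_chain[OF True] injE
          by (simp add: Z_def psubset_eq inj_image_subset_iff inj_image_eq_iff)
      next
        case False
        then have "l = N - 1" using that by simp
        then show ?thesis using strict False that by (simp add: Z_def top del: One_nat_def)
      qed
      show "Z N \<subseteq> X" by (simp add: Z_def)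
    qed
    then show False using N_pos by simp
  qed
  have "(\<lambda>x. M *v x) ` E ` X = (\<lambda>x. diagm (gv \<mu>) *v x) ` X"
    using M'(3) by (simp add: E_def image_image)
  then show ?thesis using \<open>E ` X = X\<close> M(2) by simp
qed

text \<open>The translates of X by the two kernel vectors coincide, so the second vector is the
  first times a point of X, which satisfies the binomial equation.\<close>

lemma selfdual_binomial:
  fixes \<mu> \<mu>' :: "nat \<Rightarrow> 'k::field_char_0"
  assumes sd: "k_selfdual k (X :: ('k^'i) set)" and z: "relation z"
    and \<mu>: "\<And>i. gv \<mu> i \<noteq> 0" and \<mu>': "\<And>i. gv \<mu>' i \<noteq> 0"
  shows "meval (neg_mono z) (\<chi> i. gv \<mu> i) * meval (pos_mono z) (\<chi> i. gv \<mu>' i) =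
    meval (pos_mono z) (\<chi> i. gv \<mu> i) * meval (neg_mono z) (\<chi> i. gv \<mu>' i)"
proof -
  obtain M :: "'k^'i^'i" where M: "invertible M" "(\<lambda>x. M *v x) ` X = zariski_closure (dual_torus k)"
    using sd unfolding k_selfdual_def higher_dual_X by blast
  have "diagm (gv \<mu>') *v vec 1 \<in> zariski_closure (dual_torus k)"
    using dual_torus_generic[OF \<mu>' one_in_T] zariski_closure_subset by blast
  then obtain x where x: "x \<in> X" "diagm (gv \<mu>') *v vec 1 = diagm (gv \<mu>) *v x"
    using translate_eq_dual[OF M \<mu>] by blast
  have v: "(\<chi> i. gv \<mu>' i) = (\<chi> i. (\<chi> i. gv \<mu> i) $ i * x $ i)"
    using x(2) by (simp add: diagm_mult vec_eq_iff)
  have "meval (pos_mono z) x = meval (neg_mono z) x"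
    using binom_X[OF z x(1)] by (simp add: binom_def)
  then show ?thesis unfolding v meval_times by simp
qed

text \<open>Degenerating the Gale form to one that vanishes exactly on a class of parallel vectors
  isolates the exponents of that class.\<close>

lemma selfdual_relations:
  assumes sd: "k_selfdual k (X :: ('k::field_char_0^'i) set)"
  shows cayley_relations
  unfolding cayley_relations_def
proof (intro allI impI)
  fix i0 z assume z: "relation z"
  have nz: pyramidless by (rule selfdual_pyramidless[OF sd])
  obtain \<mu>1 :: "nat \<Rightarrow> 'k" where \<mu>1: "\<And>i. gv \<mu>1 i \<noteq> 0" using generic_gv[OF nz] by blast
  have "\<exists>\<mu>\<in>{\<mu>. gv \<mu> i0 = 0}. \<forall>i\<in>- cls i0. gv (\<mu> :: nat \<Rightarrow> 'k) i \<noteq> 0"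
  proof (rule generic_combination[OF finite])
    fix v w :: "nat \<Rightarrow> 'k" and t
    assume "v \<in> {\<mu>. gv \<mu> i0 = 0}" "w \<in> {\<mu>. gv \<mu> i0 = 0}"
    then show "\<exists>u\<in>{\<mu>. gv \<mu> i0 = 0}. \<forall>i. gv u i = gv v i + t * gv w i"
      by (intro bexI[of _ "\<lambda>l. v l + t * w l"]) (simp_all add: gv_combination)
  next
    show "(\<lambda>_. 0) \<in> {\<mu>. gv \<mu> i0 = (0 :: 'k)}" by (simp add: gv_def)
  next
    fix i assume "i \<in> - cls i0"
    then obtain l m where lm: "l < c" "m < c" "\<nu> l i0 * \<nu> m i \<noteq> \<nu> m i0 * \<nu> l i"
      unfolding cls_def par_def by blast
    \<comment> \<open>A 2x2 minor with the Gale vector of \<open>i0\<close>, as a linear form in the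
      other vector: it is zero at \<open>i0\<close> and nonzero at \<open>i\<close>.\<close>
    define \<mu> :: "nat \<Rightarrow> 'k" where
      "\<mu> p = (if p = l then of_int (\<nu> m i0) else 0) - (if p = m then of_int (\<nu> l i0) else 0)" for p
    have \<mu>: "gv \<mu> j = of_int (\<nu> m i0 * \<nu> l j - \<nu> l i0 * \<nu> m j)" for j
      using lm(1,2)
      by (simp add: gv_def \<mu>_def left_diff_distrib sum_subtractf if_distrib[of "\<lambda>c. c * _"] cong: if_cong)
    then have "gv \<mu> i0 = 0" "gv \<mu> i \<noteq> 0" using lm(3) by (simp_all only: of_int_eq_0_iff) auto
    then show "\<exists>v\<in>{\<mu>. gv \<mu> i0 = 0}. gv v i \<noteq> (0 :: 'k)" by blast
  qed
  then obtain \<mu>0 :: "nat \<Rightarrow> 'k" where \<mu>0: "gv \<mu>0 i0 = 0" "\<forall>i\<in>- cls i0. gv \<mu>0 i \<noteq> 0" by blast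
  have cls0: "gv \<mu>0 i = 0" if "i \<in> cls i0" for i
  proof -
    have "par i i0" using that by (simp add: cls_def par_sym)
    then obtain s :: 'k where "\<forall>\<mu>. gv \<mu> i = s * gv \<mu> i0" using par_ratio[OF nz] by blast
    then show ?thesis using \<mu>0(1) by simp
  qed
  define v1 where "v1 = (\<chi> i. gv \<mu>1 i)"
  \<comment> \<open>At parameter t the degenerating form takes the value t times \<open>F\<close> on
    the class and \<open>F\<close> off it. Since \<open>F\<close> is nonzero at t = 0, the order in
    t can be read off.\<close>
  define F where "F i = (if i \<in> cls i0 then [:gv \<mu>1 i:] else [:gv \<mu>0 i, gv \<mu>1 i:])" for i
  define A where "A m = (\<Prod>i\<in>UNIV. F i ^ lkp m i)" for m
  have A0: "poly (A m) 0 \<noteq> 0" for m using \<mu>0(2) \<mu>1 by (auto simp: A_def F_def poly_prod)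
  have A: "poly ([:0, 1:] ^ (\<Sum>i\<in>cls i0. lkp m i) * A m) t = meval m (\<chi> i. gv (\<lambda>l. \<mu>0 l + t * \<mu>1 l) i)" for m t
  proof -
    have "t ^ (\<Sum>i\<in>cls i0. lkp m i) = (\<Prod>i\<in>UNIV. (if i \<in> cls i0 then t else 1) ^ lkp m i)"
      by (simp add: power_sum if_distrib[of "\<lambda>c. c ^ _"] prod.If_cases cong: if_cong)
    moreover have "gv (\<lambda>l. \<mu>0 l + t * \<mu>1 l) i = (if i \<in> cls i0 then t else 1) * poly (F i) t" for i
      using cls0[of i] by (simp add: gv_combination F_def)
    ultimately show ?thesis
      by (simp add: A_def meval_def poly_prod poly_power power_mult_distrib prod.distrib)
  qed
  have "smult (meval (neg_mono z) v1) ([:0, 1:] ^ (\<Sum>i\<in>cls i0. lkp (pos_mono z) i) * A (pos_mono z)) =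
      smult (meval (pos_mono z) v1) ([:0, 1:] ^ (\<Sum>i\<in>cls i0. lkp (neg_mono z) i) * A (neg_mono z))"
  proof (rule poly_eq_of_infinite)
    show "finite (range (\<lambda>i. - gv \<mu>0 i / gv \<mu>1 i))" by simp
    fix t assume t: "t \<notin> range (\<lambda>i. - gv \<mu>0 i / gv \<mu>1 i)"
    have nzt: "gv (\<lambda>l. \<mu>0 l + t * \<mu>1 l) i \<noteq> 0" for i
    proof
      assume "gv (\<lambda>l. \<mu>0 l + t * \<mu>1 l) i = 0"
      then have "gv \<mu>0 i + t * gv \<mu>1 i = 0" unfolding gv_combination .
      then have "t * gv \<mu>1 i = - gv \<mu>0 i" by (simp add: eq_neg_iff_add_eq_0 add.commute)
      then have "t = - gv \<mu>0 i / gv \<mu>1 i" using \<mu>1[of i] by (metis nonzero_mult_div_cancel_right)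
      then show False using t by blast
    qed
    show "poly (smult (meval (neg_mono z) v1) ([:0, 1:] ^ (\<Sum>i\<in>cls i0. lkp (pos_mono z) i) * A (pos_mono z))) t =
      poly (smult (meval (pos_mono z) v1) ([:0, 1:] ^ (\<Sum>i\<in>cls i0. lkp (neg_mono z) i) * A (neg_mono z))) t"
      unfolding poly_smult A v1_def by (rule selfdual_binomial[OF sd z \<mu>1 nzt])
  qed
  then have "[:0, 1:] ^ (\<Sum>i\<in>cls i0. lkp (pos_mono z) i) * smult (meval (neg_mono z) v1) (A (pos_mono z)) =
      [:0, 1:] ^ (\<Sum>i\<in>cls i0. lkp (neg_mono z) i) * smult (meval (pos_mono z) v1) (A (neg_mono z))"
    by simp
  moreover have v1: "meval m v1 \<noteq> 0" for m using \<mu>1 by (simp add: v1_def meval_nonzero)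
  ultimately have "(\<Sum>i\<in>cls i0. lkp (pos_mono z) i) = (\<Sum>i\<in>cls i0. lkp (neg_mono z) i)"
    by (elim power_X_times_eq) (simp_all add: A0 v1)
  then have "(\<Sum>i\<in>cls i0. int (nat (z i))) = (\<Sum>i\<in>cls i0. int (nat (- z i)))"
    unfolding pos_mono_def neg_mono_def lookup_mono_of of_nat_sum[symmetric] by simp
  then have "(\<Sum>i\<in>cls i0. int (nat (z i)) - int (nat (- z i))) = 0" by (simp add: sum_subtractf)
  moreover have "int (nat (z i)) - int (nat (- z i)) = z i" for i by simp
  ultimately show "(\<Sum>i\<in>cls i0. z i) = 0" by simp
qed

theorem selfdual_iff:
  "k_selfdual k (X :: ('k::field_char_0^'i) set) \<longleftrightarrow> pyramidless \<and> cayley_relations"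
  using selfdual_if selfdual_pyramidless selfdual_relations by blast

end

section \<open>Row spans, lines of Gale vectors and Cayley decompositions\<close>

lemma in_span_iff_annihilator:
  fixes G :: "(real^'i::finite) set"
  shows "v \<in> span G \<longleftrightarrow> (\<forall>y::real^'i. (\<forall>g\<in>G. (\<Sum>i\<in>UNIV. g $ i * y $ i) = 0) \<longrightarrow> (\<Sum>i\<in>UNIV. v $ i * y $ i) = 0)"
proof (intro iffI allI impI)
  fix y :: "real^'i" assume v: "v \<in> span G" and y: "\<forall>g\<in>G. (\<Sum>i\<in>UNIV. g $ i * y $ i) = 0"
  have sub: "subspace {v. (\<Sum>i\<in>UNIV. v $ i * y $ i) = 0}"
    by (simp add: subspace_def algebra_simps sum.distrib sum_distrib_left[symmetric])
  have "G \<subseteq> {v. (\<Sum>i\<in>UNIV. v $ i * y $ i) = 0}" using y by blast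
  from span_minimal[OF this sub] v show "(\<Sum>i\<in>UNIV. v $ i * y $ i) = 0" by blast
next
  assume *: "\<forall>y::real^'i. (\<forall>g\<in>G. (\<Sum>i\<in>UNIV. g $ i * y $ i) = 0) \<longrightarrow> (\<Sum>i\<in>UNIV. v $ i * y $ i) = 0"
  show "v \<in> span G"
  proof (rule double_annihilator)
    show "vec.subspace (span G)"
      by (rule vec.subspaceI) (simp_all add: span_zero span_add span_scale scalar_mult_eq_scaleR)
  qed (use * span_base in blast)
qed

section \<open>Affine lattices and affine maps\<close>

lemma affine_lattice_closed:
  assumes "x \<in> affine_lattice S" "y \<in> affine_lattice S" "z \<in> affine_lattice S"
  shows "(\<lambda>m. x m - y m + z m) \<in> affine_lattice S"
proof -
  obtain c c' c'' :: "(nat \<Rightarrow> int) \<Rightarrow> int" where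
    "x = (\<lambda>m. \<Sum>s\<in>S. c s * s m)" "y = (\<lambda>m. \<Sum>s\<in>S. c' s * s m)" "z = (\<lambda>m. \<Sum>s\<in>S. c'' s * s m)"
    "(\<Sum>s\<in>S. c s) = 1" "(\<Sum>s\<in>S. c' s) = 1" "(\<Sum>s\<in>S. c'' s) = 1"
    using assms unfolding affine_lattice_def by (elim CollectE exE conjE) (rule that)
  then show ?thesis unfolding affine_lattice_def
    by (intro CollectI exI[of _ "\<lambda>s. c s - c' s + c'' s"])
       (simp add: algebra_simps sum.distrib sum_subtractf)
qed

lemma affine_lattice_base:
  assumes "finite S" "s \<in> S" shows "s \<in> affine_lattice S"
  unfolding affine_lattice_def
  by (intro CollectI exI[of _ "\<lambda>s'. if s' = s then 1 else 0"])
     (use assms in \<open>simp add: if_distrib[of "\<lambda>c. c * _"] cong: if_cong\<close>)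

lemma affine_lattice_image:
  assumes f: "inj f" and lin: "\<And>(S :: (nat \<Rightarrow> int) set) c. f (\<lambda>m. \<Sum>s\<in>S. c s * s m) = (\<lambda>m. \<Sum>s\<in>S. c s * f s m)"
  shows "f ` affine_lattice S = affine_lattice (f ` S)"
proof (intro equalityI subsetI)
  fix v assume "v \<in> f ` affine_lattice S"
  then obtain c where c: "v = f (\<lambda>m. \<Sum>s\<in>S. c s * s m)" "(\<Sum>s\<in>S. c s) = 1"
    unfolding affine_lattice_def by auto
  have injS: "inj_on f S" by (rule inj_on_subset[OF f]) simp
  show "v \<in> affine_lattice (f ` S)" unfolding affine_lattice_def
    by (intro CollectI exI[of _ "\<lambda>s. c (inv f s)"]) (simp add: c lin sum.reindex[OF injS] inv_f_f[OF f])
next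
  fix v assume "v \<in> affine_lattice (f ` S)"
  then obtain c where c: "v = (\<lambda>m. \<Sum>s\<in>f ` S. c s * s m)" "(\<Sum>s\<in>f ` S. c s) = 1"
    unfolding affine_lattice_def by auto
  have injS: "inj_on f S" by (rule inj_on_subset[OF f]) simp
  have "v = f (\<lambda>m. \<Sum>s\<in>S. c (f s) * s m)" unfolding c(1) lin by (simp add: sum.reindex[OF injS])
  moreover have "(\<lambda>m. \<Sum>s\<in>S. c (f s) * s m) \<in> affine_lattice S" unfolding affine_lattice_def
    by (intro CollectI exI[of _ "\<lambda>s. c (f s)"]) (use c(2) in \<open>simp add: sum.reindex[OF injS]\<close>)
  ultimately show "v \<in> f ` affine_lattice S" by blast
qed

text \<open>Compatibility with x - y + z permits adding integer multiples of differences to a base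
  point. Adding \<open>z i\<close> times \<open>p i - p i0\<close> for every \<open>i\<close>
  returns to that point, and the images must do the same.\<close>

lemma affine_map_relation:
  fixes f :: "(nat \<Rightarrow> int) \<Rightarrow> nat \<Rightarrow> int" and p :: "'i::finite \<Rightarrow> nat \<Rightarrow> int"
  assumes f: "\<forall>x\<in>affine_lattice S. \<forall>y\<in>affine_lattice S. \<forall>z\<in>affine_lattice S.
      f (\<lambda>m. x m - y m + z m) = (\<lambda>m. f x m - f y m + f z m)"
    and p: "\<And>i. p i \<in> affine_lattice S"
    and z: "(\<Sum>i\<in>UNIV. z i) = 0" "\<And>m. (\<Sum>i\<in>UNIV. z i * p i m) = 0"
  shows "(\<Sum>i\<in>UNIV. z i * f (p i) m) = 0"
proof -
  define i0 :: 'i where "i0 = undefined"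
  define P where "P x y \<longleftrightarrow> x \<in> affine_lattice S \<and> f x = y" for x y
  have step: "P (\<lambda>m. x m - p i m + p j m) (\<lambda>m. y m - f (p i) m + f (p j) m)" if "P x y" for x y i j
    using that f p affine_lattice_closed unfolding P_def by blast
  have nat_mult: "P (\<lambda>m. x m + int t * (p j m - p i m)) (\<lambda>m. y m + int t * (f (p j) m - f (p i) m))"
    if "P x y" for x y i j t
  proof (induction t)
    case 0
    then show ?case using that by simp
  next
    case (Suc t)
    from step[OF Suc, of i j] show ?case by (simp add: algebra_simps)
  qed
  have mult: "P (\<lambda>m. x m + t * (p i m - p i0 m)) (\<lambda>m. y m + t * (f (p i) m - f (p i0) m))"
    if "P x y" for x y i t
  proof (cases "t \<ge> 0")
    case True
    then show ?thesis using nat_mult[OF that, of "nat t" i i0] by simp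
  next
    case False
    then show ?thesis using nat_mult[OF that, of "nat (- t)" i0 i] by (simp add: algebra_simps)
  qed
  have "P (\<lambda>m. p i0 m + (\<Sum>i\<in>I. z i * (p i m - p i0 m))) (\<lambda>m. f (p i0) m + (\<Sum>i\<in>I. z i * (f (p i) m - f (p i0) m)))"
    for I
  proof (induction I rule: infinite_finite_induct)
    case (insert i I)
    from mult[OF insert.IH, of "z i" i] show ?case using insert.hyps by (simp add: algebra_simps)
  qed (simp_all add: P_def p)
  from this[of UNIV] have "P (p i0) (\<lambda>m. f (p i0) m + (\<Sum>i\<in>UNIV. z i * f (p i) m))"
    using z by (simp add: right_diff_distrib sum_subtractf sum_distrib_right[symmetric])
  then have "f (p i0) = (\<lambda>m. f (p i0) m + (\<Sum>i\<in>UNIV. z i * f (p i) m))" by (simp add: P_def)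
  from fun_cong[OF this, of m] show ?thesis by simp
qed

context gale
begin

text \<open>By orthogonality a unit vector is in the row span iff its coordinate vanishes on the
  kernel, which can be checked on the integer basis.\<close>

lemma knap_iff: "knap k (N - 1) pt \<longleftrightarrow> pyramidless"
proof -
  have "axis i 1 \<in> row_span_Ak k (N - 1) pt \<longleftrightarrow> (\<forall>l<c. \<nu> l i = 0)" for i
  proof -
    have ker: "(\<forall>g\<in>{(\<chi> i. of_int (row_Ak (N - 1) pt \<beta> i)) | \<beta>. \<beta> \<in> exponents (N - 1) k}.
        (\<Sum>i\<in>UNIV. g $ i * y $ i) = 0) \<longleftrightarrow> y \<in> kerK k" for y :: "real^'i"
      by (auto simp: kerK_def)
    have axis: "(\<Sum>j\<in>UNIV. axis i 1 $ j * y $ j) = y $ i" for y :: "real^'i"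
      by (simp add: axis_def if_distrib[of "\<lambda>c. c * _"] cong: if_cong)
    have "axis i 1 \<in> row_span_Ak k (N - 1) pt \<longleftrightarrow> (\<forall>y\<in>kerK k. y $ i = (0 :: real))"
      unfolding row_span_Ak_def in_span_iff_annihilator ker axis by blast
    also have "\<dots> \<longleftrightarrow> (\<forall>l<c. \<nu> l i = 0)"
    proof
      assume *: "\<forall>y\<in>kerK k. y $ i = (0 :: real)"
      show "\<forall>l<c. \<nu> l i = 0"
      proof (intro allI impI)
        fix l assume l: "l < c"
        have "(\<chi> i. gv (\<lambda>m. if m = l then 1 else 0 :: real) i) $ i = 0"
          by (rule bspec[OF * gv_kerK])
        then show "\<nu> l i = 0" using gv_unit[OF l, of i, where 'a = real] by simp
      qed
    next
      assume *: "\<forall>l<c. \<nu> l i = 0"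
      show "\<forall>y\<in>kerK k. y $ i = (0 :: real)"
      proof
        fix y :: "real^'i" assume "y \<in> kerK k"
        from kerK_gv[OF this] obtain \<mu> where "y = (\<chi> i. gv \<mu> i)" by (rule exE)
        then show "y $ i = 0" using * by (simp add: gv_def)
      qed
    qed
    finally show ?thesis .
  qed
  then show ?thesis by (auto simp: knap_def pyramidless_def)
qed

lemma lift_pt: "lift_point (pt i) = \<alpha> i"
  by (rule ext) (simp add: lift_point_def pt_def alpha_0 split: nat.split)

text \<open>Integer relations annihilate the rows of A; conversely
  \<open>killed_by_relations\<close> supplies the coefficients of the combination.\<close>

lemma indicator_in_row_span:
  "(\<chi> i. if i \<in> S then 1 else 0) \<in> row_span_A (N - 1) pt \<longleftrightarrow> (\<forall>z. relation z \<longrightarrow> (\<Sum>i\<in>S. z i) = 0)"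
proof
  assume e: "(\<chi> i. if i \<in> S then 1 else 0) \<in> row_span_A (N - 1) pt"
  show "\<forall>z. relation z \<longrightarrow> (\<Sum>i\<in>S. z i) = 0"
  proof (intro allI impI)
    fix z assume z: "relation z"
    have "(\<Sum>i\<in>UNIV. g $ i * (\<chi> i. of_int (z i)) $ i) = 0"
      if g: "g \<in> {(\<chi> i. of_int (lift_point (pt i) m)) | m. m \<le> N - 1}" for g :: "real^'i"
    proof -
      obtain m where m: "g = (\<chi> i. of_int (\<alpha> i m))" "m < N" using g N_pos by (auto simp: lift_pt)
      have "(\<Sum>i\<in>UNIV. g $ i * (\<chi> i. of_int (z i)) $ i) = of_int (\<Sum>i\<in>UNIV. z i * \<alpha> i m)"
        by (simp add: m(1) mult.commute)
      also have "(\<Sum>i\<in>UNIV. z i * \<alpha> i m) = 0" using z m(2) by (simp add: relation_def)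
      finally show ?thesis by (simp only: of_int_0)
    qed
    then have "(\<Sum>i\<in>UNIV. (\<chi> i. if i \<in> S then 1 else 0) $ i * (\<chi> i. of_int (z i)) $ i) = (0 :: real)"
      by (intro e[unfolded row_span_A_def in_span_iff_annihilator, rule_format])
    then have "(of_int (\<Sum>i\<in>S. z i) :: real) = 0"
      by (simp add: if_distrib[of "\<lambda>c. c * _"] sum.If_cases cong: if_cong)
    then show "(\<Sum>i\<in>S. z i) = 0" by (simp only: of_int_eq_0_iff)
  qed
next
  assume rel: "\<forall>z. relation z \<longrightarrow> (\<Sum>i\<in>S. z i) = 0"
  have "(\<Sum>i\<in>UNIV. of_int (z i) * (if i \<in> S then 1 else 0)) = (0 :: real)" if "relation z" for z
  proof -
    have "(\<Sum>i\<in>UNIV. of_int (z i) * (if i \<in> S then 1 else 0)) = (of_int (\<Sum>i\<in>S. z i) :: real)"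
      by (simp add: if_distrib[of "\<lambda>c. _ * c"] sum.If_cases cong: if_cong)
    then show ?thesis using rel that by simp
  qed
  note killed = killed_by_relations[of "\<lambda>i. if i \<in> S then 1 else 0 :: real", OF this]
  define w :: "nat \<Rightarrow> real" where "w m = (\<Sum>i\<in>UNIV. of_int (C m i) * (if i \<in> S then 1 else 0))" for m
  have w: "(if i \<in> S then 1 else 0) = (\<Sum>m<N. of_int (\<alpha> i m) * w m)" for i
    unfolding w_def by (rule killed)
  have "(\<chi> i. if i \<in> S then 1 else 0) = (\<Sum>m<N. w m *\<^sub>R (\<chi> i. of_int (lift_point (pt i) m)) :: real^'i)"
    by (simp add: vec_eq_iff w lift_pt mult.commute)
  moreover have "\<dots> \<in> row_span_A (N - 1) pt" unfolding row_span_A_def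
    by (intro span_sum span_scale span_base CollectI exI conjI refl) auto
  ultimately show "(\<chi> i. if i \<in> S then 1 else 0) \<in> row_span_A (N - 1) pt" by (simp only:)
qed

lemma gale_vec_nonzero: "pyramidless \<Longrightarrow> gale_vec c \<nu> i \<noteq> (\<lambda>_. 0)"
  unfolding pyramidless_def gale_vec_def by (metis of_int_eq_0_iff)

section \<open>Lines carrying Gale vectors\<close>

lemma line_through:
  assumes "is_line c l" "v \<in> l" "v \<noteq> (\<lambda>_. 0)"
  shows "l = {(\<lambda>m. s * v m) | s. True}"
proof -
  obtain p where l: "l = {(\<lambda>m. s * p m) | s. True}" using assms(1) unfolding is_line_def by blast
  obtain s where v: "v = (\<lambda>m. s * p m)" using assms(2) l by blast
  have s: "s \<noteq> 0" using assms(3) v by auto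
  have "(\<lambda>m. t * p m) = (\<lambda>m. (t / s) * v m)" for t using s v by (simp add: field_simps)
  moreover have "(\<lambda>m. t * v m) = (\<lambda>m. (t * s) * p m)" for t by (simp add: v mult.assoc)
  ultimately show ?thesis unfolding l by blast
qed

lemma line_gale_vec:
  assumes "gale_vec c \<nu> i \<noteq> (\<lambda>_. 0)"
  shows "is_line c {(\<lambda>m. s * gale_vec c \<nu> i m) | s. True}"
  unfolding is_line_def by (intro bexI[of _ "gale_vec c \<nu> i"] conjI refl assms) (simp add: gale_vec_def vecs_def)

lemma gale_vec_in_own_line: "gale_vec c \<nu> i \<in> {(\<lambda>m. s * gale_vec c \<nu> i m) | s. True}"
  by (intro CollectI exI[of _ 1]) simp

lemma line_members:
  assumes nz: pyramidless and l: "is_line c l" "gale_vec c \<nu> i \<in> l"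
  shows "{j. gale_vec c \<nu> j \<in> l} = cls i"
proof -
  have l: "l = {(\<lambda>m. s * gale_vec c \<nu> i m) | s. True}"
    by (rule line_through[OF l gale_vec_nonzero[OF nz]])
  have "gale_vec c \<nu> j \<in> l \<longleftrightarrow> par i j" for j
  proof
    assume "gale_vec c \<nu> j \<in> l"
    then obtain s where sv: "gale_vec c \<nu> j = (\<lambda>m. s * gale_vec c \<nu> i m)"
      unfolding l by (elim CollectE exE conjE) (rule that)
    have s: "of_int (\<nu> m j) = s * of_int (\<nu> m i)" if "m < c" for m
      using fun_cong[OF sv, of m] that by (simp add: gale_vec_def)
    have "(of_int (\<nu> l' i * \<nu> m j) :: real) = of_int (\<nu> m i * \<nu> l' j)" if "l' < c" "m < c" for l' m
      using s[OF that(1)] s[OF that(2)] by simp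
    then show "par i j" unfolding par_def by (simp only: of_int_eq_iff) blast
  next
    assume "par i j"
    then obtain s :: real where s: "\<forall>\<mu>. gv \<mu> j = s * gv \<mu> i" using par_ratio[OF nz par_sym] by blast
    have "of_int (\<nu> m j) = s * of_int (\<nu> m i)" if "m < c" for m
      using s[rule_format, of "\<lambda>q. if q = m then 1 else 0"] by (simp add: gv_unit[OF that])
    then have "gale_vec c \<nu> j = (\<lambda>m. s * gale_vec c \<nu> i m)" by (auto simp: gale_vec_def)
    then show "gale_vec c \<nu> j \<in> l" unfolding l by (intro CollectI exI conjI TrueI)
  qed
  then show ?thesis by (auto simp: cls_def)
qed

text \<open>A line with a Gale vector on it has a class indicator as its vector; a line without one
  gives the zero vector and hence no condition.\<close>

lemma e_lines_iff:
  assumes nz: pyramidless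
  shows "(\<forall>l. is_line c l \<longrightarrow> e_line c \<nu> l \<in> row_span_A (N - 1) pt) \<longleftrightarrow> cayley_relations"
proof
  have e: "e_line c \<nu> l = (\<chi> i. if i \<in> {j. gale_vec c \<nu> j \<in> l} then 1 else 0)" for l
    by (simp add: e_line_def)
  {
    assume *: "\<forall>l. is_line c l \<longrightarrow> e_line c \<nu> l \<in> row_span_A (N - 1) pt"
    show cayley_relations unfolding cayley_relations_def
    proof (rule allI)
      fix i
      have line: "is_line c {(\<lambda>m. s * gale_vec c \<nu> i m) | s. True}"
        by (rule line_gale_vec[OF gale_vec_nonzero[OF nz]])
      have "(\<chi> j. if j \<in> cls i then 1 else 0) \<in> row_span_A (N - 1) pt"
        using *[rule_format, OF line] unfolding e line_members[OF nz line gale_vec_in_own_line] .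
      then show "\<forall>z. relation z \<longrightarrow> sum z (cls i) = 0" unfolding indicator_in_row_span .
    qed
  next
    assume cr: cayley_relations
    show "\<forall>l. is_line c l \<longrightarrow> e_line c \<nu> l \<in> row_span_A (N - 1) pt"
    proof (intro allI impI)
      fix l assume l: "is_line c l"
      show "e_line c \<nu> l \<in> row_span_A (N - 1) pt" unfolding e indicator_in_row_span
      proof (cases "\<exists>i. gale_vec c \<nu> i \<in> l")
        case True
        then obtain i where "gale_vec c \<nu> i \<in> l" by blast
        from line_members[OF nz l this]
        show "\<forall>z. relation z \<longrightarrow> sum z {j. gale_vec c \<nu> j \<in> l} = 0"
          using cr unfolding cayley_relations_def by simp
      qed simp
    qed
  }
qed

definition line_enum :: "nat \<Rightarrow> (nat \<Rightarrow> (nat \<Rightarrow> real) set) \<Rightarrow> bool" where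
  "line_enum r L \<longleftrightarrow>
    bij_betw L {..<r} {l. is_line c l \<and> (\<exists>i. gale_vec c \<nu> i \<noteq> (\<lambda>_. 0) \<and> gale_vec c \<nu> i \<in> l)}"

lemma line_enum_is_line: "line_enum r L \<Longrightarrow> j < r \<Longrightarrow> is_line c (L j)"
  unfolding line_enum_def bij_betw_def by blast

lemma line_enum_cover:
  assumes "line_enum r L" "gale_vec c \<nu> i \<noteq> (\<lambda>_. 0)"
  shows "\<exists>j<r. gale_vec c \<nu> i \<in> L j"
proof -
  let ?l = "{(\<lambda>m. s * gale_vec c \<nu> i m) | s. True}"
  have "?l \<in> {l. is_line c l \<and> (\<exists>i. gale_vec c \<nu> i \<noteq> (\<lambda>_. 0) \<and> gale_vec c \<nu> i \<in> l)}"
    by (intro CollectI conjI exI[of _ i] line_gale_vec assms(2) gale_vec_in_own_line)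
  then have "?l \<in> L ` {..<r}" unfolding bij_betw_imp_surj_on[OF assms(1)[unfolded line_enum_def]] .
  then obtain j where j: "?l = L j" "j \<in> {..<r}" by (rule imageE)
  show ?thesis using gale_vec_in_own_line[of i, unfolded j(1)] j(2) by auto
qed

lemma line_enum_class:
  assumes nz: pyramidless and L: "line_enum r L" and j: "j < r"
  shows "\<exists>i. {i. gale_vec c \<nu> i \<in> L j} = cls i"
proof -
  obtain i where "gale_vec c \<nu> i \<in> L j" using L j unfolding line_enum_def bij_betw_def by blast
  from line_members[OF nz line_enum_is_line[OF L j] this] show ?thesis by (rule exI)
qed

lemma line_enum_unique:
  assumes nz: pyramidless and L: "line_enum r L" and j: "j < r" "j' < r"
    and i: "gale_vec c \<nu> i \<in> L j" "gale_vec c \<nu> i \<in> L j'"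
  shows "j = j'"
proof -
  have "L j = L j'"
    using line_through[OF line_enum_is_line[OF L j(1)] i(1) gale_vec_nonzero[OF nz]]
      line_through[OF line_enum_is_line[OF L j(2)] i(2) gale_vec_nonzero[OF nz]] by simp
  then show ?thesis using L j unfolding line_enum_def bij_betw_def by (meson inj_onD lessThan_iff)
qed

text \<open>With fewer than \<open>c\<close> lines some nonzero linear form would vanish on all of
  them, hence at every Gale vector, against the independence of the basis.\<close>

lemma rank_le_lines:
  assumes L: "line_enum r L" shows "c \<le> r"
proof (rule ccontr)
  assume "\<not> ?thesis"
  have "\<forall>j\<in>{..<r}. \<exists>p. L j = {(\<lambda>m. s * p m) | s. True}"
    using line_enum_is_line[OF L] unfolding is_line_def by blast
  from bchoice[OF this] obtain p where p: "\<forall>j\<in>{..<r}. L j = {(\<lambda>m. s * p j m) | s. True}" by (rule exE)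
  have "card {..<r} < card {..<c}" using \<open>\<not> c \<le> r\<close> by simp
  from underdetermined[OF finite_lessThan finite_lessThan this, of "\<lambda>l j. p j l"]
  obtain \<kappa> where \<kappa>: "\<exists>l\<in>{..<c}. \<kappa> l \<noteq> 0" "\<forall>j\<in>{..<r}. (\<Sum>l<c. \<kappa> l * p j l) = 0"
    by - (elim exE conjE, rule that)
  have "(\<Sum>l<c. \<kappa> l * of_int (\<nu> l i)) = 0" for i
  proof (cases "gale_vec c \<nu> i = (\<lambda>_. 0)")
    case True
    then have "of_int (\<nu> l i) = (0 :: real)" if "l < c" for l using that unfolding gale_vec_def by metis
    then show ?thesis by simp
  next
    case False
    from line_enum_cover[OF L this] obtain j where j: "j < r" "gale_vec c \<nu> i \<in> L j" by blast
    then obtain s where "gale_vec c \<nu> i = (\<lambda>m. s * p j m)" using p by blast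
    then have "of_int (\<nu> l i) = s * p j l" if "l < c" for l using that unfolding gale_vec_def by metis
    then have "(\<Sum>l<c. \<kappa> l * of_int (\<nu> l i)) = s * (\<Sum>l<c. \<kappa> l * p j l)"
      by (simp add: sum_distrib_left mult.left_commute)
    then show ?thesis using \<kappa>(2) j(1) by simp
  qed
  then have "\<kappa> l = 0" if "l < c" for l
    using int_basis_independent[OF basis[unfolded int_kernel_orth], of \<kappa> l] that by blast
  then show False using \<kappa>(1) by auto
qed

lemma sum_class_zero:
  assumes nz: pyramidless and cr: cayley_relations and L: "line_enum r L" and j: "j < r" and z: "relation z"
  shows "(\<Sum>i\<in>{i. gale_vec c \<nu> i \<in> L j}. z i) = 0"
proof -
  obtain i where "{i. gale_vec c \<nu> i \<in> L j} = cls i" using line_enum_class[OF nz L j] by blast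
  then show ?thesis using cr z unfolding cayley_relations_def by simp
qed

text \<open>For k at least 1 the rows of A occur among the rows of \<open>A^(k)\<close>, as the
  exponents of size 0 and 1; this is where the last claim uses the bound on k.\<close>

lemma basis_relation:
  assumes "1 \<le> k" "l < c" shows "relation (\<nu> l)"
  unfolding relation_def
proof (intro allI impI)
  fix m assume m: "m < N"
  have ker: "(\<Sum>i\<in>UNIV. row_Ak (N - 1) pt \<beta> i * \<nu> l i) = 0" if "\<beta> \<in> exponents (N - 1) k" for \<beta>
    using basis assms(2) that unfolding is_int_basis_def int_kernel_Ak_def by blast
  show "(\<Sum>i\<in>UNIV. \<nu> l i * \<alpha> i m) = 0"
  proof (cases m)
    case 0
    have "(\<lambda>_. 0) \<in> exponents (N - 1) k" by (simp add: exponents_def vecs_def)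
    from ker[OF this] show ?thesis by (simp add: 0 row_Ak_def alpha_0)
  next
    case (Suc j)
    then have j: "j < N - 1" using m by simp
    define \<beta> where "\<beta> l = (if l = j then 1 else 0 :: nat)" for l
    have \<beta>: "\<beta> \<in> exponents (N - 1) k" using j assms(1) by (auto simp: exponents_def vecs_def \<beta>_def)
    moreover have "row_Ak (N - 1) pt \<beta> i = \<alpha> i m" for i
      using j by (simp add: row_Ak_def \<beta>_def Suc pt_def if_distrib[of "\<lambda>e. _ ^ e"] cong: if_cong)
    ultimately show ?thesis using ker[OF \<beta>] by (simp add: mult.commute)
  qed
qed

text \<open>A coordinate of the Cayley configuration is the indicator of a class, and affine
  isomorphisms preserve relations. Conversely the indicators are integral linear functions of the
  points and can be adjoined as coordinates.\<close>

lemma cayley_wrt_iff: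
  assumes nz: pyramidless and L: "line_enum r L" and \<Gamma>: "\<Gamma> = (\<lambda>j. {i. gale_vec c \<nu> i \<in> L j})"
  shows "cayley_wrt r \<Gamma> \<alpha> \<longleftrightarrow> cayley_relations"
proof
  assume cw: "cayley_wrt r \<Gamma> \<alpha>"
  then obtain d B f where f: "config_affine_iso f (range \<alpha>) (cayley r B)"
    "\<forall>j<r. f ` \<alpha> ` \<Gamma> j = cayley_piece r j (B j)"
    unfolding cayley_wrt_def by (elim conjE exE) (rule that)
  show cayley_relations unfolding cayley_relations_def
  proof (intro allI impI)
    fix i0 z assume z: "relation z"
    obtain j where j: "j < r" "gale_vec c \<nu> i0 \<in> L j" using line_enum_cover[OF L gale_vec_nonzero[OF nz]] by blast
    have cls: "cls i0 = \<Gamma> j" unfolding \<Gamma> by (rule line_members[OF nz line_enum_is_line[OF L j(1)] j(2), symmetric])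
    have ind: "f (\<alpha> i) j = (if i \<in> \<Gamma> j then 1 else 0)" for i
    proof -
      obtain j' where j': "j' < r" "gale_vec c \<nu> i \<in> L j'" using line_enum_cover[OF L gale_vec_nonzero[OF nz]] by blast
      then have "f (\<alpha> i) \<in> cayley_piece r j' (B j')" using f(2) by (auto simp: \<Gamma>)
      then have "f (\<alpha> i) j = (if j = j' then 1 else 0)" using j(1) by (auto simp: cayley_piece_def)
      moreover have "i \<in> \<Gamma> j \<longleftrightarrow> j = j'" using line_enum_unique[OF nz L j(1) j'(1) _ j'(2)] j'(2) by (auto simp: \<Gamma>)
      ultimately show ?thesis by simp
    qed
    have "(\<Sum>i\<in>UNIV. z i * f (\<alpha> i) j) = 0"
    proof (rule affine_map_relation[where S = "range \<alpha>" and p = \<alpha> and f = f])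
      show "\<alpha> i \<in> affine_lattice (range \<alpha>)" for i by (rule affine_lattice_base) simp_all
      show "(\<Sum>i\<in>UNIV. z i * \<alpha> i m) = 0" for m
      proof (cases "m < N")
        case True
        then show ?thesis using z by (simp add: relation_def)
      next
        case False
        then have "\<alpha> i m = 0" for i using supp[of i] by (simp add: vecs_def)
        then show ?thesis by simp
      qed
    qed (use f(1) sum_relation[OF z] in \<open>auto simp: config_affine_iso_def\<close>)
    then show "(\<Sum>i\<in>cls i0. z i) = 0"
      unfolding cls ind by (simp add: if_distrib[of "\<lambda>c. _ * c"] sum.If_cases cong: if_cong)
  qed
next
  assume cr: cayley_relations
  have "\<exists>w :: nat \<Rightarrow> int. \<forall>i. (if i \<in> \<Gamma> j then 1 else 0) = (\<Sum>m<N. \<alpha> i m * w m)" if j: "j < r" for j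
  proof -
    have "(\<Sum>i\<in>UNIV. of_int (z i) * (if i \<in> \<Gamma> j then 1 else 0)) = (0 :: int)" if z: "relation z" for z
      using sum_class_zero[OF nz cr L j z] unfolding \<Gamma>
      by (simp add: if_distrib[of "\<lambda>c. _ * c"] sum.If_cases cong: if_cong)
    note killed = killed_by_relations[of "\<lambda>i. if i \<in> \<Gamma> j then 1 else 0 :: int", OF this,
      unfolded of_int_eq_id id_apply]
    show ?thesis
      by (rule exI[of _ "\<lambda>m. \<Sum>i\<in>UNIV. C m i * (if i \<in> \<Gamma> j then 1 else 0)"], rule allI, rule killed)
  qed
  then have "\<forall>j\<in>{..<r}. \<exists>w :: nat \<Rightarrow> int. \<forall>i. (if i \<in> \<Gamma> j then 1 else 0) = (\<Sum>m<N. \<alpha> i m * w m)" by simp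
  from bchoice[OF this] obtain W :: "nat \<Rightarrow> nat \<Rightarrow> int" where
    W: "\<forall>j\<in>{..<r}. \<forall>i. (if i \<in> \<Gamma> j then 1 else 0) = (\<Sum>m<N. \<alpha> i m * W j m)" by (rule exE)
  \<comment> \<open>All old coordinates are kept behind the \<open>r\<close> new ones, so
    injectivity is immediate.\<close>
  define f :: "(nat \<Rightarrow> int) \<Rightarrow> nat \<Rightarrow> int" where
    "f v m = (if m < r then \<Sum>q<N. v q * W m q else v (m - r))" for v m
  have f_\<alpha>: "f (\<alpha> i) = (\<lambda>m. if m < r then (if m = j then 1 else 0) else \<alpha> i (m - r))"
    if j: "j < r" "i \<in> \<Gamma> j" for i j
  proof (rule ext)
    fix m
    have "m < r \<Longrightarrow> i \<in> \<Gamma> m \<longleftrightarrow> m = j" using line_enum_unique[OF nz L _ j(1)] j(2) by (auto simp: \<Gamma>)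
    then show "f (\<alpha> i) m = (if m < r then (if m = j then 1 else 0) else \<alpha> i (m - r))"
      using W[rule_format, of m i] by (simp add: f_def)
  qed
  have pieces: "f ` \<alpha> ` \<Gamma> j = cayley_piece r j (\<alpha> ` \<Gamma> j)" if "j < r" for j
    unfolding cayley_piece_def image_image by (rule image_cong[OF refl]) (rule f_\<alpha>[OF that])
  have injf: "inj f"
  proof (rule injI, rule ext)
    fix v v' m assume "f v = f v'"
    from fun_cong[OF this, of "m + r"] show "v m = v' m" by (simp add: f_def)
  qed
  have lin: "f (\<lambda>m. \<Sum>s\<in>S. c s * s m) = (\<lambda>m. \<Sum>s\<in>S. c s * f s m)" for S :: "(nat \<Rightarrow> int) set" and c
  proof (rule ext)
    fix m
    have "(\<Sum>q<N. (\<Sum>s\<in>S. c s * s q) * W m q) = (\<Sum>s\<in>S. c s * (\<Sum>q<N. s q * W m q))"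
      by (simp add: sum_distrib_left sum_distrib_right mult.assoc) (rule sum.swap)
    then show "f (\<lambda>m. \<Sum>s\<in>S. c s * s m) m = (\<Sum>s\<in>S. c s * f s m)" by (simp add: f_def)
  qed
  have cover: "(\<Union>j<r. \<Gamma> j) = UNIV"
    using line_enum_cover[OF L gale_vec_nonzero[OF nz]] by (auto simp: \<Gamma>)
  have "f ` range \<alpha> = (\<Union>j<r. f ` \<alpha> ` \<Gamma> j)" by (simp only: cover[symmetric] image_UN)
  also have "\<dots> = cayley r (\<lambda>j. \<alpha> ` \<Gamma> j)" using pieces by (simp add: cayley_def)
  finally have im: "f ` range \<alpha> = cayley r (\<lambda>j. \<alpha> ` \<Gamma> j)" .
  have iso: "config_affine_iso f (range \<alpha>) (cayley r (\<lambda>j. \<alpha> ` \<Gamma> j))"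
    unfolding config_affine_iso_def
  proof (intro conjI ballI im)
    show "bij_betw f (affine_lattice (range \<alpha>)) (affine_lattice (cayley r (\<lambda>j. \<alpha> ` \<Gamma> j)))"
      unfolding im[symmetric] bij_betw_def
      using affine_lattice_image[OF injf lin] inj_on_subset[OF injf] by blast
    show "f (\<lambda>m. x m - y m + z m) = (\<lambda>m. f x m - f y m + f z m)" for x y z
      by (rule ext) (simp add: f_def algebra_simps sum.distrib sum_subtractf)
  qed
  have conf: "lattice_config N (\<alpha> ` \<Gamma> j)" if j: "j < r" for j
  proof -
    obtain i where "\<Gamma> j = cls i" using line_enum_class[OF nz L j] unfolding \<Gamma> by blast
    then have "\<Gamma> j \<noteq> {}" using par_refl unfolding cls_def by blast
    then show ?thesis using supp by (auto simp: lattice_config_def)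
  qed
  have "disjoint_family_on \<Gamma> {..<r}" unfolding disjoint_family_on_def
    using line_enum_unique[OF nz L] by (auto simp: \<Gamma>)
  then show "cayley_wrt r \<Gamma> \<alpha>"
    unfolding cayley_wrt_def using cover iso conf pieces
    by (intro conjI exI[of _ N] exI[of _ "\<lambda>j. \<alpha> ` \<Gamma> j"] exI[of _ f]) simp_all
qed

end

section \<open>The affine torus\<close>

text \<open>The torus T consists of the nonzero multiples of the points of the affine torus, and a
  form vanishing at a point vanishes at its multiples.\<close>

lemma toric_variety_eq:
  fixes a :: "'i::finite \<Rightarrow> nat \<Rightarrow> int"
  assumes "toric (n + 1) (\<lambda>i. lift_point (a i))"
  shows "toric_variety n a = zariski_closure (tcone (n + 1) (\<lambda>i. lift_point (a i)) :: ('k::field_char_0^'i) set)"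
proof -
  interpret toric "n + 1" "\<lambda>i. lift_point (a i)" by (rule assms)
  define S where "S = {(\<chi> i. \<Prod>j<n. t j powi a i j) :: 'k^'i | t::nat \<Rightarrow> 'k. \<forall>j<n. t j \<noteq> 0}"
  have split: "chi (n + 1) (\<lambda>i. lift_point (a i)) \<tau> = \<tau> 0 *s (\<chi> i. \<Prod>j<n. \<tau> (Suc j) powi a i j)" for \<tau> :: "nat \<Rightarrow> 'k"
    by (simp add: chi_def vec_eq_iff lift_point_def prod.lessThan_Suc_shift del: prod.lessThan_Suc)
  have "S \<subseteq> T"
  proof
    fix y assume "y \<in> S"
    then obtain t where t: "y = (\<chi> i. \<Prod>j<n. t j powi a i j)" "\<forall>j<n. t j \<noteq> 0" unfolding S_def by blast
    define \<tau> where "\<tau> m = (case m of 0 \<Rightarrow> 1 | Suc j \<Rightarrow> t j)" for m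
    have "y = chi (n + 1) (\<lambda>i. lift_point (a i)) \<tau>" unfolding split by (simp add: t(1) \<tau>_def)
    moreover have "\<forall>m<n + 1. \<tau> m \<noteq> 0" using t(2) by (auto simp: \<tau>_def split: nat.split)
    ultimately show "y \<in> T" unfolding tcone_def by blast
  qed
  then have nz: "0 \<notin> S" using zero_notin_T by blast
  have "T \<subseteq> zariski_closure S"
  proof
    fix y :: "'k^'i" assume y: "y \<in> T"
    then obtain \<tau> where \<tau>: "y = chi (n + 1) (\<lambda>i. lift_point (a i)) \<tau>" "\<forall>m<n + 1. \<tau> m \<noteq> 0" unfolding tcone_def by blast
    have x: "(\<chi> i. \<Prod>j<n. \<tau> (Suc j) powi a i j) \<in> S" unfolding S_def using \<tau>(2) by force
    show "y \<in> zariski_closure S" unfolding zariski_closure_iff[OF nz]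
    proof (intro conjI allI impI)
      show "y \<noteq> 0" using y zero_notin_T by blast
      fix p :: "('k, 'i) mpoly" assume p: "homogeneous p \<and> (\<forall>y\<in>S. mpoly_eval p y = 0)"
      then obtain d where "hdeg d p" unfolding homogeneous_iff by blast
      then show "mpoly_eval p y = 0" unfolding \<tau>(1) split using p x by (simp add: eval_scale)
    qed
  qed
  then have "X \<subseteq> zariski_closure S" by (rule zariski_closure_minimal[OF zariski_closed_closure[OF nz]])
  moreover have "zariski_closure S \<subseteq> X" by (rule zariski_closure_mono) fact
  ultimately show ?thesis unfolding toric_variety_def S_def by blast
qed

theorem theorem3p4:
  fixes k n r :: nat
    and a :: "'i::finite \<Rightarrow> nat \<Rightarrow> int"
    and X :: "('k::{alg_closed_field, field_char_0}^'i) set"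
    and c :: nat and \<nu> :: "nat \<Rightarrow> 'i \<Rightarrow> int" and b :: "'i \<Rightarrow> nat \<Rightarrow> real"
    and L :: "nat \<Rightarrow> (nat \<Rightarrow> real) set" and \<Gamma> :: "nat \<Rightarrow> 'i set"
  assumes "\<And>i. a i \<in> vecs n"
    and "inj a"
    and "generates_lattice (n + 1) (\<lambda>i. lift_point (a i))"
    and X: "X = toric_variety n a"
    and c: "c = corank_Ak k n a"
    and "is_int_basis c \<nu> (int_kernel_Ak k n a)"
    and b: "b = gale_vec c \<nu>"
    and L: "bij_betw L {..<r} {l. is_line c l \<and> (\<exists>i. b i \<noteq> (\<lambda>_. 0) \<and> b i \<in> l)}"
    and \<Gamma>: "\<Gamma> = (\<lambda>j. {i. b i \<in> L j})"
  shows "(k_selfdual k X \<longleftrightarrow>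
            knap k n a \<and> (\<forall>l. is_line c l \<longrightarrow> e_line c \<nu> l \<in> row_span_A n a))
       \<and> c \<le> r
       \<and> (k_selfdual k X \<longleftrightarrow>
            knap k n a \<and> cayley_wrt r \<Gamma> (\<lambda>i. lift_point (a i)))
       \<and> (k \<ge> 1 \<longrightarrow> k_selfdual k X \<longrightarrow> (\<forall>j<r. \<forall>m. (\<Sum>i\<in>\<Gamma> j. b i m) = 0))"
proof -
  interpret toric "n + 1" "\<lambda>i. lift_point (a i)"
    by (unfold_locales, simp add: lift_point_def, simp, rule assms(3))
  have pt: "pt = a" by (intro ext, subst pt_def, simp add: lift_point_def)
  interpret gale "n + 1" "\<lambda>i. lift_point (a i)" k c \<nu>
  proof unfold_locales
    show "inj (\<lambda>i. lift_point (a i))"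
    proof (rule injI)
      fix i j assume eq: "lift_point (a i) = lift_point (a j)"
      have "a i m = a j m" for m using fun_cong[OF eq, of "Suc m"] by (simp add: lift_point_def)
      then show "i = j" using assms(2) by (metis ext injD)
    qed
    show "lift_point (a i) \<in> vecs (n + 1)" for i
      using assms(1)[of i] by (auto simp: vecs_def lift_point_def split: nat.split)
    show "is_int_basis c \<nu> (int_kernel_Ak k (n + 1 - 1) pt)" using assms(6) by (simp add: pt)
  qed
  have enum: "line_enum r L" using L unfolding line_enum_def b .
  have \<Gamma>': "\<Gamma> = (\<lambda>j. {i. gale_vec c \<nu> i \<in> L j})" unfolding \<Gamma> b ..
  have sd: "k_selfdual k X \<longleftrightarrow> pyramidless \<and> cayley_relations"
    unfolding X toric_variety_eq[OF toric_axioms] by (rule selfdual_iff)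
  have knap: "knap k n a \<longleftrightarrow> pyramidless" using knap_iff by (simp add: pt)
  have lines: "pyramidless \<Longrightarrow> (\<forall>l. is_line c l \<longrightarrow> e_line c \<nu> l \<in> row_span_A n a) \<longleftrightarrow> cayley_relations"
    using e_lines_iff by (simp add: pt)
  have cayley: "pyramidless \<Longrightarrow> cayley_wrt r \<Gamma> (\<lambda>i. lift_point (a i)) \<longleftrightarrow> cayley_relations"
    by (rule cayley_wrt_iff[OF _ enum \<Gamma>'])
  have sums: "(\<Sum>i\<in>\<Gamma> j. b i m) = 0" if "k \<ge> 1" "k_selfdual k X" "j < r" for j m
  proof (cases "m < c")
    case True
    have "(\<Sum>i\<in>\<Gamma> j. \<nu> m i) = 0"
      unfolding \<Gamma>' using sum_class_zero[OF _ _ enum that(3) basis_relation[OF that(1) True]] that(2) sd by blast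
    moreover have "(\<Sum>i\<in>\<Gamma> j. b i m) = of_int (\<Sum>i\<in>\<Gamma> j. \<nu> m i)" using True by (simp add: b gale_vec_def)
    ultimately show ?thesis by simp
  qed (simp add: b gale_vec_def)
  show ?thesis
    unfolding sd knap using lines cayley rank_le_lines[OF enum] sums[unfolded sd] by blast
qed

end
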